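(* Let $X$ and $A$ be finite sets and let $$J_{X,A}=\Big\{(\mu_{x,x',a,a'})\in M_{XA}:\ \mu_{x,x',a,a'}=0\ \text{and}\ \mu_{x,x',a,a}=\mu_{x,x',a',a'}\ \text{for all }x,x'\in X,\ a\neq a',\ \text{and}\ \sum_{x\in X}\mu_{x,x,a,a}=0\ \text{for all }a\in A\Big\}.$$ Then $J_{X,A}$ is a kernel in $M_{XA}$, and the operator system $\mathcal T_{X,A}$ is completely order isomorphic to the quotient operator system $M_{XA}/J_{X,A}$.
   Context: Notation: $M_X=\mathcal L(\mathbb C^X)$ is the algebra of complex $X\times X$ matrices, $M_{XA}=M_X\otimes M_A$, whose elements are written $(\mu_{x,x',a,a'})=\sum\mu_{x,x',a,a'}\,e_xe_{x'}^*\otimes e_ae_{a'}^*$, where $(e_x)$ is the canonical basis and $\xi\eta^*$ is the rank one operator $\zeta\mapsto\langle\zeta,\eta\rangle\xi$. Kernels and quotients: a linear subspace $J$ of an operator system $\mathcal S$ is a kernel if $J=\ker\psi$ for some operator system $\mathcal T$ and some unital completely positive map $\psi:\mathcal S\to\mathcal T$. If $J$ is a kernel, $\mathcal S/J$ carries a unique operator system structure such that whenever $\mathcal T$ is an operator system and $\phi:\mathcal S\to\mathcal T$ is a completely positive map annihilating $J$, the induced map $\mathcal S/J\to\mathcal T$ is completely positive (the operator system quotient, with the quotient map $\mathcal S\to\mathcal S/J$ unital and completely positive). Definition of $\mathcal T_{X,A}$. Let $\mathcal V^0_{X,A}$ be the ternary ring (complex vector space with a ternary product $[\cdot,\cdot,\cdot]$,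 linear in the outer variables, conjugate linear in the middle one, with $[s,t,[u,v,w]]=[s,[v,u,t],w]=[[s,t,u],v,w]$) generated by elements $v_{a,x}$, $x\in X$, $a\in A$, subject to $\sum_{a\in A}[v_{a'',x''},v_{a,x},v_{a,x'}]=\delta_{x,x'}v_{a'',x''}$ for all $x,x',x''\in X$, $a''\in A$. A representation of these relations is a family $V=(V_{a,x})_{a,x}\subseteq\mathcal B(H_V,K_V)$ with $\sum_aV_{a,x}^*V_{a,x'}=\delta_{x,x'}I_{H_V}$; it induces a ternary representation $\theta_V$ of $\mathcal V^0_{X,A}$ (i.e. $\theta_V([u,v,w])=\theta_V(u)\theta_V(v)^*\theta_V(w)$) with $\theta_V(v_{a,x})=V_{a,x}$. Let $\mathcal V_{X,A}$ be the completion of the quotient of $\mathcal V^0_{X,A}$ by the null space of the seminorm $\|u\|=\sup_V\|\theta_V(u)\|$ over all representations $V$; it is a ternary ring of operators (TRO), faithfully represented by the direct sum of the $\theta_V$ over equivalence classes of representations. $\mathcal C_{X,A}$ is its right C*-algebra: when $\mathcal V_{X,A}$ is faithfully represented as a concrete TRO, $\mathcal C_{X,A}=\overline{\mathrm{span}}\{S^*T:S,T\in\mathcal V_{X,A}\}$; it is a unital C*-algebra. Put $e_{x,x',a,a'}=v_{a,x}^*v_{a',x'}\in\mathcal C_{X,A}$, and let $\mathcal T_{X,A}=\mathrm{span}\{e_{x,x',a,a'}:x,x'\in X,a,a'\in A\}$, an operator subsystem of $\mathcal C_{X,A}$. *)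

theory Defs
  imports "HOL-Analysis.Analysis" "HOL-Algebra.AbelCoset" "Jordan_Normal_Form.VS_Connect"
begin

no_notation Matrix.vec_index (infixl \<open>$\<close> 100)

section \<open>Operator systems\<close>

text \<open>Abstract operator systems in the sense of Choi and Effros: matrix ordered
  \<open>*\<close>-vector spaces with an Archimedean matrix order unit. The vector space is a HOL-Algebra
  module over the complex numbers, matrices over it are of type \<^typ>\<open>'s mat\<close>, \<open>pos S n\<close> is the cone
  of positive elements of \<open>M\<^sub>n(S)\<close>, and the field \<open>one\<close> of the record is the order unit. The field
  \<open>mult\<close> is irrelevant.\<close>

record 's opsys = "(complex, 's) module" +
  star :: "'s \<Rightarrow> 's"
  pos :: "nat \<Rightarrow> 's mat set"

definition matrices :: "nat \<Rightarrow> ('s, 'm) opsys_scheme \<Rightarrow> 's mat set" where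
  "matrices n S = {A \<in> carrier_mat n n. \<forall>i<n. \<forall>j<n. A $$ (i, j) \<in> carrier S}"

definition mat_plus :: "('s, 'm) opsys_scheme \<Rightarrow> 's mat \<Rightarrow> 's mat \<Rightarrow> 's mat" where
  "mat_plus S A B = Matrix.mat (dim_row A) (dim_col A) (\<lambda>ij. A $$ ij \<oplus>\<^bsub>S\<^esub> B $$ ij)"

definition mat_scale :: "('s, 'm) opsys_scheme \<Rightarrow> complex \<Rightarrow> 's mat \<Rightarrow> 's mat" where
  "mat_scale S c A = map_mat (\<lambda>a. c \<odot>\<^bsub>S\<^esub> a) A"

definition mat_star :: "('s, 'm) opsys_scheme \<Rightarrow> 's mat \<Rightarrow> 's mat" where
  "mat_star S A = Matrix.mat (dim_col A) (dim_row A) (\<lambda>(i, j). star S (A $$ (j, i)))"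

definition mat_unit :: "('s, 'm) opsys_scheme \<Rightarrow> nat \<Rightarrow> 's mat" where
  "mat_unit S n = Matrix.mat n n (\<lambda>(i, j). if i = j then \<one>\<^bsub>S\<^esub> else \<zero>\<^bsub>S\<^esub>)"

definition mat_null :: "('s, 'm) opsys_scheme \<Rightarrow> nat \<Rightarrow> 's mat" where
  "mat_null S n = Matrix.mat n n (\<lambda>ij. \<zero>\<^bsub>S\<^esub>)"

text \<open>The compression \<open>\<alpha>\<^sup>* A \<alpha>\<close> by a rectangular scalar matrix \<open>\<alpha>\<close>.\<close>

definition mat_compress :: "('s, 'm) opsys_scheme \<Rightarrow> complex mat \<Rightarrow> 's mat \<Rightarrow> 's mat" where
  "mat_compress S \<alpha> A = Matrix.mat (dim_col \<alpha>) (dim_col \<alpha>) (\<lambda>(p, q).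
     \<Oplus>\<^bsub>S\<^esub> i \<in> {..<dim_row \<alpha>}. \<Oplus>\<^bsub>S\<^esub> j \<in> {..<dim_row \<alpha>}.
       (cnj (\<alpha> $$ (i, p)) * \<alpha> $$ (j, q)) \<odot>\<^bsub>S\<^esub> A $$ (i, j))"

locale operator_system = vectorspace class_ring S
  for S :: "('s, 'm) opsys_scheme" (structure) +
  assumes star_closed: "s \<in> carrier S \<Longrightarrow> star S s \<in> carrier S"
    and star_star: "s \<in> carrier S \<Longrightarrow> star S (star S s) = s"
    and star_add: "\<lbrakk>s \<in> carrier S; t \<in> carrier S\<rbrakk> \<Longrightarrow> star S (s \<oplus> t) = star S s \<oplus> star S t"
    and star_smult: "s \<in> carrier S \<Longrightarrow> star S (c \<odot> s) = cnj c \<odot> star S s"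
    and unit_closed: "\<one> \<in> carrier S"
    and star_unit: "star S \<one> = \<one>"
    and pos_hermitian: "A \<in> pos S n \<Longrightarrow> A \<in> matrices n S \<and> mat_star S A = A"
    and pos_plus: "\<lbrakk>A \<in> pos S n; B \<in> pos S n\<rbrakk> \<Longrightarrow> mat_plus S A B \<in> pos S n"
    and pos_scale: "\<lbrakk>A \<in> pos S n; 0 \<le> r\<rbrakk> \<Longrightarrow> mat_scale S (complex_of_real r) A \<in> pos S n"
    and pos_proper: "\<lbrakk>A \<in> pos S n; mat_scale S (- 1) A \<in> pos S n\<rbrakk> \<Longrightarrow> A = mat_null S n"
    and pos_compress: "\<lbrakk>A \<in> pos S n; \<alpha> \<in> carrier_mat n m\<rbrakk> \<Longrightarrow> mat_compress S \<alpha> A \<in> pos S m"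
    and order_unit: "\<lbrakk>A \<in> matrices n S; mat_star S A = A\<rbrakk> \<Longrightarrow>
      \<exists>r>0. mat_plus S (mat_scale S (complex_of_real r) (mat_unit S n)) A \<in> pos S n"
    and archimedean: "\<lbrakk>A \<in> matrices n S;
      \<And>r. r > 0 \<Longrightarrow> mat_plus S (mat_scale S (complex_of_real r) (mat_unit S n)) A \<in> pos S n\<rbrakk> \<Longrightarrow>
      A \<in> pos S n"

definition completely_positive ::
  "('s, 'm) opsys_scheme \<Rightarrow> ('t, 'n) opsys_scheme \<Rightarrow> ('s \<Rightarrow> 't) \<Rightarrow> bool" where
  "completely_positive S T \<phi> \<longleftrightarrow>
     \<phi> \<in> module_hom class_ring S T \<and> (\<forall>n. \<forall>A \<in> pos S n. map_mat \<phi> A \<in> pos T n)"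

definition unital_completely_positive ::
  "('s, 'm) opsys_scheme \<Rightarrow> ('t, 'n) opsys_scheme \<Rightarrow> ('s \<Rightarrow> 't) \<Rightarrow> bool" where
  "unital_completely_positive S T \<phi> \<longleftrightarrow> completely_positive S T \<phi> \<and> \<phi> \<one>\<^bsub>S\<^esub> = \<one>\<^bsub>T\<^esub>"

definition completely_order_isomorphic ::
  "('s, 'm) opsys_scheme \<Rightarrow> ('t, 'n) opsys_scheme \<Rightarrow> bool" where
  "completely_order_isomorphic S T \<longleftrightarrow> operator_system S \<and> operator_system T \<and>
     (\<exists>\<phi>. bij_betw \<phi> (carrier S) (carrier T) \<and> \<phi> \<one>\<^bsub>S\<^esub> = \<one>\<^bsub>T\<^esub> \<and>
        completely_positive S T \<phi> \<and> completely_positive T S (inv_into (carrier S) \<phi>))"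

definition operator_subsystem :: "('s, 'm) opsys_scheme \<Rightarrow> 's set \<Rightarrow> ('s, 'm) opsys_scheme" where
  "operator_subsystem S W = S\<lparr>carrier := W, pos := \<lambda>n. {A \<in> pos S n. elements_mat A \<subseteq> W}\<rparr>"


section \<open>Kernels and quotients\<close>

text \<open>HOL cannot quantify over the types carrying the target systems \<open>\<T>\<close>, so their underlying sets
  are taken in the type \<^typ>\<open>'s set\<close>, to which the cosets in \<open>S\<close> belong. Nothing is lost: the range
  of \<open>\<psi>\<close> in the definition of a kernel is in bijection with a set of cosets, and in the universal
  property \<open>\<T>\<close> may be replaced by the linear span of its unit and the range of \<open>\<phi>\<close>, whose
  cardinality is at most that of \<open>S/J\<close> as soon as \<open>S/J \<noteq> 0\<close>.\<close>

definition is_kernel :: "('s, 'm) opsys_scheme \<Rightarrow> 's set \<Rightarrow> bool" where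
  "is_kernel S J \<longleftrightarrow> (\<exists>(T :: 's set opsys) \<psi>. operator_system T \<and>
     unital_completely_positive S T \<psi> \<and> J = {s \<in> carrier S. \<psi> s = \<zero>\<^bsub>T\<^esub>})"

text \<open>The quotient \<open>*\<close>-vector space \<open>S/J\<close>, with a given family of matrix cones \<open>C\<close>.\<close>

definition coset_opsys ::
  "('s, 'm) opsys_scheme \<Rightarrow> 's set \<Rightarrow> (nat \<Rightarrow> 's set mat set) \<Rightarrow> 's set opsys" where
  "coset_opsys S J C =
     \<lparr>carrier = a_rcosets\<^bsub>S\<^esub> J, mult = undefined, one = J +>\<^bsub>S\<^esub> \<one>\<^bsub>S\<^esub>,
      zero = J, add = set_add S,
      smult = (\<lambda>c K. \<Union>k\<in>K. J +>\<^bsub>S\<^esub> (c \<odot>\<^bsub>S\<^esub> k)),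
      star = (\<lambda>K. \<Union>k\<in>K. J +>\<^bsub>S\<^esub> star S k), pos = C\<rparr>"

definition quotient_cones ::
  "('s, 'm) opsys_scheme \<Rightarrow> 's set \<Rightarrow> (nat \<Rightarrow> 's set mat set) \<Rightarrow> bool" where
  "quotient_cones S J C \<longleftrightarrow>
     operator_system (coset_opsys S J C) \<and>
     unital_completely_positive S (coset_opsys S J C) (\<lambda>s. J +>\<^bsub>S\<^esub> s) \<and>
     (\<forall>(T :: 's set opsys) \<phi> \<phi>'. operator_system T \<longrightarrow> completely_positive S T \<phi> \<longrightarrow>
        (\<forall>s\<in>J. \<phi> s = \<zero>\<^bsub>T\<^esub>) \<longrightarrow> (\<forall>s\<in>carrier S. \<phi>' (J +>\<^bsub>S\<^esub> s) = \<phi> s) \<longrightarrow>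
        completely_positive (coset_opsys S J C) T \<phi>')"

definition quotient_opsys :: "('s, 'm) opsys_scheme \<Rightarrow> 's set \<Rightarrow> 's set opsys" where
  "quotient_opsys S J = coset_opsys S J (THE C. quotient_cones S J C)"


section \<open>Hilbert spaces and bounded operators\<close>

text \<open>Hilbert spaces with an explicit carrier set, so that one can quantify over all Hilbert spaces
  whose points belong to a given type. The inner product is linear in the first variable. The fields
  \<open>mult\<close> and \<open>one\<close> of the record are irrelevant.\<close>

record 'h hilbert = "(complex, 'h) module" +
  ip :: "'h \<Rightarrow> 'h \<Rightarrow> complex"

definition hnorm :: "('h, 'm) hilbert_scheme \<Rightarrow> 'h \<Rightarrow> real" where
  "hnorm H \<xi> = sqrt (Re (ip H \<xi> \<xi>))"

locale hilbert_space = vectorspace class_ring H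
  for H :: "('h, 'm) hilbert_scheme" (structure) +
  assumes ip_add: "\<lbrakk>\<xi> \<in> carrier H; \<eta> \<in> carrier H; \<zeta> \<in> carrier H\<rbrakk> \<Longrightarrow>
      ip H (\<xi> \<oplus> \<eta>) \<zeta> = ip H \<xi> \<zeta> + ip H \<eta> \<zeta>"
    and ip_smult: "\<lbrakk>\<xi> \<in> carrier H; \<eta> \<in> carrier H\<rbrakk> \<Longrightarrow> ip H (c \<odot> \<xi>) \<eta> = c * ip H \<xi> \<eta>"
    and ip_cnj: "\<lbrakk>\<xi> \<in> carrier H; \<eta> \<in> carrier H\<rbrakk> \<Longrightarrow> ip H \<eta> \<xi> = cnj (ip H \<xi> \<eta>)"
    and ip_nonneg: "\<xi> \<in> carrier H \<Longrightarrow> 0 \<le> ip H \<xi> \<xi>"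
    and ip_definite: "\<lbrakk>\<xi> \<in> carrier H; ip H \<xi> \<xi> = 0\<rbrakk> \<Longrightarrow> \<xi> = \<zero>"
    and complete: "\<lbrakk>\<And>n. s n \<in> carrier H;
      \<And>\<epsilon>. \<epsilon> > 0 \<Longrightarrow> \<exists>N. \<forall>m\<ge>N. \<forall>n\<ge>N. hnorm H (s m \<ominus> s n) < \<epsilon>\<rbrakk> \<Longrightarrow>
      \<exists>\<xi>\<in>carrier H. (\<lambda>n. hnorm H (s n \<ominus> \<xi>)) \<longlonglongrightarrow> 0"

definition bounded_ops ::
  "('h, 'm) hilbert_scheme \<Rightarrow> ('k, 'n) hilbert_scheme \<Rightarrow> ('h \<Rightarrow> 'k) set" where
  "bounded_ops H K = {T \<in> extensional (carrier H). T \<in> module_hom class_ring H K \<and>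
     (\<exists>c. \<forall>\<xi>\<in>carrier H. hnorm K (T \<xi>) \<le> c * hnorm H \<xi>)}"

definition opnorm ::
  "('h, 'm) hilbert_scheme \<Rightarrow> ('k, 'n) hilbert_scheme \<Rightarrow> ('h \<Rightarrow> 'k) \<Rightarrow> real" where
  "opnorm H K T = Inf {c. 0 \<le> c \<and> (\<forall>\<xi>\<in>carrier H. hnorm K (T \<xi>) \<le> c * hnorm H \<xi>)}"

definition adj ::
  "('h, 'm) hilbert_scheme \<Rightarrow> ('k, 'n) hilbert_scheme \<Rightarrow> ('h \<Rightarrow> 'k) \<Rightarrow> 'k \<Rightarrow> 'h" where
  "adj H K T = (THE S. S \<in> bounded_ops K H \<and>
     (\<forall>\<xi>\<in>carrier H. \<forall>\<eta>\<in>carrier K. ip K (T \<xi>) \<eta> = ip H \<xi> (S \<eta>)))"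

definition op_space ::
  "('h, 'm) hilbert_scheme \<Rightarrow> ('k, 'n) hilbert_scheme \<Rightarrow> (complex, 'h \<Rightarrow> 'k) module" where
  "op_space H K =
     \<lparr>carrier = bounded_ops H K, mult = undefined, one = undefined,
      zero = (\<lambda>\<xi>\<in>carrier H. \<zero>\<^bsub>K\<^esub>), add = (\<lambda>S T. \<lambda>\<xi>\<in>carrier H. S \<xi> \<oplus>\<^bsub>K\<^esub> T \<xi>),
      smult = (\<lambda>c T. \<lambda>\<xi>\<in>carrier H. c \<odot>\<^bsub>K\<^esub> T \<xi>)\<rparr>"

text \<open>\<open>\<B>(H)\<close>; an operator matrix is positive if it is positive as an operator on \<open>H\<^sup>n\<close>.\<close>

definition bounded_op_system :: "('h, 'm) hilbert_scheme \<Rightarrow> ('h \<Rightarrow> 'h) opsys" where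
  "bounded_op_system H =
     \<lparr>carrier = bounded_ops H H, mult = compose (carrier H), one = (\<lambda>\<xi>\<in>carrier H. \<xi>),
      zero = \<zero>\<^bsub>op_space H H\<^esub>, add = add (op_space H H), smult = smult (op_space H H),
      star = adj H H,
      pos = (\<lambda>n. {A \<in> carrier_mat n n. elements_mat A \<subseteq> bounded_ops H H \<and>
        (\<forall>\<xi>. (\<forall>i<n. \<xi> i \<in> carrier H) \<longrightarrow>
           0 \<le> (\<Sum>i<n. \<Sum>j<n. ip H ((A $$ (i, j)) (\<xi> j)) (\<xi> i)))})\<rparr>"

definition closed_span :: "('h, 'm) hilbert_scheme \<Rightarrow> ('h \<Rightarrow> 'h) set \<Rightarrow> ('h \<Rightarrow> 'h) set" where
  "closed_span H G = {T \<in> bounded_ops H H. \<forall>\<epsilon>>0.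
     \<exists>S \<in> LinearCombinations.module.span class_ring (op_space H H) G.
       opnorm H H (T \<ominus>\<^bsub>op_space H H\<^esub> S) < \<epsilon>}"

definition hilbert_sum :: "'i set \<Rightarrow> ('i \<Rightarrow> ('h, 'm) hilbert_scheme) \<Rightarrow> ('i \<Rightarrow> 'h) hilbert" where
  "hilbert_sum I H =
     \<lparr>carrier = {\<xi> \<in> \<Pi>\<^sub>E i\<in>I. carrier (H i). (\<lambda>i. (hnorm (H i) (\<xi> i))\<^sup>2) summable_on I},
      mult = undefined, one = undefined, zero = (\<lambda>i\<in>I. \<zero>\<^bsub>H i\<^esub>),
      add = (\<lambda>\<xi> \<eta>. \<lambda>i\<in>I. \<xi> i \<oplus>\<^bsub>H i\<^esub> \<eta> i), smult = (\<lambda>c \<xi>. \<lambda>i\<in>I. c \<odot>\<^bsub>H i\<^esub> \<xi> i),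
      ip = (\<lambda>\<xi> \<eta>. \<Sum>\<^sub>\<infinity>i\<in>I. ip (H i) (\<xi> i) (\<eta> i))\<rparr>"

definition op_sum ::
  "'i set \<Rightarrow> ('i \<Rightarrow> ('h, 'm) hilbert_scheme) \<Rightarrow> ('i \<Rightarrow> 'h \<Rightarrow> 'k) \<Rightarrow> ('i \<Rightarrow> 'h) \<Rightarrow> 'i \<Rightarrow> 'k" where
  "op_sum I H T = (\<lambda>\<xi>\<in>carrier (hilbert_sum I H). \<lambda>i\<in>I. T i (\<xi> i))"


section \<open>The ternary ring \<open>\<V>\<^sup>0\<close> given by generators and relations\<close>

datatype ('a, 'x) tern_term =
    Gen 'a 'x
  | Zero
  | Add "('a, 'x) tern_term" "('a, 'x) tern_term"
  | Scale complex "('a, 'x) tern_term"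
  | Tern "('a, 'x) tern_term" "('a, 'x) tern_term" "('a, 'x) tern_term"

text \<open>The least congruence on terms satisfying the axioms of ternary rings and the relations
  \<open>\<Sum>\<^sub>a [v\<^bsub>a'',x''\<^esub>, v\<^bsub>a,x\<^esub>, v\<^bsub>a,x'\<^esub>] = \<delta>\<^bsub>x,x'\<^esub> v\<^bsub>a'',x''\<^esub>\<close>, where the sum is spelled out along an
  enumeration \<open>as\<close> of the index set.\<close>

inductive tern_eq :: "('a, 'x) tern_term \<Rightarrow> ('a, 'x) tern_term \<Rightarrow> bool" (infix \<open>\<doteq>\<close> 50) where
  refl: "u \<doteq> u"
| sym: "u \<doteq> v \<Longrightarrow> v \<doteq> u"
| trans: "u \<doteq> v \<Longrightarrow> v \<doteq> w \<Longrightarrow> u \<doteq> w"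
| cong_Add: "u \<doteq> u' \<Longrightarrow> v \<doteq> v' \<Longrightarrow> Add u v \<doteq> Add u' v'"
| cong_Scale: "u \<doteq> u' \<Longrightarrow> Scale c u \<doteq> Scale c u'"
| cong_Tern: "u \<doteq> u' \<Longrightarrow> v \<doteq> v' \<Longrightarrow> w \<doteq> w' \<Longrightarrow> Tern u v w \<doteq> Tern u' v' w'"
| add_assoc: "Add (Add u v) w \<doteq> Add u (Add v w)"
| add_commute: "Add u v \<doteq> Add v u"
| add_Zero: "Add u Zero \<doteq> u"
| add_neg: "Add u (Scale (- 1) u) \<doteq> Zero"
| scale_add: "Scale c (Add u v) \<doteq> Add (Scale c u) (Scale c v)"
| add_scale: "Scale (c + d) u \<doteq> Add (Scale c u) (Scale d u)"
| scale_scale: "Scale c (Scale d u) \<doteq> Scale (c * d) u"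
| scale_one: "Scale 1 u \<doteq> u"
| tern_add_left: "Tern (Add u u') v w \<doteq> Add (Tern u v w) (Tern u' v w)"
| tern_add_middle: "Tern u (Add v v') w \<doteq> Add (Tern u v w) (Tern u v' w)"
| tern_add_right: "Tern u v (Add w w') \<doteq> Add (Tern u v w) (Tern u v w')"
| tern_scale_left: "Tern (Scale c u) v w \<doteq> Scale c (Tern u v w)"
| tern_scale_middle: "Tern u (Scale c v) w \<doteq> Scale (cnj c) (Tern u v w)"
| tern_scale_right: "Tern u v (Scale c w) \<doteq> Scale c (Tern u v w)"
| tern_assoc_middle: "Tern s t (Tern u v w) \<doteq> Tern s (Tern v u t) w"
| tern_assoc_left: "Tern s t (Tern u v w) \<doteq> Tern (Tern s t u) v w"
| relation: "distinct as \<Longrightarrow> set as = UNIV \<Longrightarrow>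
    foldr (\<lambda>a. Add (Tern (Gen a'' x'') (Gen a x) (Gen a x'))) as Zero \<doteq>
    (if x = x' then Gen a'' x'' else Zero)"

quotient_type ('a, 'x) tern = "('a, 'x) tern_term" / tern_eq
  by (intro equivpI reflpI sympI transpI) (fact tern_eq.refl, fact tern_eq.sym, fact tern_eq.trans)

lift_definition gen :: "'a \<Rightarrow> 'x \<Rightarrow> ('a, 'x) tern" is Gen .

lift_definition tadd :: "('a, 'x) tern \<Rightarrow> ('a, 'x) tern \<Rightarrow> ('a, 'x) tern" is Add
  by (fact tern_eq.cong_Add)

lift_definition tscale :: "complex \<Rightarrow> ('a, 'x) tern \<Rightarrow> ('a, 'x) tern" is Scale
  by (fact tern_eq.cong_Scale)

lift_definition tern :: "('a, 'x) tern \<Rightarrow> ('a, 'x) tern \<Rightarrow> ('a, 'x) tern \<Rightarrow> ('a, 'x) tern" is Tern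
  by (fact tern_eq.cong_Tern)

definition tminus :: "('a, 'x) tern \<Rightarrow> ('a, 'x) tern \<Rightarrow> ('a, 'x) tern" where
  "tminus u v = tadd u (tscale (- 1) v)"


section \<open>Representations and the universal TRO\<close>

definition is_rep ::
  "('h, 'm) hilbert_scheme \<Rightarrow> ('k, 'n) hilbert_scheme \<Rightarrow> ('a::finite \<Rightarrow> 'x \<Rightarrow> 'h \<Rightarrow> 'k) \<Rightarrow> bool" where
  "is_rep H K V \<longleftrightarrow> hilbert_space H \<and> hilbert_space K \<and> (\<forall>a x. V a x \<in> bounded_ops H K) \<and>
     (\<forall>x x'. (\<Oplus>\<^bsub>op_space H H\<^esub> a \<in> UNIV. compose (carrier H) (adj H K (V a x)) (V a x')) =
        (if x = x' then (\<lambda>\<xi>\<in>carrier H. \<xi>) else \<zero>\<^bsub>op_space H H\<^esub>))"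

text \<open>The ternary representation \<open>\<theta>\<^sub>V\<close> of \<open>\<V>\<^sup>0\<close> induced by \<open>V\<close>.\<close>

definition induced_rep ::
  "('h, 'm) hilbert_scheme \<Rightarrow> ('k, 'n) hilbert_scheme \<Rightarrow> ('a \<Rightarrow> 'x \<Rightarrow> 'h \<Rightarrow> 'k) \<Rightarrow>
   ('a, 'x) tern \<Rightarrow> 'h \<Rightarrow> 'k" where
  "induced_rep H K V = (THE \<theta>.
     (\<forall>u. \<theta> u \<in> bounded_ops H K) \<and>
     (\<forall>u v. \<theta> (tadd u v) = \<theta> u \<oplus>\<^bsub>op_space H K\<^esub> \<theta> v) \<and>
     (\<forall>c u. \<theta> (tscale c u) = c \<odot>\<^bsub>op_space H K\<^esub> \<theta> u) \<and>
     (\<forall>u v w. \<theta> (tern u v w) =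
        compose (carrier H) (\<theta> u) (compose (carrier H) (adj H K (\<theta> v)) (\<theta> w))) \<and>
     (\<forall>a x. \<theta> (gen a x) = V a x))"

text \<open>All representations on Hilbert spaces whose underlying sets are contained in the type
  \<^typ>\<open>nat \<times> 'u \<Rightarrow> complex\<close>. Whatever \<^typ>\<open>'u\<close> is, this includes copies of all separable
  Hilbert spaces, which already determine the universal seminorm and the universal TRO; by the choice
  of \<^typ>\<open>'u\<close> Hilbert spaces of any prescribed dimension are included (as \<open>\<ell>\<^sup>2\<close>-spaces).\<close>

type_synonym 'u univ = "nat \<times> 'u \<Rightarrow> complex"

type_synonym ('u, 'a, 'x) rep = "'u univ hilbert \<times> 'u univ hilbert \<times> ('a \<Rightarrow> 'x \<Rightarrow> 'u univ \<Rightarrow> 'u univ)"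

definition all_reps :: "('u, 'a::finite, 'x) rep set" where
  "all_reps = {(H, K, V). is_rep H K V}"

definition univ_seminorm :: "'u itself \<Rightarrow> ('a::finite, 'x) tern \<Rightarrow> real" where
  "univ_seminorm _ u = (SUP (H, K, V) \<in> (all_reps :: ('u, 'a, 'x) rep set).
     opnorm H K (induced_rep H K V u))"

text \<open>The completion of the quotient of \<open>\<V>\<^sup>0\<close> by the null space of the seminorm, as the set of
  Cauchy sequences in \<open>\<V>\<^sup>0\<close> modulo the sequences converging to 0 in the seminorm.\<close>

definition tern_cauchy :: "'u itself \<Rightarrow> (nat \<Rightarrow> ('a::finite, 'x) tern) set" where
  "tern_cauchy U = {s. \<forall>\<epsilon>>0. \<exists>N. \<forall>m\<ge>N. \<forall>n\<ge>N. univ_seminorm U (tminus (s m) (s n)) < \<epsilon>}"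

definition tern_null_rel ::
  "'u itself \<Rightarrow> ((nat \<Rightarrow> ('a::finite, 'x) tern) \<times> (nat \<Rightarrow> ('a, 'x) tern)) set" where
  "tern_null_rel U = {(s, t). s \<in> tern_cauchy U \<and> t \<in> tern_cauchy U \<and>
     (\<lambda>n. univ_seminorm U (tminus (s n) (t n))) \<longlonglongrightarrow> 0}"

definition V_XA :: "'u itself \<Rightarrow> (nat \<Rightarrow> ('a::finite, 'x) tern) set set" where
  "V_XA U = tern_cauchy U // tern_null_rel U"

definition v_XA :: "'u itself \<Rightarrow> 'a \<Rightarrow> 'x \<Rightarrow> (nat \<Rightarrow> ('a::finite, 'x) tern) set" where
  "v_XA U a x = tern_null_rel U `` {\<lambda>_. gen a x}"

text \<open>The direct sum of all \<open>\<theta>\<^sub>V\<close>. Unitarily equivalent representations are not identified; this only adds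
  multiplicity.\<close>

definition H_univ :: "(('u, 'a::finite, 'x) rep \<Rightarrow> 'u univ) hilbert" where
  "H_univ = hilbert_sum all_reps fst"

definition K_univ :: "(('u, 'a::finite, 'x) rep \<Rightarrow> 'u univ) hilbert" where
  "K_univ = hilbert_sum all_reps (fst \<circ> snd)"

definition theta_univ ::
  "('a::finite, 'x) tern \<Rightarrow> (('u, 'a, 'x) rep \<Rightarrow> 'u univ) \<Rightarrow> ('u, 'a, 'x) rep \<Rightarrow> 'u univ" where
  "theta_univ u = op_sum all_reps fst (\<lambda>(H, K, V). induced_rep H K V u)"

text \<open>Its continuous extension to the completion, a faithful representation of the TRO.\<close>

definition faithful_rep ::
  "(nat \<Rightarrow> ('a::finite, 'x) tern) set \<Rightarrow>
   (('u, 'a, 'x) rep \<Rightarrow> 'u univ) \<Rightarrow> ('u, 'a, 'x) rep \<Rightarrow> 'u univ" where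
  "faithful_rep w = (THE T. T \<in> bounded_ops H_univ K_univ \<and>
     (\<forall>s\<in>w. (\<lambda>n. opnorm H_univ K_univ (theta_univ (s n) \<ominus>\<^bsub>op_space H_univ K_univ\<^esub> T)) \<longlonglongrightarrow> 0))"


section \<open>The operator systems of the statement\<close>

definition C_XA :: "((('u, 'a::finite, 'x) rep \<Rightarrow> 'u univ) \<Rightarrow> ('u, 'a, 'x) rep \<Rightarrow> 'u univ) opsys" where
  "C_XA = operator_subsystem (bounded_op_system H_univ) (closed_span H_univ
     {compose (carrier H_univ) (adj H_univ K_univ (faithful_rep s)) (faithful_rep t) | s t.
        s \<in> V_XA TYPE('u) \<and> t \<in> V_XA TYPE('u)})"

definition e_XA ::
  "'x \<Rightarrow> 'x \<Rightarrow> 'a::finite \<Rightarrow> 'a \<Rightarrow> (('u, 'a, 'x) rep \<Rightarrow> 'u univ) \<Rightarrow> ('u, 'a, 'x) rep \<Rightarrow> 'u univ" where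
  "e_XA x x' a a' = compose (carrier H_univ)
     (adj H_univ K_univ (faithful_rep (v_XA TYPE('u) a x))) (faithful_rep (v_XA TYPE('u) a' x'))"

definition T_XA :: "((('u, 'a::finite, 'x) rep \<Rightarrow> 'u univ) \<Rightarrow> ('u, 'a, 'x) rep \<Rightarrow> 'u univ) opsys" where
  "T_XA = operator_subsystem C_XA
     (LinearCombinations.module.span class_ring C_XA {e_XA x x' a a' | x x' a a'. True})"

text \<open>The matrix algebra \<open>M\<^sub>I\<close>; a matrix over it is positive if it is positive as an operator on
  \<open>(\<complex>\<^sup>I)\<^sup>n\<close>.\<close>

definition matrix_system :: "(complex ^ 'i ^ 'i) opsys" where
  "matrix_system =
     \<lparr>carrier = UNIV, mult = (**), one = Finite_Cartesian_Product.mat 1, zero = 0, add = (+),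
      smult = (\<lambda>c \<mu>. \<chi> p q. c * \<mu> $ p $ q),
      star = (\<lambda>\<mu>. \<chi> p q. cnj (\<mu> $ q $ p)),
      pos = (\<lambda>n. {A \<in> carrier_mat n n. \<forall>\<xi> :: nat \<Rightarrow> complex ^ 'i.
        0 \<le> (\<Sum>i<n. \<Sum>j<n. \<Sum>p\<in>UNIV. \<Sum>q\<in>UNIV.
          cnj (\<xi> i $ p) * (A $$ (i, j)) $ p $ q * \<xi> j $ q)})\<rparr>"

text \<open>\<open>M\<^sub>X \<otimes> M\<^sub>A\<close> is identified with \<open>M\<^bsub>X \<times> A\<^esub>\<close>; the coefficient \<open>\<mu>\<^bsub>x,x',a,a'\<^esub>\<close> is
  \<open>\<mu> $ (x, a) $ (x', a')\<close>.\<close>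

definition M_XA :: "(complex ^ ('x::finite \<times> 'a::finite) ^ ('x \<times> 'a)) opsys" where
  "M_XA = matrix_system"

definition J_XA :: "(complex ^ ('x::finite \<times> 'a::finite) ^ ('x \<times> 'a)) set" where
  "J_XA = {\<mu>. (\<forall>x x' a a'. a \<noteq> a' \<longrightarrow>
       \<mu> $ (x, a) $ (x', a') = 0 \<and> \<mu> $ (x, a) $ (x', a) = \<mu> $ (x, a') $ (x', a')) \<and>
     (\<forall>a. (\<Sum>x\<in>UNIV. \<mu> $ (x, a) $ (x, a)) = 0)}"

end

theory Submission
  imports Defs
begin

text \<open>Represent the universal TRO on a Hilbert space \<open>H\<close>. The map sending \<open>\<mu>\<close> to
  \<open>\<Sum> \<mu>\<^bsub>p,q\<^esub> v\<^sub>p\<^sup>* v\<^sub>q\<close> divided by \<open>|X|\<close>, for \<open>p, q \<in> X \<times> A\<close>, is unital, completely positive, maps \<open>M\<^bsub>XA\<^esub>\<close> onto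
  \<open>\<T>\<^bsub>X,A\<^esub>\<close> and has kernel \<open>J\<^bsub>X,A\<^esub>\<close>. The point is that, after adding \<open>r > 0\<close> to a matrix over \<open>M\<^bsub>XA\<^esub>\<close> whose
  image in \<open>M\<^sub>n(\<T>\<^bsub>X,A\<^esub>)\<close> is positive, it is congruent to a positive matrix modulo \<open>J\<^bsub>X,A\<^esub>\<close>. Otherwise,
  separation in finite dimensions yields a positive semidefinite matrix \<open>Q\<close> that annihilates \<open>J\<^bsub>X,A\<^esub>\<close> and
  pairs negatively with the given matrix; adding a small multiple of the identity makes \<open>Q\<close> strictly
  positive. To annihilate \<open>J\<^bsub>X,A\<^esub>\<close> means that \<open>\<Sum>\<^sub>a Q((i,x,a),(j,x',a)) = \<delta>\<^bsub>x,x'\<^esub> g(i,j)\<close>, and this says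
  that \<open>Q\<close> is the Gram matrix of vectors \<open>v\<^bsub>a,x\<^esub> h\<^sub>i\<close> in a finite-dimensional representation of the
  relations, contradicting the positivity of the image.\<close>

section \<open>Inner product geometry, nearest points of convex sets and the Riesz theorem\<close>

section \<open>Hilbert spaces\<close>

text \<open>The sum of the positive cone and the matrices over J is not shown to be closed.
  Positivity of an image is therefore lifted only after adding \<open>r\<close>: this keeps the
  matrix at a definite distance from the cone, so that separation is strict, and the Archimedean
  axiom of the target removes \<open>r\<close> afterwards. A separating Q may be singular, and a
  singular Gram matrix would force a quotient of the representation space. The multiple of the
  identity added to Q avoids this; it respects the relation because the identity satisfies it too,
  with g(i,j) equal to |A| for i = j and 0 otherwise. The cones of the quotient are not built from
  those of the matrix algebra. They are carried over from the image by the bijection with the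
  cosets, which makes the quotient an operator system at once and leaves only the universal
  property. Applied to the identity on cosets, this property also determines the cones, as the
  description in \<open>quotient_opsys\<close> requires. One nearest point argument serves twice:
  for the Riesz theorem, on which adjoints rest, and for the separation.\<close>

lemma complex_nonneg_iff: "0 \<le> z \<longleftrightarrow> 0 \<le> Re z \<and> Im z = 0"
  by (auto simp: less_eq_complex_def)

context hilbert_space
begin

lemma smult_in_carrier [simp, intro]: "\<xi> \<in> carrier H \<Longrightarrow> c \<odot> \<xi> \<in> carrier H"
  by (rule smult_closed) auto

lemma zero_smult [simp]: "\<xi> \<in> carrier H \<Longrightarrow> 0 \<odot> \<xi> = \<zero>"
  using lmult_0[of \<xi>] by simp

text \<open>Reducing subtraction to multiplication by -1 lets additivity and homogeneity of
  \<open>ip\<close> evaluate all inner products of differences.\<close>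

lemma a_inv_eq_smult: "\<xi> \<in> carrier H \<Longrightarrow> \<ominus> \<xi> = (- 1) \<odot> \<xi>"
  using smult_minus_1[of \<xi>] by (simp add: class_ring_simps class_ring.ring_simprules)

lemma minus_eq_smult: "\<xi> \<in> carrier H \<Longrightarrow> \<xi> \<ominus> \<eta> = \<xi> \<oplus> (- 1) \<odot> \<eta>" if "\<eta> \<in> carrier H"
  using that by (simp add: a_minus_def a_inv_eq_smult)

declare ip_add [simp] ip_smult [simp]

lemma ip_zero [simp]: "\<eta> \<in> carrier H \<Longrightarrow> ip H \<zero> \<eta> = 0"
  using ip_smult[of \<eta> \<eta> 0] by simp

lemma ip_minus [simp]:
  "\<lbrakk>\<xi> \<in> carrier H; \<eta> \<in> carrier H; \<zeta> \<in> carrier H\<rbrakk> \<Longrightarrow> ip H (\<xi> \<ominus> \<eta>) \<zeta> = ip H \<xi> \<zeta> - ip H \<eta> \<zeta>"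
  by (simp add: minus_eq_smult)

lemma ip_add_right [simp]:
  assumes "\<xi> \<in> carrier H" "\<eta> \<in> carrier H" "\<zeta> \<in> carrier H"
  shows "ip H \<zeta> (\<xi> \<oplus> \<eta>) = ip H \<zeta> \<xi> + ip H \<zeta> \<eta>"
proof -
  have "ip H \<zeta> (\<xi> \<oplus> \<eta>) = cnj (ip H (\<xi> \<oplus> \<eta>) \<zeta>)"
    using assms by (intro ip_cnj) auto
  also have "\<dots> = cnj (ip H \<xi> \<zeta>) + cnj (ip H \<eta> \<zeta>)"
    using assms by simp
  finally show ?thesis
    using assms ip_cnj[of \<xi> \<zeta>] ip_cnj[of \<eta> \<zeta>] by simp
qed

lemma ip_smult_right [simp]:
  assumes "\<xi> \<in> carrier H" "\<eta> \<in> carrier H"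
  shows "ip H \<xi> (c \<odot> \<eta>) = cnj c * ip H \<xi> \<eta>"
proof -
  have "ip H \<xi> (c \<odot> \<eta>) = cnj (ip H (c \<odot> \<eta>) \<xi>)"
    using assms by (intro ip_cnj) auto
  then show ?thesis
    using assms ip_cnj[of \<eta> \<xi>] by simp
qed

lemma ip_zero_right [simp]: "\<eta> \<in> carrier H \<Longrightarrow> ip H \<eta> \<zero> = 0"
  using ip_smult_right[of \<eta> \<eta> 0] by simp

lemma ip_minus_right [simp]:
  "\<lbrakk>\<xi> \<in> carrier H; \<eta> \<in> carrier H; \<zeta> \<in> carrier H\<rbrakk> \<Longrightarrow> ip H \<zeta> (\<xi> \<ominus> \<eta>) = ip H \<zeta> \<xi> - ip H \<zeta> \<eta>"
  by (simp add: minus_eq_smult)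

text \<open>The difference is orthogonal to itself, hence zero by definiteness. The rule turns
  vector identities into scalar ones, which \<open>simp\<close> settles from linearity of
  \<open>ip\<close>; many module and operator identities below are proved in this way.\<close>

lemma vector_eqI:
  assumes "\<xi> \<in> carrier H" "\<eta> \<in> carrier H"
    and "\<And>\<zeta>. \<zeta> \<in> carrier H \<Longrightarrow> ip H \<xi> \<zeta> = ip H \<eta> \<zeta>"
  shows "\<xi> = \<eta>"
proof -
  have "\<xi> \<ominus> \<eta> = \<zero>"
    using assms by (intro ip_definite) auto
  then show ?thesis
    using assms(1,2) by simp
qed

lemma vector_eqI_right:
  assumes "\<xi> \<in> carrier H" "\<eta> \<in> carrier H"
    and "\<And>\<zeta>. \<zeta> \<in> carrier H \<Longrightarrow> ip H \<zeta> \<xi> = ip H \<zeta> \<eta>"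
  shows "\<xi> = \<eta>"
  using assms ip_cnj by (intro vector_eqI) metis+

lemma ip_self: "\<xi> \<in> carrier H \<Longrightarrow> ip H \<xi> \<xi> = complex_of_real ((hnorm H \<xi>)\<^sup>2)"
  using ip_nonneg[of \<xi>] by (auto simp: hnorm_def complex_eq_iff complex_nonneg_iff)

lemma hnorm_nonneg [simp]: "0 \<le> hnorm H \<xi>" if "\<xi> \<in> carrier H"
  using ip_nonneg[OF that] by (auto simp: hnorm_def complex_nonneg_iff)

lemma hnorm_sq: "\<xi> \<in> carrier H \<Longrightarrow> (hnorm H \<xi>)\<^sup>2 = Re (ip H \<xi> \<xi>)"
  by (simp add: ip_self)

lemma hnorm_zero [simp]: "hnorm H \<zero> = 0"
  by (simp add: hnorm_def)

lemma hnorm_eq_0: "\<xi> \<in> carrier H \<Longrightarrow> hnorm H \<xi> = 0 \<longleftrightarrow> \<xi> = \<zero>"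
  using ip_definite[of \<xi>] by (auto simp: ip_self)

lemma hnorm_add_sq:
  assumes "\<xi> \<in> carrier H" "\<eta> \<in> carrier H"
  shows "(hnorm H (\<xi> \<oplus> \<eta>))\<^sup>2 = (hnorm H \<xi>)\<^sup>2 + 2 * Re (ip H \<xi> \<eta>) + (hnorm H \<eta>)\<^sup>2"
  using assms by (simp add: hnorm_sq ip_cnj[of \<xi> \<eta>])

lemma hnorm_minus_sq:
  assumes "\<xi> \<in> carrier H" "\<eta> \<in> carrier H"
  shows "(hnorm H (\<xi> \<ominus> \<eta>))\<^sup>2 = (hnorm H \<xi>)\<^sup>2 - 2 * Re (ip H \<xi> \<eta>) + (hnorm H \<eta>)\<^sup>2"
  using assms by (simp add: hnorm_sq ip_cnj[of \<xi> \<eta>])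

lemma hnorm_smult [simp]:
  assumes "\<xi> \<in> carrier H"
  shows "hnorm H (c \<odot> \<xi>) = cmod c * hnorm H \<xi>"
proof -
  have "ip H (c \<odot> \<xi>) (c \<odot> \<xi>) = complex_of_real ((cmod c * hnorm H \<xi>)\<^sup>2)"
    using assms complex_norm_square[of c]
    by (simp add: ip_self[OF assms] power_mult_distrib mult.assoc[symmetric])
  then have "(hnorm H (c \<odot> \<xi>))\<^sup>2 = (cmod c * hnorm H \<xi>)\<^sup>2"
    using assms by (simp add: hnorm_sq del: ip_smult ip_smult_right)
  then show ?thesis
    using assms by (simp add: power2_eq_iff_nonneg)
qed

lemma cauchy_schwarz:
  assumes "\<xi> \<in> carrier H" "\<eta> \<in> carrier H"
  shows "cmod (ip H \<xi> \<eta>) \<le> hnorm H \<xi> * hnorm H \<eta>"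
proof (cases "hnorm H \<eta> = 0")
  case True
  then show ?thesis
    using assms hnorm_eq_0 by auto
next
  case False
  define n where "n = (hnorm H \<eta>)\<^sup>2"
  define c where "c = ip H \<xi> \<eta>"
  have "n > 0"
    using False by (simp add: n_def)
  \<comment> \<open>The subtracted vector is the orthogonal projection of \<xi> on the line of
    \<eta>.\<close>
  have "0 \<le> (hnorm H (\<xi> \<ominus> (c / n) \<odot> \<eta>))\<^sup>2"
    by simp
  also have "\<dots> = (hnorm H \<xi>)\<^sup>2 - 2 * Re (cnj (c / n) * c) + (cmod (c / n) * hnorm H \<eta>)\<^sup>2"
    using assms by (simp add: hnorm_minus_sq c_def)
  also have "cnj (c / n) * c = complex_of_real ((cmod c)\<^sup>2 / n)"
    using complex_norm_square[of c] by (simp add: mult.commute)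
  also have "(cmod (c / n) * hnorm H \<eta>)\<^sup>2 = (cmod c)\<^sup>2 / n"
    using \<open>n > 0\<close> by (simp add: power_mult_distrib norm_divide power_divide n_def[symmetric]) (simp add: power2_eq_square)
  finally have "(cmod c)\<^sup>2 \<le> (hnorm H \<xi>)\<^sup>2 * n"
    using \<open>n > 0\<close> by (simp add: field_simps)
  then have "(cmod c)\<^sup>2 \<le> (hnorm H \<xi> * hnorm H \<eta>)\<^sup>2"
    by (simp add: n_def power_mult_distrib)
  then show ?thesis
    unfolding c_def using assms by (auto intro: power2_le_imp_le)
qed

lemma hnorm_triangle:
  assumes "\<xi> \<in> carrier H" "\<eta> \<in> carrier H"
  shows "hnorm H (\<xi> \<oplus> \<eta>) \<le> hnorm H \<xi> + hnorm H \<eta>"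
proof -
  have "Re (ip H \<xi> \<eta>) \<le> hnorm H \<xi> * hnorm H \<eta>"
    using cauchy_schwarz[OF assms] complex_Re_le_cmod[of "ip H \<xi> \<eta>"] by linarith
  then have "(hnorm H (\<xi> \<oplus> \<eta>))\<^sup>2 \<le> (hnorm H \<xi> + hnorm H \<eta>)\<^sup>2"
    using assms by (simp add: hnorm_add_sq power2_sum)
  then show ?thesis
    using assms by (auto intro: power2_le_imp_le)
qed

lemma hnorm_minus_commute:
  assumes "\<xi> \<in> carrier H" "\<eta> \<in> carrier H"
  shows "hnorm H (\<xi> \<ominus> \<eta>) = hnorm H (\<eta> \<ominus> \<xi>)"
  using assms by (simp add: hnorm_def algebra_simps)

lemma hnorm_triangle_minus:
  assumes "\<xi> \<in> carrier H" "\<eta> \<in> carrier H"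
  shows "hnorm H (\<xi> \<ominus> \<eta>) \<le> hnorm H \<xi> + hnorm H \<eta>"
  using hnorm_triangle[of \<xi> "(- 1) \<odot> \<eta>"] assms by (simp add: minus_eq_smult)

lemma hnorm_diff_le:
  assumes "\<xi> \<in> carrier H" "\<eta> \<in> carrier H"
  shows "\<bar>hnorm H \<xi> - hnorm H \<eta>\<bar> \<le> hnorm H (\<xi> \<ominus> \<eta>)"
proof -
  have "hnorm H \<alpha> \<le> hnorm H (\<alpha> \<ominus> \<beta>) + hnorm H \<beta>" if "\<alpha> \<in> carrier H" "\<beta> \<in> carrier H" for \<alpha> \<beta>
  proof -
    have "\<alpha> = (\<alpha> \<ominus> \<beta>) \<oplus> \<beta>"
      using that by (intro vector_eqI) auto
    then show ?thesis
      using that hnorm_triangle[of "\<alpha> \<ominus> \<beta>" \<beta>] by simp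
  qed
  from this[OF assms] this[OF assms(2,1)] show ?thesis
    using hnorm_minus_commute[OF assms] by linarith
qed

lemma hnorm_tendsto:
  assumes "\<And>n. s n \<in> carrier H" "\<xi> \<in> carrier H" "(\<lambda>n. hnorm H (s n \<ominus> \<xi>)) \<longlonglongrightarrow> 0"
  shows "(\<lambda>n. hnorm H (s n)) \<longlonglongrightarrow> hnorm H \<xi>"
proof -
  have "(\<lambda>n. hnorm H (s n) - hnorm H \<xi>) \<longlonglongrightarrow> 0"
    by (rule tendsto_rabs_zero_cancel, rule tendsto_sandwich[OF _ _ tendsto_const assms(3)])
      (use assms hnorm_diff_le in auto)
  then show ?thesis
    by (simp add: LIM_zero_iff)
qed

lemma ip_tendsto:
  assumes "\<And>n. s n \<in> carrier H" "\<xi> \<in> carrier H" "(\<lambda>n. hnorm H (s n \<ominus> \<xi>)) \<longlonglongrightarrow> 0"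
    and "\<eta> \<in> carrier H"
  shows "(\<lambda>n. ip H (s n) \<eta>) \<longlonglongrightarrow> ip H \<xi> \<eta>"
proof -
  have "(\<lambda>n. hnorm H (s n \<ominus> \<xi>) * hnorm H \<eta>) \<longlonglongrightarrow> 0"
    using tendsto_mult_right[OF assms(3), of "hnorm H \<eta>"] by simp
  then have "(\<lambda>n. ip H (s n) \<eta> - ip H \<xi> \<eta>) \<longlonglongrightarrow> 0"
  proof (rule Lim_null_comparison[rotated])
    show "\<forall>\<^sub>F n in sequentially. norm (ip H (s n) \<eta> - ip H \<xi> \<eta>) \<le> hnorm H (s n \<ominus> \<xi>) * hnorm H \<eta>"
      using assms cauchy_schwarz[of "s n \<ominus> \<xi>" \<eta> for n] by (intro always_eventually) auto
  qed
  then show ?thesis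
    by (simp add: LIM_zero_iff)
qed

lemma ip_finsum [simp]:
  "\<lbrakk>f \<in> I \<rightarrow> carrier H; \<eta> \<in> carrier H\<rbrakk> \<Longrightarrow> ip H (\<Oplus>i\<in>I. f i) \<eta> = (\<Sum>i\<in>I. ip H (f i) \<eta>)"
  by (induction I rule: infinite_finite_induct) (auto simp: Pi_iff)

lemma ip_finsum_right [simp]:
  "\<lbrakk>f \<in> I \<rightarrow> carrier H; \<eta> \<in> carrier H\<rbrakk> \<Longrightarrow> ip H \<eta> (\<Oplus>i\<in>I. f i) = (\<Sum>i\<in>I. ip H \<eta> (f i))"
  by (induction I rule: infinite_finite_induct) (auto simp: Pi_iff)

text \<open>The limit of a minimizing sequence of a convex set, which is Cauchy by the parallelogram law.\<close>

lemma minimizing_sequence: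
  assumes D: "D \<subseteq> carrier H" "D \<noteq> {}"
    and convex: "\<And>\<xi> \<eta> t. \<lbrakk>\<xi> \<in> D; \<eta> \<in> D; 0 \<le> t; t \<le> 1\<rbrakk> \<Longrightarrow>
      complex_of_real (1 - t) \<odot> \<xi> \<oplus> complex_of_real t \<odot> \<eta> \<in> D"
  shows "\<exists>s \<rho>. (\<forall>n. s n \<in> D) \<and> \<rho> \<in> carrier H \<and> (\<lambda>n. hnorm H (s n \<ominus> \<rho>)) \<longlonglongrightarrow> 0 \<and>
    (\<forall>\<eta>\<in>D. (hnorm H \<rho>)\<^sup>2 \<le> Re (ip H \<eta> \<rho>))"
proof -
  define d where "d = Inf (hnorm H ` D)"
  have D_carrier: "\<xi> \<in> D \<Longrightarrow> \<xi> \<in> carrier H" for \<xi>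
    using D by auto
  have bdd: "bdd_below (hnorm H ` D)"
    using D_carrier by (intro bdd_belowI[of _ 0]) auto
  have d_le: "d \<le> hnorm H \<xi>" if "\<xi> \<in> D" for \<xi>
    unfolding d_def using that bdd by (auto intro: cInf_lower)
  have "0 \<le> d"
    unfolding d_def using D by (intro cInf_greatest) (auto dest: D_carrier)
  have "\<exists>\<xi>\<in>D. hnorm H \<xi> < d + 1 / real (Suc n)" for n
    using cInf_lessD[of "hnorm H ` D" "d + 1 / real (Suc n)"] D unfolding d_def by auto
  then obtain s where s: "\<And>n. s n \<in> D" and s_lt: "\<And>n. hnorm H (s n) < d + 1 / real (Suc n)"
    by metis
  have s_carrier [simp]: "s n \<in> carrier H" for n
    using s D_carrier by auto
  \<comment> \<open>From index \<open>N\<close> on, squared norms are at most d^2 + e N, while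
    midpoints have norm at least d; the parallelogram law then bounds the differences by
    \<open>e N\<close>.\<close>
  define e where "e n = (d + 1 / real (Suc n))\<^sup>2 - d\<^sup>2" for n
  have e_lim: "e \<longlonglongrightarrow> 0"
  proof -
    have "e \<longlonglongrightarrow> (d + 0)\<^sup>2 - d\<^sup>2"
      unfolding e_def by (intro tendsto_intros LIMSEQ_inverse_real_of_nat[unfolded inverse_eq_divide])
    then show ?thesis by simp
  qed
  have close: "(hnorm H (s m \<ominus> s n))\<^sup>2 \<le> 4 * e N" if "N \<le> m" "N \<le> n" for m n N
  proof -
    have "complex_of_real (1 - 1/2) \<odot> s m \<oplus> complex_of_real (1/2) \<odot> s n \<in> D"
      by (intro convex s) auto
    moreover have "complex_of_real (1 - 1/2) \<odot> s m \<oplus> complex_of_real (1/2) \<odot> s n = (1/2) \<odot> (s m \<oplus> s n)"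
      by (intro vector_eqI) (auto simp: algebra_simps)
    ultimately have "d \<le> hnorm H ((1/2) \<odot> (s m \<oplus> s n))"
      using d_le by metis
    then have "2 * d \<le> hnorm H (s m \<oplus> s n)"
      by simp
    then have "(2 * d)\<^sup>2 \<le> (hnorm H (s m \<oplus> s n))\<^sup>2"
      using \<open>0 \<le> d\<close> by (intro power_mono) auto
    have "(hnorm H (s k))\<^sup>2 \<le> (d + 1 / real (Suc N))\<^sup>2" if "N \<le> k" for k
    proof -
      have "1 / real (Suc k) \<le> 1 / real (Suc N)"
        using that by (intro divide_left_mono) auto
      then show ?thesis
        using s_lt[of k] by (intro power_mono) auto
    qed
    from this[OF that(1)] this[OF that(2)] have "2 * (hnorm H (s m))\<^sup>2 + 2 * (hnorm H (s n))\<^sup>2 \<le> 4 * (e N + d\<^sup>2)"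
      by (simp add: e_def)
    with \<open>(2 * d)\<^sup>2 \<le> _\<close> show ?thesis
      by (simp add: hnorm_add_sq hnorm_minus_sq)
  qed
  obtain \<rho> where \<rho>: "\<rho> \<in> carrier H" and lim: "(\<lambda>n. hnorm H (s n \<ominus> \<rho>)) \<longlonglongrightarrow> 0"
  proof -
    have "\<exists>N. \<forall>m\<ge>N. \<forall>n\<ge>N. hnorm H (s m \<ominus> s n) < \<epsilon>" if "\<epsilon> > 0" for \<epsilon>
    proof -
      have "eventually (\<lambda>n. e n < \<epsilon>\<^sup>2 / 4) sequentially"
        using e_lim that by (intro order_tendstoD(2)[OF e_lim]) auto
      then obtain N where N: "e N < \<epsilon>\<^sup>2 / 4"
        by (auto simp: eventually_sequentially)
      have "hnorm H (s m \<ominus> s n) < \<epsilon>" if "m \<ge> N" "n \<ge> N" for m n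
      proof (rule power2_less_imp_less)
        show "(hnorm H (s m \<ominus> s n))\<^sup>2 < \<epsilon>\<^sup>2"
          using close[OF that] N by linarith
        show "0 \<le> \<epsilon>"
          using \<open>\<epsilon> > 0\<close> by simp
      qed
      then show ?thesis by blast
    qed
    from complete[of s, OF s_carrier this] that show ?thesis by blast
  qed
  have "hnorm H \<rho> = d"
  proof (rule LIMSEQ_unique)
    show "(\<lambda>n. hnorm H (s n)) \<longlonglongrightarrow> hnorm H \<rho>"
      by (rule hnorm_tendsto[OF _ \<rho> lim]) simp
    have "(\<lambda>n. d + 1 / real (Suc n)) \<longlonglongrightarrow> d + 0"
      by (intro tendsto_intros LIMSEQ_inverse_real_of_nat[unfolded inverse_eq_divide])
    then have "(\<lambda>n. d + 1 / real (Suc n)) \<longlonglongrightarrow> d"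
      by simp
    then show "(\<lambda>n. hnorm H (s n)) \<longlonglongrightarrow> d"
      by (rule tendsto_sandwich[OF _ _ tendsto_const, rotated 2])
        (use d_le s s_lt in \<open>auto intro!: always_eventually less_imp_le\<close>)
  qed
  have "(hnorm H \<rho>)\<^sup>2 \<le> Re (ip H \<eta> \<rho>)" if "\<eta> \<in> D" for \<eta>
  proof -
    have [simp]: "\<eta> \<in> carrier H" "\<rho> \<in> carrier H"
      using that \<rho> D_carrier by auto
    \<comment> \<open>\<open>D\<close> need not be closed, so \<rho> may lie outside it. The segment
      is therefore drawn from \<open>s n\<close> to \<eta>, inside \<open>D\<close>, and only the
      norm is passed to the limit; afterwards \<open>t\<close> tends to 0.\<close>
    have "0 \<le> 2 * Re (ip H (\<eta> \<ominus> \<rho>) \<rho>) + t * (hnorm H (\<eta> \<ominus> \<rho>))\<^sup>2" if t: "0 < t" "t \<le> 1" for t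
    proof -
      define x where "x n = complex_of_real (1 - t) \<odot> s n \<oplus> complex_of_real t \<odot> \<eta>" for n
      define y where "y = complex_of_real (1 - t) \<odot> \<rho> \<oplus> complex_of_real t \<odot> \<eta>"
      have x: "x n \<in> D" for n
        unfolding x_def using t by (intro convex s \<open>\<eta> \<in> D\<close>) auto
      have [simp]: "x n \<in> carrier H" "y \<in> carrier H" for n
        by (auto simp: x_def y_def)
      have "x n \<ominus> y = complex_of_real (1 - t) \<odot> (s n \<ominus> \<rho>)" for n
        unfolding x_def y_def by (intro vector_eqI) (auto simp: algebra_simps)
      then have "hnorm H (x n \<ominus> y) = (1 - t) * hnorm H (s n \<ominus> \<rho>)" for n
        using t by (simp add: abs_of_nonneg del: of_real_diff)
      then have "(\<lambda>n. hnorm H (x n \<ominus> y)) \<longlonglongrightarrow> 0"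
        using tendsto_mult_left[OF lim, of "1 - t"] by simp
      then have "(\<lambda>n. hnorm H (x n)) \<longlonglongrightarrow> hnorm H y"
        by (intro hnorm_tendsto) auto
      then have "d \<le> hnorm H y"
        by (rule LIMSEQ_le_const) (use d_le x in auto)
      then have "(hnorm H \<rho>)\<^sup>2 \<le> (hnorm H y)\<^sup>2"
        using \<open>hnorm H \<rho> = d\<close> \<open>0 \<le> d\<close> by (intro power_mono) auto
      also have "y = \<rho> \<oplus> complex_of_real t \<odot> (\<eta> \<ominus> \<rho>)"
        unfolding y_def by (intro vector_eqI) (auto simp: algebra_simps)
      also have "(hnorm H \<dots>)\<^sup>2 = (hnorm H \<rho>)\<^sup>2 + 2 * (t * Re (ip H \<rho> (\<eta> \<ominus> \<rho>))) + t\<^sup>2 * (hnorm H (\<eta> \<ominus> \<rho>))\<^sup>2"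
        using t by (simp add: hnorm_add_sq power_mult_distrib del: ip_minus_right)
      finally have "0 \<le> t * (2 * Re (ip H \<rho> (\<eta> \<ominus> \<rho>)) + t * (hnorm H (\<eta> \<ominus> \<rho>))\<^sup>2)"
        by (simp add: algebra_simps power2_eq_square)
      then have "0 \<le> 2 * Re (ip H \<rho> (\<eta> \<ominus> \<rho>)) + t * (hnorm H (\<eta> \<ominus> \<rho>))\<^sup>2"
        using t by (simp add: zero_le_mult_iff)
      moreover have "Re (ip H \<rho> (\<eta> \<ominus> \<rho>)) = Re (ip H (\<eta> \<ominus> \<rho>) \<rho>)"
        by (subst ip_cnj[of "\<eta> \<ominus> \<rho>"]) (auto simp del: ip_minus)
      ultimately show ?thesis by simp
    qed
    then have ge: "\<forall>\<^sub>F t in at_right 0. 0 \<le> 2 * Re (ip H (\<eta> \<ominus> \<rho>) \<rho>) + t * (hnorm H (\<eta> \<ominus> \<rho>))\<^sup>2"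
      unfolding eventually_at_right_field by (auto intro!: exI[of _ 1])
    have "((\<lambda>t. 2 * Re (ip H (\<eta> \<ominus> \<rho>) \<rho>) + t * (hnorm H (\<eta> \<ominus> \<rho>))\<^sup>2) \<longlongrightarrow>
        2 * Re (ip H (\<eta> \<ominus> \<rho>) \<rho>) + 0 * (hnorm H (\<eta> \<ominus> \<rho>))\<^sup>2) (at_right 0)"
      by (intro tendsto_intros)
    from tendsto_lowerbound[OF this ge] have "0 \<le> Re (ip H (\<eta> \<ominus> \<rho>) \<rho>)"
      by simp
    then show ?thesis
      by (simp add: hnorm_sq)
  qed
  with s \<rho> lim show ?thesis
    by (intro exI[of _ s] exI[of _ \<rho>]) auto
qed

text \<open>The set \<open>D\<close> where \<open>f\<close> equals 1 is convex, and its point \<rho>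
  of least norm is orthogonal to the kernel of \<open>f\<close>. Since \<xi> - f(\<xi>) \<rho> lies
  in that kernel, \<open>f\<close> is represented by \<rho> divided by its squared norm.\<close>

theorem riesz_representation:
  assumes add: "\<And>\<xi> \<eta>. \<lbrakk>\<xi> \<in> carrier H; \<eta> \<in> carrier H\<rbrakk> \<Longrightarrow> f (\<xi> \<oplus> \<eta>) = f \<xi> + f \<eta>"
    and smult: "\<And>c \<xi>. \<xi> \<in> carrier H \<Longrightarrow> f (c \<odot> \<xi>) = c * f \<xi>"
    and bounded: "\<And>\<xi>. \<xi> \<in> carrier H \<Longrightarrow> cmod (f \<xi>) \<le> b * hnorm H \<xi>"
  obtains \<eta> where "\<eta> \<in> carrier H" "\<And>\<xi>. \<xi> \<in> carrier H \<Longrightarrow> f \<xi> = ip H \<xi> \<eta>"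
proof (cases "\<forall>\<xi>\<in>carrier H. f \<xi> = 0")
  case True
  show thesis
    by (rule that[of \<zero>]) (simp_all add: True)
next
  case False
  then obtain \<xi>0 where \<xi>0: "\<xi>0 \<in> carrier H" "f \<xi>0 \<noteq> 0"
    by auto
  have minus: "f (\<xi> \<ominus> \<eta>) = f \<xi> - f \<eta>" if "\<xi> \<in> carrier H" "\<eta> \<in> carrier H" for \<xi> \<eta>
    using that by (simp add: minus_eq_smult add smult)
  define D where "D = {\<xi> \<in> carrier H. f \<xi> = 1}"
  have "(1 / f \<xi>0) \<odot> \<xi>0 \<in> D"
    using \<xi>0 by (simp add: D_def smult)
  then have "D \<noteq> {}" by blast
  have "D \<subseteq> carrier H"
    by (auto simp: D_def)
  have convex: "complex_of_real (1 - t) \<odot> \<xi> \<oplus> complex_of_real t \<odot> \<eta> \<in> D"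
    if "\<xi> \<in> D" "\<eta> \<in> D" for \<xi> \<eta> t
    using that by (auto simp: D_def add smult)
  obtain s \<rho> where s: "\<And>n. s n \<in> D" and \<rho>: "\<rho> \<in> carrier H"
    and lim: "(\<lambda>n. hnorm H (s n \<ominus> \<rho>)) \<longlonglongrightarrow> 0"
    and min: "\<And>\<eta>. \<eta> \<in> D \<Longrightarrow> (hnorm H \<rho>)\<^sup>2 \<le> Re (ip H \<eta> \<rho>)"
    using minimizing_sequence[OF \<open>D \<subseteq> carrier H\<close> \<open>D \<noteq> {}\<close>] convex by blast
  \<comment> \<open>Boundedness of \<open>f\<close> makes the hyperplane closed, so the limit of the
    points \<open>s n\<close> still belongs to it.\<close>
  have "f \<rho> = 1"
  proof -
    have "cmod (1 - f \<rho>) \<le> b * hnorm H (s n \<ominus> \<rho>)" for n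
      using bounded[of "s n \<ominus> \<rho>"] s[of n] \<rho> by (simp add: minus D_def)
    moreover have "(\<lambda>n. b * hnorm H (s n \<ominus> \<rho>)) \<longlonglongrightarrow> b * 0"
      by (intro tendsto_intros lim)
    ultimately have "cmod (1 - f \<rho>) \<le> b * 0"
      by (intro LIMSEQ_le_const) auto
    then show ?thesis by simp
  qed
  have orth: "ip H \<zeta> \<rho> = 0" if "\<zeta> \<in> carrier H" "f \<zeta> = 0" for \<zeta>
  proof -
    \<comment> \<open>Shifts of \<rho> along the kernel stay in \<open>D\<close>. With this
      coefficient the variational inequality says that the squared modulus of
      \<open>ip H \<zeta> \<rho>\<close> is at most 0.\<close>
    have "\<rho> \<oplus> (- cnj (ip H \<zeta> \<rho>)) \<odot> \<zeta> \<in> D"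
      using that \<rho> \<open>f \<rho> = 1\<close> by (simp add: D_def add smult)
    from min[OF this] have "Re (cnj (ip H \<zeta> \<rho>) * ip H \<zeta> \<rho>) \<le> 0"
      using that \<rho> by (simp add: hnorm_sq)
    then have "(cmod (ip H \<zeta> \<rho>))\<^sup>2 \<le> 0"
      by (simp add: cmod_power2) (simp add: power2_eq_square)
    then show ?thesis by simp
  qed
  define n where "n = complex_of_real ((hnorm H \<rho>)\<^sup>2)"
  have "hnorm H \<rho> \<noteq> 0"
    using \<open>f \<rho> = 1\<close> bounded[OF \<rho>] by auto
  then have "n \<noteq> 0"
    by (simp add: n_def)
  show thesis
  proof (rule that)
    show "(1 / n) \<odot> \<rho> \<in> carrier H"
      using \<rho> by simp
    fix \<xi> assume \<xi>: "\<xi> \<in> carrier H"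
    have "ip H (\<xi> \<ominus> f \<xi> \<odot> \<rho>) \<rho> = 0"
      using \<xi> \<rho> \<open>f \<rho> = 1\<close> by (intro orth) (auto simp: minus smult)
    then have "ip H \<xi> \<rho> = f \<xi> * n"
      using \<xi> \<rho> by (simp add: n_def ip_self)
    moreover have "cnj n = n"
      by (simp add: n_def)
    ultimately show "f \<xi> = ip H \<xi> ((1 / n) \<odot> \<rho>)"
      using \<xi> \<rho> \<open>n \<noteq> 0\<close> by simp
  qed
qed

end

section \<open>Operator norm, adjoints and the vector space of bounded operators\<close>

section \<open>Bounded operators\<close>

lemma elements_mat_subset_iff:
  "A \<in> carrier_mat n n \<Longrightarrow> elements_mat A \<subseteq> S \<longleftrightarrow> (\<forall>i<n. \<forall>j<n. A $$ (i, j) \<in> S)"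
  by (fastforce simp: elements_mat_def)

text \<open>Module axioms involve only the additive group and the scalar action, so they pass
  between records that differ in \<open>one\<close>, \<open>mult\<close>, \<open>star\<close> or
  \<open>pos\<close>.\<close>

lemma module_cong:
  assumes "module R M" "carrier N = carrier M" "add N = add M" "zero N = zero M" "smult N = smult M"
  shows "module R N"
proof -
  interpret M: module R M by fact
  have "\<exists>w\<in>carrier M. v \<oplus>\<^bsub>M\<^esub> w = \<zero>\<^bsub>M\<^esub>" if "v \<in> carrier M" for v
    using that M.r_neg M.a_inv_closed by blast
  then show ?thesis
    unfolding assms(2-) by (intro module_criteria)
      (simp_all add: assms M.a_ac M.smult_assoc1 M.smult_l_distr M.smult_r_distr M.R.is_cring)
qed

lemma finsum_record_cong:
  assumes "carrier N = carrier M" "add N = add M" "zero N = zero M"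
  shows "finsum N = finsum M"
  using assms by (intro ext) (simp add: finsum_def finprod_def)

lemma vectorspace_class_ringI: "module (class_ring :: complex ring) M \<Longrightarrow> vectorspace class_ring M"
  by (simp add: vectorspace_def class_field)

locale hilbert_pair = dom: hilbert_space H + cod: hilbert_space K
  for H :: "('h, 'm) hilbert_scheme" and K :: "('k, 'n) hilbert_scheme"
begin

lemma bounded_opsI:
  assumes "T \<in> extensional (carrier H)"
    and "\<And>\<xi>. \<xi> \<in> carrier H \<Longrightarrow> T \<xi> \<in> carrier K"
    and "\<And>\<xi> \<eta>. \<lbrakk>\<xi> \<in> carrier H; \<eta> \<in> carrier H\<rbrakk> \<Longrightarrow> T (\<xi> \<oplus>\<^bsub>H\<^esub> \<eta>) = T \<xi> \<oplus>\<^bsub>K\<^esub> T \<eta>"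
    and "\<And>c \<xi>. \<xi> \<in> carrier H \<Longrightarrow> T (c \<odot>\<^bsub>H\<^esub> \<xi>) = c \<odot>\<^bsub>K\<^esub> T \<xi>"
    and "\<And>\<xi>. \<xi> \<in> carrier H \<Longrightarrow> hnorm K (T \<xi>) \<le> c * hnorm H \<xi>"
  shows "T \<in> bounded_ops H K"
  using assms by (auto simp: bounded_ops_def module_hom_def intro!: exI[of _ c])

context
  fixes T assumes T: "T \<in> bounded_ops H K"
begin

lemma op_extensional: "T \<in> extensional (carrier H)"
  using T by (simp add: bounded_ops_def)

lemma op_closed [simp]: "\<xi> \<in> carrier H \<Longrightarrow> T \<xi> \<in> carrier K"
  using T by (auto simp: bounded_ops_def module_hom_def)

lemma op_add [simp]:
  "\<lbrakk>\<xi> \<in> carrier H; \<eta> \<in> carrier H\<rbrakk> \<Longrightarrow> T (\<xi> \<oplus>\<^bsub>H\<^esub> \<eta>) = T \<xi> \<oplus>\<^bsub>K\<^esub> T \<eta>"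
  using T by (auto simp: bounded_ops_def module_hom_def)

lemma op_smult [simp]: "\<xi> \<in> carrier H \<Longrightarrow> T (c \<odot>\<^bsub>H\<^esub> \<xi>) = c \<odot>\<^bsub>K\<^esub> T \<xi>"
  using T by (auto simp: bounded_ops_def module_hom_def)

lemma op_zero [simp]: "T \<zero>\<^bsub>H\<^esub> = \<zero>\<^bsub>K\<^esub>"
  using op_smult[of "\<zero>\<^bsub>H\<^esub>" 0] by simp

lemma op_minus [simp]:
  "\<lbrakk>\<xi> \<in> carrier H; \<eta> \<in> carrier H\<rbrakk> \<Longrightarrow> T (\<xi> \<ominus>\<^bsub>H\<^esub> \<eta>) = T \<xi> \<ominus>\<^bsub>K\<^esub> T \<eta>"
  by (simp add: dom.minus_eq_smult cod.minus_eq_smult)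

lemma op_finsum [simp]:
  "f \<in> I \<rightarrow> carrier H \<Longrightarrow> T (finsum H f I) = (\<Oplus>\<^bsub>K\<^esub> i\<in>I. T (f i))"
  by (induction I rule: infinite_finite_induct) (auto simp: Pi_iff)

lemma opnorm_set: "\<exists>c. 0 \<le> c \<and> (\<forall>\<xi>\<in>carrier H. hnorm K (T \<xi>) \<le> c * hnorm H \<xi>)"
proof -
  obtain c where "\<forall>\<xi>\<in>carrier H. hnorm K (T \<xi>) \<le> c * hnorm H \<xi>"
    using T by (auto simp: bounded_ops_def)
  then have "\<forall>\<xi>\<in>carrier H. hnorm K (T \<xi>) \<le> max c 0 * hnorm H \<xi>"
    by (meson dom.hnorm_nonneg dual_order.trans max.cobounded1 mult_right_mono)
  then show ?thesis
    by (intro exI[of _ "max c 0"]) auto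
qed

lemma opnorm_nonneg: "0 \<le> opnorm H K T"
  unfolding opnorm_def using opnorm_set by (intro cInf_greatest) auto

lemma opnorm_bound:
  assumes \<xi>: "\<xi> \<in> carrier H"
  shows "hnorm K (T \<xi>) \<le> opnorm H K T * hnorm H \<xi>"
proof (cases "hnorm H \<xi> = 0")
  case True
  then have "\<xi> = \<zero>\<^bsub>H\<^esub>"
    using \<xi> dom.hnorm_eq_0 by auto
  then show ?thesis by simp
next
  case False
  then have pos: "0 < hnorm H \<xi>"
    using dom.hnorm_nonneg[OF \<xi>] by linarith
  have "hnorm K (T \<xi>) / hnorm H \<xi> \<le> opnorm H K T"
    unfolding opnorm_def using opnorm_set \<xi> pos by (intro cInf_greatest) (auto simp: divide_le_eq)
  then show ?thesis
    using pos by (simp add: divide_le_eq)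
qed

end

lemma opnorm_le:
  assumes "0 \<le> c" "\<And>\<xi>. \<xi> \<in> carrier H \<Longrightarrow> hnorm K (T \<xi>) \<le> c * hnorm H \<xi>"
  shows "opnorm H K T \<le> c"
  unfolding opnorm_def using assms by (intro cInf_lower) (auto intro!: bdd_belowI[of _ 0])

lemma op_ext:
  assumes "S \<in> bounded_ops H K" "T \<in> bounded_ops H K"
    and "\<And>\<xi>. \<xi> \<in> carrier H \<Longrightarrow> S \<xi> = T \<xi>"
  shows "S = T"
  by (rule extensionalityI[of _ "carrier H"]) (use assms op_extensional in auto)

lemma op_eqI:
  assumes "S \<in> bounded_ops H K" "T \<in> bounded_ops H K"
    and "\<And>\<xi> \<eta>. \<lbrakk>\<xi> \<in> carrier H; \<eta> \<in> carrier K\<rbrakk> \<Longrightarrow> ip K (S \<xi>) \<eta> = ip K (T \<xi>) \<eta>"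
  shows "S = T"
  using assms by (intro op_ext cod.vector_eqI) auto

subsection \<open>Adjoints\<close>

text \<open>The Riesz theorem, applied to the functional \<open>ip K (T \<xi>) \<eta>\<close> of
  \<xi> for each \<eta>, gives the values of the adjoint. Its bound comes from taking \<xi> = S
  \<eta>: the squared norm of S \<eta> is at most the norm of T times the norms of S \<eta> and
  \<eta>.\<close>

lemma adj_ex1:
  assumes T: "T \<in> bounded_ops H K"
  shows "\<exists>!S. S \<in> bounded_ops K H \<and>
    (\<forall>\<xi>\<in>carrier H. \<forall>\<eta>\<in>carrier K. ip K (T \<xi>) \<eta> = ip H \<xi> (S \<eta>))"
proof -
  interpret swap: hilbert_pair K H ..
  have "\<exists>\<zeta>. \<zeta> \<in> carrier H \<and> (\<forall>\<xi>\<in>carrier H. ip K (T \<xi>) \<eta> = ip H \<xi> \<zeta>)" if \<eta>: "\<eta> \<in> carrier K" for \<eta>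
  proof -
    have "cmod (ip K (T \<xi>) \<eta>) \<le> (opnorm H K T * hnorm K \<eta>) * hnorm H \<xi>" if \<xi>: "\<xi> \<in> carrier H" for \<xi>
    proof -
      have "cmod (ip K (T \<xi>) \<eta>) \<le> hnorm K (T \<xi>) * hnorm K \<eta>"
        using T \<xi> \<eta> by (intro cod.cauchy_schwarz) auto
      also have "\<dots> \<le> (opnorm H K T * hnorm H \<xi>) * hnorm K \<eta>"
        using opnorm_bound[OF T \<xi>] \<eta> by (intro mult_right_mono) auto
      finally show ?thesis
        by (simp add: algebra_simps)
    qed
    then obtain \<zeta> where "\<zeta> \<in> carrier H" "\<And>\<xi>. \<xi> \<in> carrier H \<Longrightarrow> ip K (T \<xi>) \<eta> = ip H \<xi> \<zeta>"
      using T \<eta> by (rule_tac dom.riesz_representation[of "\<lambda>\<xi>. ip K (T \<xi>) \<eta>"]) auto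
    then show ?thesis by blast
  qed
  then obtain S0 where S0: "\<And>\<eta>. \<eta> \<in> carrier K \<Longrightarrow> S0 \<eta> \<in> carrier H"
    and ip0: "\<And>\<xi> \<eta>. \<lbrakk>\<xi> \<in> carrier H; \<eta> \<in> carrier K\<rbrakk> \<Longrightarrow> ip K (T \<xi>) \<eta> = ip H \<xi> (S0 \<eta>)"
    by metis
  \<comment> \<open>Elements of \<open>bounded_ops\<close> are extensional functions; the
    restriction brings the chosen values into this form, which is also what makes the adjoint
    unique.\<close>
  define S where "S = restrict S0 (carrier K)"
  have S [simp]: "S \<eta> \<in> carrier H" if "\<eta> \<in> carrier K" for \<eta>
    using that S0 by (simp add: S_def)
  have ip_S: "ip H \<xi> (S \<eta>) = ip K (T \<xi>) \<eta>" if "\<xi> \<in> carrier H" "\<eta> \<in> carrier K" for \<xi> \<eta>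
    using that ip0 by (simp add: S_def)
  have "S \<in> bounded_ops K H"
  proof (rule swap.bounded_opsI)
    show "S \<in> extensional (carrier K)"
      by (simp add: S_def)
    fix \<eta> assume \<eta>: "\<eta> \<in> carrier K"
    then show "S \<eta> \<in> carrier H" by simp
    show "S (c \<odot>\<^bsub>K\<^esub> \<eta>) = c \<odot>\<^bsub>H\<^esub> S \<eta>" for c
      using \<eta> T by (intro dom.vector_eqI_right) (auto simp: ip_S)
    show "S (\<eta> \<oplus>\<^bsub>K\<^esub> \<eta>') = S \<eta> \<oplus>\<^bsub>H\<^esub> S \<eta>'" if "\<eta>' \<in> carrier K" for \<eta>'
      using \<eta> that T by (intro dom.vector_eqI_right) (auto simp: ip_S)
    have "(hnorm H (S \<eta>))\<^sup>2 = Re (ip K (T (S \<eta>)) \<eta>)"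
      using \<eta> by (simp add: dom.hnorm_sq ip_S)
    also have "\<dots> \<le> hnorm K (T (S \<eta>)) * hnorm K \<eta>"
      using \<eta> T cod.cauchy_schwarz[of "T (S \<eta>)" \<eta>] complex_Re_le_cmod order_trans by fastforce
    also have "\<dots> \<le> opnorm H K T * hnorm H (S \<eta>) * hnorm K \<eta>"
      using \<eta> opnorm_bound[OF T, of "S \<eta>"] by (intro mult_right_mono) auto
    finally have "hnorm H (S \<eta>) * hnorm H (S \<eta>) \<le> hnorm H (S \<eta>) * (opnorm H K T * hnorm K \<eta>)"
      by (simp add: power2_eq_square algebra_simps)
    then show "hnorm H (S \<eta>) \<le> opnorm H K T * hnorm K \<eta>"
      using \<eta> dom.hnorm_nonneg[of "S \<eta>"] opnorm_nonneg[OF T] cod.hnorm_nonneg[OF \<eta>]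
      by (cases "hnorm H (S \<eta>) = 0") (auto simp: mult_le_cancel_left less_le)
  qed
  moreover have "R = S" if "R \<in> bounded_ops K H"
    "\<forall>\<xi>\<in>carrier H. \<forall>\<eta>\<in>carrier K. ip K (T \<xi>) \<eta> = ip H \<xi> (R \<eta>)" for R
    using that \<open>S \<in> bounded_ops K H\<close> ip_S
    by (intro swap.op_ext dom.vector_eqI_right) (auto simp: swap.op_closed)
  ultimately show ?thesis
    using ip_S[symmetric] by blast
qed

lemma
  assumes "T \<in> bounded_ops H K"
  shows adj_bounded: "adj H K T \<in> bounded_ops K H"
    and ip_adj: "\<lbrakk>\<xi> \<in> carrier H; \<eta> \<in> carrier K\<rbrakk> \<Longrightarrow> ip H \<xi> (adj H K T \<eta>) = ip K (T \<xi>) \<eta>"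
    and adj_closed [simp]: "\<eta> \<in> carrier K \<Longrightarrow> adj H K T \<eta> \<in> carrier H"
proof -
  interpret swap: hilbert_pair K H ..
  have "adj H K T \<in> bounded_ops K H \<and>
      (\<forall>\<xi>\<in>carrier H. \<forall>\<eta>\<in>carrier K. ip K (T \<xi>) \<eta> = ip H \<xi> (adj H K T \<eta>))"
    unfolding adj_def using adj_ex1[OF assms] by (rule theI')
  then show *: "adj H K T \<in> bounded_ops K H"
    and "\<lbrakk>\<xi> \<in> carrier H; \<eta> \<in> carrier K\<rbrakk> \<Longrightarrow> ip H \<xi> (adj H K T \<eta>) = ip K (T \<xi>) \<eta>"
    by auto
  show "\<eta> \<in> carrier K \<Longrightarrow> adj H K T \<eta> \<in> carrier H"
    using swap.op_closed[OF *] .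
qed

lemma ip_adj_left:
  assumes "T \<in> bounded_ops H K" "\<xi> \<in> carrier H" "\<eta> \<in> carrier K"
  shows "ip H (adj H K T \<eta>) \<xi> = ip K \<eta> (T \<xi>)"
  using assms ip_adj[OF assms] dom.ip_cnj[of \<xi> "adj H K T \<eta>"] cod.ip_cnj[of "T \<xi>" \<eta>] by simp

lemma adj_eqI:
  assumes "T \<in> bounded_ops H K" "S \<in> bounded_ops K H"
    and "\<And>\<xi> \<eta>. \<lbrakk>\<xi> \<in> carrier H; \<eta> \<in> carrier K\<rbrakk> \<Longrightarrow> ip K (T \<xi>) \<eta> = ip H \<xi> (S \<eta>)"
  shows "adj H K T = S"
  using adj_ex1[OF assms(1)] assms ip_adj adj_bounded by metis

lemma opnorm_adj_le:
  assumes T: "T \<in> bounded_ops H K"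
  shows "opnorm K H (adj H K T) \<le> opnorm H K T"
proof -
  interpret swap: hilbert_pair K H ..
  show ?thesis
  proof (rule swap.opnorm_le)
    show "0 \<le> opnorm H K T"
      by (rule opnorm_nonneg[OF T])
    fix \<eta> assume \<eta>: "\<eta> \<in> carrier K"
    let ?S = "adj H K T"
    have "(hnorm H (?S \<eta>))\<^sup>2 = Re (ip K (T (?S \<eta>)) \<eta>)"
      using T \<eta> by (simp add: dom.hnorm_sq ip_adj)
    also have "\<dots> \<le> hnorm K (T (?S \<eta>)) * hnorm K \<eta>"
      using T \<eta> cod.cauchy_schwarz[of "T (?S \<eta>)" \<eta>] complex_Re_le_cmod order_trans by fastforce
    also have "\<dots> \<le> opnorm H K T * hnorm H (?S \<eta>) * hnorm K \<eta>"
      using T \<eta> opnorm_bound[OF T, of "?S \<eta>"] by (intro mult_right_mono) auto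
    finally have "hnorm H (?S \<eta>) * hnorm H (?S \<eta>) \<le> hnorm H (?S \<eta>) * (opnorm H K T * hnorm K \<eta>)"
      by (simp add: power2_eq_square algebra_simps)
    then show "hnorm H (?S \<eta>) \<le> opnorm H K T * hnorm K \<eta>"
      using T \<eta> dom.hnorm_nonneg[of "?S \<eta>"] opnorm_nonneg[OF T] cod.hnorm_nonneg[OF \<eta>]
      by (cases "hnorm H (?S \<eta>) = 0") (auto simp: mult_le_cancel_left less_le)
  qed
qed

subsection \<open>The space of bounded operators\<close>

lemma op_space_carrier [simp]: "carrier (op_space H K) = bounded_ops H K"
  by (simp add: op_space_def)

lemma op_space_zero_apply [simp]: "\<xi> \<in> carrier H \<Longrightarrow> \<zero>\<^bsub>op_space H K\<^esub> \<xi> = \<zero>\<^bsub>K\<^esub>"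
  by (simp add: op_space_def)

lemma op_space_add_apply [simp]: "\<xi> \<in> carrier H \<Longrightarrow> (S \<oplus>\<^bsub>op_space H K\<^esub> T) \<xi> = S \<xi> \<oplus>\<^bsub>K\<^esub> T \<xi>"
  by (simp add: op_space_def)

lemma op_space_smult_apply [simp]: "\<xi> \<in> carrier H \<Longrightarrow> (c \<odot>\<^bsub>op_space H K\<^esub> T) \<xi> = c \<odot>\<^bsub>K\<^esub> T \<xi>"
  by (simp add: op_space_def)

lemma zero_op [simp]: "\<zero>\<^bsub>op_space H K\<^esub> \<in> bounded_ops H K"
  by (rule bounded_opsI[where c = 0]) (auto simp: op_space_def)

lemma add_op [simp]:
  assumes S: "S \<in> bounded_ops H K" and T: "T \<in> bounded_ops H K"
  shows "S \<oplus>\<^bsub>op_space H K\<^esub> T \<in> bounded_ops H K"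
proof (rule bounded_opsI)
  show "S \<oplus>\<^bsub>op_space H K\<^esub> T \<in> extensional (carrier H)"
    by (simp add: op_space_def)
  fix \<xi> assume \<xi>: "\<xi> \<in> carrier H"
  show "(S \<oplus>\<^bsub>op_space H K\<^esub> T) \<xi> \<in> carrier K"
    using S T \<xi> by simp
  show "(S \<oplus>\<^bsub>op_space H K\<^esub> T) (c \<odot>\<^bsub>H\<^esub> \<xi>) = c \<odot>\<^bsub>K\<^esub> (S \<oplus>\<^bsub>op_space H K\<^esub> T) \<xi>" for c
    using S T \<xi> by (simp add: cod.smult_r_distr)
  show "(S \<oplus>\<^bsub>op_space H K\<^esub> T) (\<xi> \<oplus>\<^bsub>H\<^esub> \<eta>) = (S \<oplus>\<^bsub>op_space H K\<^esub> T) \<xi> \<oplus>\<^bsub>K\<^esub> (S \<oplus>\<^bsub>op_space H K\<^esub> T) \<eta>"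
    if "\<eta> \<in> carrier H" for \<eta>
    using S T \<xi> that by (intro cod.vector_eqI) auto
  have "hnorm K (S \<xi> \<oplus>\<^bsub>K\<^esub> T \<xi>) \<le> hnorm K (S \<xi>) + hnorm K (T \<xi>)"
    using S T \<xi> by (intro cod.hnorm_triangle) auto
  also have "\<dots> \<le> (opnorm H K S + opnorm H K T) * hnorm H \<xi>"
    using opnorm_bound[OF S \<xi>] opnorm_bound[OF T \<xi>] by (simp add: distrib_right)
  finally show "hnorm K ((S \<oplus>\<^bsub>op_space H K\<^esub> T) \<xi>) \<le> (opnorm H K S + opnorm H K T) * hnorm H \<xi>"
    using \<xi> by simp
qed

lemma smult_op [simp]:
  assumes T: "T \<in> bounded_ops H K"
  shows "c \<odot>\<^bsub>op_space H K\<^esub> T \<in> bounded_ops H K"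
proof (rule bounded_opsI)
  show "c \<odot>\<^bsub>op_space H K\<^esub> T \<in> extensional (carrier H)"
    by (simp add: op_space_def)
  fix \<xi> assume \<xi>: "\<xi> \<in> carrier H"
  show "(c \<odot>\<^bsub>op_space H K\<^esub> T) \<xi> \<in> carrier K"
    using T \<xi> by simp
  show "(c \<odot>\<^bsub>op_space H K\<^esub> T) (d \<odot>\<^bsub>H\<^esub> \<xi>) = d \<odot>\<^bsub>K\<^esub> (c \<odot>\<^bsub>op_space H K\<^esub> T) \<xi>" for d
    using T \<xi> by (intro cod.vector_eqI) auto
  show "(c \<odot>\<^bsub>op_space H K\<^esub> T) (\<xi> \<oplus>\<^bsub>H\<^esub> \<eta>) = (c \<odot>\<^bsub>op_space H K\<^esub> T) \<xi> \<oplus>\<^bsub>K\<^esub> (c \<odot>\<^bsub>op_space H K\<^esub> T) \<eta>"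
    if "\<eta> \<in> carrier H" for \<eta>
    using T \<xi> that by (intro cod.vector_eqI) (auto simp: algebra_simps)
  show "hnorm K ((c \<odot>\<^bsub>op_space H K\<^esub> T) \<xi>) \<le> (cmod c * opnorm H K T) * hnorm H \<xi>"
    using T \<xi> opnorm_bound[OF T \<xi>] by (simp add: mult.assoc mult_left_mono)
qed

lemma op_space_module: "module class_ring (op_space H K)"
proof (rule module_criteria)
  show "cring (class_ring :: complex ring)" ..
  show "\<forall>T\<in>carrier (op_space H K). \<exists>S\<in>carrier (op_space H K). T \<oplus>\<^bsub>op_space H K\<^esub> S = \<zero>\<^bsub>op_space H K\<^esub>"
  proof
    fix T assume T: "T \<in> carrier (op_space H K)"
    then have "T \<oplus>\<^bsub>op_space H K\<^esub> ((- 1) \<odot>\<^bsub>op_space H K\<^esub> T) = \<zero>\<^bsub>op_space H K\<^esub>"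
      by (intro op_eqI) auto
    then show "\<exists>S\<in>carrier (op_space H K). T \<oplus>\<^bsub>op_space H K\<^esub> S = \<zero>\<^bsub>op_space H K\<^esub>"
      using T smult_op[of T] by (metis op_space_carrier)
  qed
qed (auto intro!: op_eqI simp: algebra_simps)

sublocale op: vectorspace class_ring "op_space H K"
  by (rule vectorspace_class_ringI) (rule op_space_module)

lemma op_space_minus_apply [simp]:
  assumes "S \<in> bounded_ops H K" "T \<in> bounded_ops H K" "\<xi> \<in> carrier H"
  shows "(S \<ominus>\<^bsub>op_space H K\<^esub> T) \<xi> = S \<xi> \<ominus>\<^bsub>K\<^esub> T \<xi>"
proof -
  have "\<ominus>\<^bsub>op_space H K\<^esub> T = (- 1) \<odot>\<^bsub>op_space H K\<^esub> T"
    using op.smult_minus_1[of T] assms by (simp add: class_ring_simps class_ring.ring_simprules)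
  then show ?thesis
    using assms by (simp add: a_minus_def cod.a_inv_eq_smult)
qed

lemma minus_op [simp]:
  "\<lbrakk>S \<in> bounded_ops H K; T \<in> bounded_ops H K\<rbrakk> \<Longrightarrow> S \<ominus>\<^bsub>op_space H K\<^esub> T \<in> bounded_ops H K"
  using op.minus_closed by simp

lemma op_space_finsum_apply:
  assumes "\<xi> \<in> carrier H"
  shows "T \<in> I \<rightarrow> bounded_ops H K \<Longrightarrow> finsum (op_space H K) T I \<xi> = (\<Oplus>\<^bsub>K\<^esub> i\<in>I. T i \<xi>)"
  using assms by (induction I rule: infinite_finite_induct) (auto simp: Pi_iff)

lemma opnorm_zero [simp]: "opnorm H K \<zero>\<^bsub>op_space H K\<^esub> = 0"
  using opnorm_nonneg[OF zero_op] by (intro antisym opnorm_le) auto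

lemma opnorm_eq_0D:
  assumes T: "T \<in> bounded_ops H K" and "opnorm H K T = 0"
  shows "T = \<zero>\<^bsub>op_space H K\<^esub>"
proof (rule op_ext[OF T zero_op])
  fix \<xi> assume \<xi>: "\<xi> \<in> carrier H"
  then have "hnorm K (T \<xi>) = 0"
    using opnorm_bound[OF T \<xi>] assms cod.hnorm_nonneg[OF op_closed[OF T \<xi>]] by simp
  then show "T \<xi> = \<zero>\<^bsub>op_space H K\<^esub> \<xi>"
    using \<xi> T by (simp add: cod.hnorm_eq_0)
qed

lemma opnorm_add_le:
  assumes S: "S \<in> bounded_ops H K" and T: "T \<in> bounded_ops H K"
  shows "opnorm H K (S \<oplus>\<^bsub>op_space H K\<^esub> T) \<le> opnorm H K S + opnorm H K T"
proof (rule opnorm_le)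
  fix \<xi> assume \<xi>: "\<xi> \<in> carrier H"
  have "hnorm K (S \<xi> \<oplus>\<^bsub>K\<^esub> T \<xi>) \<le> hnorm K (S \<xi>) + hnorm K (T \<xi>)"
    using S T \<xi> by (intro cod.hnorm_triangle) auto
  also have "\<dots> \<le> (opnorm H K S + opnorm H K T) * hnorm H \<xi>"
    using opnorm_bound[OF S \<xi>] opnorm_bound[OF T \<xi>] by (simp add: distrib_right)
  finally show "hnorm K ((S \<oplus>\<^bsub>op_space H K\<^esub> T) \<xi>) \<le> (opnorm H K S + opnorm H K T) * hnorm H \<xi>"
    using \<xi> by simp
qed (use opnorm_nonneg S T in auto)

lemma opnorm_smult_le:
  assumes T: "T \<in> bounded_ops H K"
  shows "opnorm H K (c \<odot>\<^bsub>op_space H K\<^esub> T) \<le> cmod c * opnorm H K T"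
  using opnorm_nonneg[OF T] T opnorm_bound[OF T]
  by (intro opnorm_le) (auto simp: mult.assoc mult_left_mono)

lemma op_minus_eq_smult:
  assumes S: "S \<in> bounded_ops H K" and T: "T \<in> bounded_ops H K"
  shows "S \<ominus>\<^bsub>op_space H K\<^esub> T = S \<oplus>\<^bsub>op_space H K\<^esub> ((- 1) \<odot>\<^bsub>op_space H K\<^esub> T)"
  using assms by (intro op_eqI) auto

end

lemma compose_op:
  assumes "hilbert_space H" "hilbert_space K" "hilbert_space L"
    and S: "S \<in> bounded_ops K L" and T: "T \<in> bounded_ops H K"
  shows "compose (carrier H) S T \<in> bounded_ops H L"
    and "opnorm H L (compose (carrier H) S T) \<le> opnorm K L S * opnorm H K T"
proof -
  interpret H: hilbert_space H by fact
  interpret K: hilbert_space K by fact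
  interpret L: hilbert_space L by fact
  interpret HK: hilbert_pair H K ..
  interpret KL: hilbert_pair K L ..
  interpret HL: hilbert_pair H L ..
  have bound: "hnorm L (compose (carrier H) S T \<xi>) \<le> (opnorm K L S * opnorm H K T) * hnorm H \<xi>"
    if \<xi>: "\<xi> \<in> carrier H" for \<xi>
  proof -
    have "hnorm L (S (T \<xi>)) \<le> opnorm K L S * hnorm K (T \<xi>)"
      using T \<xi> by (intro KL.opnorm_bound[OF S]) auto
    also have "\<dots> \<le> opnorm K L S * (opnorm H K T * hnorm H \<xi>)"
      using HK.opnorm_bound[OF T \<xi>] KL.opnorm_nonneg[OF S] by (rule mult_left_mono)
    finally show ?thesis
      using \<xi> by (simp add: compose_def mult.assoc)
  qed
  show "compose (carrier H) S T \<in> bounded_ops H L"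
    using S T by (intro HL.bounded_opsI[OF _ _ _ _ bound]) (auto simp: compose_def extensional_def)
  show "opnorm H L (compose (carrier H) S T) \<le> opnorm K L S * opnorm H K T"
    using bound KL.opnorm_nonneg[OF S] HK.opnorm_nonneg[OF T] by (intro HL.opnorm_le) auto
qed

context hilbert_space
begin

lemma self_pair: "hilbert_pair H H"
  by unfold_locales

lemma id_op: "(\<lambda>\<xi>\<in>carrier H. \<xi>) \<in> bounded_ops H H"
  by (rule hilbert_pair.bounded_opsI[OF self_pair, where c = 1]) auto

end

section \<open>The Choi-Effros axioms for B(H), read off from sesquilinear forms\<close>

section \<open>The operator system of bounded operators\<close>

lemma sum_swap4:
  "(\<Sum>p\<in>P. \<Sum>q\<in>Q. \<Sum>i\<in>I. \<Sum>j\<in>J. f p q i j) = (\<Sum>i\<in>I. \<Sum>j\<in>J. \<Sum>p\<in>P. \<Sum>q\<in>Q. f p q i j)"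
proof -
  have "(\<Sum>p\<in>P. \<Sum>q\<in>Q. \<Sum>i\<in>I. \<Sum>j\<in>J. f p q i j) = (\<Sum>p\<in>P. \<Sum>i\<in>I. \<Sum>j\<in>J. \<Sum>q\<in>Q. f p q i j)"
    by (subst (2) sum.swap, subst (3) sum.swap) simp
  also have "\<dots> = (\<Sum>i\<in>I. \<Sum>j\<in>J. \<Sum>p\<in>P. \<Sum>q\<in>Q. f p q i j)"
    by (subst sum.swap, subst (2) sum.swap) simp
  finally show ?thesis .
qed

text \<open>The limit of \<open>r\<close> to 0 in scalar form, by which inequalities perturbed by
  \<open>r\<close> times the unit lose the perturbation. The 1 added to \<open>s\<close> in the
  proof allows \<open>s\<close> to be 0.\<close>

lemma nonneg_if_perturbations_nonneg:
  fixes x s :: real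
  assumes "0 \<le> s" and "\<And>r. r > 0 \<Longrightarrow> 0 \<le> r * s + x"
  shows "0 \<le> x"
proof (rule field_le_epsilon)
  fix e :: real assume "e > 0"
  have "e / (s + 1) * s \<le> e"
    using \<open>e > 0\<close> \<open>0 \<le> s\<close> by (simp add: field_simps)
  moreover have "0 \<le> e / (s + 1) * s + x"
    using \<open>e > 0\<close> \<open>0 \<le> s\<close> by (intro assms(2)) auto
  ultimately show "0 \<le> x + e" by linarith
qed

text \<open>The expression is a sesquilinear form evaluated at \<xi> + c \<eta>, with diagonal
  values \<open>d\<close> and \<open>e\<close> and mixed values \<open>a\<close> and
  \<open>b\<close>. Testing c = 0, 1, -1, \<i>, -\<i> is enough to polarize.\<close>

lemma sesquilinear_hermitian:
  fixes a b d e :: complex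
  assumes "\<And>c. Im (d + cnj c * a + c * b + c * cnj c * e) = 0"
  shows "b = cnj a"
  using assms[of 0] assms[of 1] assms[of "- 1"] assms[of \<i>] assms[of "- \<i>"]
  by (auto simp: complex_eq_iff)

lemma sesquilinear_eq_0:
  fixes a b :: complex
  assumes "\<And>c. cnj c * a + c * b = 0"
  shows "a = 0"
  using assms[of 1] assms[of \<i>] by (auto simp: complex_eq_iff)

context hilbert_space
begin

interpretation self: hilbert_pair H H
  by (rule self_pair)

lemma bounded_op_system_simps [simp]:
  "carrier (bounded_op_system H) = bounded_ops H H"
  "\<one>\<^bsub>bounded_op_system H\<^esub> = (\<lambda>\<xi>\<in>carrier H. \<xi>)"
  "\<zero>\<^bsub>bounded_op_system H\<^esub> = \<zero>\<^bsub>op_space H H\<^esub>"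
  "add (bounded_op_system H) = add (op_space H H)"
  "smult (bounded_op_system H) = smult (op_space H H)"
  "star (bounded_op_system H) = adj H H"
  by (simp_all add: bounded_op_system_def)

lemma bounded_op_system_module: "module class_ring (bounded_op_system H)"
  by (rule module_cong[OF self.op_space_module]) simp_all

lemma bounded_op_system_finsum: "finsum (bounded_op_system H) = finsum (op_space H H)"
  by (rule finsum_record_cong) simp_all

definition op_form :: "nat \<Rightarrow> ('h \<Rightarrow> 'h) mat \<Rightarrow> (nat \<Rightarrow> 'h) \<Rightarrow> (nat \<Rightarrow> 'h) \<Rightarrow> complex" where
  "op_form n A \<xi> \<eta> = (\<Sum>i<n. \<Sum>j<n. ip H ((A $$ (i, j)) (\<xi> j)) (\<eta> i))"

lemma matrices_iff:
  "A \<in> matrices n (bounded_op_system H) \<longleftrightarrow>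
    A \<in> carrier_mat n n \<and> (\<forall>i<n. \<forall>j<n. A $$ (i, j) \<in> bounded_ops H H)"
  by (auto simp: matrices_def)

lemma pos_iff:
  "A \<in> pos (bounded_op_system H) n \<longleftrightarrow> A \<in> matrices n (bounded_op_system H) \<and>
    (\<forall>\<xi>. (\<forall>i<n. \<xi> i \<in> carrier H) \<longrightarrow> 0 \<le> op_form n A \<xi> \<xi>)"
proof -
  have "A \<in> pos (bounded_op_system H) n \<longleftrightarrow> A \<in> carrier_mat n n \<and> elements_mat A \<subseteq> bounded_ops H H \<and>
    (\<forall>\<xi>. (\<forall>i<n. \<xi> i \<in> carrier H) \<longrightarrow> 0 \<le> op_form n A \<xi> \<xi>)"
    by (simp add: bounded_op_system_def op_form_def)
  then show ?thesis
    by (auto simp: matrices_iff elements_mat_subset_iff)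
qed

lemma
  assumes "A \<in> matrices n (bounded_op_system H)"
    and "\<forall>i<n. \<xi> i \<in> carrier H" "\<forall>i<n. \<xi>' i \<in> carrier H" "\<forall>i<n. \<eta> i \<in> carrier H"
  shows op_form_add: "op_form n A (\<lambda>i. \<xi> i \<oplus> c \<odot> \<xi>' i) \<eta> = op_form n A \<xi> \<eta> + c * op_form n A \<xi>' \<eta>"
    and op_form_add_right: "op_form n A \<eta> (\<lambda>i. \<xi> i \<oplus> c \<odot> \<xi>' i) = op_form n A \<eta> \<xi> + cnj c * op_form n A \<eta> \<xi>'"
  using assms unfolding op_form_def sum_distrib_left sum.distrib[symmetric]
  by (auto simp: matrices_iff intro!: sum.cong)

lemma op_form_polarization:
  assumes "A \<in> matrices n (bounded_op_system H)"
    and "\<forall>i<n. \<xi> i \<in> carrier H" "\<forall>i<n. \<eta> i \<in> carrier H"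
  shows "op_form n A (\<lambda>i. \<xi> i \<oplus> c \<odot> \<eta> i) (\<lambda>i. \<xi> i \<oplus> c \<odot> \<eta> i) =
    op_form n A \<xi> \<xi> + cnj c * op_form n A \<xi> \<eta> + c * op_form n A \<eta> \<xi> + c * cnj c * op_form n A \<eta> \<eta>"
  using assms by (simp add: op_form_add op_form_add_right algebra_simps)

definition at_index :: "nat \<Rightarrow> 'h \<Rightarrow> nat \<Rightarrow> 'h" where
  "at_index j \<xi> = (\<lambda>i. if i = j then \<xi> else \<zero>)"

lemma at_index_closed: "\<xi> \<in> carrier H \<Longrightarrow> \<forall>i<n. at_index j \<xi> i \<in> carrier H"
  by (simp add: at_index_def)

lemma op_form_at_index:
  assumes "A \<in> matrices n (bounded_op_system H)" "i < n" "j < n" "\<xi> \<in> carrier H" "\<eta> \<in> carrier H"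
  shows "op_form n A (at_index j \<xi>) (at_index i \<eta>) = ip H ((A $$ (i, j)) \<xi>) \<eta>"
proof -
  have "op_form n A (at_index j \<xi>) (at_index i \<eta>) =
      (\<Sum>k<n. if k = i then \<Sum>l<n. if l = j then ip H ((A $$ (i, j)) \<xi>) \<eta> else 0 else 0)"
    unfolding op_form_def
  proof (intro sum.cong HOL.refl)
    fix k assume k: "k \<in> {..<n}"
    have "ip H ((A $$ (k, l)) (at_index j \<xi> l)) (at_index i \<eta> k) =
        (if k = i then if l = j then ip H ((A $$ (i, j)) \<xi>) \<eta> else 0 else 0)" if "l < n" for l
      using assms k that by (auto simp: matrices_iff at_index_def)
    then show "(\<Sum>l<n. ip H ((A $$ (k, l)) (at_index j \<xi> l)) (at_index i \<eta> k)) =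
        (if k = i then \<Sum>l<n. if l = j then ip H ((A $$ (i, j)) \<xi>) \<eta> else 0 else 0)"
      by auto
  qed
  then show ?thesis
    using assms by simp
qed

lemma hermitian_op_form:
  assumes A: "A \<in> matrices n (bounded_op_system H)" "mat_star (bounded_op_system H) A = A"
    and \<xi>: "\<forall>i<n. \<xi> i \<in> carrier H" "\<forall>i<n. \<eta> i \<in> carrier H"
  shows "cnj (op_form n A \<xi> \<eta>) = op_form n A \<eta> \<xi>"
proof -
  have *: "A $$ (i, j) = adj H H (A $$ (j, i))" if "i < n" "j < n" for i j
    using A that by (metis (no_types, lifting) bounded_op_system_simps(6) carrier_matD case_prod_conv
      index_mat(1) mat_star_def matrices_iff)
  have "cnj (ip H ((A $$ (i, j)) (\<xi> j)) (\<eta> i)) = ip H ((A $$ (j, i)) (\<eta> i)) (\<xi> j)"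
    if "i < n" "j < n" for i j
  proof -
    have op: "A $$ (j, i) \<in> bounded_ops H H"
      using A that by (simp add: matrices_iff)
    then have "ip H ((A $$ (i, j)) (\<xi> j)) (\<eta> i) = ip H (\<xi> j) ((A $$ (j, i)) (\<eta> i))"
      using that \<xi> by (subst *) (auto simp: self.ip_adj_left)
    then show ?thesis
      using op that \<xi> by (subst ip_cnj) auto
  qed
  then have "cnj (op_form n A \<xi> \<eta>) = (\<Sum>i<n. \<Sum>j<n. ip H ((A $$ (j, i)) (\<eta> i)) (\<xi> j))"
    unfolding op_form_def cnj_sum by (intro sum.cong) auto
  then show ?thesis
    unfolding op_form_def by (subst (asm) sum.swap)
qed

text \<open>Cauchy-Schwarz for each entry costs only the sum of the entry norms, since a product of
  two lengths is at most the sum of all squared lengths. The resulting constant serves the order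
  unit axiom.\<close>

lemma op_form_bound:
  assumes A: "A \<in> matrices n (bounded_op_system H)" and \<xi>: "\<forall>i<n. \<xi> i \<in> carrier H"
  shows "cmod (op_form n A \<xi> \<xi>) \<le>
    (\<Sum>i<n. \<Sum>j<n. opnorm H H (A $$ (i, j))) * (\<Sum>k<n. (hnorm H (\<xi> k))\<^sup>2)"
proof -
  define s where "s = (\<Sum>k<n. (hnorm H (\<xi> k))\<^sup>2)"
  have le_s: "(hnorm H (\<xi> i))\<^sup>2 \<le> s" if "i < n" for i
    unfolding s_def using that by (intro member_le_sum) auto
  have "cmod (ip H ((A $$ (i, j)) (\<xi> j)) (\<xi> i)) \<le> opnorm H H (A $$ (i, j)) * s" if "i < n" "j < n" for i j
  proof -
    have op: "A $$ (i, j) \<in> bounded_ops H H"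
      using A that by (simp add: matrices_iff)
    have [simp]: "\<xi> i \<in> carrier H" "\<xi> j \<in> carrier H"
      using that \<xi> by auto
    have "0 \<le> (hnorm H (\<xi> i) - hnorm H (\<xi> j))\<^sup>2"
      by simp
    then have prod: "hnorm H (\<xi> j) * hnorm H (\<xi> i) \<le> s"
      using le_s[OF that(1)] le_s[OF that(2)] unfolding power2_diff by (simp add: algebra_simps)
    have "cmod (ip H ((A $$ (i, j)) (\<xi> j)) (\<xi> i)) \<le> hnorm H ((A $$ (i, j)) (\<xi> j)) * hnorm H (\<xi> i)"
      using op by (intro cauchy_schwarz) auto
    also have "\<dots> \<le> opnorm H H (A $$ (i, j)) * hnorm H (\<xi> j) * hnorm H (\<xi> i)"
      using self.opnorm_bound[OF op, of "\<xi> j"] by (intro mult_right_mono) auto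
    also have "\<dots> \<le> opnorm H H (A $$ (i, j)) * s"
      using prod self.opnorm_nonneg[OF op] by (simp add: mult.assoc mult_left_mono)
    finally show ?thesis .
  qed
  then show ?thesis
    unfolding op_form_def s_def[symmetric] sum_distrib_right
    by (intro order_trans[OF norm_sum] sum_mono) auto
qed

lemma op_form_plus_unit:
  assumes A: "A \<in> matrices n (bounded_op_system H)" and \<xi>: "\<forall>i<n. \<xi> i \<in> carrier H"
  shows "op_form n (mat_plus (bounded_op_system H)
      (mat_scale (bounded_op_system H) (complex_of_real r) (mat_unit (bounded_op_system H) n)) A) \<xi> \<xi> =
    complex_of_real (r * (\<Sum>k<n. (hnorm H (\<xi> k))\<^sup>2)) + op_form n A \<xi> \<xi>"
proof -
  have "op_form n (mat_plus (bounded_op_system H)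
      (mat_scale (bounded_op_system H) (complex_of_real r) (mat_unit (bounded_op_system H) n)) A) \<xi> \<xi> =
    (\<Sum>i<n. \<Sum>j<n. (if j = i then complex_of_real (r * (hnorm H (\<xi> i))\<^sup>2) else 0) + ip H ((A $$ (i, j)) (\<xi> j)) (\<xi> i))"
    unfolding op_form_def using assms
    by (intro sum.cong) (auto simp: mat_plus_def mat_scale_def mat_unit_def matrices_iff ip_self)
  also have "\<dots> = (\<Sum>i<n. complex_of_real (r * (hnorm H (\<xi> i))\<^sup>2)) + op_form n A \<xi> \<xi>"
    by (simp add: sum.distrib op_form_def)
  finally show ?thesis
    by (simp add: sum_distrib_left)
qed

lemma mat_plus_unit_matrices:
  "A \<in> matrices n (bounded_op_system H) \<Longrightarrow> mat_plus (bounded_op_system H)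
      (mat_scale (bounded_op_system H) c (mat_unit (bounded_op_system H) n)) A \<in> matrices n (bounded_op_system H)"
  by (auto simp: matrices_iff mat_plus_def mat_scale_def mat_unit_def id_op)

text \<open>The scalar matrix moves from the operators to the vectors: the form of \<alpha>^* A
  \<alpha> at \<xi> is that of A at \<alpha> \<xi>. Hence compressions preserve positivity.\<close>

lemma op_form_compress:
  assumes A: "A \<in> matrices n (bounded_op_system H)" and \<alpha>: "\<alpha> \<in> carrier_mat n m"
    and \<xi>: "\<forall>i<m. \<xi> i \<in> carrier H"
  shows "op_form m (mat_compress (bounded_op_system H) \<alpha> A) \<xi> \<xi> =
    op_form n A (\<lambda>i. \<Oplus>p\<in>{..<m}. \<alpha> $$ (i, p) \<odot> \<xi> p) (\<lambda>i. \<Oplus>p\<in>{..<m}. \<alpha> $$ (i, p) \<odot> \<xi> p)"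
proof -
  have [simp]: "dim_row \<alpha> = n" "dim_col \<alpha> = m"
    using \<alpha> by auto
  have "op_form m (mat_compress (bounded_op_system H) \<alpha> A) \<xi> \<xi> =
    (\<Sum>p<m. \<Sum>q<m. \<Sum>i<n. \<Sum>j<n. cnj (\<alpha> $$ (i, p)) * \<alpha> $$ (j, q) * ip H ((A $$ (i, j)) (\<xi> q)) (\<xi> p))"
    unfolding op_form_def
  proof (intro sum.cong HOL.refl)
    fix p q assume pq: "p \<in> {..<m}" "q \<in> {..<m}"
    have [simp]: "\<xi> p \<in> carrier H" "\<xi> q \<in> carrier H"
      using pq \<xi> by auto
    have [simp]: "finsum (op_space H H) (\<lambda>j. (cnj (\<alpha> $$ (i, p)) * \<alpha> $$ (j, q)) \<odot>\<^bsub>op_space H H\<^esub> A $$ (i, j)) {..<n}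
        \<in> bounded_ops H H" if "i < n" for i
      using self.op.finsum_closed[of "\<lambda>j. (cnj (\<alpha> $$ (i, p)) * \<alpha> $$ (j, q)) \<odot>\<^bsub>op_space H H\<^esub> A $$ (i, j)" "{..<n}"]
        A that by (auto simp: matrices_iff)
    show "ip H ((mat_compress (bounded_op_system H) \<alpha> A $$ (p, q)) (\<xi> q)) (\<xi> p) =
       (\<Sum>i<n. \<Sum>j<n. cnj (\<alpha> $$ (i, p)) * \<alpha> $$ (j, q) * ip H ((A $$ (i, j)) (\<xi> q)) (\<xi> p))"
      using pq A by (auto simp: mat_compress_def bounded_op_system_finsum self.op_space_finsum_apply
          matrices_iff Pi_iff intro!: sum.cong)
  qed
  also have "\<dots> = (\<Sum>i<n. \<Sum>j<n. \<Sum>p<m. \<Sum>q<m.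
      cnj (\<alpha> $$ (i, p)) * \<alpha> $$ (j, q) * ip H ((A $$ (i, j)) (\<xi> q)) (\<xi> p))"
    by (rule sum_swap4)
  also have "\<dots> = op_form n A (\<lambda>i. \<Oplus>p\<in>{..<m}. \<alpha> $$ (i, p) \<odot> \<xi> p) (\<lambda>i. \<Oplus>p\<in>{..<m}. \<alpha> $$ (i, p) \<odot> \<xi> p)"
    unfolding op_form_def
  proof (intro sum.cong HOL.refl)
    fix i j assume ij: "i \<in> {..<n}" "j \<in> {..<n}"
    then have op: "A $$ (i, j) \<in> bounded_ops H H"
      using A by (auto simp: matrices_iff)
    show "(\<Sum>p<m. \<Sum>q<m. cnj (\<alpha> $$ (i, p)) * \<alpha> $$ (j, q) * ip H ((A $$ (i, j)) (\<xi> q)) (\<xi> p)) =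
      ip H ((A $$ (i, j)) (\<Oplus>p\<in>{..<m}. \<alpha> $$ (j, p) \<odot> \<xi> p)) (\<Oplus>p\<in>{..<m}. \<alpha> $$ (i, p) \<odot> \<xi> p)"
      using \<xi> op by (simp add: Pi_iff sum_distrib_left mult.assoc)
  qed
  finally show ?thesis .
qed

lemma mat_compress_matrices:
  assumes A: "A \<in> matrices n (bounded_op_system H)" and \<alpha>: "\<alpha> \<in> carrier_mat n m"
  shows "mat_compress (bounded_op_system H) \<alpha> A \<in> matrices m (bounded_op_system H)"
proof -
  have "(\<Oplus>\<^bsub>op_space H H\<^esub> i\<in>{..<n}. \<Oplus>\<^bsub>op_space H H\<^esub> j\<in>{..<n}. c i j \<odot>\<^bsub>op_space H H\<^esub> A $$ (i, j))
      \<in> carrier (op_space H H)" for c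
    using A by (intro self.op.finsum_closed) (auto simp: matrices_iff intro!: self.op.finsum_closed[simplified])
  then show ?thesis
    using \<alpha> by (auto simp: matrices_iff mat_compress_def bounded_op_system_finsum)
qed

text \<open>Positivity makes the form real at every vector. Polarization between vectors
  concentrated at two indices \<open>i\<close> and \<open>j\<close> then identifies the (i,j) entry
  with the adjoint of the (j,i) entry.\<close>

lemma pos_hermitian_op:
  assumes "A \<in> pos (bounded_op_system H) n"
  shows "mat_star (bounded_op_system H) A = A"
proof (rule eq_matI)
  have A: "A \<in> matrices n (bounded_op_system H)"
    and nonneg: "\<And>\<xi>. \<forall>i<n. \<xi> i \<in> carrier H \<Longrightarrow> 0 \<le> op_form n A \<xi> \<xi>"
    using assms by (auto simp: pos_iff)
  then have dim [simp]: "dim_row A = n" "dim_col A = n"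
    by (auto simp: matrices_iff)
  then show "dim_row (mat_star (bounded_op_system H) A) = dim_row A"
    "dim_col (mat_star (bounded_op_system H) A) = dim_col A"
    by (auto simp: mat_star_def)
  fix i j assume "i < dim_row A" "j < dim_col A"
  then have ij: "i < n" "j < n" by auto
  have "adj H H (A $$ (j, i)) = A $$ (i, j)"
  proof (rule self.adj_eqI)
    fix \<xi> \<eta> assume \<xi>: "\<xi> \<in> carrier H" "\<eta> \<in> carrier H"
    let ?x = "at_index i \<xi>" and ?y = "at_index j \<eta>"
    have "op_form n A ?y ?x = cnj (op_form n A ?x ?y)"
    proof (rule sesquilinear_hermitian)
      fix c
      have "0 \<le> op_form n A (\<lambda>i. ?x i \<oplus> c \<odot> ?y i) (\<lambda>i. ?x i \<oplus> c \<odot> ?y i)"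
        using \<xi> by (intro nonneg) (auto simp: at_index_def)
      then show "Im (op_form n A ?x ?x + cnj c * op_form n A ?x ?y + c * op_form n A ?y ?x + c * cnj c * op_form n A ?y ?y) = 0"
        using op_form_polarization[OF A at_index_closed at_index_closed] \<xi>
        by (simp add: complex_nonneg_iff)
    qed
    moreover have "op_form n A ?y ?x = ip H ((A $$ (i, j)) \<eta>) \<xi>"
      using A ij \<xi> by (simp add: op_form_at_index)
    moreover have "op_form n A ?x ?y = ip H ((A $$ (j, i)) \<xi>) \<eta>"
      using A ij \<xi> by (simp add: op_form_at_index)
    ultimately have "ip H ((A $$ (i, j)) \<eta>) \<xi> = cnj (ip H ((A $$ (j, i)) \<xi>) \<eta>)"
      by simp
    then show "ip H ((A $$ (j, i)) \<xi>) \<eta> = ip H \<xi> ((A $$ (i, j)) \<eta>)"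
      using A ij \<xi> ip_cnj[of "(A $$ (i, j)) \<eta>" \<xi>] by (simp add: matrices_iff)
  qed (use A ij in \<open>auto simp: matrices_iff\<close>)
  then show "mat_star (bounded_op_system H) A $$ (i, j) = A $$ (i, j)"
    using ij by (simp add: mat_star_def)
qed

text \<open>The order axioms are statements about \<open>op_form\<close>: the order unit comes from
  its norm bound, and the Archimedean axiom from letting \<open>r\<close> tend to 0 at each vector
  separately.\<close>

theorem bounded_op_system: "operator_system (bounded_op_system H)"
proof (intro operator_system.intro operator_system_axioms.intro)
  show "vectorspace class_ring (bounded_op_system H)"
    by (rule vectorspace_class_ringI) (rule bounded_op_system_module)
next
  fix s assume "s \<in> carrier (bounded_op_system H)"
  then show "star (bounded_op_system H) s \<in> carrier (bounded_op_system H)"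
    by (simp add: self.adj_bounded)
next
  fix s assume "s \<in> carrier (bounded_op_system H)"
  then show "star (bounded_op_system H) (star (bounded_op_system H) s) = s"
    by (auto intro!: self.adj_eqI simp: self.adj_bounded self.ip_adj_left)
next
  fix s t assume "s \<in> carrier (bounded_op_system H)" "t \<in> carrier (bounded_op_system H)"
  then show "star (bounded_op_system H) (s \<oplus>\<^bsub>bounded_op_system H\<^esub> t) =
      star (bounded_op_system H) s \<oplus>\<^bsub>bounded_op_system H\<^esub> star (bounded_op_system H) t"
    by (auto intro!: self.adj_eqI simp: self.adj_bounded self.ip_adj)
next
  fix s c assume "s \<in> carrier (bounded_op_system H)"
  then show "star (bounded_op_system H) (c \<odot>\<^bsub>bounded_op_system H\<^esub> s) =
      cnj c \<odot>\<^bsub>bounded_op_system H\<^esub> star (bounded_op_system H) s"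
    by (auto intro!: self.adj_eqI simp: self.adj_bounded self.ip_adj)
next
  show "\<one>\<^bsub>bounded_op_system H\<^esub> \<in> carrier (bounded_op_system H)"
    by (simp add: id_op)
next
  show "star (bounded_op_system H) \<one>\<^bsub>bounded_op_system H\<^esub> = \<one>\<^bsub>bounded_op_system H\<^esub>"
    using id_op by (auto intro!: self.adj_eqI)
next
  fix A n assume "A \<in> pos (bounded_op_system H) n"
  then show "A \<in> matrices n (bounded_op_system H) \<and> mat_star (bounded_op_system H) A = A"
    using pos_hermitian_op by (auto simp: pos_iff)
next
  fix A B n assume AB: "A \<in> pos (bounded_op_system H) n" "B \<in> pos (bounded_op_system H) n"
  have "op_form n (mat_plus (bounded_op_system H) A B) \<xi> \<xi> = op_form n A \<xi> \<xi> + op_form n B \<xi> \<xi>"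
    if "\<forall>i<n. \<xi> i \<in> carrier H" for \<xi>
    using AB that unfolding op_form_def sum.distrib[symmetric]
    by (auto simp: pos_iff matrices_iff mat_plus_def intro!: sum.cong)
  with AB show "mat_plus (bounded_op_system H) A B \<in> pos (bounded_op_system H) n"
    by (auto simp: pos_iff matrices_iff mat_plus_def)
next
  fix A n and r :: real assume A: "A \<in> pos (bounded_op_system H) n" and "0 \<le> r"
  have "op_form n (mat_scale (bounded_op_system H) (complex_of_real r) A) \<xi> \<xi> = r * op_form n A \<xi> \<xi>"
    if "\<forall>i<n. \<xi> i \<in> carrier H" for \<xi>
    using A that unfolding op_form_def sum_distrib_left
    by (auto simp: pos_iff matrices_iff mat_scale_def intro!: sum.cong)
  with A \<open>0 \<le> r\<close> show "mat_scale (bounded_op_system H) (complex_of_real r) A \<in> pos (bounded_op_system H) n"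
    by (auto simp: pos_iff matrices_iff mat_scale_def complex_nonneg_iff)
next
  fix A n assume A': "A \<in> pos (bounded_op_system H) n"
    and neg: "mat_scale (bounded_op_system H) (- 1) A \<in> pos (bounded_op_system H) n"
  then have A: "A \<in> matrices n (bounded_op_system H)"
    by (simp add: pos_iff)
  have zero: "op_form n A \<xi> \<xi> = 0" if \<xi>: "\<forall>i<n. \<xi> i \<in> carrier H" for \<xi>
  proof -
    have "op_form n (mat_scale (bounded_op_system H) (- 1) A) \<xi> \<xi> = - op_form n A \<xi> \<xi>"
      using A \<xi> unfolding op_form_def sum_negf[symmetric]
      by (auto simp: matrices_iff mat_scale_def intro!: sum.cong)
    moreover have "0 \<le> op_form n (mat_scale (bounded_op_system H) (- 1) A) \<xi> \<xi>" "0 \<le> op_form n A \<xi> \<xi>"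
      using A' neg \<xi> by (simp_all add: pos_iff)
    ultimately show ?thesis
      by (auto simp: complex_nonneg_iff complex_eq_iff)
  qed
  show "A = mat_null (bounded_op_system H) n"
  proof (rule eq_matI)
    fix i j assume "i < dim_row (mat_null (bounded_op_system H) n)" "j < dim_col (mat_null (bounded_op_system H) n)"
    then have ij: "i < n" "j < n"
      by (auto simp: mat_null_def)
    have "A $$ (i, j) = \<zero>\<^bsub>op_space H H\<^esub>"
    proof (rule self.op_eqI)
      fix \<xi> \<eta> assume \<xi>: "\<xi> \<in> carrier H" "\<eta> \<in> carrier H"
      let ?x = "at_index j \<xi>" and ?y = "at_index i \<eta>"
      \<comment> \<open>The form vanishes on the diagonal, hence everywhere by polarization, and
        vectors concentrated at one index read off the entries.\<close>
      have "op_form n A ?x ?y = 0"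
      proof (rule sesquilinear_eq_0)
        fix c
        have "op_form n A (\<lambda>i. ?x i \<oplus> c \<odot> ?y i) (\<lambda>i. ?x i \<oplus> c \<odot> ?y i) = 0"
          using \<xi> by (intro zero) (auto simp: at_index_def)
        then show "cnj c * op_form n A ?x ?y + c * op_form n A ?y ?x = 0"
          using op_form_polarization[OF A at_index_closed at_index_closed] \<xi> zero[OF at_index_closed]
          by simp
      qed
      then show "ip H ((A $$ (i, j)) \<xi>) \<eta> = ip H (\<zero>\<^bsub>op_space H H\<^esub> \<xi>) \<eta>"
        using A ij \<xi> by (simp add: op_form_at_index)
    qed (use A ij in \<open>auto simp: matrices_iff\<close>)
    then show "A $$ (i, j) = mat_null (bounded_op_system H) n $$ (i, j)"
      using ij by (simp add: mat_null_def)
  qed (use A in \<open>auto simp: matrices_iff mat_null_def\<close>)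
next
  fix A n m and \<alpha> :: "complex mat" assume A: "A \<in> pos (bounded_op_system H) n" and \<alpha>: "\<alpha> \<in> carrier_mat n m"
  then have mat: "A \<in> matrices n (bounded_op_system H)"
    by (simp add: pos_iff)
  have "0 \<le> op_form m (mat_compress (bounded_op_system H) \<alpha> A) \<xi> \<xi>" if "\<forall>i<m. \<xi> i \<in> carrier H" for \<xi>
    using A that unfolding op_form_compress[OF mat \<alpha> that]
    by (auto simp: pos_iff Pi_iff intro!: finsum_closed)
  then show "mat_compress (bounded_op_system H) \<alpha> A \<in> pos (bounded_op_system H) m"
    using mat_compress_matrices[OF mat \<alpha>] by (simp add: pos_iff)
next
  fix A n assume A: "A \<in> matrices n (bounded_op_system H)" and herm: "mat_star (bounded_op_system H) A = A"
  \<comment> \<open>The summand 1 guarantees r > 0 when all entries vanish.\<close>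
  define r where "r = 1 + (\<Sum>i<n. \<Sum>j<n. opnorm H H (A $$ (i, j)))"
  have "r > 0"
    unfolding r_def using A self.opnorm_nonneg by (auto simp: matrices_iff intro!: add_pos_nonneg sum_nonneg)
  moreover have "0 \<le> complex_of_real (r * (\<Sum>k<n. (hnorm H (\<xi> k))\<^sup>2)) + op_form n A \<xi> \<xi>"
    if \<xi>: "\<forall>i<n. \<xi> i \<in> carrier H" for \<xi>
  proof -
    have "cmod (op_form n A \<xi> \<xi>) \<le> r * (\<Sum>k<n. (hnorm H (\<xi> k))\<^sup>2)"
      using op_form_bound[OF A \<xi>] sum_nonneg[of "{..<n}" "\<lambda>k. (hnorm H (\<xi> k))\<^sup>2"]
      by (simp add: r_def distrib_right)
    moreover have "Im (op_form n A \<xi> \<xi>) = 0"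
      using hermitian_op_form[OF A herm \<xi> \<xi>] by (simp add: complex_eq_iff)
    ultimately show ?thesis
      using abs_Re_le_cmod[of "op_form n A \<xi> \<xi>"] by (simp add: complex_nonneg_iff)
  qed
  ultimately show "\<exists>r>0. mat_plus (bounded_op_system H)
      (mat_scale (bounded_op_system H) (complex_of_real r) (mat_unit (bounded_op_system H) n)) A
        \<in> pos (bounded_op_system H) n"
    using mat_plus_unit_matrices[OF A] op_form_plus_unit[OF A] by (auto simp: pos_iff intro!: exI[of _ r])
next
  fix A n assume A: "A \<in> matrices n (bounded_op_system H)"
    and pos: "\<And>r. r > 0 \<Longrightarrow> mat_plus (bounded_op_system H)
      (mat_scale (bounded_op_system H) (complex_of_real r) (mat_unit (bounded_op_system H) n)) A
        \<in> pos (bounded_op_system H) n"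
  have "0 \<le> op_form n A \<xi> \<xi>" if \<xi>: "\<forall>i<n. \<xi> i \<in> carrier H" for \<xi>
  proof -
    have *: "0 \<le> complex_of_real (r * (\<Sum>k<n. (hnorm H (\<xi> k))\<^sup>2)) + op_form n A \<xi> \<xi>" if "r > 0" for r
      using pos[OF that] \<xi> op_form_plus_unit[OF A \<xi>] by (auto simp: pos_iff)
    have "0 \<le> Re (op_form n A \<xi> \<xi>)"
      by (rule nonneg_if_perturbations_nonneg[of "\<Sum>k<n. (hnorm H (\<xi> k))\<^sup>2"])
        (use * in \<open>auto simp: complex_nonneg_iff intro: sum_nonneg\<close>)
    then show ?thesis
      using *[of 1] by (simp add: complex_nonneg_iff)
  qed
  with A show "A \<in> pos (bounded_op_system H) n"
    by (simp add: pos_iff)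
qed

end

section \<open>Unital self-adjoint subspaces as operator systems\<close>

section \<open>Operator subsystems\<close>

text \<open>\<open>finsum\<close> refers to the carrier of its record, so sums formed in a subspace
  and in the ambient space are a priori different terms.\<close>

lemma (in module) finsum_subset_carrier:
  assumes N: "module R N" "carrier N \<subseteq> carrier M" "add N = add M" "\<zero>\<^bsub>N\<^esub> = \<zero>\<^bsub>M\<^esub>"
    and f: "f \<in> A \<rightarrow> carrier N"
  shows "finsum N f A = finsum M f A"
  using f
proof (induction A rule: infinite_finite_induct)
  case (insert a A)
  interpret N: module R N by fact
  have "f a \<in> carrier M" "f \<in> A \<rightarrow> carrier M"
    using insert.prems N(2) by auto
  then show ?case
    using insert N by simp
next
  case (infinite A)
  interpret N: module R N by fact
  show ?case
    using infinite N by simp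
next
  case empty
  interpret N: module R N by fact
  show ?case
    using N by simp
qed

lemma (in module) submodule_module:
  assumes "submodule R W M" "carrier N = W" "add N = add M" "\<zero>\<^bsub>N\<^esub> = \<zero>\<^bsub>M\<^esub>" "smult N = smult M"
  shows "module R N"
  by (rule module_cong[OF submodule_is_module[OF assms(1)]]) (simp_all add: assms)

text \<open>The axioms are inherited, because the cones are those of \<open>S\<close> cut down to
  matrices with entries in \<open>W\<close>. The work lies in \<open>mat_compress\<close>, whose
  sums are formed with respect to the smaller carrier.\<close>

lemma (in operator_system) operator_subsystem:
  assumes W: "submodule class_ring W S" and star: "\<And>w. w \<in> W \<Longrightarrow> star S w \<in> W" and one: "\<one> \<in> W"
  shows "operator_system (operator_subsystem S W)"
proof -
  let ?T = "operator_subsystem S W"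
  have W_carrier: "W \<subseteq> carrier S"
    using W by (simp add: submodule_def)
  have simps [simp]: "carrier ?T = W" "\<one>\<^bsub>?T\<^esub> = \<one>" "\<zero>\<^bsub>?T\<^esub> = \<zero>" "add ?T = add S" "smult ?T = smult S" "star ?T = star S"
    by (simp_all add: operator_subsystem_def)
  have mod: "module class_ring ?T"
    by (rule submodule_module[OF W]) simp_all
  then interpret T: module class_ring ?T .
  have mat_simps: "mat_plus ?T = mat_plus S" "mat_scale ?T = mat_scale S" "mat_star ?T = mat_star S"
    "mat_unit ?T = mat_unit S" "mat_null ?T = mat_null S"
    by (intro ext; simp add: mat_plus_def mat_scale_def mat_star_def mat_unit_def mat_null_def cong: if_cong)+
  have matrices: "A \<in> matrices n ?T \<longleftrightarrow> A \<in> matrices n S \<and> elements_mat A \<subseteq> W" for A n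
    using W_carrier by (auto simp: matrices_def elements_mat_subset_iff)
  have pos: "A \<in> pos ?T n \<longleftrightarrow> A \<in> pos S n \<and> A \<in> matrices n ?T" for A n
    using pos_hermitian by (auto simp: operator_subsystem_def matrices[unfolded operator_subsystem_def])
  have closed: "\<And>v w. \<lbrakk>v \<in> W; w \<in> W\<rbrakk> \<Longrightarrow> v \<oplus> w \<in> W" "\<And>c w. w \<in> W \<Longrightarrow> c \<odot> w \<in> W"
    using W by (auto simp: submodule_def)
  have compress: "mat_compress ?T \<alpha> A = mat_compress S \<alpha> A"
    if "A \<in> matrices n ?T" "\<alpha> \<in> carrier_mat n m" for \<alpha> A n m
  proof -
    have dims: "dim_row \<alpha> = n" "dim_col \<alpha> = m"
      using that by auto
    have entries: "c \<odot> A $$ (i, j) \<in> W" if "i < n" "j < n" for c i j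
      using \<open>A \<in> matrices n ?T\<close> that closed by (auto simp: matrices_def)
    have inner: "finsum ?T (\<lambda>j. c j \<odot> A $$ (i, j)) {..<n} = finsum S (\<lambda>j. c j \<odot> A $$ (i, j)) {..<n}"
      "finsum ?T (\<lambda>j. c j \<odot> A $$ (i, j)) {..<n} \<in> W" if "i < n" for i c
      using entries that W_carrier T.finsum_closed[of "\<lambda>j. c j \<odot> A $$ (i, j)" "{..<n}"]
      by (auto intro!: finsum_subset_carrier mod)
    have "finsum ?T (\<lambda>i. finsum ?T (\<lambda>j. c i j \<odot> A $$ (i, j)) {..<n}) {..<n} =
        finsum S (\<lambda>i. finsum S (\<lambda>j. c i j \<odot> A $$ (i, j)) {..<n}) {..<n}" for c
    proof -
      have "finsum ?T (\<lambda>i. finsum ?T (\<lambda>j. c i j \<odot> A $$ (i, j)) {..<n}) {..<n} =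
        finsum S (\<lambda>i. finsum ?T (\<lambda>j. c i j \<odot> A $$ (i, j)) {..<n}) {..<n}"
        using inner W_carrier by (intro finsum_subset_carrier mod) auto
      also have "\<dots> = finsum S (\<lambda>i. finsum S (\<lambda>j. c i j \<odot> A $$ (i, j)) {..<n}) {..<n}"
        using inner W_carrier by (intro finsum_cong') auto
      finally show ?thesis .
    qed
    then show ?thesis
      by (simp add: mat_compress_def dims)
  qed
  have compress_matrices: "mat_compress ?T \<alpha> A \<in> matrices m ?T"
    if "A \<in> matrices n ?T" "\<alpha> \<in> carrier_mat n m" for \<alpha> A n m
  proof -
    have "finsum ?T (\<lambda>i. finsum ?T (\<lambda>j. c i j \<odot> A $$ (i, j)) {..<n}) {..<n} \<in> carrier ?T" for c
      using that closed by (intro T.finsum_closed) (auto simp: matrices_def intro!: T.finsum_closed[simplified])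
    then show ?thesis
      using that by (auto simp: matrices_def mat_compress_def)
  qed
  show ?thesis
  proof (intro operator_system.intro operator_system_axioms.intro; (unfold mat_simps simps)?)
    show "vectorspace class_ring ?T"
      by (rule vectorspace_class_ringI[OF mod])
    show "star S s \<in> W" if "s \<in> W" for s
      using that by (rule star)
    show "star S (star S s) = s" if "s \<in> W" for s
      using that W_carrier star_star by auto
    show "star S (s \<oplus> t) = star S s \<oplus> star S t" if "s \<in> W" "t \<in> W" for s t
      using that W_carrier star_add by auto
    show "star S (c \<odot> s) = cnj c \<odot> star S s" if "s \<in> W" for s c
      using that W_carrier star_smult by auto
    show "\<one> \<in> W" by (rule one)
    show "star S \<one> = \<one>" by (rule star_unit)
    show "A \<in> matrices n ?T \<and> mat_star S A = A" if "A \<in> pos ?T n" for A n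
      using that pos_hermitian pos by auto
    show "mat_plus S A B \<in> pos ?T n" if "A \<in> pos ?T n" "B \<in> pos ?T n" for A B n
      using that pos_plus closed by (auto simp: pos matrices_def mat_plus_def)
    show "mat_scale S (complex_of_real r) A \<in> pos ?T n" if "A \<in> pos ?T n" "0 \<le> r" for A n r
      using that pos_scale closed by (auto simp: pos matrices_def mat_scale_def)
    show "A = mat_null S n" if "A \<in> pos ?T n" "mat_scale S (- 1) A \<in> pos ?T n" for A n
      using that pos_proper by (auto simp: pos)
    show "mat_compress ?T \<alpha> A \<in> pos ?T m" if "A \<in> pos ?T n" "\<alpha> \<in> carrier_mat n m" for A n \<alpha> m
      using that pos_compress[of A n \<alpha> m] compress compress_matrices by (auto simp: pos)
    show "\<exists>r>0. mat_plus S (mat_scale S (complex_of_real r) (mat_unit S n)) A \<in> pos ?T n"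
      if A: "A \<in> matrices n ?T" "mat_star S A = A" for A n
    proof -
      obtain r where r: "r > 0" "mat_plus S (mat_scale S (complex_of_real r) (mat_unit S n)) A \<in> pos S n"
        using order_unit[of A n] A matrices by auto
      moreover have "mat_plus S (mat_scale S (complex_of_real r) (mat_unit S n)) A \<in> matrices n ?T"
        using A closed one T.zero_closed by (auto simp: matrices_def mat_plus_def mat_scale_def mat_unit_def)
      ultimately show ?thesis
        using pos by auto
    qed
    show "A \<in> pos ?T n" if "A \<in> matrices n ?T"
      "\<And>r. r > 0 \<Longrightarrow> mat_plus S (mat_scale S (complex_of_real r) (mat_unit S n)) A \<in> pos ?T n" for A n
      using that archimedean[of A n] pos matrices by auto
  qed
qed

section \<open>Square summable families and diagonal operators between them\<close>

section \<open>Direct sums of Hilbert spaces\<close>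

lemma infsum_of_real_complex:
  "f summable_on A \<Longrightarrow> infsum (\<lambda>i. complex_of_real (f i)) A = complex_of_real (infsum f A)"
  by (intro infsumI has_sum_of_real has_sum_infsum)

locale hilbert_family =
  fixes I :: "'i set" and H :: "'i \<Rightarrow> ('h, 'm) hilbert_scheme"
  assumes component: "i \<in> I \<Longrightarrow> hilbert_space (H i)"
begin

lemma component_group: "i \<in> I \<Longrightarrow> abelian_group (H i)"
  using component by (simp add: hilbert_space_def vectorspace_def module_def)

lemma component_monoid: "i \<in> I \<Longrightarrow> abelian_monoid (H i)"
  using component_group by (simp add: abelian_group_def)

lemma hilbert_sum_carrier:
  "\<xi> \<in> carrier (hilbert_sum I H) \<longleftrightarrow>
    \<xi> \<in> (\<Pi>\<^sub>E i\<in>I. carrier (H i)) \<and> (\<lambda>i. (hnorm (H i) (\<xi> i))\<^sup>2) summable_on I"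
  by (simp add: hilbert_sum_def)

lemma hilbert_sum_simps:
  "\<zero>\<^bsub>hilbert_sum I H\<^esub> = (\<lambda>i\<in>I. \<zero>\<^bsub>H i\<^esub>)"
  "\<xi> \<oplus>\<^bsub>hilbert_sum I H\<^esub> \<eta> = (\<lambda>i\<in>I. \<xi> i \<oplus>\<^bsub>H i\<^esub> \<eta> i)"
  "c \<odot>\<^bsub>hilbert_sum I H\<^esub> \<xi> = (\<lambda>i\<in>I. c \<odot>\<^bsub>H i\<^esub> \<xi> i)"
  "ip (hilbert_sum I H) \<xi> \<eta> = (\<Sum>\<^sub>\<infinity>i\<in>I. ip (H i) (\<xi> i) (\<eta> i))"
  by (simp_all add: hilbert_sum_def)

lemma component_closed: "\<lbrakk>\<xi> \<in> carrier (hilbert_sum I H); i \<in> I\<rbrakk> \<Longrightarrow> \<xi> i \<in> carrier (H i)"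
  by (auto simp: hilbert_sum_carrier)

lemma component_norm_summable:
  "\<xi> \<in> carrier (hilbert_sum I H) \<Longrightarrow> (\<lambda>i. (hnorm (H i) (\<xi> i))\<^sup>2) summable_on I"
  by (simp add: hilbert_sum_carrier)

lemma hilbert_sum_eqI:
  assumes "\<xi> \<in> carrier (hilbert_sum I H)" "\<eta> \<in> carrier (hilbert_sum I H)"
    and "\<And>i. i \<in> I \<Longrightarrow> \<xi> i = \<eta> i"
  shows "\<xi> = \<eta>"
  using assms by (intro PiE_ext[of \<xi> I _ \<eta>]) (auto simp: hilbert_sum_carrier)

text \<open>Cauchy-Schwarz in each component, with the product of two norms bounded by the sum of
  their squares, gives a summable majorant.\<close>

lemma ip_summable:
  assumes "\<xi> \<in> carrier (hilbert_sum I H)" "\<eta> \<in> carrier (hilbert_sum I H)"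
  shows "(\<lambda>i. ip (H i) (\<xi> i) (\<eta> i)) summable_on I"
proof -
  have "(\<lambda>i. (hnorm (H i) (\<xi> i))\<^sup>2 + (hnorm (H i) (\<eta> i))\<^sup>2) summable_on I"
    using assms by (intro summable_on_add component_norm_summable)
  then have "(\<lambda>i. norm (ip (H i) (\<xi> i) (\<eta> i))) summable_on I"
  proof (rule Infinite_Sum.abs_summable_on_comparison_test')
    fix i assume "i \<in> I"
    then interpret Hi: hilbert_space "H i" by (rule component)
    have [simp]: "\<xi> i \<in> carrier (H i)" "\<eta> i \<in> carrier (H i)"
      using assms \<open>i \<in> I\<close> component_closed by auto
    have "0 \<le> (hnorm (H i) (\<xi> i) - hnorm (H i) (\<eta> i))\<^sup>2" "0 \<le> hnorm (H i) (\<xi> i) * hnorm (H i) (\<eta> i)"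
      by auto
    moreover have "norm (ip (H i) (\<xi> i) (\<eta> i)) \<le> hnorm (H i) (\<xi> i) * hnorm (H i) (\<eta> i)"
      by (rule Hi.cauchy_schwarz) simp_all
    ultimately show "norm (ip (H i) (\<xi> i) (\<eta> i)) \<le> (hnorm (H i) (\<xi> i))\<^sup>2 + (hnorm (H i) (\<eta> i))\<^sup>2"
      unfolding power2_diff by linarith
  qed
  then show ?thesis
    by (rule Infinite_Sum.abs_summable_summable)
qed

lemma hilbert_sum_norm:
  assumes "\<xi> \<in> carrier (hilbert_sum I H)"
  shows "ip (hilbert_sum I H) \<xi> \<xi> = complex_of_real (\<Sum>\<^sub>\<infinity>i\<in>I. (hnorm (H i) (\<xi> i))\<^sup>2)"
proof -
  have "ip (hilbert_sum I H) \<xi> \<xi> = (\<Sum>\<^sub>\<infinity>i\<in>I. complex_of_real ((hnorm (H i) (\<xi> i))\<^sup>2))"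
    unfolding hilbert_sum_simps
    by (intro infsum_cong hilbert_space.ip_self component component_closed assms)
  also have "\<dots> = complex_of_real (\<Sum>\<^sub>\<infinity>i\<in>I. (hnorm (H i) (\<xi> i))\<^sup>2)"
    by (rule infsum_of_real_complex[OF component_norm_summable[OF assms]])
  finally show ?thesis .
qed

lemma hilbert_sum_closed:
  shows zero_in_sum: "\<zero>\<^bsub>hilbert_sum I H\<^esub> \<in> carrier (hilbert_sum I H)"
    and add_in_sum: "\<lbrakk>\<xi> \<in> carrier (hilbert_sum I H); \<eta> \<in> carrier (hilbert_sum I H)\<rbrakk> \<Longrightarrow>
      \<xi> \<oplus>\<^bsub>hilbert_sum I H\<^esub> \<eta> \<in> carrier (hilbert_sum I H)"
    and smult_in_sum: "\<xi> \<in> carrier (hilbert_sum I H) \<Longrightarrow> c \<odot>\<^bsub>hilbert_sum I H\<^esub> \<xi> \<in> carrier (hilbert_sum I H)"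
proof -
  have "(\<lambda>i\<in>I. \<zero>\<^bsub>H i\<^esub>) \<in> (\<Pi>\<^sub>E i\<in>I. carrier (H i))"
    by (auto intro!: abelian_monoid.zero_closed component_monoid)
  moreover have "(\<lambda>i. (hnorm (H i) ((\<lambda>i\<in>I. \<zero>\<^bsub>H i\<^esub>) i))\<^sup>2) summable_on I \<longleftrightarrow> (\<lambda>i. 0 :: real) summable_on I"
    by (intro summable_on_cong) (auto simp: hilbert_space.hnorm_zero component)
  ultimately show "\<zero>\<^bsub>hilbert_sum I H\<^esub> \<in> carrier (hilbert_sum I H)"
    by (simp add: hilbert_sum_carrier hilbert_sum_simps)
next
  assume \<xi>: "\<xi> \<in> carrier (hilbert_sum I H)" and \<eta>: "\<eta> \<in> carrier (hilbert_sum I H)"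
  let ?z = "\<lambda>i\<in>I. \<xi> i \<oplus>\<^bsub>H i\<^esub> \<eta> i"
  \<comment> \<open>By the parallelogram law this dominates the squared norms of the componentwise
    sum.\<close>
  have "(\<lambda>i. 2 * (hnorm (H i) (\<xi> i))\<^sup>2 + 2 * (hnorm (H i) (\<eta> i))\<^sup>2) summable_on I"
    using \<xi> \<eta> by (intro summable_on_add summable_on_cmult_right component_norm_summable)
  then have "(\<lambda>i. (hnorm (H i) (?z i))\<^sup>2) summable_on I"
  proof (rule summable_on_comparison_test)
    fix i assume i: "i \<in> I"
    then interpret Hi: hilbert_space "H i" by (rule component)
    have [simp]: "\<xi> i \<in> carrier (H i)" "\<eta> i \<in> carrier (H i)"
      using \<xi> \<eta> i component_closed by auto
    have "0 \<le> (hnorm (H i) (\<xi> i \<ominus>\<^bsub>H i\<^esub> \<eta> i))\<^sup>2"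
      by simp
    then show "(hnorm (H i) (?z i))\<^sup>2 \<le> 2 * (hnorm (H i) (\<xi> i))\<^sup>2 + 2 * (hnorm (H i) (\<eta> i))\<^sup>2"
      using i by (simp add: Hi.hnorm_add_sq Hi.hnorm_minus_sq)
  qed auto
  moreover have "?z \<in> (\<Pi>\<^sub>E i\<in>I. carrier (H i))"
    using \<xi> \<eta> component_closed by (auto intro!: abelian_monoid.a_closed component_monoid)
  ultimately show "\<xi> \<oplus>\<^bsub>hilbert_sum I H\<^esub> \<eta> \<in> carrier (hilbert_sum I H)"
    by (simp add: hilbert_sum_carrier hilbert_sum_simps)
next
  assume \<xi>: "\<xi> \<in> carrier (hilbert_sum I H)"
  have "(\<lambda>i. (cmod c)\<^sup>2 * (hnorm (H i) (\<xi> i))\<^sup>2) summable_on I"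
    using \<xi> by (intro summable_on_cmult_right component_norm_summable)
  also have "?this \<longleftrightarrow> (\<lambda>i. (hnorm (H i) ((\<lambda>i\<in>I. c \<odot>\<^bsub>H i\<^esub> \<xi> i) i))\<^sup>2) summable_on I"
    using \<xi> by (intro summable_on_cong)
      (auto simp: hilbert_space.hnorm_smult[OF component component_closed] power_mult_distrib)
  finally show "c \<odot>\<^bsub>hilbert_sum I H\<^esub> \<xi> \<in> carrier (hilbert_sum I H)"
    using \<xi> by (auto simp: hilbert_sum_carrier hilbert_sum_simps intro!: hilbert_space.smult_in_carrier[OF component])
qed

lemma hilbert_sum_module: "module class_ring (hilbert_sum I H)"
proof -
  let ?S = "hilbert_sum I H"
  have comp: "module class_ring (H i)" if "i \<in> I" for i
    using component[OF that] by (simp add: hilbert_space_def vectorspace_def)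
  note c = component_closed
  note closed = hilbert_sum_closed
  show ?thesis
  proof (rule module_criteria)
    show "cring (class_ring :: complex ring)" ..
    show "\<forall>v\<in>carrier ?S. \<exists>w\<in>carrier ?S. v \<oplus>\<^bsub>?S\<^esub> w = \<zero>\<^bsub>?S\<^esub>"
    proof
      fix v assume v: "v \<in> carrier ?S"
      have "v \<oplus>\<^bsub>?S\<^esub> ((- 1) \<odot>\<^bsub>?S\<^esub> v) = \<zero>\<^bsub>?S\<^esub>"
      proof (rule hilbert_sum_eqI)
        fix i assume i: "i \<in> I"
        then interpret Hi: hilbert_space "H i" by (rule component)
        show "(v \<oplus>\<^bsub>?S\<^esub> ((- 1) \<odot>\<^bsub>?S\<^esub> v)) i = \<zero>\<^bsub>?S\<^esub> i"
          using i c[OF v i] by (simp add: hilbert_sum_simps Hi.a_inv_eq_smult[symmetric] Hi.r_neg)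
      qed (use v closed in auto)
      then show "\<exists>w\<in>carrier ?S. v \<oplus>\<^bsub>?S\<^esub> w = \<zero>\<^bsub>?S\<^esub>"
        using closed(3)[OF v] by blast
    qed
    show "\<forall>v w. v \<in> carrier ?S \<and> w \<in> carrier ?S \<longrightarrow> v \<oplus>\<^bsub>?S\<^esub> w = w \<oplus>\<^bsub>?S\<^esub> v"
      by (auto simp: hilbert_sum_simps fun_eq_iff restrict_def abelian_monoid.a_comm[OF component_monoid c c])
    show "\<forall>v w x. v \<in> carrier ?S \<and> w \<in> carrier ?S \<and> x \<in> carrier ?S \<longrightarrow>
        v \<oplus>\<^bsub>?S\<^esub> w \<oplus>\<^bsub>?S\<^esub> x = v \<oplus>\<^bsub>?S\<^esub> (w \<oplus>\<^bsub>?S\<^esub> x)"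
      by (auto simp: hilbert_sum_simps fun_eq_iff restrict_def abelian_monoid.a_assoc[OF component_monoid c c c])
    show "\<forall>v\<in>carrier ?S. v \<oplus>\<^bsub>?S\<^esub> \<zero>\<^bsub>?S\<^esub> = v"
    proof
      fix v assume v: "v \<in> carrier ?S"
      show "v \<oplus>\<^bsub>?S\<^esub> \<zero>\<^bsub>?S\<^esub> = v"
      proof (rule hilbert_sum_eqI[OF closed(2)[OF v closed(1)] v])
        show "(v \<oplus>\<^bsub>?S\<^esub> \<zero>\<^bsub>?S\<^esub>) i = v i" if "i \<in> I" for i
          using that abelian_monoid.r_zero[OF component_monoid c[OF v that]]
          by (simp add: hilbert_sum_simps)
      qed
    qed
    show "\<forall>a b v. a \<in> carrier class_ring \<and> b \<in> carrier class_ring \<and> v \<in> carrier ?S \<longrightarrow>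
        (a \<otimes>\<^bsub>class_ring\<^esub> b) \<odot>\<^bsub>?S\<^esub> v = a \<odot>\<^bsub>?S\<^esub> (b \<odot>\<^bsub>?S\<^esub> v)"
      using module.smult_assoc1[OF comp _ _ c]
      by (auto simp: hilbert_sum_simps fun_eq_iff restrict_def)
    show "\<forall>v\<in>carrier ?S. \<one>\<^bsub>class_ring\<^esub> \<odot>\<^bsub>?S\<^esub> v = v"
    proof
      fix v assume v: "v \<in> carrier ?S"
      show "\<one>\<^bsub>class_ring\<^esub> \<odot>\<^bsub>?S\<^esub> v = v"
        using module.smult_one[OF comp c[OF v]] v closed(3)[OF v]
        by (intro hilbert_sum_eqI) (auto simp: hilbert_sum_simps)
    qed
    show "\<forall>a b v. a \<in> carrier class_ring \<and> b \<in> carrier class_ring \<and> v \<in> carrier ?S \<longrightarrow>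
        (a \<oplus>\<^bsub>class_ring\<^esub> b) \<odot>\<^bsub>?S\<^esub> v = a \<odot>\<^bsub>?S\<^esub> v \<oplus>\<^bsub>?S\<^esub> b \<odot>\<^bsub>?S\<^esub> v"
      using module.smult_l_distr[OF comp _ _ c]
      by (auto simp: hilbert_sum_simps fun_eq_iff restrict_def)
    show "\<forall>a v w. a \<in> carrier class_ring \<and> v \<in> carrier ?S \<and> w \<in> carrier ?S \<longrightarrow>
        a \<odot>\<^bsub>?S\<^esub> (v \<oplus>\<^bsub>?S\<^esub> w) = a \<odot>\<^bsub>?S\<^esub> v \<oplus>\<^bsub>?S\<^esub> a \<odot>\<^bsub>?S\<^esub> w"
      using module.smult_r_distr[OF comp _ c c]
      by (auto simp: hilbert_sum_simps fun_eq_iff restrict_def)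
  qed (use closed in auto)
qed

lemma hilbert_sum_minus:
  assumes "\<xi> \<in> carrier (hilbert_sum I H)" "\<eta> \<in> carrier (hilbert_sum I H)" "i \<in> I"
  shows "(\<xi> \<ominus>\<^bsub>hilbert_sum I H\<^esub> \<eta>) i = \<xi> i \<ominus>\<^bsub>H i\<^esub> \<eta> i"
proof -
  interpret S: module class_ring "hilbert_sum I H" by (rule hilbert_sum_module)
  interpret Hi: hilbert_space "H i" by (rule component) fact
  have "\<ominus>\<^bsub>hilbert_sum I H\<^esub> \<eta> = (- 1) \<odot>\<^bsub>hilbert_sum I H\<^esub> \<eta>"
    using S.smult_minus_1[of \<eta>] assms by (simp add: class_ring_simps class_ring.ring_simprules)
  then show ?thesis
    using assms component_closed[OF assms(2,3)]
    by (simp add: a_minus_def hilbert_sum_simps Hi.a_inv_eq_smult)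
qed

lemma hilbert_sum_hnorm:
  assumes "\<xi> \<in> carrier (hilbert_sum I H)"
  shows "(hnorm (hilbert_sum I H) \<xi>)\<^sup>2 = (\<Sum>\<^sub>\<infinity>i\<in>I. (hnorm (H i) (\<xi> i))\<^sup>2)"
proof -
  have "0 \<le> (\<Sum>\<^sub>\<infinity>i\<in>I. (hnorm (H i) (\<xi> i))\<^sup>2)"
    by (rule infsum_nonneg) simp
  then show ?thesis
    by (simp add: hnorm_def[of "hilbert_sum I H"] hilbert_sum_norm[OF assms])
qed

lemma finite_sum_le_hnorm:
  assumes "\<xi> \<in> carrier (hilbert_sum I H)" "finite F" "F \<subseteq> I"
  shows "(\<Sum>i\<in>F. (hnorm (H i) (\<xi> i))\<^sup>2) \<le> (hnorm (hilbert_sum I H) \<xi>)\<^sup>2"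
  unfolding hilbert_sum_hnorm[OF assms(1)]
  by (rule finite_sum_le_infsum) (use assms component_norm_summable in auto)

lemma component_hnorm_le:
  assumes "\<xi> \<in> carrier (hilbert_sum I H)" "i \<in> I"
  shows "hnorm (H i) (\<xi> i) \<le> hnorm (hilbert_sum I H) \<xi>"
proof -
  have "(hnorm (H i) (\<xi> i))\<^sup>2 \<le> (hnorm (hilbert_sum I H) \<xi>)\<^sup>2"
    using finite_sum_le_hnorm[OF assms(1), of "{i}"] assms by simp
  moreover have "0 \<le> hnorm (hilbert_sum I H) \<xi>"
    by (simp add: hnorm_def hilbert_sum_norm[OF assms(1)] infsum_nonneg)
  ultimately show ?thesis
    by (rule power2_le_imp_le)
qed

text \<open>Completeness: the coordinatewise limit of a Cauchy sequence is its limit in norm, since the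
  bounds for the finite partial sums pass to the limit.\<close>

theorem hilbert_sum: "hilbert_space (hilbert_sum I H)"
proof (intro hilbert_space.intro hilbert_space_axioms.intro)
  let ?S = "hilbert_sum I H"
  interpret S: module class_ring ?S by (rule hilbert_sum_module)
  note c = component_closed
  show "vectorspace class_ring ?S"
    by (rule vectorspace_class_ringI[OF hilbert_sum_module])
  show "ip ?S (\<xi> \<oplus>\<^bsub>?S\<^esub> \<eta>) \<zeta> = ip ?S \<xi> \<zeta> + ip ?S \<eta> \<zeta>"
    if "\<xi> \<in> carrier ?S" "\<eta> \<in> carrier ?S" "\<zeta> \<in> carrier ?S" for \<xi> \<eta> \<zeta>
  proof -
    have "ip ?S (\<xi> \<oplus>\<^bsub>?S\<^esub> \<eta>) \<zeta> = (\<Sum>\<^sub>\<infinity>i\<in>I. ip (H i) (\<xi> i) (\<zeta> i) + ip (H i) (\<eta> i) (\<zeta> i))"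
      unfolding hilbert_sum_simps
      by (intro infsum_cong) (use that in \<open>simp add: hilbert_space.ip_add[OF component] c\<close>)
    also have "\<dots> = ip ?S \<xi> \<zeta> + ip ?S \<eta> \<zeta>"
      unfolding hilbert_sum_simps by (intro infsum_add ip_summable that)
    finally show ?thesis .
  qed
  show "ip ?S (a \<odot>\<^bsub>?S\<^esub> \<xi>) \<eta> = a * ip ?S \<xi> \<eta>" if "\<xi> \<in> carrier ?S" "\<eta> \<in> carrier ?S" for \<xi> \<eta> a
    unfolding hilbert_sum_simps infsum_cmult_right'[symmetric]
    by (intro infsum_cong) (use that in \<open>simp add: hilbert_space.ip_smult[OF component] c\<close>)
  show "ip ?S \<eta> \<xi> = cnj (ip ?S \<xi> \<eta>)" if "\<xi> \<in> carrier ?S" "\<eta> \<in> carrier ?S" for \<xi> \<eta>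
    unfolding hilbert_sum_simps infsum_cnj[symmetric]
    by (intro infsum_cong hilbert_space.ip_cnj component c that)
  show "0 \<le> ip ?S \<xi> \<xi>" if "\<xi> \<in> carrier ?S" for \<xi>
    unfolding hilbert_sum_norm[OF that] by (simp add: complex_nonneg_iff infsum_nonneg)
  show "\<xi> = \<zero>\<^bsub>?S\<^esub>" if \<xi>: "\<xi> \<in> carrier ?S" and "ip ?S \<xi> \<xi> = 0" for \<xi>
  proof (rule hilbert_sum_eqI[OF \<xi> S.zero_closed])
    fix i assume i: "i \<in> I"
    then interpret Hi: hilbert_space "H i" by (rule component)
    have "(hnorm (H i) (\<xi> i))\<^sup>2 = 0"
      by (rule nonneg_infsum_le_0D[OF _ component_norm_summable[OF \<xi>] _ i])
        (use that hilbert_sum_norm[OF \<xi>] in auto)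
    then show "\<xi> i = \<zero>\<^bsub>?S\<^esub> i"
      using i c[OF \<xi> i] by (simp add: Hi.hnorm_eq_0 hilbert_sum_simps)
  qed
  fix s :: "nat \<Rightarrow> 'i \<Rightarrow> 'h"
  assume s: "\<And>n. s n \<in> carrier ?S"
    and cauchy: "\<And>\<epsilon>. \<epsilon> > 0 \<Longrightarrow> \<exists>N. \<forall>m\<ge>N. \<forall>n\<ge>N. hnorm ?S (s m \<ominus>\<^bsub>?S\<^esub> s n) < \<epsilon>"
  have diff: "s m \<ominus>\<^bsub>?S\<^esub> s n \<in> carrier ?S" for m n
    using s by simp
  have "\<exists>x\<in>carrier (H i). (\<lambda>n. hnorm (H i) (s n i \<ominus>\<^bsub>H i\<^esub> x)) \<longlonglongrightarrow> 0" if i: "i \<in> I" for i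
  proof (rule hilbert_space.complete[OF component[OF i]])
    show "s n i \<in> carrier (H i)" for n
      using s i by (rule c)
    fix \<epsilon> :: real assume "\<epsilon> > 0"
    then obtain N where "\<forall>m\<ge>N. \<forall>n\<ge>N. hnorm ?S (s m \<ominus>\<^bsub>?S\<^esub> s n) < \<epsilon>"
      using cauchy by blast
    moreover have "hnorm (H i) (s m i \<ominus>\<^bsub>H i\<^esub> s n i) \<le> hnorm ?S (s m \<ominus>\<^bsub>?S\<^esub> s n)" for m n
      using component_hnorm_le[OF diff i, of m n] hilbert_sum_minus[OF s s i, of m n] by simp
    ultimately show "\<exists>N. \<forall>m\<ge>N. \<forall>n\<ge>N. hnorm (H i) (s m i \<ominus>\<^bsub>H i\<^esub> s n i) < \<epsilon>"
      by (meson le_less_trans)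
  qed
  then obtain x where x: "\<And>i. i \<in> I \<Longrightarrow> x i \<in> carrier (H i)"
    and lim: "\<And>i. i \<in> I \<Longrightarrow> (\<lambda>n. hnorm (H i) (s n i \<ominus>\<^bsub>H i\<^esub> x i)) \<longlonglongrightarrow> 0"
    by metis
  define \<xi> where "\<xi> = restrict x I"
  \<comment> \<open>Bounds on partial sums show that \<open>d m\<close> belongs to the direct sum
    for large \<open>m\<close>. Membership of the coordinatewise limit \<xi> is then deduced from
    \<xi> = s N1 - d N1.\<close>
  define d where "d n = (\<lambda>i\<in>I. s n i \<ominus>\<^bsub>H i\<^esub> x i)" for n
  have d_PiE: "d n \<in> (\<Pi>\<^sub>E i\<in>I. carrier (H i))" for n
    using x c[OF s] by (auto simp: d_def intro!: abelian_group.minus_closed component_group)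
  have partial: "(\<Sum>i\<in>F. (hnorm (H i) (d m i))\<^sup>2) \<le> \<epsilon>\<^sup>2"
    if N: "\<And>m n. \<lbrakk>N \<le> m; N \<le> n\<rbrakk> \<Longrightarrow> hnorm ?S (s m \<ominus>\<^bsub>?S\<^esub> s n) < \<epsilon>" and "0 < \<epsilon>"
      and F: "finite F" "F \<subseteq> I" and m: "N \<le> m" for N \<epsilon> F m
  proof (rule LIMSEQ_le_const2)
    show "(\<lambda>n. \<Sum>i\<in>F. (hnorm (H i) (s m i \<ominus>\<^bsub>H i\<^esub> s n i))\<^sup>2) \<longlonglongrightarrow> (\<Sum>i\<in>F. (hnorm (H i) (d m i))\<^sup>2)"
    proof (intro tendsto_sum tendsto_power)
      fix i assume "i \<in> F"
      then have i: "i \<in> I" using F by auto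
      then interpret Hi: hilbert_space "H i" by (rule component)
      have [simp]: "s n i \<in> carrier (H i)" "x i \<in> carrier (H i)" for n
        using s x i c by auto
      have "(s m i \<ominus>\<^bsub>H i\<^esub> s n i) \<ominus>\<^bsub>H i\<^esub> d m i = x i \<ominus>\<^bsub>H i\<^esub> s n i" for n
        using i unfolding d_def by (intro Hi.vector_eqI) auto
      then have "hnorm (H i) ((s m i \<ominus>\<^bsub>H i\<^esub> s n i) \<ominus>\<^bsub>H i\<^esub> d m i) = hnorm (H i) (s n i \<ominus>\<^bsub>H i\<^esub> x i)" for n
        by (simp add: Hi.hnorm_minus_commute)
      then show "(\<lambda>n. hnorm (H i) (s m i \<ominus>\<^bsub>H i\<^esub> s n i)) \<longlonglongrightarrow> hnorm (H i) (d m i)"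
        using lim[OF i] i by (intro Hi.hnorm_tendsto) (auto simp: d_def)
    qed
    have "(\<Sum>i\<in>F. (hnorm (H i) (s m i \<ominus>\<^bsub>H i\<^esub> s n i))\<^sup>2) \<le> \<epsilon>\<^sup>2" if "N \<le> n" for n
    proof -
      have "(\<Sum>i\<in>F. (hnorm (H i) (s m i \<ominus>\<^bsub>H i\<^esub> s n i))\<^sup>2) =
          (\<Sum>i\<in>F. (hnorm (H i) ((s m \<ominus>\<^bsub>?S\<^esub> s n) i))\<^sup>2)"
        using F hilbert_sum_minus[OF s s] by (intro sum.cong) auto
      also have "\<dots> \<le> (hnorm ?S (s m \<ominus>\<^bsub>?S\<^esub> s n))\<^sup>2"
        by (rule finite_sum_le_hnorm[OF diff F])
      also have "\<dots> \<le> \<epsilon>\<^sup>2"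
        using N[OF m that] by (intro power_mono) (auto simp: hnorm_def hilbert_sum_norm[OF diff] infsum_nonneg)
      finally show ?thesis .
    qed
    then show "\<exists>M. \<forall>n\<ge>M. (\<Sum>i\<in>F. (hnorm (H i) (s m i \<ominus>\<^bsub>H i\<^esub> s n i))\<^sup>2) \<le> \<epsilon>\<^sup>2"
      by blast
  qed
  have near: "d m \<in> carrier ?S \<and> hnorm ?S (d m) \<le> \<epsilon>"
    if N: "\<And>m n. \<lbrakk>N \<le> m; N \<le> n\<rbrakk> \<Longrightarrow> hnorm ?S (s m \<ominus>\<^bsub>?S\<^esub> s n) < \<epsilon>" and "0 < \<epsilon>" and m: "N \<le> m" for N \<epsilon> m
  proof -
    have "(\<lambda>i. (hnorm (H i) (d m i))\<^sup>2) summable_on I"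
      by (rule nonneg_bdd_above_summable_on) (use partial[OF N] that in \<open>auto intro!: bdd_aboveI2\<close>)
    then have carrier: "d m \<in> carrier ?S"
      using d_PiE by (simp add: hilbert_sum_carrier)
    have "(hnorm ?S (d m))\<^sup>2 \<le> \<epsilon>\<^sup>2"
      unfolding hilbert_sum_hnorm[OF carrier]
      by (rule infsum_le_finite_sums[OF component_norm_summable[OF carrier]]) (use partial[OF N] that in auto)
    then show ?thesis
      using carrier \<open>0 < \<epsilon>\<close> by (auto intro: power2_le_imp_le)
  qed
  obtain N1 where N1: "\<And>m n. \<lbrakk>N1 \<le> m; N1 \<le> n\<rbrakk> \<Longrightarrow> hnorm ?S (s m \<ominus>\<^bsub>?S\<^esub> s n) < 1"
    using cauchy[of 1] by auto
  have \<xi>_diff: "s n i \<ominus>\<^bsub>H i\<^esub> d n i = x i" if i: "i \<in> I" for i n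
  proof -
    interpret Hi: hilbert_space "H i" by (rule component[OF i])
    have [simp]: "s n i \<in> carrier (H i)" "x i \<in> carrier (H i)"
      using s x i c by auto
    show ?thesis
      using i unfolding d_def by (intro Hi.vector_eqI) auto
  qed
  have d_N1: "d N1 \<in> carrier ?S"
    using near[OF N1, of N1] by simp
  then have diff_N1: "s N1 \<ominus>\<^bsub>?S\<^esub> d N1 \<in> carrier ?S"
    using s by simp
  have "\<xi> = s N1 \<ominus>\<^bsub>?S\<^esub> d N1"
  proof (rule extensionalityI[of _ I])
    show "\<xi> \<in> extensional I"
      by (simp add: \<xi>_def)
    show "s N1 \<ominus>\<^bsub>?S\<^esub> d N1 \<in> extensional I"
      using diff_N1 by (auto simp: hilbert_sum_carrier PiE_def)
    show "\<xi> i = (s N1 \<ominus>\<^bsub>?S\<^esub> d N1) i" if "i \<in> I" for i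
      using that by (simp add: hilbert_sum_minus[OF s d_N1] \<xi>_diff) (simp add: \<xi>_def)
  qed
  with diff_N1 have \<xi>: "\<xi> \<in> carrier ?S"
    by simp
  have "s n \<ominus>\<^bsub>?S\<^esub> \<xi> = d n" for n
  proof (rule extensionalityI[of _ I])
    show "s n \<ominus>\<^bsub>?S\<^esub> \<xi> \<in> extensional I"
      using S.minus_closed[OF s \<xi>] by (auto simp: hilbert_sum_carrier PiE_def)
    show "d n \<in> extensional I"
      by (simp add: d_def)
    show "(s n \<ominus>\<^bsub>?S\<^esub> \<xi>) i = d n i" if "i \<in> I" for i
      using that s \<xi> by (simp add: hilbert_sum_minus) (simp add: d_def \<xi>_def)
  qed
  moreover have "(\<lambda>n. hnorm ?S (d n)) \<longlonglongrightarrow> 0"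
  proof (rule LIMSEQ_I)
    fix r :: real assume "r > 0"
    then obtain N where N: "\<And>m n. \<lbrakk>N \<le> m; N \<le> n\<rbrakk> \<Longrightarrow> hnorm ?S (s m \<ominus>\<^bsub>?S\<^esub> s n) < r / 2"
      using cauchy[of "r / 2"] by auto
    have "norm (hnorm ?S (d n) - 0) < r" if "N \<le> n" for n
    proof -
      have "d n \<in> carrier ?S" "hnorm ?S (d n) \<le> r / 2"
        using near[OF N _ that] \<open>r > 0\<close> by auto
      moreover have "0 \<le> hnorm ?S (d n)"
        by (simp add: hnorm_def hilbert_sum_norm[OF \<open>d n \<in> carrier ?S\<close>] infsum_nonneg)
      ultimately show ?thesis
        using \<open>r > 0\<close> by simp
    qed
    then show "\<exists>N. \<forall>n\<ge>N. norm (hnorm ?S (d n) - 0) < r"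
      by blast
  qed
  ultimately show "\<exists>\<xi>\<in>carrier ?S. (\<lambda>n. hnorm ?S (s n \<ominus>\<^bsub>?S\<^esub> \<xi>)) \<longlonglongrightarrow> 0"
    using \<xi> by (intro bexI[of _ \<xi>]) auto
qed

end

text \<open>The bound \<open>c\<close>, common to all components, is what keeps images square
  summable.\<close>

lemma op_sum:
  assumes HI: "\<And>i. i \<in> I \<Longrightarrow> hilbert_space (H i)" and KI: "\<And>i. i \<in> I \<Longrightarrow> hilbert_space (K i)"
    and T: "\<And>i. i \<in> I \<Longrightarrow> T i \<in> bounded_ops (H i) (K i)"
    and c: "0 \<le> c" "\<And>i. i \<in> I \<Longrightarrow> opnorm (H i) (K i) (T i) \<le> c"
  shows "op_sum I H T \<in> bounded_ops (hilbert_sum I H) (hilbert_sum I K)"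
    and "opnorm (hilbert_sum I H) (hilbert_sum I K) (op_sum I H T) \<le> c"
proof -
  interpret H: hilbert_family I H by (rule hilbert_family.intro) (rule HI)
  interpret K: hilbert_family I K by (rule hilbert_family.intro) (rule KI)
  interpret HS: hilbert_space "hilbert_sum I H" by (rule H.hilbert_sum)
  interpret KS: hilbert_space "hilbert_sum I K" by (rule K.hilbert_sum)
  interpret SS: hilbert_pair "hilbert_sum I H" "hilbert_sum I K" ..
  have pair: "hilbert_pair (H i) (K i)" if "i \<in> I" for i
    using that HI KI by (simp add: hilbert_pair_def)
  have apply_in: "op_sum I H T \<xi> = (\<lambda>i\<in>I. T i (\<xi> i))" if "\<xi> \<in> carrier (hilbert_sum I H)" for \<xi>
    using that by (simp add: op_sum_def)
  have comp_le: "(hnorm (K i) (T i (\<xi> i)))\<^sup>2 \<le> c\<^sup>2 * (hnorm (H i) (\<xi> i))\<^sup>2"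
    if "\<xi> \<in> carrier (hilbert_sum I H)" and i: "i \<in> I" for \<xi> i
  proof -
    interpret p: hilbert_pair "H i" "K i" by (rule pair[OF i])
    have \<xi>i: "\<xi> i \<in> carrier (H i)"
      using that H.component_closed by auto
    have "hnorm (K i) (T i (\<xi> i)) \<le> opnorm (H i) (K i) (T i) * hnorm (H i) (\<xi> i)"
      by (rule p.opnorm_bound[OF T[OF i] \<xi>i])
    also have "\<dots> \<le> c * hnorm (H i) (\<xi> i)"
      using c(2)[OF i] \<xi>i by (intro mult_right_mono) auto
    finally show ?thesis
      using T[OF i] \<xi>i unfolding power_mult_distrib[symmetric] by (intro power_mono) auto
  qed
  have closed: "op_sum I H T \<xi> \<in> carrier (hilbert_sum I K)" if \<xi>: "\<xi> \<in> carrier (hilbert_sum I H)" for \<xi>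
  proof -
    have "(\<lambda>i. c\<^sup>2 * (hnorm (H i) (\<xi> i))\<^sup>2) summable_on I"
      using \<xi> by (intro summable_on_cmult_right H.component_norm_summable)
    then have "(\<lambda>i. (hnorm (K i) (op_sum I H T \<xi> i))\<^sup>2) summable_on I"
      by (rule summable_on_comparison_test) (use comp_le[OF \<xi>] \<xi> in \<open>auto simp: apply_in\<close>)
    then show ?thesis
      using \<xi> T H.component_closed[OF \<xi>]
      by (auto simp: K.hilbert_sum_carrier apply_in hilbert_pair.op_closed[OF pair])
  qed
  have bound: "hnorm (hilbert_sum I K) (op_sum I H T \<xi>) \<le> c * hnorm (hilbert_sum I H) \<xi>"
    if \<xi>: "\<xi> \<in> carrier (hilbert_sum I H)" for \<xi>
  proof (rule power2_le_imp_le)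
    have "(hnorm (hilbert_sum I K) (op_sum I H T \<xi>))\<^sup>2 = (\<Sum>\<^sub>\<infinity>i\<in>I. (hnorm (K i) (op_sum I H T \<xi> i))\<^sup>2)"
      by (rule K.hilbert_sum_hnorm[OF closed[OF \<xi>]])
    also have "\<dots> \<le> (\<Sum>\<^sub>\<infinity>i\<in>I. c\<^sup>2 * (hnorm (H i) (\<xi> i))\<^sup>2)"
      using comp_le[OF \<xi>] \<xi> K.component_norm_summable[OF closed[OF \<xi>]] H.component_norm_summable[OF \<xi>]
      by (intro infsum_mono summable_on_cmult_right) (auto simp: apply_in)
    also have "\<dots> = (c * hnorm (hilbert_sum I H) \<xi>)\<^sup>2"
      by (simp add: infsum_cmult_right' power_mult_distrib H.hilbert_sum_hnorm[OF \<xi>])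
    finally show "(hnorm (hilbert_sum I K) (op_sum I H T \<xi>))\<^sup>2 \<le> (c * hnorm (hilbert_sum I H) \<xi>)\<^sup>2" .
    show "0 \<le> c * hnorm (hilbert_sum I H) \<xi>"
      using c \<xi> by simp
  qed
  show "op_sum I H T \<in> bounded_ops (hilbert_sum I H) (hilbert_sum I K)"
  proof (rule SS.bounded_opsI[OF _ closed _ _ bound])
    show "op_sum I H T \<in> extensional (carrier (hilbert_sum I H))"
      by (simp add: op_sum_def)
    fix \<xi> assume \<xi>: "\<xi> \<in> carrier (hilbert_sum I H)"
    show "op_sum I H T (a \<odot>\<^bsub>hilbert_sum I H\<^esub> \<xi>) = a \<odot>\<^bsub>hilbert_sum I K\<^esub> op_sum I H T \<xi>" for a
    proof (rule K.hilbert_sum_eqI)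
      fix i assume i: "i \<in> I"
      then show "op_sum I H T (a \<odot>\<^bsub>hilbert_sum I H\<^esub> \<xi>) i = (a \<odot>\<^bsub>hilbert_sum I K\<^esub> op_sum I H T \<xi>) i"
        using \<xi> H.component_closed[OF \<xi> i] HS.smult_in_carrier[OF \<xi>, of a]
        by (simp add: apply_in K.hilbert_sum_simps H.hilbert_sum_simps(3) hilbert_pair.op_smult[OF pair T])
    qed (use \<xi> closed in auto)
    show "op_sum I H T (\<xi> \<oplus>\<^bsub>hilbert_sum I H\<^esub> \<eta>) = op_sum I H T \<xi> \<oplus>\<^bsub>hilbert_sum I K\<^esub> op_sum I H T \<eta>"
      if \<eta>: "\<eta> \<in> carrier (hilbert_sum I H)" for \<eta>
    proof (rule K.hilbert_sum_eqI)
      fix i assume i: "i \<in> I"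
      then show "op_sum I H T (\<xi> \<oplus>\<^bsub>hilbert_sum I H\<^esub> \<eta>) i = (op_sum I H T \<xi> \<oplus>\<^bsub>hilbert_sum I K\<^esub> op_sum I H T \<eta>) i"
        using \<xi> \<eta> H.component_closed[OF \<xi> i] H.component_closed[OF \<eta> i] HS.a_closed[OF \<xi> \<eta>]
        by (simp add: apply_in K.hilbert_sum_simps H.hilbert_sum_simps(2) hilbert_pair.op_add[OF pair T])
    qed (use \<xi> \<eta> closed in auto)
  qed
  show "opnorm (hilbert_sum I H) (hilbert_sum I K) (op_sum I H T) \<le> c"
    by (rule SS.opnorm_le[OF c(1) bound])
qed

section \<open>Coordinate spaces with the inner product of a strictly positive matrix\<close>

section \<open>Finite-dimensional Hilbert spaces with a given Gram matrix\<close>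

text \<open>\<open>G s t\<close> is the inner product of the basis vectors at \<open>t\<close> and
  \<open>s\<close>, in this order because \<open>ip\<close> is linear in its first argument. No null
  vectors are divided out, so definiteness has to come from strict positivity of \<open>G\<close>.
  Vectors vanish off \<open>F\<close> instead of being undefined there, which keeps the operations
  pointwise.\<close>

definition kernel_hilbert :: "'i set \<Rightarrow> ('i \<Rightarrow> 'i \<Rightarrow> complex) \<Rightarrow> ('i \<Rightarrow> complex) hilbert" where
  "kernel_hilbert F G =
     \<lparr>carrier = {\<xi>. \<forall>i. i \<notin> F \<longrightarrow> \<xi> i = 0}, mult = undefined, one = undefined, zero = (\<lambda>_. 0),
      add = (\<lambda>\<xi> \<eta> i. \<xi> i + \<eta> i), smult = (\<lambda>c \<xi> i. c * \<xi> i),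
      ip = (\<lambda>\<xi> \<eta>. \<Sum>s\<in>F. \<Sum>t\<in>F. G s t * \<xi> t * cnj (\<eta> s))\<rparr>"

lemma kernel_hilbert_simps:
  "carrier (kernel_hilbert F G) = {\<xi>. \<forall>i. i \<notin> F \<longrightarrow> \<xi> i = 0}"
  "\<zero>\<^bsub>kernel_hilbert F G\<^esub> = (\<lambda>_. 0)"
  "\<xi> \<oplus>\<^bsub>kernel_hilbert F G\<^esub> \<eta> = (\<lambda>i. \<xi> i + \<eta> i)"
  "c \<odot>\<^bsub>kernel_hilbert F G\<^esub> \<xi> = (\<lambda>i. c * \<xi> i)"
  "ip (kernel_hilbert F G) \<xi> \<eta> = (\<Sum>s\<in>F. \<Sum>t\<in>F. G s t * \<xi> t * cnj (\<eta> s))"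
  by (simp_all add: kernel_hilbert_def)

lemma kernel_hilbert_module: "module class_ring (kernel_hilbert F G)"
proof (rule module_criteria)
  show "cring (class_ring :: complex ring)" ..
  show "\<forall>v\<in>carrier (kernel_hilbert F G). \<exists>w\<in>carrier (kernel_hilbert F G).
      v \<oplus>\<^bsub>kernel_hilbert F G\<^esub> w = \<zero>\<^bsub>kernel_hilbert F G\<^esub>"
  proof
    fix v assume "v \<in> carrier (kernel_hilbert F G)"
    then show "\<exists>w\<in>carrier (kernel_hilbert F G). v \<oplus>\<^bsub>kernel_hilbert F G\<^esub> w = \<zero>\<^bsub>kernel_hilbert F G\<^esub>"
      by (intro bexI[of _ "\<lambda>i. - v i"]) (auto simp: kernel_hilbert_simps)
  qed
qed (auto simp: kernel_hilbert_simps algebra_simps)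

lemma kernel_hilbert_minus:
  assumes "\<xi> \<in> carrier (kernel_hilbert F G)" "\<eta> \<in> carrier (kernel_hilbert F G)"
  shows "\<xi> \<ominus>\<^bsub>kernel_hilbert F G\<^esub> \<eta> = (\<lambda>i. \<xi> i - \<eta> i)"
proof -
  interpret M: module class_ring "kernel_hilbert F G" by (rule kernel_hilbert_module)
  have "\<ominus>\<^bsub>kernel_hilbert F G\<^esub> \<eta> = (- 1) \<odot>\<^bsub>kernel_hilbert F G\<^esub> \<eta>"
    using M.smult_minus_1[of \<eta>] assms by (simp add: class_ring_simps class_ring.ring_simprules)
  then show ?thesis
    by (simp add: a_minus_def kernel_hilbert_simps)
qed

text \<open>The constant \<epsilon> lets the norm control every coordinate in \<open>F\<close>. This
  gives definiteness and makes Cauchy sequences Cauchy in each coordinate; finitely many coordinate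
  limits then combine to a limit in norm.\<close>

theorem kernel_hilbert:
  fixes F :: "'i set"
  assumes F: "finite F" and herm: "\<And>s t. \<lbrakk>s \<in> F; t \<in> F\<rbrakk> \<Longrightarrow> G t s = cnj (G s t)"
    and "0 < \<epsilon>"
    and pos: "\<And>\<xi>. \<epsilon> * (\<Sum>s\<in>F. (cmod (\<xi> s))\<^sup>2) \<le> Re (\<Sum>s\<in>F. \<Sum>t\<in>F. G s t * \<xi> t * cnj (\<xi> s))"
  shows "hilbert_space (kernel_hilbert F G)"
proof (intro hilbert_space.intro hilbert_space_axioms.intro)
  let ?H = "kernel_hilbert F G"
  show "vectorspace class_ring ?H"
    by (rule vectorspace_class_ringI[OF kernel_hilbert_module])
  interpret M: module class_ring ?H by (rule kernel_hilbert_module)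
  show "ip ?H (\<xi> \<oplus>\<^bsub>?H\<^esub> \<eta>) \<zeta> = ip ?H \<xi> \<zeta> + ip ?H \<eta> \<zeta>" for \<xi> \<eta> \<zeta>
    by (simp add: kernel_hilbert_simps algebra_simps sum.distrib)
  show "ip ?H (c \<odot>\<^bsub>?H\<^esub> \<xi>) \<eta> = c * ip ?H \<xi> \<eta>" for c \<xi> \<eta>
    by (simp add: kernel_hilbert_simps sum_distrib_left algebra_simps)
  show cnj: "ip ?H \<eta> \<xi> = cnj (ip ?H \<xi> \<eta>)" for \<xi> \<eta>
  proof -
    have "cnj (ip ?H \<xi> \<eta>) = (\<Sum>s\<in>F. \<Sum>t\<in>F. G t s * cnj (\<xi> t) * \<eta> s)"
      unfolding kernel_hilbert_simps cnj_sum by (intro sum.cong) (auto simp: herm[symmetric])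
    also have "\<dots> = ip ?H \<eta> \<xi>"
      unfolding kernel_hilbert_simps by (subst sum.swap) (simp add: mult.assoc mult.left_commute mult.commute)
    finally show ?thesis ..
  qed
  have ge: "\<epsilon> * (\<Sum>s\<in>F. (cmod (\<xi> s))\<^sup>2) \<le> Re (ip ?H \<xi> \<xi>)" for \<xi>
    unfolding kernel_hilbert_simps by (rule pos)
  have coord: "\<epsilon> * (cmod (\<xi> s))\<^sup>2 \<le> Re (ip ?H \<xi> \<xi>)" if "s \<in> F" for \<xi> s
    using member_le_sum[of s F "\<lambda>s. (cmod (\<xi> s))\<^sup>2"] that F \<open>0 < \<epsilon>\<close>
    by (intro order_trans[OF _ ge] mult_left_mono) auto
  have Re_nonneg: "0 \<le> Re (ip ?H \<xi> \<xi>)" for \<xi>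
    using \<open>0 < \<epsilon>\<close> by (intro order_trans[OF _ ge]) (auto intro!: mult_nonneg_nonneg sum_nonneg)
  show "0 \<le> ip ?H \<xi> \<xi>" for \<xi>
    using Re_nonneg[of \<xi>] cnj[of \<xi> \<xi>] by (simp add: complex_nonneg_iff complex_eq_iff)
  show "\<xi> = \<zero>\<^bsub>?H\<^esub>" if \<xi>: "\<xi> \<in> carrier ?H" "ip ?H \<xi> \<xi> = 0" for \<xi>
  proof
    fix s show "\<xi> s = \<zero>\<^bsub>?H\<^esub> s"
      using coord[of s \<xi>] \<xi> \<open>0 < \<epsilon>\<close> by (cases "s \<in> F") (auto simp: kernel_hilbert_simps(1,2) mult_le_0_iff)
  qed
  fix s :: "nat \<Rightarrow> 'i \<Rightarrow> complex"
  assume s: "\<And>n. s n \<in> carrier ?H"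
    and cauchy: "\<And>\<epsilon>. \<epsilon> > 0 \<Longrightarrow> \<exists>N. \<forall>m\<ge>N. \<forall>n\<ge>N. hnorm ?H (s m \<ominus>\<^bsub>?H\<^esub> s n) < \<epsilon>"
  have "\<exists>x. (\<lambda>n. s n i) \<longlonglongrightarrow> x" if i: "i \<in> F" for i
  proof -
    have "Cauchy (\<lambda>n. s n i)"
    proof (rule metric_CauchyI)
      fix e :: real assume "e > 0"
      then obtain N where N: "\<And>m n. \<lbrakk>N \<le> m; N \<le> n\<rbrakk> \<Longrightarrow> hnorm ?H (s m \<ominus>\<^bsub>?H\<^esub> s n) < sqrt \<epsilon> * e"
        using cauchy[of "sqrt \<epsilon> * e"] \<open>0 < \<epsilon>\<close> by auto
      have "dist (s m i) (s n i) < e" if "N \<le> m" "N \<le> n" for m n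
      proof -
        have "sqrt \<epsilon> * cmod (s m i - s n i) = sqrt (\<epsilon> * (cmod (s m i - s n i))\<^sup>2)"
          by (simp add: real_sqrt_mult)
        also have "\<dots> \<le> hnorm ?H (s m \<ominus>\<^bsub>?H\<^esub> s n)"
          unfolding hnorm_def kernel_hilbert_minus[OF s s] by (intro real_sqrt_le_mono coord[OF i])
        also have "\<dots> < sqrt \<epsilon> * e"
          by (rule N[OF that])
        finally show ?thesis
          using \<open>0 < \<epsilon>\<close> by (simp add: dist_norm)
      qed
      then show "\<exists>M. \<forall>m\<ge>M. \<forall>n\<ge>M. dist (s m i) (s n i) < e"
        by blast
    qed
    then show ?thesis
      using Cauchy_convergent convergent_def by blast
  qed
  then obtain x where x: "\<And>i. i \<in> F \<Longrightarrow> (\<lambda>n. s n i) \<longlonglongrightarrow> x i"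
    by metis
  define \<xi> where "\<xi> i = (if i \<in> F then x i else 0)" for i
  have \<xi>: "\<xi> \<in> carrier ?H"
    by (simp add: \<xi>_def kernel_hilbert_simps)
  have lim: "(\<lambda>n. s n i - \<xi> i) \<longlonglongrightarrow> 0" if "i \<in> F" for i
    using x[OF that] that by (simp add: \<xi>_def LIM_zero_iff)
  have "(\<lambda>n. sqrt (Re (\<Sum>i\<in>F. \<Sum>j\<in>F. G i j * (s n j - \<xi> j) * cnj (s n i - \<xi> i)))) \<longlonglongrightarrow>
      sqrt (Re (\<Sum>i\<in>F. \<Sum>j\<in>F. G i j * 0 * cnj 0))"
    by (intro tendsto_intros lim)
  then have "(\<lambda>n. hnorm ?H (s n \<ominus>\<^bsub>?H\<^esub> \<xi>)) \<longlonglongrightarrow> 0"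
    by (simp add: hnorm_def kernel_hilbert_minus[OF s \<xi>] kernel_hilbert_simps(5))
  then show "\<exists>\<xi>\<in>carrier ?H. (\<lambda>n. hnorm ?H (s n \<ominus>\<^bsub>?H\<^esub> \<xi>)) \<longlonglongrightarrow> 0"
    using \<xi> by blast
qed

section \<open>Evaluation of ternary terms, with a bound uniform over all representations\<close>

section \<open>Representations of the ternary ring\<close>

text \<open>Recursion is available for terms but not for the quotient type;
  \<open>rep_term_cong\<close> makes the evaluation well defined on classes.\<close>

primrec rep_term ::
  "('h, 'm) hilbert_scheme \<Rightarrow> ('k, 'n) hilbert_scheme \<Rightarrow> ('a \<Rightarrow> 'x \<Rightarrow> 'h \<Rightarrow> 'k) \<Rightarrow>
    ('a, 'x) tern_term \<Rightarrow> 'h \<Rightarrow> 'k" where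
  "rep_term H K V (Gen a x) = V a x"
| "rep_term H K V Zero = \<zero>\<^bsub>op_space H K\<^esub>"
| "rep_term H K V (Add u v) = rep_term H K V u \<oplus>\<^bsub>op_space H K\<^esub> rep_term H K V v"
| "rep_term H K V (Scale c u) = c \<odot>\<^bsub>op_space H K\<^esub> rep_term H K V u"
| "rep_term H K V (Tern u v w) = compose (carrier H) (rep_term H K V u)
     (compose (carrier H) (adj H K (rep_term H K V v)) (rep_term H K V w))"

text \<open>A norm bound for the evaluated term that does not depend on the representation, resting
  on contractivity of the generators. It keeps the supremum in \<open>univ_seminorm\<close>
  finite.\<close>

primrec term_bound :: "('a, 'x) tern_term \<Rightarrow> real" where
  "term_bound (Gen a x) = 1"
| "term_bound Zero = 0"
| "term_bound (Add u v) = term_bound u + term_bound v"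
| "term_bound (Scale c u) = cmod c * term_bound u"
| "term_bound (Tern u v w) = term_bound u * (term_bound v * term_bound w)"

lemma term_bound_nonneg: "0 \<le> term_bound u"
  by (induction u) auto

context hilbert_pair
begin

lemma adj_add_apply:
  assumes "S \<in> bounded_ops H K" "T \<in> bounded_ops H K" "\<eta> \<in> carrier K"
  shows "adj H K (S \<oplus>\<^bsub>op_space H K\<^esub> T) \<eta> = adj H K S \<eta> \<oplus>\<^bsub>H\<^esub> adj H K T \<eta>"
  using assms by (intro dom.vector_eqI_right) (auto simp: ip_adj)

lemma adj_smult_apply:
  assumes "T \<in> bounded_ops H K" "\<eta> \<in> carrier K"
  shows "adj H K (c \<odot>\<^bsub>op_space H K\<^esub> T) \<eta> = cnj c \<odot>\<^bsub>H\<^esub> adj H K T \<eta>"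
  using assms by (intro dom.vector_eqI_right) (auto simp: ip_adj)

lemma adj_apply_add:
  assumes "T \<in> bounded_ops H K" "\<eta> \<in> carrier K" "\<eta>' \<in> carrier K"
  shows "adj H K T (\<eta> \<oplus>\<^bsub>K\<^esub> \<eta>') = adj H K T \<eta> \<oplus>\<^bsub>H\<^esub> adj H K T \<eta>'"
  using assms by (intro dom.vector_eqI_right) (auto simp: ip_adj)

lemma adj_apply_smult:
  assumes "T \<in> bounded_ops H K" "\<eta> \<in> carrier K"
  shows "adj H K T (c \<odot>\<^bsub>K\<^esub> \<eta>) = c \<odot>\<^bsub>H\<^esub> adj H K T \<eta>"
  using assms by (intro dom.vector_eqI_right) (auto simp: ip_adj)

definition op_tern :: "('h \<Rightarrow> 'k) \<Rightarrow> ('h \<Rightarrow> 'k) \<Rightarrow> ('h \<Rightarrow> 'k) \<Rightarrow> 'h \<Rightarrow> 'k" where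
  "op_tern R S T = compose (carrier H) R (compose (carrier H) (adj H K S) T)"

lemma
  assumes R: "R \<in> bounded_ops H K" and S: "S \<in> bounded_ops H K" and T: "T \<in> bounded_ops H K"
  shows op_tern_closed: "op_tern R S T \<in> bounded_ops H K"
    and op_tern_apply: "\<xi> \<in> carrier H \<Longrightarrow> op_tern R S T \<xi> = R (adj H K S (T \<xi>))"
    and opnorm_op_tern: "opnorm H K (op_tern R S T) \<le> opnorm H K R * (opnorm H K S * opnorm H K T)"
proof -
  interpret swap: hilbert_pair K H ..
  note hs = dom.hilbert_space_axioms cod.hilbert_space_axioms
  have ST: "compose (carrier H) (adj H K S) T \<in> bounded_ops H H"
    "opnorm H H (compose (carrier H) (adj H K S) T) \<le> opnorm K H (adj H K S) * opnorm H K T"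
    using compose_op[OF hs(1,2,1) adj_bounded[OF S] T] by auto
  show "op_tern R S T \<in> bounded_ops H K"
    unfolding op_tern_def using compose_op[OF hs(1,1,2) R ST(1)] by auto
  show "\<xi> \<in> carrier H \<Longrightarrow> op_tern R S T \<xi> = R (adj H K S (T \<xi>))"
    by (simp add: op_tern_def compose_def)
  have "opnorm H K (op_tern R S T) \<le> opnorm H K R * opnorm H H (compose (carrier H) (adj H K S) T)"
    unfolding op_tern_def using compose_op[OF hs(1,1,2) R ST(1)] by auto
  also have "\<dots> \<le> opnorm H K R * (opnorm K H (adj H K S) * opnorm H K T)"
    by (intro mult_left_mono ST(2) opnorm_nonneg R)
  also have "\<dots> \<le> opnorm H K R * (opnorm H K S * opnorm H K T)"
    by (intro mult_left_mono mult_right_mono opnorm_adj_le opnorm_nonneg R S T)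
  finally show "opnorm H K (op_tern R S T) \<le> opnorm H K R * (opnorm H K S * opnorm H K T)" .
qed

text \<open>Taking adjoints reverses the order: the adjoint of R S^* T is T^* S R^*. This accounts
  for the swapped entries in the axiom \<open>tern_assoc_middle\<close>.\<close>

lemma adj_op_tern_apply:
  assumes R: "R \<in> bounded_ops H K" and S: "S \<in> bounded_ops H K" and T: "T \<in> bounded_ops H K"
    and \<eta>: "\<eta> \<in> carrier K"
  shows "adj H K (op_tern R S T) \<eta> = adj H K T (S (adj H K R \<eta>))"
proof (rule dom.vector_eqI_right)
  fix \<zeta> assume \<zeta>: "\<zeta> \<in> carrier H"
  have "ip H \<zeta> (adj H K T (S (adj H K R \<eta>))) = ip H (adj H K S (T \<zeta>)) (adj H K R \<eta>)"
    using ip_adj[OF T \<zeta>, of "S (adj H K R \<eta>)"] ip_adj_left[OF S, of "adj H K R \<eta>" "T \<zeta>"] assms \<zeta>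
    by simp
  also have "\<dots> = ip K (op_tern R S T \<zeta>) \<eta>"
    using assms \<zeta> by (simp add: ip_adj op_tern_apply)
  finally show "ip H \<zeta> (adj H K (op_tern R S T) \<eta>) = ip H \<zeta> (adj H K T (S (adj H K R \<eta>)))"
    using assms \<zeta> by (simp add: ip_adj op_tern_closed)
qed (use assms in \<open>auto simp: op_tern_closed\<close>)

end

locale representation = hilbert_pair H K
  for H :: "('h, 'm) hilbert_scheme" and K :: "('k, 'n) hilbert_scheme" +
  fixes V :: "'a::finite \<Rightarrow> 'x \<Rightarrow> 'h \<Rightarrow> 'k"
  assumes V_bounded: "V a x \<in> bounded_ops H K"
    and V_relation: "(\<Oplus>\<^bsub>op_space H H\<^esub> a \<in> UNIV. compose (carrier H) (adj H K (V a x)) (V a x')) =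
        (if x = x' then (\<lambda>\<xi>\<in>carrier H. \<xi>) else \<zero>\<^bsub>op_space H H\<^esub>)"

lemma is_rep_iff: "is_rep H K V \<longleftrightarrow> representation H K V"
  by (auto simp: is_rep_def representation_def representation_axioms_def hilbert_pair_def)

context representation
begin

lemma relation_apply:
  assumes \<xi>: "\<xi> \<in> carrier H"
  shows "(\<Oplus>\<^bsub>H\<^esub> a \<in> UNIV. adj H K (V a x) (V a x' \<xi>)) = (if x = x' then \<xi> else \<zero>\<^bsub>H\<^esub>)"
proof -
  interpret HH: hilbert_pair H H ..
  have "(\<lambda>a. compose (carrier H) (adj H K (V a x)) (V a x')) \<in> UNIV \<rightarrow> bounded_ops H H"
    using compose_op(1)[OF dom.hilbert_space_axioms cod.hilbert_space_axioms dom.hilbert_space_axioms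
        adj_bounded V_bounded] V_bounded by auto
  from HH.op_space_finsum_apply[OF \<xi> this]
  have "(\<Oplus>\<^bsub>op_space H H\<^esub> a \<in> UNIV. compose (carrier H) (adj H K (V a x)) (V a x')) \<xi> =
      (\<Oplus>\<^bsub>H\<^esub> a \<in> UNIV. adj H K (V a x) (V a x' \<xi>))"
    using \<xi> by (simp add: compose_def)
  then have "(\<Oplus>\<^bsub>H\<^esub> a \<in> UNIV. adj H K (V a x) (V a x' \<xi>)) =
      (if x = x' then (\<lambda>\<xi>\<in>carrier H. \<xi>) else \<zero>\<^bsub>op_space H H\<^esub>) \<xi>"
    unfolding V_relation by (rule HOL.sym)
  then show ?thesis
    using \<xi> by (cases "x = x'") simp_all
qed

text \<open>The relation in weak form. For each \<open>x\<close> the operators \<open>V a x\<close>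
  make up one column; these columns are isometries, and different columns have orthogonal
  ranges.\<close>

lemma relation_ip:
  assumes \<xi>: "\<xi> \<in> carrier H" and \<eta>: "\<eta> \<in> carrier H"
  shows "(\<Sum>a\<in>UNIV. ip K (V a x' \<xi>) (V a x \<eta>)) = (if x = x' then ip H \<xi> \<eta> else 0)"
proof -
  have "(\<Sum>a\<in>UNIV. ip K (V a x' \<xi>) (V a x \<eta>)) = (\<Sum>a\<in>UNIV. ip H (adj H K (V a x) (V a x' \<xi>)) \<eta>)"
    using V_bounded \<xi> \<eta> by (simp add: ip_adj_left)
  also have "\<dots> = ip H (\<Oplus>\<^bsub>H\<^esub> a \<in> UNIV. adj H K (V a x) (V a x' \<xi>)) \<eta>"
    using V_bounded \<xi> \<eta> by (subst dom.ip_finsum) auto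
  finally show ?thesis
    using \<eta> by (simp add: relation_apply[OF \<xi>])
qed

text \<open>Over all \<open>a\<close>, the squared norms of \<open>V a x \<xi>\<close> add up to
  that of \<xi>, so no single one exceeds it.\<close>

lemma opnorm_V_le: "opnorm H K (V a x) \<le> 1"
proof (rule opnorm_le)
  fix \<xi> assume \<xi>: "\<xi> \<in> carrier H"
  have "complex_of_real (\<Sum>a\<in>UNIV. (hnorm K (V a x \<xi>))\<^sup>2) = (\<Sum>a\<in>UNIV. ip K (V a x \<xi>) (V a x \<xi>))"
    using V_bounded \<xi> by (simp add: cod.ip_self)
  also have "\<dots> = complex_of_real ((hnorm H \<xi>)\<^sup>2)"
    using relation_ip[OF \<xi> \<xi>, of x x] \<xi> by (simp add: dom.ip_self)
  finally have "(\<Sum>a\<in>UNIV. (hnorm K (V a x \<xi>))\<^sup>2) = (hnorm H \<xi>)\<^sup>2"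
    by (simp only: of_real_eq_iff)
  moreover have "(hnorm K (V a x \<xi>))\<^sup>2 \<le> (\<Sum>a\<in>UNIV. (hnorm K (V a x \<xi>))\<^sup>2)"
    by (rule member_le_sum) auto
  ultimately have "(hnorm K (V a x \<xi>))\<^sup>2 \<le> (hnorm H \<xi>)\<^sup>2"
    by simp
  then show "hnorm K (V a x \<xi>) \<le> 1 * hnorm H \<xi>"
    using \<xi> by (auto intro: power2_le_imp_le)
qed simp

abbreviation "R \<equiv> rep_term H K V"

lemma rep_term_Tern: "R (Tern u v w) = op_tern (R u) (R v) (R w)"
  by (simp add: op_tern_def)

lemma rep_term_bounded: "R u \<in> bounded_ops H K"
  by (induction u) (auto simp: V_bounded rep_term_Tern op_tern_closed simp del: rep_term.simps(5))

lemma opnorm_rep_term: "opnorm H K (R u) \<le> term_bound u"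
proof (induction u)
  case (Add u v)
  then show ?case
    using opnorm_add_le[OF rep_term_bounded[of u] rep_term_bounded[of v]] by simp
next
  case (Scale c u)
  have "opnorm H K (R (Scale c u)) \<le> cmod c * opnorm H K (R u)"
    using opnorm_smult_le[OF rep_term_bounded[of u]] by simp
  also have "\<dots> \<le> term_bound (Scale c u)"
    using Scale by (simp add: mult_left_mono)
  finally show ?case .
next
  case (Tern u v w)
  have "opnorm H K (R (Tern u v w)) \<le> opnorm H K (R u) * (opnorm H K (R v) * opnorm H K (R w))"
    unfolding rep_term_Tern by (intro opnorm_op_tern rep_term_bounded)
  also have "\<dots> \<le> term_bound (Tern u v w)"
    using Tern opnorm_nonneg[OF rep_term_bounded]
    by (auto intro!: mult_mono mult_nonneg_nonneg term_bound_nonneg)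
  finally show ?case .
qed (auto simp: opnorm_V_le)

lemma rep_term_relation:
  assumes "distinct as" and \<xi>: "\<xi> \<in> carrier H"
  shows "R (foldr (\<lambda>a. Add (Tern (Gen a'' x'') (Gen a x) (Gen a x'))) as Zero) \<xi> =
    (\<Oplus>\<^bsub>K\<^esub> a \<in> set as. V a'' x'' (adj H K (V a x) (V a x' \<xi>)))"
  using assms(1)
proof (induction as)
  case Nil
  then show ?case
    using \<xi> by simp
next
  case (Cons a as)
  have "V a'' x'' (adj H K (V b x) (V b x' \<xi>)) \<in> carrier K" for b
    using V_bounded \<xi> by simp
  then show ?case
    using Cons \<xi> by (auto simp: compose_def)
qed

text \<open>Each ternary axiom holds for the operator product R S^* T. For the defining relation,
  \<open>V a'' x''\<close> is pulled out of the sum over \<open>a\<close>, to which the relation for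
  \<open>V\<close> then applies.\<close>

lemma rep_term_cong: "u \<doteq> v \<Longrightarrow> R u = R v"
proof (induction rule: tern_eq.induct)
  case (relation as a'' x'' x x')
  show ?case
  proof (rule op_ext[OF rep_term_bounded rep_term_bounded])
    fix \<xi> assume \<xi>: "\<xi> \<in> carrier H"
    have "(\<Oplus>\<^bsub>K\<^esub> a \<in> UNIV. V a'' x'' (adj H K (V a x) (V a x' \<xi>))) =
        V a'' x'' (\<Oplus>\<^bsub>H\<^esub> a \<in> UNIV. adj H K (V a x) (V a x' \<xi>))"
      using V_bounded \<xi> by (subst op_finsum) auto
    also have "\<dots> = (if x = x' then V a'' x'' \<xi> else \<zero>\<^bsub>K\<^esub>)"
      using V_bounded by (simp add: relation_apply[OF \<xi>])
    finally show "R (foldr (\<lambda>a. Add (Tern (Gen a'' x'') (Gen a x) (Gen a x'))) as Zero) \<xi> =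
        R (if x = x' then Gen a'' x'' else Zero) \<xi>"
      using relation \<xi> by (simp add: rep_term_relation)
  qed
qed (use rep_term_bounded in \<open>auto intro!: op_eqI simp: rep_term_Tern op_tern_closed op_tern_apply
    adj_add_apply adj_smult_apply adj_op_tern_apply adj_apply_add adj_apply_smult algebra_simps simp del: rep_term.simps(5)\<close>)

text \<open>The condition that \<open>induced_rep\<close> describes, named so that unique existence
  can be proved and the description resolved.\<close>

definition is_induced :: "(('a, 'x) tern \<Rightarrow> 'h \<Rightarrow> 'k) \<Rightarrow> bool" where
  "is_induced \<theta> \<longleftrightarrow> (\<forall>u. \<theta> u \<in> bounded_ops H K) \<and>
     (\<forall>u v. \<theta> (tadd u v) = \<theta> u \<oplus>\<^bsub>op_space H K\<^esub> \<theta> v) \<and>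
     (\<forall>c u. \<theta> (tscale c u) = c \<odot>\<^bsub>op_space H K\<^esub> \<theta> u) \<and>
     (\<forall>u v w. \<theta> (tern u v w) =
        compose (carrier H) (\<theta> u) (compose (carrier H) (adj H K (\<theta> v)) (\<theta> w))) \<and>
     (\<forall>a x. \<theta> (gen a x) = V a x)"

lemma is_induced_unique:
  assumes "is_induced \<theta>"
  shows "\<theta> (abs_tern t) = R t"
proof (induction t)
  case Zero
  \<comment> \<open>\<open>is_induced\<close> does not mention \<open>Zero\<close>; its value
    follows because \<open>Zero\<close> plus -1 times \<open>Zero\<close> is again the class of
    \<open>Zero\<close>.\<close>
  have "tadd (abs_tern Zero) (tscale (- 1) (abs_tern Zero)) = (abs_tern Zero :: ('a, 'x) tern)"
    unfolding tadd.abs_eq tscale.abs_eq tern.abs_eq_iff by (rule tern_eq.add_neg)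
  then have "\<theta> (abs_tern Zero) = \<theta> (abs_tern Zero) \<oplus>\<^bsub>op_space H K\<^esub> ((- 1) \<odot>\<^bsub>op_space H K\<^esub> \<theta> (abs_tern Zero))"
    using assms unfolding is_induced_def by metis
  moreover have "\<theta> (abs_tern Zero) \<in> bounded_ops H K"
    using assms by (auto simp: is_induced_def)
  then have "\<theta> (abs_tern Zero) \<oplus>\<^bsub>op_space H K\<^esub> ((- 1) \<odot>\<^bsub>op_space H K\<^esub> \<theta> (abs_tern Zero)) = \<zero>\<^bsub>op_space H K\<^esub>"
    by (intro op_eqI) auto
  ultimately show ?case by simp
qed (use assms in \<open>auto simp: is_induced_def simp flip: tadd.abs_eq tscale.abs_eq tern.abs_eq gen.abs_eq\<close>)

lemma is_induced_rep_tern: "is_induced (\<lambda>u. R (rep_tern u))"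
proof -
  have abs: "R (rep_tern (abs_tern t)) = R t" for t
    by (intro rep_term_cong) (simp add: Quotient3_rep_abs[OF Quotient3_tern] tern_eq.refl)
  have ops: "\<exists>t. u = abs_tern t" for u :: "('a, 'x) tern"
    by (metis Quotient3_abs_rep[OF Quotient3_tern])
  show ?thesis
    unfolding is_induced_def
  proof (intro conjI allI)
    fix u v w :: "('a, 'x) tern" and c a x
    obtain t t' t'' where t: "u = abs_tern t" "v = abs_tern t'" "w = abs_tern t''"
      using ops by metis
    show "R (rep_tern u) \<in> bounded_ops H K"
      by (rule rep_term_bounded)
    show "R (rep_tern (tadd u v)) = R (rep_tern u) \<oplus>\<^bsub>op_space H K\<^esub> R (rep_tern v)"
      by (simp add: t tadd.abs_eq abs)
    show "R (rep_tern (tscale c u)) = c \<odot>\<^bsub>op_space H K\<^esub> R (rep_tern u)"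
      by (simp add: t tscale.abs_eq abs)
    show "R (rep_tern (tern u v w)) = compose (carrier H) (R (rep_tern u))
        (compose (carrier H) (adj H K (R (rep_tern v))) (R (rep_tern w)))"
      by (simp add: t tern.abs_eq abs)
    show "R (rep_tern (gen a x)) = V a x"
      by (simp add: gen.abs_eq abs)
  qed
qed

lemma is_induced_induced_rep: "is_induced (induced_rep H K V)"
proof -
  have "\<exists>!\<theta>. is_induced \<theta>"
  proof (rule ex1I)
    show "is_induced (\<lambda>u. R (rep_tern u))"
      by (rule is_induced_rep_tern)
    fix \<theta> assume \<theta>: "is_induced \<theta>"
    show "\<theta> = (\<lambda>u. R (rep_tern u))"
    proof
      fix u show "\<theta> u = R (rep_tern u)"
        using is_induced_unique[OF \<theta>, of "rep_tern u"] by (simp add: Quotient3_abs_rep[OF Quotient3_tern])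
    qed
  qed
  then show ?thesis
    unfolding induced_rep_def is_induced_def by (rule theI')
qed

lemma induced_rep_bounded: "induced_rep H K V u \<in> bounded_ops H K"
  and induced_rep_tadd: "induced_rep H K V (tadd u v) =
    induced_rep H K V u \<oplus>\<^bsub>op_space H K\<^esub> induced_rep H K V v"
  and induced_rep_tscale: "induced_rep H K V (tscale c u) = c \<odot>\<^bsub>op_space H K\<^esub> induced_rep H K V u"
  and induced_rep_gen: "induced_rep H K V (gen a x) = V a x"
  using is_induced_induced_rep unfolding is_induced_def by auto

lemma induced_rep_tminus:
  "induced_rep H K V (tminus u v) = induced_rep H K V u \<ominus>\<^bsub>op_space H K\<^esub> induced_rep H K V v"
  using induced_rep_bounded by (simp add: tminus_def induced_rep_tadd induced_rep_tscale op_minus_eq_smult)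

lemma opnorm_induced_rep_le: "opnorm H K (induced_rep H K V u) \<le> term_bound (rep_tern u)"
  using is_induced_unique[OF is_induced_induced_rep, of "rep_tern u"] opnorm_rep_term[of "rep_tern u"]
  by (simp add: Quotient3_abs_rep[OF Quotient3_tern])

end

section \<open>Completeness in operator norm and the direct sum of all representations\<close>

section \<open>The universal representation\<close>

context hilbert_pair
begin

lemma opnorm_minus_commute:
  assumes "S \<in> bounded_ops H K" "T \<in> bounded_ops H K"
  shows "opnorm H K (S \<ominus>\<^bsub>op_space H K\<^esub> T) = opnorm H K (T \<ominus>\<^bsub>op_space H K\<^esub> S)"
proof -
  have "opnorm H K (S \<ominus>\<^bsub>op_space H K\<^esub> T) \<le> opnorm H K (T \<ominus>\<^bsub>op_space H K\<^esub> S)"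
    if "S \<in> bounded_ops H K" "T \<in> bounded_ops H K" for S T
    using that opnorm_bound[OF minus_op[OF that(2,1)]] cod.hnorm_minus_commute
    by (intro opnorm_le opnorm_nonneg) auto
  then show ?thesis
    using assms by (intro antisym)
qed

lemma opnorm_minus_self:
  assumes "T \<in> bounded_ops H K"
  shows "opnorm H K (T \<ominus>\<^bsub>op_space H K\<^esub> T) = 0"
proof -
  have "T \<ominus>\<^bsub>op_space H K\<^esub> T = \<zero>\<^bsub>op_space H K\<^esub>"
    using assms by (intro op_eqI) auto
  then show ?thesis by simp
qed

lemma opnorm_triangle_dist:
  assumes "R \<in> bounded_ops H K" "S \<in> bounded_ops H K" "T \<in> bounded_ops H K"
  shows "opnorm H K (R \<ominus>\<^bsub>op_space H K\<^esub> T) \<le>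
    opnorm H K (R \<ominus>\<^bsub>op_space H K\<^esub> S) + opnorm H K (S \<ominus>\<^bsub>op_space H K\<^esub> T)"
proof -
  have "R \<ominus>\<^bsub>op_space H K\<^esub> T = (R \<ominus>\<^bsub>op_space H K\<^esub> S) \<oplus>\<^bsub>op_space H K\<^esub> (S \<ominus>\<^bsub>op_space H K\<^esub> T)"
    using assms by (intro op_eqI) auto
  then show ?thesis
    using assms opnorm_add_le[of "R \<ominus>\<^bsub>op_space H K\<^esub> S" "S \<ominus>\<^bsub>op_space H K\<^esub> T"] by simp
qed

lemma op_minus_eq_zeroD:
  assumes "S \<in> bounded_ops H K" "T \<in> bounded_ops H K"
    and "S \<ominus>\<^bsub>op_space H K\<^esub> T = \<zero>\<^bsub>op_space H K\<^esub>"
  shows "S = T"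
proof (rule op_ext[OF assms(1,2)])
  fix \<xi> assume \<xi>: "\<xi> \<in> carrier H"
  have "S \<xi> \<ominus>\<^bsub>K\<^esub> T \<xi> = \<zero>\<^bsub>K\<^esub>"
    using op_space_minus_apply[OF assms(1,2) \<xi>] \<xi> assms(3) by simp
  then show "S \<xi> = T \<xi>"
    using assms \<xi> by simp
qed

lemma opnorm_limit_unique:
  assumes "\<And>n. T n \<in> bounded_ops H K" "R \<in> bounded_ops H K" "S \<in> bounded_ops H K"
    and R: "(\<lambda>n. opnorm H K (T n \<ominus>\<^bsub>op_space H K\<^esub> R)) \<longlonglongrightarrow> 0"
    and S: "(\<lambda>n. opnorm H K (T n \<ominus>\<^bsub>op_space H K\<^esub> S)) \<longlonglongrightarrow> 0"
  shows "R = S"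
proof -
  have "opnorm H K (R \<ominus>\<^bsub>op_space H K\<^esub> S) \<le>
      opnorm H K (T n \<ominus>\<^bsub>op_space H K\<^esub> R) + opnorm H K (T n \<ominus>\<^bsub>op_space H K\<^esub> S)" for n
    using opnorm_triangle_dist[OF assms(2) assms(1)[of n] assms(3)]
      opnorm_minus_commute[OF assms(2) assms(1)[of n]] by simp
  then have "opnorm H K (R \<ominus>\<^bsub>op_space H K\<^esub> S) \<le> 0 + 0"
    by (intro LIMSEQ_le_const[OF tendsto_add[OF R S]]) auto
  then have "opnorm H K (R \<ominus>\<^bsub>op_space H K\<^esub> S) = 0"
    using opnorm_nonneg[OF minus_op[OF assms(2,3)]] by simp
  then show ?thesis
    using assms by (intro op_minus_eq_zeroD[OF assms(2,3)] opnorm_eq_0D minus_op)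
qed

text \<open>Pointwise limits exist by completeness of \<open>K\<close> and are linear by continuity
  of \<open>ip\<close>. The Cauchy estimate is a constant times the norm of \<xi>, so it survives
  the limit in one index and gives convergence in operator norm.\<close>

lemma bounded_ops_complete:
  assumes T: "\<And>n. T n \<in> bounded_ops H K"
    and cauchy: "\<And>\<epsilon>. \<epsilon> > 0 \<Longrightarrow> \<exists>N. \<forall>m\<ge>N. \<forall>n\<ge>N. opnorm H K (T m \<ominus>\<^bsub>op_space H K\<^esub> T n) < \<epsilon>"
  shows "\<exists>S\<in>bounded_ops H K. (\<lambda>n. opnorm H K (T n \<ominus>\<^bsub>op_space H K\<^esub> S)) \<longlonglongrightarrow> 0"
proof -
  have bound: "hnorm K (T m \<xi> \<ominus>\<^bsub>K\<^esub> T n \<xi>) \<le> opnorm H K (T m \<ominus>\<^bsub>op_space H K\<^esub> T n) * hnorm H \<xi>"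
    if "\<xi> \<in> carrier H" for m n \<xi>
    using opnorm_bound[OF minus_op[OF T[of m] T[of n]] that] T that by simp
  have "\<exists>\<eta>\<in>carrier K. (\<lambda>n. hnorm K (T n \<xi> \<ominus>\<^bsub>K\<^esub> \<eta>)) \<longlonglongrightarrow> 0" if \<xi>: "\<xi> \<in> carrier H" for \<xi>
  proof (rule cod.complete)
    show "T n \<xi> \<in> carrier K" for n
      using T \<xi> by simp
    fix \<epsilon> :: real assume "\<epsilon> > 0"
    \<comment> \<open>The summand 1 keeps the denominator positive for \<xi> = 0.\<close>
    then obtain N where N: "\<forall>m\<ge>N. \<forall>n\<ge>N. opnorm H K (T m \<ominus>\<^bsub>op_space H K\<^esub> T n) < \<epsilon> / (hnorm H \<xi> + 1)"
      using cauchy[of "\<epsilon> / (hnorm H \<xi> + 1)"] dom.hnorm_nonneg[OF \<xi>] by auto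
    have "hnorm K (T m \<xi> \<ominus>\<^bsub>K\<^esub> T n \<xi>) < \<epsilon>" if "N \<le> m" "N \<le> n" for m n
    proof -
      have "opnorm H K (T m \<ominus>\<^bsub>op_space H K\<^esub> T n) * hnorm H \<xi> \<le> \<epsilon> / (hnorm H \<xi> + 1) * hnorm H \<xi>"
        using N that \<xi> by (intro mult_right_mono) (auto intro: less_imp_le)
      also have "\<dots> < \<epsilon>"
        using dom.hnorm_nonneg[OF \<xi>] \<open>\<epsilon> > 0\<close> by (simp add: field_simps)
      finally show ?thesis
        using bound[OF \<xi>, of m n] by simp
    qed
    then show "\<exists>N. \<forall>m\<ge>N. \<forall>n\<ge>N. hnorm K (T m \<xi> \<ominus>\<^bsub>K\<^esub> T n \<xi>) < \<epsilon>"
      by blast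
  qed
  then obtain S0 where S0: "\<And>\<xi>. \<xi> \<in> carrier H \<Longrightarrow> S0 \<xi> \<in> carrier K"
    and lim: "\<And>\<xi>. \<xi> \<in> carrier H \<Longrightarrow> (\<lambda>n. hnorm K (T n \<xi> \<ominus>\<^bsub>K\<^esub> S0 \<xi>)) \<longlonglongrightarrow> 0"
    by metis
  have ip_lim: "(\<lambda>n. ip K (T n \<xi>) \<eta>) \<longlonglongrightarrow> ip K (S0 \<xi>) \<eta>" if "\<xi> \<in> carrier H" "\<eta> \<in> carrier K" for \<xi> \<eta>
    using cod.ip_tendsto[OF _ S0 lim, of _ \<eta>] T that by simp
  define S where "S = restrict S0 (carrier H)"
  obtain N1 where N1: "\<And>n. N1 \<le> n \<Longrightarrow> opnorm H K (T N1 \<ominus>\<^bsub>op_space H K\<^esub> T n) < 1"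
    using cauchy[of 1] by auto
  have near: "hnorm K (T m \<xi> \<ominus>\<^bsub>K\<^esub> S0 \<xi>) \<le> \<epsilon> * hnorm H \<xi>"
    if \<xi>: "\<xi> \<in> carrier H" and N: "\<And>n. N \<le> n \<Longrightarrow> opnorm H K (T m \<ominus>\<^bsub>op_space H K\<^esub> T n) \<le> \<epsilon>" for m N \<epsilon> \<xi>
  proof (rule LIMSEQ_le_const2)
    have [simp]: "T n \<xi> \<in> carrier K" "S0 \<xi> \<in> carrier K" for n
      using T \<xi> S0 by auto
    have "(T m \<xi> \<ominus>\<^bsub>K\<^esub> T n \<xi>) \<ominus>\<^bsub>K\<^esub> (T m \<xi> \<ominus>\<^bsub>K\<^esub> S0 \<xi>) = S0 \<xi> \<ominus>\<^bsub>K\<^esub> T n \<xi>" for n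
      by (intro cod.vector_eqI) auto
    then have "hnorm K ((T m \<xi> \<ominus>\<^bsub>K\<^esub> T n \<xi>) \<ominus>\<^bsub>K\<^esub> (T m \<xi> \<ominus>\<^bsub>K\<^esub> S0 \<xi>)) = hnorm K (T n \<xi> \<ominus>\<^bsub>K\<^esub> S0 \<xi>)" for n
      by (simp add: cod.hnorm_minus_commute)
    then show "(\<lambda>n. hnorm K (T m \<xi> \<ominus>\<^bsub>K\<^esub> T n \<xi>)) \<longlonglongrightarrow> hnorm K (T m \<xi> \<ominus>\<^bsub>K\<^esub> S0 \<xi>)"
      using lim[OF \<xi>] by (intro cod.hnorm_tendsto) auto
    have "hnorm K (T m \<xi> \<ominus>\<^bsub>K\<^esub> T n \<xi>) \<le> \<epsilon> * hnorm H \<xi>" if "N \<le> n" for n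
      using bound[OF \<xi>, of m n] N[OF that] dom.hnorm_nonneg[OF \<xi>]
      by (meson mult_right_mono order_trans)
    then show "\<exists>N. \<forall>n\<ge>N. hnorm K (T m \<xi> \<ominus>\<^bsub>K\<^esub> T n \<xi>) \<le> \<epsilon> * hnorm H \<xi>"
      by blast
  qed
  have S: "S \<in> bounded_ops H K"
  proof (rule bounded_opsI)
    show "S \<in> extensional (carrier H)"
      by (simp add: S_def)
    fix \<xi> assume \<xi>: "\<xi> \<in> carrier H"
    then show "S \<xi> \<in> carrier K"
      using S0 by (simp add: S_def)
    show "S (c \<odot>\<^bsub>H\<^esub> \<xi>) = c \<odot>\<^bsub>K\<^esub> S \<xi>" for c
    proof (rule cod.vector_eqI)
      fix \<eta> assume \<eta>: "\<eta> \<in> carrier K"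
      have "(\<lambda>n. ip K (T n (c \<odot>\<^bsub>H\<^esub> \<xi>)) \<eta>) \<longlonglongrightarrow> ip K (c \<odot>\<^bsub>K\<^esub> S0 \<xi>) \<eta>"
        using tendsto_mult_left[OF ip_lim[OF \<xi> \<eta>], of c] T \<xi> \<eta> S0 by simp
      then show "ip K (S (c \<odot>\<^bsub>H\<^esub> \<xi>)) \<eta> = ip K (c \<odot>\<^bsub>K\<^esub> S \<xi>) \<eta>"
        using LIMSEQ_unique[OF ip_lim[of "c \<odot>\<^bsub>H\<^esub> \<xi>" \<eta>]] \<xi> \<eta> by (simp add: S_def)
    qed (use \<xi> S0 in \<open>auto simp: S_def\<close>)
    show "S (\<xi> \<oplus>\<^bsub>H\<^esub> \<xi>') = S \<xi> \<oplus>\<^bsub>K\<^esub> S \<xi>'" if \<xi>': "\<xi>' \<in> carrier H" for \<xi>'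
    proof (rule cod.vector_eqI)
      fix \<eta> assume \<eta>: "\<eta> \<in> carrier K"
      have "(\<lambda>n. ip K (T n (\<xi> \<oplus>\<^bsub>H\<^esub> \<xi>')) \<eta>) \<longlonglongrightarrow> ip K (S0 \<xi> \<oplus>\<^bsub>K\<^esub> S0 \<xi>') \<eta>"
        using tendsto_add[OF ip_lim[OF \<xi> \<eta>] ip_lim[OF \<xi>' \<eta>]] T \<xi> \<xi>' \<eta> S0 by simp
      then show "ip K (S (\<xi> \<oplus>\<^bsub>H\<^esub> \<xi>')) \<eta> = ip K (S \<xi> \<oplus>\<^bsub>K\<^esub> S \<xi>') \<eta>"
        using LIMSEQ_unique[OF ip_lim[of "\<xi> \<oplus>\<^bsub>H\<^esub> \<xi>'" \<eta>]] \<xi> \<xi>' \<eta> by (simp add: S_def)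
    qed (use \<xi> \<xi>' S0 in \<open>auto simp: S_def\<close>)
    have [simp]: "T N1 \<xi> \<in> carrier K" "S0 \<xi> \<in> carrier K"
      using T \<xi> S0 by auto
    have "S0 \<xi> = T N1 \<xi> \<ominus>\<^bsub>K\<^esub> (T N1 \<xi> \<ominus>\<^bsub>K\<^esub> S0 \<xi>)"
      by (intro cod.vector_eqI) auto
    then have "hnorm K (S0 \<xi>) \<le> hnorm K (T N1 \<xi>) + hnorm K (T N1 \<xi> \<ominus>\<^bsub>K\<^esub> S0 \<xi>)"
      using cod.hnorm_triangle_minus[of "T N1 \<xi>" "T N1 \<xi> \<ominus>\<^bsub>K\<^esub> S0 \<xi>"] by simp
    also have "\<dots> \<le> opnorm H K (T N1) * hnorm H \<xi> + 1 * hnorm H \<xi>"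
      using opnorm_bound[OF T \<xi>] near[OF \<xi>, of N1 N1 1] N1 by (intro add_mono) (auto intro: less_imp_le)
    finally show "hnorm K (S \<xi>) \<le> (opnorm H K (T N1) + 1) * hnorm H \<xi>"
      using \<xi> by (simp add: S_def distrib_right)
  qed
  have "(\<lambda>n. opnorm H K (T n \<ominus>\<^bsub>op_space H K\<^esub> S)) \<longlonglongrightarrow> 0"
  proof (rule LIMSEQ_I)
    fix r :: real assume "r > 0"
    then obtain N where N: "\<And>m n. \<lbrakk>N \<le> m; N \<le> n\<rbrakk> \<Longrightarrow> opnorm H K (T m \<ominus>\<^bsub>op_space H K\<^esub> T n) < r / 2"
      using cauchy[of "r / 2"] by auto
    have "norm (opnorm H K (T m \<ominus>\<^bsub>op_space H K\<^esub> S) - 0) < r" if "N \<le> m" for m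
    proof -
      have "opnorm H K (T m \<ominus>\<^bsub>op_space H K\<^esub> S) \<le> r / 2"
      proof (rule opnorm_le)
        fix \<xi> assume \<xi>: "\<xi> \<in> carrier H"
        have "hnorm K (T m \<xi> \<ominus>\<^bsub>K\<^esub> S0 \<xi>) \<le> r / 2 * hnorm H \<xi>"
          using N[OF that] by (intro near[OF \<xi>, of N]) (auto intro: less_imp_le)
        then show "hnorm K ((T m \<ominus>\<^bsub>op_space H K\<^esub> S) \<xi>) \<le> r / 2 * hnorm H \<xi>"
          using \<xi> S T by (simp add: S_def)
      qed (use \<open>r > 0\<close> in simp)
      then show ?thesis
        using opnorm_nonneg[OF minus_op[OF T[of m] S]] \<open>r > 0\<close> by simp
    qed
    then show "\<exists>N. \<forall>n\<ge>N. norm (opnorm H K (T n \<ominus>\<^bsub>op_space H K\<^esub> S) - 0) < r"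
      by blast
  qed
  with S show ?thesis by blast
qed

end

lemma all_reps_representation: "(H, K, V) \<in> all_reps \<Longrightarrow> representation H K V"
  by (simp add: all_reps_def is_rep_iff)

text \<open>On the zero space the identity and the zero operator coincide, so all relations hold.
  The supremum in \<open>univ_seminorm\<close> thus has a nonempty index set.\<close>

lemma all_reps_nonempty: "(all_reps :: ('u, 'a::finite, 'x) rep set) \<noteq> {}"
proof -
  define N :: "'u univ hilbert" where "N = kernel_hilbert {} (\<lambda>_ _. 0)"
  interpret hilbert_space N
    unfolding N_def by (rule kernel_hilbert[where \<epsilon> = 1]) auto
  interpret p: hilbert_pair N N ..
  have zero: "\<xi> = \<zero>\<^bsub>N\<^esub>" if "\<xi> \<in> carrier N" for \<xi>
    using that by (auto simp: N_def kernel_hilbert_simps)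
  have eq: "S = T" if "S \<in> bounded_ops N N" "T \<in> bounded_ops N N" for S T
    using that zero p.op_closed by (intro p.op_ext) metis+
  have "representation N N (\<lambda>(a::'a) (x::'x). \<zero>\<^bsub>op_space N N\<^esub>)"
  proof (intro representation.intro representation_axioms.intro)
    show "hilbert_pair N N" ..
    show "\<zero>\<^bsub>op_space N N\<^esub> \<in> bounded_ops N N"
      by simp
    have "compose (carrier N) (adj N N \<zero>\<^bsub>op_space N N\<^esub>) \<zero>\<^bsub>op_space N N\<^esub> \<in> bounded_ops N N"
      using compose_op(1)[OF hilbert_space_axioms hilbert_space_axioms hilbert_space_axioms
          p.adj_bounded[OF p.zero_op] p.zero_op] .
    then have "(\<Oplus>\<^bsub>op_space N N\<^esub> a \<in> (UNIV :: 'a set). compose (carrier N) (adj N N \<zero>\<^bsub>op_space N N\<^esub>) \<zero>\<^bsub>op_space N N\<^esub>)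
        \<in> carrier (op_space N N)"
      by (intro p.op.finsum_closed) auto
    then show "(\<Oplus>\<^bsub>op_space N N\<^esub> a \<in> (UNIV :: 'a set). compose (carrier N) (adj N N \<zero>\<^bsub>op_space N N\<^esub>) \<zero>\<^bsub>op_space N N\<^esub>) =
        (if x = x' then \<lambda>\<xi>\<in>carrier N. \<xi> else \<zero>\<^bsub>op_space N N\<^esub>)" for x x' :: 'x
      using id_op by (intro eq) auto
  qed
  then have "(N, N, \<lambda>_ _. \<zero>\<^bsub>op_space N N\<^esub>) \<in> (all_reps :: ('u, 'a, 'x) rep set)"
    by (simp add: all_reps_def is_rep_iff)
  then show ?thesis by blast
qed

lemma opnorm_induced_rep_le_seminorm:
  fixes V :: "'a::finite \<Rightarrow> 'x \<Rightarrow> 'u univ \<Rightarrow> 'u univ"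
  assumes "(H, K, V) \<in> all_reps"
  shows "opnorm H K (induced_rep H K V u) \<le> univ_seminorm TYPE('u) u"
proof -
  have "bdd_above ((\<lambda>(H, K, V). opnorm H K (induced_rep H K V u)) ` (all_reps :: ('u, 'a, 'x) rep set))"
    using representation.opnorm_induced_rep_le[OF all_reps_representation]
    by (intro bdd_aboveI2[of _ _ "term_bound (rep_tern u)"]) auto
  then show ?thesis
    unfolding univ_seminorm_def using assms by (intro cSUP_upper2[OF _ assms]) auto
qed

lemma univ_seminorm_nonneg: "0 \<le> univ_seminorm TYPE('u) (u :: ('a::finite, 'x) tern)"
proof -
  obtain H K V where r: "(H, K, V) \<in> (all_reps :: ('u, 'a, 'x) rep set)"
    using all_reps_nonempty by (metis ex_in_conv prod_cases3)
  then interpret representation H K V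
    by (rule all_reps_representation)
  show ?thesis
    using opnorm_nonneg[OF induced_rep_bounded] opnorm_induced_rep_le_seminorm[OF r] by (meson order_trans)
qed

lemma univ_seminorm_tminus_self: "univ_seminorm TYPE('u) (tminus u u :: ('a::finite, 'x) tern) = 0"
proof -
  have "opnorm H K (induced_rep H K V (tminus u u)) = 0" if "(H, K, V) \<in> (all_reps :: ('u, 'a, 'x) rep set)" for H K V
  proof -
    interpret representation H K V
      by (rule all_reps_representation[OF that])
    have "induced_rep H K V (tminus u u) = \<zero>\<^bsub>op_space H K\<^esub>"
      unfolding induced_rep_tminus using induced_rep_bounded by (intro op_eqI) auto
    then show ?thesis by simp
  qed
  then have "univ_seminorm TYPE('u) (tminus u u) = (SUP r \<in> (all_reps :: ('u, 'a, 'x) rep set). 0)"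
    unfolding univ_seminorm_def by (intro SUP_cong) auto
  also have "\<dots> = 0"
    by (rule cSUP_const[OF all_reps_nonempty])
  finally show ?thesis .
qed

lemma component_hilbert_spaces:
  assumes "r \<in> (all_reps :: ('u, 'a::finite, 'x) rep set)"
  shows "hilbert_space (fst r)" "hilbert_space ((fst \<circ> snd) r)"
proof -
  obtain H K V where r: "r = (H, K, V)"
    by (rule prod_cases3)
  then have "representation H K V"
    using assms all_reps_representation by simp
  then show "hilbert_space (fst r)" "hilbert_space ((fst \<circ> snd) r)"
    unfolding representation_def hilbert_pair_def by (simp_all add: r)
qed

lemma H_fam: "hilbert_family (all_reps :: ('u, 'a::finite, 'x) rep set) fst"
  by (rule hilbert_family.intro) (rule component_hilbert_spaces)

lemma K_fam: "hilbert_family (all_reps :: ('u, 'a::finite, 'x) rep set) (fst \<circ> snd)"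
  by (rule hilbert_family.intro) (rule component_hilbert_spaces)

lemma univ_pair: "hilbert_pair (H_univ :: (('u, 'a::finite, 'x) rep \<Rightarrow> 'u univ) hilbert) K_univ"
  unfolding H_univ_def K_univ_def hilbert_pair_def
  using hilbert_family.hilbert_sum[OF H_fam] hilbert_family.hilbert_sum[OF K_fam] by blast

lemma H_univ_component:
  "\<lbrakk>\<xi> \<in> carrier H_univ; (H, K, V) \<in> all_reps\<rbrakk> \<Longrightarrow> \<xi> (H, K, V) \<in> carrier H"
  using hilbert_family.component_closed[OF H_fam, of \<xi> "(H, K, V)"] by (simp add: H_univ_def)

lemma ip_H_univ: "ip H_univ \<xi> \<eta> = (\<Sum>\<^sub>\<infinity>r\<in>all_reps. ip (fst r) (\<xi> r) (\<eta> r))"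
  by (simp add: H_univ_def hilbert_family.hilbert_sum_simps[OF H_fam])

lemma ip_K_univ: "ip K_univ \<xi> \<eta> = (\<Sum>\<^sub>\<infinity>r\<in>all_reps. ip (fst (snd r)) (\<xi> r) (\<eta> r))"
  by (simp add: K_univ_def hilbert_family.hilbert_sum_simps[OF K_fam])

lemma ip_K_univ_summable:
  "\<lbrakk>\<xi> \<in> carrier K_univ; \<eta> \<in> carrier K_univ\<rbrakk> \<Longrightarrow> (\<lambda>r. ip (fst (snd r)) (\<xi> r) (\<eta> r)) summable_on all_reps"
  using hilbert_family.ip_summable[OF K_fam, of \<xi> \<eta>] by (simp add: K_univ_def)

lemma theta_univ_apply:
  assumes "\<xi> \<in> carrier H_univ" "(H, K, V) \<in> all_reps"
  shows "theta_univ u \<xi> (H, K, V) = induced_rep H K V u (\<xi> (H, K, V))"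
  using assms by (simp add: theta_univ_def op_sum_def H_univ_def)

lemma
  fixes u :: "('a::finite, 'x) tern"
  shows theta_univ_bounded: "(theta_univ u :: (('u, 'a, 'x) rep \<Rightarrow> 'u univ) \<Rightarrow> _) \<in> bounded_ops H_univ K_univ"
    and opnorm_theta_univ: "opnorm H_univ K_univ (theta_univ u :: (('u, 'a, 'x) rep \<Rightarrow> 'u univ) \<Rightarrow> _)
      \<le> univ_seminorm TYPE('u) u"
proof -
  have bounded: "(\<lambda>(H, K, V). induced_rep H K V u) r \<in> bounded_ops (fst r) ((fst \<circ> snd) r)"
    if "r \<in> (all_reps :: ('u, 'a, 'x) rep set)" for r
    using that by (cases r) (auto intro!: representation.induced_rep_bounded all_reps_representation)
  have norm: "opnorm (fst r) ((fst \<circ> snd) r) ((\<lambda>(H, K, V). induced_rep H K V u) r) \<le> univ_seminorm TYPE('u) u"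
    if "r \<in> (all_reps :: ('u, 'a, 'x) rep set)" for r
    using that by (cases r) (auto intro!: opnorm_induced_rep_le_seminorm)
  show "(theta_univ u :: (('u, 'a, 'x) rep \<Rightarrow> 'u univ) \<Rightarrow> _) \<in> bounded_ops H_univ K_univ"
    and "opnorm H_univ K_univ (theta_univ u :: (('u, 'a, 'x) rep \<Rightarrow> 'u univ) \<Rightarrow> _) \<le> univ_seminorm TYPE('u) u"
    unfolding theta_univ_def H_univ_def K_univ_def
    by (rule op_sum[of _ fst "fst \<circ> snd", OF component_hilbert_spaces bounded univ_seminorm_nonneg norm], assumption+)+
qed

lemma K_univ_eqI:
  assumes "\<xi> \<in> carrier K_univ" "\<eta> \<in> carrier K_univ"
    and "\<And>H K V. (H, K, V) \<in> all_reps \<Longrightarrow> \<xi> (H, K, V) = \<eta> (H, K, V)"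
  shows "\<xi> = \<eta>"
  using assms hilbert_family.hilbert_sum_eqI[OF K_fam, of \<xi> \<eta>] by (auto simp: K_univ_def)

lemma theta_univ_tminus:
  fixes u v :: "('a::finite, 'x) tern"
  shows "(theta_univ (tminus u v) :: (('u, 'a, 'x) rep \<Rightarrow> 'u univ) \<Rightarrow> _) =
    theta_univ u \<ominus>\<^bsub>op_space H_univ K_univ\<^esub> theta_univ v"
proof (rule hilbert_pair.op_ext[OF univ_pair])
  fix \<xi> :: "('u, 'a, 'x) rep \<Rightarrow> 'u univ" assume \<xi>: "\<xi> \<in> carrier H_univ"
  have [simp]: "theta_univ w \<xi> \<in> carrier K_univ" for w :: "('a, 'x) tern"
    by (rule hilbert_pair.op_closed[OF univ_pair theta_univ_bounded \<xi>])
  show "theta_univ (tminus u v) \<xi> = (theta_univ u \<ominus>\<^bsub>op_space H_univ K_univ\<^esub> theta_univ v) \<xi>"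
  proof (rule K_univ_eqI)
    fix H K and V :: "'a \<Rightarrow> 'x \<Rightarrow> 'u univ \<Rightarrow> 'u univ" assume r: "(H, K, V) \<in> all_reps"
    interpret representation H K V
      by (rule all_reps_representation[OF r])
    have "(theta_univ u \<xi> \<ominus>\<^bsub>K_univ\<^esub> theta_univ v \<xi>) (H, K, V) =
        theta_univ u \<xi> (H, K, V) \<ominus>\<^bsub>K\<^esub> theta_univ v \<xi> (H, K, V)"
      using hilbert_family.hilbert_sum_minus[OF K_fam _ _ r, of "theta_univ u \<xi>" "theta_univ v \<xi>"]
      by (simp flip: K_univ_def)
    then show "theta_univ (tminus u v) \<xi> (H, K, V) = (theta_univ u \<ominus>\<^bsub>op_space H_univ K_univ\<^esub> theta_univ v) \<xi> (H, K, V)"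
      using \<xi> r H_univ_component[OF \<xi> r]
      by (simp add: hilbert_pair.op_space_minus_apply[OF univ_pair] theta_univ_bounded theta_univ_apply induced_rep_tminus induced_rep_bounded)
  qed (intro hilbert_pair.op_closed[OF univ_pair] hilbert_pair.minus_op[OF univ_pair] theta_univ_bounded \<xi>)+
qed (intro hilbert_pair.minus_op[OF univ_pair] theta_univ_bounded)+

lemma opnorm_theta_univ_diff:
  fixes u v :: "('a::finite, 'x) tern"
  shows "opnorm H_univ K_univ ((theta_univ u :: (('u, 'a, 'x) rep \<Rightarrow> 'u univ) \<Rightarrow> _)
    \<ominus>\<^bsub>op_space H_univ K_univ\<^esub> theta_univ v) \<le> univ_seminorm TYPE('u) (tminus u v)"
  unfolding theta_univ_tminus[symmetric] by (rule opnorm_theta_univ)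

text \<open>Along equivalent sequences the operators \<open>theta_univ\<close> differ by no more
  than the seminorm and share their limit, so one representative decides for the whole
  class.\<close>

lemma faithful_rep_eqI:
  fixes t :: "nat \<Rightarrow> ('a::finite, 'x) tern" and T :: "(('u, 'a, 'x) rep \<Rightarrow> 'u univ) \<Rightarrow> ('u, 'a, 'x) rep \<Rightarrow> 'u univ"
  assumes t: "t \<in> tern_cauchy TYPE('u)" and T: "T \<in> bounded_ops H_univ K_univ"
    and lim: "(\<lambda>n. opnorm H_univ K_univ (theta_univ (t n) \<ominus>\<^bsub>op_space H_univ K_univ\<^esub> T)) \<longlonglongrightarrow> 0"
  shows "faithful_rep (tern_null_rel TYPE('u) `` {t}) = T"
  unfolding faithful_rep_def
proof (rule the_equality)
  \<comment> \<open>Uniqueness is tested on a member of the class, and \<open>t\<close> itself is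
    one.\<close>
  have "t \<in> tern_null_rel TYPE('u) `` {t}"
    using t by (simp add: tern_null_rel_def univ_seminorm_tminus_self)
  then show "S = T" if "S \<in> bounded_ops H_univ K_univ \<and> (\<forall>s\<in>tern_null_rel TYPE('u) `` {t}.
      (\<lambda>n. opnorm H_univ K_univ (theta_univ (s n) \<ominus>\<^bsub>op_space H_univ K_univ\<^esub> S)) \<longlonglongrightarrow> 0)" for S
    using that T lim by (intro hilbert_pair.opnorm_limit_unique[OF univ_pair, of "\<lambda>n. theta_univ (t n)"]) (auto simp: theta_univ_bounded)
  have "(\<lambda>n. opnorm H_univ K_univ (theta_univ (s n) \<ominus>\<^bsub>op_space H_univ K_univ\<^esub> T)) \<longlonglongrightarrow> 0"
    if s: "s \<in> tern_null_rel TYPE('u) `` {t}" for s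
  proof (rule tendsto_sandwich[OF _ _ tendsto_const])
    let ?d = "\<lambda>n. univ_seminorm TYPE('u) (tminus (t n) (s n)) +
      opnorm H_univ K_univ (theta_univ (t n) \<ominus>\<^bsub>op_space H_univ K_univ\<^esub> T)"
    have "(\<lambda>n. univ_seminorm TYPE('u) (tminus (t n) (s n))) \<longlonglongrightarrow> 0"
      using s by (simp add: tern_null_rel_def)
    from tendsto_add[OF this lim] show "?d \<longlonglongrightarrow> 0" by simp
    show "\<forall>\<^sub>F n in sequentially. 0 \<le> opnorm H_univ K_univ (theta_univ (s n) \<ominus>\<^bsub>op_space H_univ K_univ\<^esub> T)"
      by (intro always_eventually allI hilbert_pair.opnorm_nonneg[OF univ_pair] hilbert_pair.minus_op[OF univ_pair] theta_univ_bounded T)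
    show "\<forall>\<^sub>F n in sequentially. opnorm H_univ K_univ (theta_univ (s n) \<ominus>\<^bsub>op_space H_univ K_univ\<^esub> T) \<le> ?d n"
    proof (intro always_eventually allI)
      fix n
      have "opnorm H_univ K_univ (theta_univ (s n) \<ominus>\<^bsub>op_space H_univ K_univ\<^esub> T) \<le>
        opnorm H_univ K_univ ((theta_univ (s n) :: (('u, 'a, 'x) rep \<Rightarrow> 'u univ) \<Rightarrow> _) \<ominus>\<^bsub>op_space H_univ K_univ\<^esub> theta_univ (t n)) +
        opnorm H_univ K_univ (theta_univ (t n) \<ominus>\<^bsub>op_space H_univ K_univ\<^esub> T)"
        by (intro hilbert_pair.opnorm_triangle_dist[OF univ_pair] theta_univ_bounded T)
      also have "opnorm H_univ K_univ ((theta_univ (s n) :: (('u, 'a, 'x) rep \<Rightarrow> 'u univ) \<Rightarrow> _) \<ominus>\<^bsub>op_space H_univ K_univ\<^esub> theta_univ (t n))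
          \<le> univ_seminorm TYPE('u) (tminus (t n) (s n))"
        unfolding hilbert_pair.opnorm_minus_commute[OF univ_pair theta_univ_bounded theta_univ_bounded, of "s n"]
        by (rule opnorm_theta_univ_diff)
      finally show "opnorm H_univ K_univ (theta_univ (s n) \<ominus>\<^bsub>op_space H_univ K_univ\<^esub> T) \<le> ?d n"
        by simp
    qed
  qed
  with T show "T \<in> bounded_ops H_univ K_univ \<and> (\<forall>s\<in>tern_null_rel TYPE('u) `` {t}.
      (\<lambda>n. opnorm H_univ K_univ (theta_univ (s n) \<ominus>\<^bsub>op_space H_univ K_univ\<^esub> T)) \<longlonglongrightarrow> 0)"
    by blast
qed

lemma const_tern_cauchy: "(\<lambda>_. u) \<in> tern_cauchy TYPE('u)"
  by (simp add: tern_cauchy_def univ_seminorm_tminus_self)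

text \<open>A constant sequence has its own operator as limit. The abstract generators of the TRO
  thereby become the concrete operators \<open>theta_univ (gen a x)\<close>.\<close>

lemma faithful_rep_v_XA:
  fixes a :: "'a::finite" and x :: 'x
  shows "faithful_rep (v_XA TYPE('u) a x) = (theta_univ (gen a x) :: (('u, 'a, 'x) rep \<Rightarrow> 'u univ) \<Rightarrow> _)"
  unfolding v_XA_def
proof (rule faithful_rep_eqI[OF const_tern_cauchy theta_univ_bounded])
  have "opnorm H_univ K_univ (theta_univ (gen a x) \<ominus>\<^bsub>op_space H_univ K_univ\<^esub>
      (theta_univ (gen a x) :: (('u, 'a, 'x) rep \<Rightarrow> 'u univ) \<Rightarrow> _)) = 0"
    by (rule hilbert_pair.opnorm_minus_self[OF univ_pair theta_univ_bounded])
  then show "(\<lambda>n. opnorm H_univ K_univ (theta_univ (gen a x) \<ominus>\<^bsub>op_space H_univ K_univ\<^esub>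
      (theta_univ (gen a x) :: (('u, 'a, 'x) rep \<Rightarrow> 'u univ) \<Rightarrow> _))) \<longlonglongrightarrow> 0"
    by simp
qed

lemma v_XA_in_V_XA: "v_XA TYPE('u) a x \<in> V_XA TYPE('u)"
  by (auto simp: v_XA_def V_XA_def intro!: quotientI const_tern_cauchy)

lemma faithful_rep_bounded:
  fixes w :: "(nat \<Rightarrow> ('a::finite, 'x) tern) set"
  assumes "w \<in> V_XA TYPE('u)"
  shows "(faithful_rep w :: (('u, 'a, 'x) rep \<Rightarrow> 'u univ) \<Rightarrow> _) \<in> bounded_ops H_univ K_univ"
proof -
  obtain t where t: "t \<in> tern_cauchy TYPE('u)" and w: "w = tern_null_rel TYPE('u) `` {t}"
    using assms by (auto simp: V_XA_def elim: quotientE)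
  have "\<exists>T\<in>bounded_ops H_univ K_univ. (\<lambda>n. opnorm H_univ K_univ
      ((theta_univ (t n) :: (('u, 'a, 'x) rep \<Rightarrow> 'u univ) \<Rightarrow> _) \<ominus>\<^bsub>op_space H_univ K_univ\<^esub> T)) \<longlonglongrightarrow> 0"
  proof (rule hilbert_pair.bounded_ops_complete[OF univ_pair theta_univ_bounded])
    fix \<epsilon> :: real assume "\<epsilon> > 0"
    then obtain N where "\<forall>m\<ge>N. \<forall>n\<ge>N. univ_seminorm TYPE('u) (tminus (t m) (t n)) < \<epsilon>"
      using t by (auto simp: tern_cauchy_def)
    then show "\<exists>N. \<forall>m\<ge>N. \<forall>n\<ge>N. opnorm H_univ K_univ ((theta_univ (t m) :: (('u, 'a, 'x) rep \<Rightarrow> 'u univ) \<Rightarrow> _)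
        \<ominus>\<^bsub>op_space H_univ K_univ\<^esub> theta_univ (t n)) < \<epsilon>"
      using opnorm_theta_univ_diff by (meson le_less_trans)
  qed
  then show ?thesis
    unfolding w using faithful_rep_eqI[OF t] by auto
qed

section \<open>Linearity and positivity of the map from coefficient matrices to sums of v_p^*
  v_q\<close>

section \<open>Operators spanned by the Gram matrix of a family\<close>

text \<open>Induction on the index set, splitting off a Schur complement; strict positivity passes to the
  complement with the same constant.\<close>

lemma (in hilbert_space) gram_nonneg_strict:
  fixes A :: "'s \<Rightarrow> 's \<Rightarrow> complex"
  assumes "finite S" "0 < \<epsilon>"
    and "\<And>s t. \<lbrakk>s \<in> S; t \<in> S\<rbrakk> \<Longrightarrow> cnj (A s t) = A t s"
    and "\<And>\<xi>. \<epsilon> * (\<Sum>s\<in>S. (cmod (\<xi> s))\<^sup>2) \<le> Re (\<Sum>s\<in>S. \<Sum>t\<in>S. cnj (\<xi> s) * A s t * \<xi> t)"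
    and "\<And>s. s \<in> S \<Longrightarrow> w s \<in> carrier H"
  shows "0 \<le> Re (\<Sum>s\<in>S. \<Sum>t\<in>S. A s t * ip H (w t) (w s))"
  using assms
proof (induction S arbitrary: A rule: finite_induct)
  case empty
  then show ?case by simp
next
  case (insert z S)
  note herm = insert.prems(2) and pos = insert.prems(3) and w = insert.prems(4)
  have split: "(\<Sum>s\<in>insert z S. \<Sum>t\<in>insert z S. f s t) =
      f z z + (\<Sum>t\<in>S. f z t) + (\<Sum>s\<in>S. f s z) + (\<Sum>s\<in>S. \<Sum>t\<in>S. f s t)" for f :: "'s \<Rightarrow> 's \<Rightarrow> complex"
    using insert.hyps by (simp add: sum.distrib)
  define a where "a = Re (A z z)"
  have a: "A z z = complex_of_real a"
    using herm[of z z] by (simp add: a_def complex_eq_iff)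
  have "0 < a"
  proof -
    \<comment> \<open>The basis vector at \<open>z\<close> singles out the corner entry and shows
      that it is at least \<epsilon>.\<close>
    define e :: "'s \<Rightarrow> complex" where "e s = (if s = z then 1 else 0)" for s
    have e: "e z = 1" "\<And>s. s \<in> S \<Longrightarrow> e s = 0"
      using insert.hyps by (auto simp: e_def)
    have "\<epsilon> * (\<Sum>s\<in>insert z S. (cmod (e s))\<^sup>2) \<le>
        Re (\<Sum>s\<in>insert z S. \<Sum>t\<in>insert z S. cnj (e s) * A s t * e t)"
      by (rule pos)
    also have "(\<Sum>s\<in>insert z S. \<Sum>t\<in>insert z S. cnj (e s) * A s t * e t) = A z z"
      unfolding split by (simp add: e cong: sum.cong_simp)
    also have "(\<Sum>s\<in>insert z S. (cmod (e s))\<^sup>2) = 1"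
      using insert.hyps by (simp add: e cong: sum.cong_simp)
    finally show ?thesis
      using \<open>0 < \<epsilon>\<close> by (simp add: a_def)
  qed
  define A' where "A' s t = A s t - A s z * A z t / a" for s t
  have z_left: "(\<Sum>s\<in>S. A s z * cnj (f s)) = cnj (\<Sum>t\<in>S. A z t * f t)" for f
    unfolding cnj_sum by (intro sum.cong) (auto simp: herm)
  have "0 \<le> Re (\<Sum>s\<in>S. \<Sum>t\<in>S. A' s t * ip H (w t) (w s))"
  proof (rule insert.IH[OF \<open>0 < \<epsilon>\<close>])
    show "cnj (A' s t) = A' t s" if "s \<in> S" "t \<in> S" for s t
      using that by (simp add: A'_def herm mult.commute)
    show "w s \<in> carrier H" if "s \<in> S" for s
      using that w by simp
    fix \<xi> :: "'s \<Rightarrow> complex"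
    define l where "l = (\<Sum>t\<in>S. A z t * \<xi> t)"
    \<comment> \<open>The value at \<open>z\<close> minimizes the form over all extensions of \<xi>;
      the minimum is the form of the Schur complement at \<xi>.\<close>
    define \<zeta> where "\<zeta> s = (if s = z then - l / a else \<xi> s)" for s
    have \<zeta>: "\<zeta> z = - l / a" "s \<in> S \<Longrightarrow> \<zeta> s = \<xi> s" for s
      using insert.hyps by (auto simp: \<zeta>_def)
    have "\<epsilon> * (\<Sum>s\<in>S. (cmod (\<xi> s))\<^sup>2) \<le> \<epsilon> * (\<Sum>s\<in>insert z S. (cmod (\<zeta> s))\<^sup>2)"
      using insert.hyps \<open>0 < \<epsilon>\<close> by (simp add: \<zeta>)
    also have "\<dots> \<le> Re (\<Sum>s\<in>insert z S. \<Sum>t\<in>insert z S. cnj (\<zeta> s) * A s t * \<zeta> t)"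
      by (rule pos)
    also have "(\<Sum>s\<in>insert z S. \<Sum>t\<in>insert z S. cnj (\<zeta> s) * A s t * \<zeta> t) =
        cnj (\<zeta> z) * A z z * \<zeta> z + cnj (\<zeta> z) * l + \<zeta> z * cnj l + (\<Sum>s\<in>S. \<Sum>t\<in>S. cnj (\<xi> s) * A s t * \<xi> t)"
      unfolding split l_def z_left[symmetric] sum_distrib_left by (simp add: \<zeta>(2) ac_simps)
    also have "\<dots> = (\<Sum>s\<in>S. \<Sum>t\<in>S. cnj (\<xi> s) * A s t * \<xi> t) - cnj l * l / a"
      using \<open>0 < a\<close> by (simp add: \<zeta>(1) a field_simps)
    also have "cnj l * l = (\<Sum>s\<in>S. \<Sum>t\<in>S. cnj (\<xi> s) * (A s z * A z t) * \<xi> t)"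
      unfolding l_def z_left[symmetric] sum_product by (simp add: ac_simps)
    also have "(\<Sum>s\<in>S. \<Sum>t\<in>S. cnj (\<xi> s) * A s t * \<xi> t) - (\<Sum>s\<in>S. \<Sum>t\<in>S. cnj (\<xi> s) * (A s z * A z t) * \<xi> t) / a =
        (\<Sum>s\<in>S. \<Sum>t\<in>S. cnj (\<xi> s) * A' s t * \<xi> t)"
      unfolding sum_divide_distrib sum_subtractf[symmetric]
      by (intro sum.cong) (auto simp: A'_def algebra_simps)
    finally show "\<epsilon> * (\<Sum>s\<in>S. (cmod (\<xi> s))\<^sup>2) \<le> Re (\<Sum>s\<in>S. \<Sum>t\<in>S. cnj (\<xi> s) * A' s t * \<xi> t)" .
  qed
  \<comment> \<open>Completing the square: what the Schur complement leaves over is the inner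
    product of one vector with itself, divided by \<open>a\<close>.\<close>
  moreover have "(\<Sum>s\<in>insert z S. \<Sum>t\<in>insert z S. A s t * ip H (w t) (w s)) =
      (\<Sum>s\<in>S. \<Sum>t\<in>S. A' s t * ip H (w t) (w s)) +
      ip H (a \<odot> w z \<oplus> (\<Oplus>t\<in>S. A z t \<odot> w t)) (a \<odot> w z \<oplus> (\<Oplus>t\<in>S. A z t \<odot> w t)) / a"
  proof -
    define y where "y = (\<Oplus>t\<in>S. A z t \<odot> w t)"
    have [simp]: "w z \<in> carrier H" "y \<in> carrier H"
      using w unfolding y_def by (auto intro!: finsum_closed)
    have wS: "w \<in> S \<rightarrow> carrier H" "(\<lambda>t. A z t \<odot> w t) \<in> S \<rightarrow> carrier H"
      using w by auto
    have y1: "ip H y \<eta> = (\<Sum>t\<in>S. A z t * ip H (w t) \<eta>)" if "\<eta> \<in> carrier H" for \<eta>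
      using that w unfolding y_def by (subst ip_finsum[OF wS(2)]) auto
    have y2: "ip H \<eta> y = (\<Sum>s\<in>S. A s z * ip H \<eta> (w s))" if "\<eta> \<in> carrier H" for \<eta>
      using that w unfolding y_def by (subst ip_finsum_right[OF wS(2)]) (auto simp: herm)
    have "ip H y y = (\<Sum>s\<in>S. \<Sum>t\<in>S. A s z * A z t * ip H (w t) (w s))"
      using w by (simp add: y2 y1 sum_distrib_left mult.assoc)
    then have "(\<Sum>s\<in>S. \<Sum>t\<in>S. A' s t * ip H (w t) (w s)) =
        (\<Sum>s\<in>S. \<Sum>t\<in>S. A s t * ip H (w t) (w s)) - ip H y y / a"
      unfolding sum_divide_distrib by (simp add: A'_def left_diff_distrib sum_subtractf sum_divide_distrib)
    moreover have "ip H (a \<odot> w z \<oplus> y) (a \<odot> w z \<oplus> y) / a =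
        A z z * ip H (w z) (w z) + ip H y (w z) + ip H (w z) y + ip H y y / a"
      using \<open>0 < a\<close> by (simp add: a field_simps)
    ultimately show ?thesis
      unfolding split y_def[symmetric] by (simp add: y1 y2)
  qed
  moreover have "0 \<le> Re (ip H (a \<odot> w z \<oplus> (\<Oplus>t\<in>S. A z t \<odot> w t)) (a \<odot> w z \<oplus> (\<Oplus>t\<in>S. A z t \<odot> w t)))"
  proof -
    have "(\<Oplus>t\<in>S. A z t \<odot> w t) \<in> carrier H"
      using w by (auto intro!: finsum_closed)
    then have "a \<odot> w z \<oplus> (\<Oplus>t\<in>S. A z t \<odot> w t) \<in> carrier H"
      using w by auto
    from ip_nonneg[OF this] show ?thesis
      by (simp add: complex_nonneg_iff)
  qed
  ultimately show ?case
    using \<open>0 < a\<close> by simp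
qed

text \<open>Adding \<epsilon> on the diagonal makes the strict version applicable; its contribution
  is \<epsilon> times the sum of the squared norms and disappears in the limit. This positivity of
  the pairing with a Gram matrix is the source of complete positivity of
  \<open>quot\<close>.\<close>

lemma (in hilbert_space) gram_nonneg:
  fixes A :: "'s \<Rightarrow> 's \<Rightarrow> complex"
  assumes "finite S"
    and herm: "\<And>s t. \<lbrakk>s \<in> S; t \<in> S\<rbrakk> \<Longrightarrow> cnj (A s t) = A t s"
    and pos: "\<And>\<xi>. 0 \<le> Re (\<Sum>s\<in>S. \<Sum>t\<in>S. cnj (\<xi> s) * A s t * \<xi> t)"
    and w: "\<And>s. s \<in> S \<Longrightarrow> w s \<in> carrier H"
  shows "0 \<le> Re (\<Sum>s\<in>S. \<Sum>t\<in>S. A s t * ip H (w t) (w s))"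
proof (rule nonneg_if_perturbations_nonneg)
  show "0 \<le> (\<Sum>s\<in>S. (hnorm H (w s))\<^sup>2)"
    by (rule sum_nonneg) simp
  fix \<epsilon> :: real assume "\<epsilon> > 0"
  define B where "B s t = A s t + (if t = s then complex_of_real \<epsilon> else 0)" for s t
  have B: "(\<Sum>s\<in>S. \<Sum>t\<in>S. f s t * B s t) = (\<Sum>s\<in>S. \<Sum>t\<in>S. f s t * A s t) + \<epsilon> * (\<Sum>s\<in>S. f s s)" for f :: "'s \<Rightarrow> 's \<Rightarrow> complex"
  proof -
    have "(\<Sum>s\<in>S. \<Sum>t\<in>S. f s t * B s t) = (\<Sum>s\<in>S. \<Sum>t\<in>S. f s t * A s t + (if t = s then \<epsilon> * f s s else 0))"
      by (intro sum.cong) (auto simp: B_def algebra_simps)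
    then show ?thesis
      using \<open>finite S\<close> by (simp add: sum.distrib sum_distrib_left)
  qed
  have "0 \<le> Re (\<Sum>s\<in>S. \<Sum>t\<in>S. B s t * ip H (w t) (w s))"
  proof (rule gram_nonneg_strict[OF \<open>finite S\<close> \<open>\<epsilon> > 0\<close> _ _ w])
    show "cnj (B s t) = B t s" if "s \<in> S" "t \<in> S" for s t
      using that by (simp add: B_def herm)
    fix \<xi> :: "'s \<Rightarrow> complex"
    have "(\<Sum>s\<in>S. \<Sum>t\<in>S. cnj (\<xi> s) * B s t * \<xi> t) = (\<Sum>s\<in>S. \<Sum>t\<in>S. cnj (\<xi> s) * \<xi> t * B s t)"
      by (simp add: ac_simps)
    also have "\<dots> = (\<Sum>s\<in>S. \<Sum>t\<in>S. cnj (\<xi> s) * A s t * \<xi> t) + \<epsilon> * (\<Sum>s\<in>S. complex_of_real ((cmod (\<xi> s))\<^sup>2))"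
      unfolding B complex_norm_square by (simp add: ac_simps)
    finally show "\<epsilon> * (\<Sum>s\<in>S. (cmod (\<xi> s))\<^sup>2) \<le> Re (\<Sum>s\<in>S. \<Sum>t\<in>S. cnj (\<xi> s) * B s t * \<xi> t)"
      using pos[of \<xi>] by (simp flip: of_real_sum)
  qed
  also have "(\<Sum>s\<in>S. \<Sum>t\<in>S. B s t * ip H (w t) (w s)) =
      (\<Sum>s\<in>S. \<Sum>t\<in>S. A s t * ip H (w t) (w s)) + \<epsilon> * (\<Sum>s\<in>S. complex_of_real ((hnorm H (w s))\<^sup>2))"
    using B[of "\<lambda>s t. ip H (w t) (w s)"] w by (simp add: ip_self ac_simps)
  finally show "0 \<le> \<epsilon> * (\<Sum>s\<in>S. (hnorm H (w s))\<^sup>2) + Re (\<Sum>s\<in>S. \<Sum>t\<in>S. A s t * ip H (w t) (w s))"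
    by (simp flip: of_real_sum of_real_power add: add.commute)
qed

lemma sum_Times: "sum f (A \<times> B) = (\<Sum>a\<in>A. \<Sum>b\<in>B. f (a, b))"
  by (simp add: sum.cartesian_product)

lemma submodule_finsum:
  assumes "submodule R N M" "f \<in> I \<rightarrow> N"
  shows "finsum M f I \<in> N"
proof -
  interpret module R M
    using assms(1) by (simp add: submodule_def)
  show ?thesis
    using assms(2)
  proof (induction I rule: infinite_finite_induct)
    case (insert i I)
    then have "f i \<in> N" "finsum M f I \<in> N" "f \<in> I \<rightarrow> carrier M" "f i \<in> carrier M"
      using assms(1) by (auto simp: submodule_def)
    then show ?case
      using insert assms(1) by (simp add: submodule.m_closed)
  qed (use assms(1) in \<open>auto simp: submodule.zero_closed\<close>)
qed

text \<open>Sums and multiples of approximants approximate sums and multiples. The subspace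
  structure lets \<open>C_XA\<close> serve as the ambient space of the span in
  \<open>T_XA\<close>.\<close>

lemma (in hilbert_space) closed_span_submodule:
  assumes G: "G \<subseteq> bounded_ops H H"
  shows "submodule class_ring (closed_span H G) (op_space H H)" and "G \<subseteq> closed_span H G"
proof -
  interpret self: hilbert_pair H H by (rule self_pair)
  let ?span = "LinearCombinations.module.span class_ring (op_space H H) G"
  have span: "submodule class_ring ?span (op_space H H)"
    by (rule self.op.span_is_submodule) (use G in simp)
  then have span_bounded: "?span \<subseteq> bounded_ops H H"
    by (auto simp: submodule_def)
  have span_add: "S \<oplus>\<^bsub>op_space H H\<^esub> T \<in> ?span" if "S \<in> ?span" "T \<in> ?span" for S T
    using span that by (simp add: submodule.m_closed)
  have span_smult: "c \<odot>\<^bsub>op_space H H\<^esub> T \<in> ?span" if "T \<in> ?span" for c T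
    using span that by (simp add: submodule.smult_closed)
  have span_sub: "?span \<subseteq> closed_span H G"
  proof
    fix T assume T: "T \<in> ?span"
    then have "\<exists>S\<in>?span. opnorm H H (T \<ominus>\<^bsub>op_space H H\<^esub> S) < \<epsilon>" if "\<epsilon> > 0" for \<epsilon>
      using that self.opnorm_minus_self[of T] span_bounded by (intro bexI[of _ T]) auto
    then show "T \<in> closed_span H G"
      using T span_bounded by (auto simp: closed_span_def)
  qed
  moreover have "G \<subseteq> ?span"
    using self.op.in_own_span[of G] G by simp
  ultimately show "G \<subseteq> closed_span H G" by blast
  show "submodule class_ring (closed_span H G) (op_space H H)"
    unfolding submodule_def
  proof (intro conjI allI impI)
    show "module class_ring (op_space H H)"
      by (rule self.op_space_module)
    show "closed_span H G \<subseteq> carrier (op_space H H)"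
      by (auto simp: closed_span_def)
    show "\<zero>\<^bsub>op_space H H\<^esub> \<in> closed_span H G"
      using span span_sub by (auto simp: submodule_def)
  next
    fix T1 T2 assume "T1 \<in> closed_span H G" "T2 \<in> closed_span H G"
    then have T: "T1 \<in> bounded_ops H H" "T2 \<in> bounded_ops H H"
      and near: "\<And>\<epsilon>. \<epsilon> > 0 \<Longrightarrow> \<exists>S\<in>?span. opnorm H H (T1 \<ominus>\<^bsub>op_space H H\<^esub> S) < \<epsilon>"
        "\<And>\<epsilon>. \<epsilon> > 0 \<Longrightarrow> \<exists>S\<in>?span. opnorm H H (T2 \<ominus>\<^bsub>op_space H H\<^esub> S) < \<epsilon>"
      by (auto simp: closed_span_def)
    have "\<exists>S\<in>?span. opnorm H H ((T1 \<oplus>\<^bsub>op_space H H\<^esub> T2) \<ominus>\<^bsub>op_space H H\<^esub> S) < \<epsilon>" if "\<epsilon> > 0" for \<epsilon>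
    proof -
      obtain S1 S2 where S: "S1 \<in> ?span" "opnorm H H (T1 \<ominus>\<^bsub>op_space H H\<^esub> S1) < \<epsilon> / 2"
        "S2 \<in> ?span" "opnorm H H (T2 \<ominus>\<^bsub>op_space H H\<^esub> S2) < \<epsilon> / 2"
        using near[of "\<epsilon> / 2"] \<open>\<epsilon> > 0\<close> by auto
      have S_bounded: "S1 \<in> bounded_ops H H" "S2 \<in> bounded_ops H H"
        using S span_bounded by auto
      have "(T1 \<oplus>\<^bsub>op_space H H\<^esub> T2) \<ominus>\<^bsub>op_space H H\<^esub> (S1 \<oplus>\<^bsub>op_space H H\<^esub> S2) =
          (T1 \<ominus>\<^bsub>op_space H H\<^esub> S1) \<oplus>\<^bsub>op_space H H\<^esub> (T2 \<ominus>\<^bsub>op_space H H\<^esub> S2)"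
        using T S_bounded by (intro self.op_eqI) auto
      then have "opnorm H H ((T1 \<oplus>\<^bsub>op_space H H\<^esub> T2) \<ominus>\<^bsub>op_space H H\<^esub> (S1 \<oplus>\<^bsub>op_space H H\<^esub> S2)) < \<epsilon>"
        using self.opnorm_add_le[OF self.minus_op self.minus_op, OF T(1) S_bounded(1) T(2) S_bounded(2)] S
        by simp
      then show ?thesis
        using span_add[OF S(1,3)] by blast
    qed
    then show "T1 \<oplus>\<^bsub>op_space H H\<^esub> T2 \<in> closed_span H G"
      using T by (simp add: closed_span_def)
  next
    fix c T assume "T \<in> closed_span H G"
    then have T: "T \<in> bounded_ops H H"
      and near: "\<And>\<epsilon>. \<epsilon> > 0 \<Longrightarrow> \<exists>S\<in>?span. opnorm H H (T \<ominus>\<^bsub>op_space H H\<^esub> S) < \<epsilon>"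
      by (auto simp: closed_span_def)
    have "\<exists>S\<in>?span. opnorm H H ((c \<odot>\<^bsub>op_space H H\<^esub> T) \<ominus>\<^bsub>op_space H H\<^esub> S) < \<epsilon>" if "\<epsilon> > 0" for \<epsilon>
    proof -
      have pos: "0 < cmod c + 1"
        by (simp add: add_nonneg_pos)
      then obtain S where S: "S \<in> ?span" "opnorm H H (T \<ominus>\<^bsub>op_space H H\<^esub> S) < \<epsilon> / (cmod c + 1)"
        using near[of "\<epsilon> / (cmod c + 1)"] \<open>\<epsilon> > 0\<close> by auto
      have S_bounded: "S \<in> bounded_ops H H"
        using S span_bounded by auto
      have "(c \<odot>\<^bsub>op_space H H\<^esub> T) \<ominus>\<^bsub>op_space H H\<^esub> (c \<odot>\<^bsub>op_space H H\<^esub> S) = c \<odot>\<^bsub>op_space H H\<^esub> (T \<ominus>\<^bsub>op_space H H\<^esub> S)"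
        using T S_bounded by (intro self.op_eqI) (auto simp: algebra_simps)
      then have "opnorm H H ((c \<odot>\<^bsub>op_space H H\<^esub> T) \<ominus>\<^bsub>op_space H H\<^esub> (c \<odot>\<^bsub>op_space H H\<^esub> S)) \<le>
          cmod c * opnorm H H (T \<ominus>\<^bsub>op_space H H\<^esub> S)"
        using self.opnorm_smult_le[OF self.minus_op[OF T S_bounded]] by simp
      also have "\<dots> \<le> cmod c * (\<epsilon> / (cmod c + 1))"
        using S by (intro mult_left_mono) auto
      also have "\<dots> < \<epsilon>"
        using \<open>\<epsilon> > 0\<close> pos by (simp add: field_simps)
      finally show ?thesis
        using span_smult[OF S(1)] by blast
    qed
    then show "c \<odot>\<^bsub>op_space H H\<^esub> T \<in> closed_span H G"
      using T by (simp add: closed_span_def)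
  qed
qed

locale operator_family = hilbert_pair H K
  for H :: "('h, 'm) hilbert_scheme" and K :: "('k, 'n) hilbert_scheme" +
  fixes v :: "'i::finite \<Rightarrow> 'h \<Rightarrow> 'k"
  assumes v_bounded: "v p \<in> bounded_ops H K"
begin

interpretation HH: hilbert_pair H H ..

definition gram :: "'i \<Rightarrow> 'i \<Rightarrow> 'h \<Rightarrow> 'h" where
  "gram p q = compose (carrier H) (adj H K (v p)) (v q)"

lemma gram_bounded: "gram p q \<in> bounded_ops H H"
  unfolding gram_def
  by (rule compose_op(1)[OF dom.hilbert_space_axioms cod.hilbert_space_axioms dom.hilbert_space_axioms
      adj_bounded[OF v_bounded] v_bounded])

lemma ip_gram:
  "\<lbrakk>\<xi> \<in> carrier H; \<eta> \<in> carrier H\<rbrakk> \<Longrightarrow> ip H (gram p q \<xi>) \<eta> = ip K (v q \<xi>) (v p \<eta>)"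
  using v_bounded by (simp add: gram_def compose_def ip_adj_left)

definition gram_sum :: "complex ^ 'i ^ 'i \<Rightarrow> 'h \<Rightarrow> 'h" where
  "gram_sum \<mu> = (\<Oplus>\<^bsub>op_space H H\<^esub> p\<in>UNIV. \<Oplus>\<^bsub>op_space H H\<^esub> q\<in>UNIV. \<mu> $ p $ q \<odot>\<^bsub>op_space H H\<^esub> gram p q)"

lemma gram_sum_inner_bounded:
  "(\<Oplus>\<^bsub>op_space H H\<^esub> q\<in>UNIV. \<mu> $ p $ q \<odot>\<^bsub>op_space H H\<^esub> gram p q) \<in> bounded_ops H H"
  using HH.op.finsum_closed[of "\<lambda>q. \<mu> $ p $ q \<odot>\<^bsub>op_space H H\<^esub> gram p q" UNIV] gram_bounded by auto

lemma gram_sum_bounded: "gram_sum \<mu> \<in> bounded_ops H H"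
  unfolding gram_sum_def
  using HH.op.finsum_closed[of "\<lambda>p. \<Oplus>\<^bsub>op_space H H\<^esub> q\<in>UNIV. \<mu> $ p $ q \<odot>\<^bsub>op_space H H\<^esub> gram p q" UNIV]
    gram_sum_inner_bounded by auto

lemma ip_gram_sum:
  assumes \<xi>: "\<xi> \<in> carrier H" and \<eta>: "\<eta> \<in> carrier H"
  shows "ip H (gram_sum \<mu> \<xi>) \<eta> = (\<Sum>p\<in>UNIV. \<Sum>q\<in>UNIV. \<mu> $ p $ q * ip K (v q \<xi>) (v p \<eta>))"
proof -
  have inner: "ip H ((\<Oplus>\<^bsub>op_space H H\<^esub> q\<in>UNIV. \<mu> $ p $ q \<odot>\<^bsub>op_space H H\<^esub> gram p q) \<xi>) \<eta> =
      (\<Sum>q\<in>UNIV. \<mu> $ p $ q * ip K (v q \<xi>) (v p \<eta>))" for p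
    using gram_bounded \<xi> \<eta> by (simp add: HH.op_space_finsum_apply ip_gram)
  show ?thesis
    unfolding gram_sum_def
    using gram_sum_inner_bounded HH.op_closed[OF gram_sum_inner_bounded \<xi>] \<xi> \<eta>
    by (simp add: HH.op_space_finsum_apply inner)
qed

lemma gram_sum_add: "gram_sum (\<mu> + \<nu>) = gram_sum \<mu> \<oplus>\<^bsub>op_space H H\<^esub> gram_sum \<nu>"
  by (intro HH.op_eqI)
    (auto simp: gram_sum_bounded ip_gram_sum distrib_right sum.distrib)

lemma gram_sum_smult: "gram_sum (\<chi> p q. c * \<mu> $ p $ q) = c \<odot>\<^bsub>op_space H H\<^esub> gram_sum \<mu>"
  by (intro HH.op_eqI)
    (auto simp: gram_sum_bounded ip_gram_sum sum_distrib_left mult.assoc)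

lemma gram_sum_zero: "gram_sum 0 = \<zero>\<^bsub>op_space H H\<^esub>"
  by (intro HH.op_eqI) (auto simp: gram_sum_bounded ip_gram_sum)

lemma gram_sum_adj: "adj H H (gram_sum \<mu>) = gram_sum (\<chi> p q. cnj (\<mu> $ q $ p))"
proof (rule HH.adj_eqI)
  fix \<xi> \<eta> assume \<xi>: "\<xi> \<in> carrier H" and \<eta>: "\<eta> \<in> carrier H"
  have "ip H \<xi> (gram_sum (\<chi> p q. cnj (\<mu> $ q $ p)) \<eta>) = cnj (ip H (gram_sum (\<chi> p q. cnj (\<mu> $ q $ p)) \<eta>) \<xi>)"
    using \<xi> \<eta> gram_sum_bounded by (intro dom.ip_cnj) auto
  also have "\<dots> = (\<Sum>p\<in>UNIV. \<Sum>q\<in>UNIV. \<mu> $ q $ p * ip K (v p \<xi>) (v q \<eta>))"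
    using \<xi> \<eta> v_bounded by (simp add: ip_gram_sum cod.ip_cnj[of "v p \<xi>" "v q \<eta>" for p q])
  also have "\<dots> = ip H (gram_sum \<mu> \<xi>) \<eta>"
    by (subst sum.swap) (simp add: ip_gram_sum \<xi> \<eta>)
  finally show "ip H (gram_sum \<mu> \<xi>) \<eta> = ip H \<xi> (gram_sum (\<chi> p q. cnj (\<mu> $ q $ p)) \<eta>)" ..
qed (auto simp: gram_sum_bounded)

lemma gram_eq_gram_sum: "gram p q = gram_sum (\<chi> p' q'. if p' = p then if q' = q then 1 else 0 else 0)"
proof (rule HH.op_eqI[OF gram_bounded gram_sum_bounded])
  fix \<xi> \<eta> assume *: "\<xi> \<in> carrier H" "\<eta> \<in> carrier H"
  have "(\<Sum>p'\<in>UNIV. \<Sum>q'\<in>UNIV. (if p' = p then if q' = q then 1 else 0 else 0) * ip K (v q' \<xi>) (v p' \<eta>)) =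
      (\<Sum>p'\<in>UNIV. if p' = p then \<Sum>q'\<in>UNIV. if q' = q then ip K (v q \<xi>) (v p \<eta>) else 0 else 0)"
    by (intro sum.cong) (auto simp: if_distrib[of "\<lambda>z. z * _"] cong: if_cong)
  then show "ip H (gram p q \<xi>) \<eta> = ip H (gram_sum (\<chi> p' q'. if p' = p then if q' = q then 1 else 0 else 0) \<xi>) \<eta>"
    using * by (simp add: ip_gram ip_gram_sum)
qed

lemma range_gram_sum_submodule: "submodule class_ring (range gram_sum) (op_space H H)"
  unfolding submodule_def
proof (intro conjI allI impI)
  show "module class_ring (op_space H H)"
    by (rule HH.op_space_module)
  show "range gram_sum \<subseteq> carrier (op_space H H)"
    using gram_sum_bounded by auto
  show "\<zero>\<^bsub>op_space H H\<^esub> \<in> range gram_sum"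
    unfolding gram_sum_zero[symmetric] by (rule rangeI)
  show "S \<oplus>\<^bsub>op_space H H\<^esub> T \<in> range gram_sum" if "S \<in> range gram_sum" "T \<in> range gram_sum" for S T
  proof -
    from that obtain \<mu> \<nu> where "S = gram_sum \<mu>" "T = gram_sum \<nu>" by auto
    then have "S \<oplus>\<^bsub>op_space H H\<^esub> T = gram_sum (\<mu> + \<nu>)"
      by (simp only: gram_sum_add)
    then show ?thesis by (rule range_eqI)
  qed
  show "c \<odot>\<^bsub>op_space H H\<^esub> T \<in> range gram_sum" if "T \<in> range gram_sum" for c T
  proof -
    from that obtain \<mu> where "T = gram_sum \<mu>" by auto
    then have "c \<odot>\<^bsub>op_space H H\<^esub> T = gram_sum (\<chi> p q. c * \<mu> $ p $ q)"
      by (simp only: gram_sum_smult)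
    then show ?thesis by (rule range_eqI)
  qed
qed

text \<open>The record \<open>C\<close> is arbitrary because \<open>T_XA\<close> takes its span
  inside \<open>C_XA\<close>. Linear combinations formed there agree with those among all bounded
  operators, and a combination of the generators collects into one coefficient matrix.\<close>

lemma span_gram:
  assumes C: "module class_ring C" "carrier C \<subseteq> bounded_ops H H"
    and ops: "add C = add (op_space H H)" "\<zero>\<^bsub>C\<^esub> = \<zero>\<^bsub>op_space H H\<^esub>" "smult C = smult (op_space H H)"
    and gens: "\<And>p q. gram p q \<in> carrier C"
  shows "LinearCombinations.module.span class_ring C {gram p q | p q. True} = range gram_sum"
proof
  interpret C: module class_ring C by fact
  let ?E = "{gram p q | p q. True}"
  have E: "?E \<subseteq> carrier C"
    using gens by auto
  show "C.span ?E \<subseteq> range gram_sum"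
  proof
    fix T assume "T \<in> C.span ?E"
    then obtain c F where F: "F \<subseteq> ?E" and T: "T = finsum C (\<lambda>w. c w \<odot>\<^bsub>C\<^esub> w) F"
      by (auto simp: C.span_def C.lincomb_def)
    have "T = finsum (op_space H H) (\<lambda>w. c w \<odot>\<^bsub>C\<^esub> w) F"
      unfolding T using F E C(2) ops
      by (intro HH.op.finsum_subset_carrier[OF C(1)] Pi_I C.smult_closed) auto
    also have "\<dots> \<in> range gram_sum"
    proof (intro submodule_finsum[OF range_gram_sum_submodule] Pi_I)
      fix w assume "w \<in> F"
      then have "w \<in> range gram_sum"
        using F by (auto simp: gram_eq_gram_sum)
      then show "c w \<odot>\<^bsub>C\<^esub> w \<in> range gram_sum"
        unfolding ops by (intro submodule.smult_closed[OF range_gram_sum_submodule]) auto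
    qed
    finally show "T \<in> range gram_sum" .
  qed
  have sub: "submodule class_ring (C.span ?E) C"
    by (rule C.span_is_submodule[OF E])
  have sub': "submodule class_ring (C.span ?E) (op_space H H)"
    using sub C(2) HH.op_space_module by (auto simp: submodule_def ops)
  have "gram p q \<in> C.span ?E" for p q
    using C.in_own_span[OF E] by blast
  then have "gram_sum \<mu> \<in> C.span ?E" for \<mu>
    unfolding gram_sum_def
    by (intro submodule_finsum[OF sub'] Pi_I submodule.smult_closed[OF sub']) simp_all
  then show "range gram_sum \<subseteq> C.span ?E"
    by (rule image_subsetI)
qed

text \<open>Positivity of the image of \<open>A\<close> thus concerns the pairing of a scalar
  matrix, indexed by \<open>{..<n} \<times> UNIV\<close>, with the Gram matrix of the vectors
  \<open>v p (\<xi> i)\<close>.\<close>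

lemma op_form_gram_sum:
  assumes \<xi>: "\<forall>i<n. \<xi> i \<in> carrier H" and A: "A \<in> carrier_mat n n"
  shows "dom.op_form n (map_mat gram_sum A) \<xi> \<xi> =
    (\<Sum>s\<in>{..<n} \<times> UNIV. \<Sum>t\<in>{..<n} \<times> UNIV.
      (A $$ (fst s, fst t)) $ snd s $ snd t * ip K (v (snd t) (\<xi> (fst t))) (v (snd s) (\<xi> (fst s))))"
proof -
  have "dom.op_form n (map_mat gram_sum A) \<xi> \<xi> = (\<Sum>i<n. \<Sum>j<n. \<Sum>p\<in>UNIV. \<Sum>q\<in>UNIV.
      (A $$ (i, j)) $ p $ q * ip K (v q (\<xi> j)) (v p (\<xi> i)))"
    unfolding dom.op_form_def using \<xi> A by (auto simp: ip_gram_sum intro!: sum.cong)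
  also have "\<dots> = (\<Sum>i<n. \<Sum>p\<in>UNIV. \<Sum>j<n. \<Sum>q\<in>UNIV.
      (A $$ (i, j)) $ p $ q * ip K (v q (\<xi> j)) (v p (\<xi> i)))"
    by (intro sum.cong HOL.refl sum.swap)
  finally show ?thesis
    unfolding sum_Times by simp
qed

end

section \<open>Finite-dimensional duality for the positive semidefinite cone plus a subspace\<close>

section \<open>Separating a Hermitian matrix from a cone\<close>

definition hermitian_on :: "'s set \<Rightarrow> ('s \<Rightarrow> 's \<Rightarrow> complex) \<Rightarrow> bool" where
  "hermitian_on S p \<longleftrightarrow> (\<forall>s\<in>S. \<forall>t\<in>S. cnj (p s t) = p t s)"

text \<open>Only the real part is constrained, which leaves Hermitian symmetry as a separate
  condition; together they make the form nonnegative as a complex number.\<close>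

definition psd_on :: "'s set \<Rightarrow> ('s \<Rightarrow> 's \<Rightarrow> complex) \<Rightarrow> bool" where
  "psd_on S p \<longleftrightarrow> (\<forall>\<xi>. 0 \<le> Re (\<Sum>s\<in>S. \<Sum>t\<in>S. cnj (\<xi> s) * p s t * \<xi> t))"

text \<open>A negative \<open>x\<close> would have a multiple below \<open>m\<close>, for instance
  with k = (|m| + 1) / (-x). The rule is meant for functionals that are bounded below on a
  cone.\<close>

lemma nonneg_if_unbounded_multiples:
  fixes x m :: real
  assumes "\<And>k. 0 \<le> k \<Longrightarrow> m \<le> k * x"
  shows "0 \<le> x"
proof (rule ccontr)
  assume "\<not> 0 \<le> x"
  then have "m \<le> (\<bar>m\<bar> + 1) / (- x) * x"
    by (intro assms) (auto intro!: divide_nonneg_neg simp: divide_nonneg_pos)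
  also have "\<dots> = - (\<bar>m\<bar> + 1)"
    using \<open>\<not> 0 \<le> x\<close> by (simp add: field_simps)
  finally show False by linarith
qed

text \<open>If \<open>a + r\<close> lies outside the cone spanned by the positive matrices and the Hermitian parts of \<open>J\<close>,
  then \<open>a\<close> has positive distance to that cone. The functional is the difference between \<open>a\<close> and its nearest
  point in the closure of the cone.\<close>

lemma separating_functional:
  fixes S :: "'s set" and a :: "'s \<Rightarrow> 's \<Rightarrow> complex"
  assumes S: "finite S" and a: "hermitian_on S a" and "0 < r"
    and J0: "(\<lambda>_ _. 0) \<in> J"
    and J_add: "\<And>b c. \<lbrakk>b \<in> J; c \<in> J\<rbrakk> \<Longrightarrow> (\<lambda>s t. b s t + c s t) \<in> J"
    and J_scale: "\<And>k b. b \<in> J \<Longrightarrow> (\<lambda>s t. k * b s t) \<in> J"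
    and not_psd: "\<And>b. b \<in> J \<Longrightarrow>
      \<not> psd_on S (\<lambda>s t. a s t + (if s = t then complex_of_real r else 0) + (b s t + cnj (b t s)))"
  obtains Q where "hermitian_on S Q" "psd_on S Q"
    "\<And>b. b \<in> J \<Longrightarrow> (\<Sum>s\<in>S. \<Sum>t\<in>S. b s t * Q s t) = 0"
    "Re (\<Sum>s\<in>S. \<Sum>t\<in>S. a s t * Q s t) < 0"
proof -
  \<comment> \<open>The square matrices over \<open>S\<close> with the Hilbert-Schmidt inner
    product, obtained from the identity as Gram matrix.\<close>
  define E where "E = kernel_hilbert (S \<times> S) (\<lambda>u v. if u = v then 1 else 0 :: complex)"
  have diag: "(\<Sum>u\<in>S\<times>S. \<Sum>v\<in>S\<times>S. (if u = v then 1 else 0) * \<xi> v * cnj (\<eta> u)) = (\<Sum>u\<in>S\<times>S. \<xi> u * cnj (\<eta> u))"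
    for \<xi> \<eta> :: "'s \<times> 's \<Rightarrow> complex"
  proof (intro sum.cong HOL.refl)
    fix u assume "u \<in> S \<times> S"
    have "(\<Sum>v\<in>S\<times>S. (if u = v then 1 else 0) * \<xi> v * cnj (\<eta> u)) = (\<Sum>v\<in>S\<times>S. if u = v then \<xi> u * cnj (\<eta> u) else 0)"
      by (intro sum.cong) auto
    then show "(\<Sum>v\<in>S\<times>S. (if u = v then 1 else 0) * \<xi> v * cnj (\<eta> u)) = \<xi> u * cnj (\<eta> u)"
      using S \<open>u \<in> S \<times> S\<close> by simp
  qed
  interpret E: hilbert_space E
    unfolding E_def
  proof (rule kernel_hilbert[where \<epsilon> = 1])
    fix \<xi> :: "'s \<times> 's \<Rightarrow> complex"
    have "(\<Sum>u\<in>S\<times>S. \<xi> u * cnj (\<xi> u)) = complex_of_real (\<Sum>u\<in>S\<times>S. (cmod (\<xi> u))\<^sup>2)"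
      by (simp only: of_real_sum complex_norm_square)
    then show "1 * (\<Sum>u\<in>S\<times>S. (cmod (\<xi> u))\<^sup>2) \<le>
        Re (\<Sum>u\<in>S\<times>S. \<Sum>v\<in>S\<times>S. (if u = v then 1 else 0) * \<xi> v * cnj (\<xi> u))"
      unfolding diag by simp
  qed (use S in auto)
  define vec where "vec p = (\<lambda>(s, t). if s \<in> S \<and> t \<in> S then p s t else 0)" for p :: "'s \<Rightarrow> 's \<Rightarrow> complex"
  have vec [simp]: "vec p \<in> carrier E" for p
    by (auto simp: E_def kernel_hilbert_simps vec_def)
  have ip_vec: "ip E (vec p) \<rho> = (\<Sum>s\<in>S. \<Sum>t\<in>S. p s t * cnj (\<rho> (s, t)))" for p \<rho>
    unfolding E_def kernel_hilbert_simps diag unfolding sum_Times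
    by (intro sum.cong) (auto simp: vec_def)
  \<comment> \<open>The cone is translated by the negative of \<open>a\<close>, so that distance
    from \<open>a\<close> becomes the norm and \<open>minimizing_sequence\<close> finds the nearest
    point.\<close>
  define D where "D = {vec (\<lambda>s t. p s t + (b s t + cnj (b t s)) - a s t) | p b.
    hermitian_on S p \<and> psd_on S p \<and> b \<in> J}"
  have D_I: "vec (\<lambda>s t. p s t + (b s t + cnj (b t s)) - a s t) \<in> D"
    if "hermitian_on S p" "psd_on S p" "b \<in> J" for p b
    using that unfolding D_def by blast
  have scale_psd: "psd_on S (\<lambda>s t. complex_of_real k * p s t)" if "psd_on S p" "0 \<le> k" for p k
  proof -
    have "(\<Sum>s\<in>S. \<Sum>t\<in>S. cnj (\<xi> s) * (complex_of_real k * p s t) * \<xi> t) =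
        complex_of_real k * (\<Sum>s\<in>S. \<Sum>t\<in>S. cnj (\<xi> s) * p s t * \<xi> t)" for \<xi>
      by (simp add: sum_distrib_left ac_simps)
    then show ?thesis
      using that by (simp add: psd_on_def)
  qed
  have add_psd: "psd_on S (\<lambda>s t. p s t + q s t)" if "psd_on S p" "psd_on S q" for p q
    using that by (simp add: psd_on_def distrib_left distrib_right sum.distrib)
  have zero_psd: "hermitian_on S (\<lambda>_ _. 0)" "psd_on S (\<lambda>_ _. 0)"
    by (auto simp: hermitian_on_def psd_on_def)
  have "\<exists>s \<rho>. (\<forall>n. s n \<in> D) \<and> \<rho> \<in> carrier E \<and> (\<lambda>n. hnorm E (s n \<ominus>\<^bsub>E\<^esub> \<rho>)) \<longlonglongrightarrow> 0 \<and>
    (\<forall>\<eta>\<in>D. (hnorm E \<rho>)\<^sup>2 \<le> Re (ip E \<eta> \<rho>))"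
  proof (rule E.minimizing_sequence)
    show "D \<subseteq> carrier E"
      by (auto simp: D_def)
    show "D \<noteq> {}"
      using D_I[OF zero_psd J0] by blast
    fix \<xi> \<eta> and k :: real assume "\<xi> \<in> D" "\<eta> \<in> D" and k: "0 \<le> k" "k \<le> 1"
    then obtain p b q c where p: "hermitian_on S p" "psd_on S p" "b \<in> J"
      and \<xi>: "\<xi> = vec (\<lambda>s t. p s t + (b s t + cnj (b t s)) - a s t)"
      and q: "hermitian_on S q" "psd_on S q" "c \<in> J"
      and \<eta>: "\<eta> = vec (\<lambda>s t. q s t + (c s t + cnj (c t s)) - a s t)"
      by (auto simp: D_def)
    define p' where "p' s t = complex_of_real (1 - k) * p s t + complex_of_real k * q s t" for s t
    define b' where "b' s t = complex_of_real (1 - k) * b s t + complex_of_real k * c s t" for s t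
    have "hermitian_on S p'"
      using p q unfolding hermitian_on_def p'_def by auto
    moreover have "psd_on S p'"
      unfolding p'_def using p q k by (intro add_psd scale_psd) auto
    moreover have "b' \<in> J"
      unfolding b'_def using p q by (intro J_add J_scale)
    ultimately have "vec (\<lambda>s t. p' s t + (b' s t + cnj (b' t s)) - a s t) \<in> D"
      by (rule D_I)
    also have "vec (\<lambda>s t. p' s t + (b' s t + cnj (b' t s)) - a s t) =
        complex_of_real (1 - k) \<odot>\<^bsub>E\<^esub> \<xi> \<oplus>\<^bsub>E\<^esub> complex_of_real k \<odot>\<^bsub>E\<^esub> \<eta>"
      by (auto simp: \<xi> \<eta> E_def kernel_hilbert_simps vec_def p'_def b'_def fun_eq_iff algebra_simps)
    finally show "complex_of_real (1 - k) \<odot>\<^bsub>E\<^esub> \<xi> \<oplus>\<^bsub>E\<^esub> complex_of_real k \<odot>\<^bsub>E\<^esub> \<eta> \<in> D" .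
  qed
  then obtain s \<rho> where s: "\<And>n. s n \<in> D" and \<rho>: "\<rho> \<in> carrier E"
    and lim: "(\<lambda>n. hnorm E (s n \<ominus>\<^bsub>E\<^esub> \<rho>)) \<longlonglongrightarrow> 0"
    and min: "\<And>\<eta>. \<eta> \<in> D \<Longrightarrow> (hnorm E \<rho>)\<^sup>2 \<le> Re (ip E \<eta> \<rho>)"
    by blast
  have D_norm: "r \<le> hnorm E d" if d: "d \<in> D" for d
  proof (rule ccontr)
    assume "\<not> r \<le> hnorm E d"
    obtain p b where p: "psd_on S p" "b \<in> J" and d_eq: "d = vec (\<lambda>s t. p s t + (b s t + cnj (b t s)) - a s t)"
      using d by (auto simp: D_def)
    define e where "e s t = p s t + (b s t + cnj (b t s)) - a s t" for s t
    \<comment> \<open>A Hilbert-Schmidt norm below \<open>r\<close> bounds the form of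
      \<open>e\<close> by \<open>r\<close> times the squared length, so p + r - e is positive
      semidefinite. This matrix is a + r minus the Hermitian element b + b^*, which
      \<open>not_psd\<close> excludes.\<close>
    have "psd_on S (\<lambda>s t. a s t + (if s = t then complex_of_real r else 0) + (- 1 * b s t + cnj (- 1 * b t s)))"
      unfolding psd_on_def
    proof
      fix \<xi> :: "'s \<Rightarrow> complex"
      define x where "x = (\<Sum>s\<in>S. (cmod (\<xi> s))\<^sup>2)"
      have "0 \<le> x"
        unfolding x_def by (rule sum_nonneg) simp
      have "(hnorm E (vec (\<lambda>s t. \<xi> s * cnj (\<xi> t))))\<^sup>2 = x\<^sup>2"
      proof -
        have "ip E (vec (\<lambda>s t. \<xi> s * cnj (\<xi> t))) (vec (\<lambda>s t. \<xi> s * cnj (\<xi> t))) =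
            (\<Sum>s\<in>S. \<Sum>t\<in>S. (\<xi> s * cnj (\<xi> s)) * (\<xi> t * cnj (\<xi> t)))"
          unfolding ip_vec by (intro sum.cong) (auto simp: vec_def)
        also have "\<dots> = complex_of_real (x\<^sup>2)"
          unfolding sum_product[symmetric] complex_norm_square[symmetric] x_def
          by (simp add: power2_eq_square)
        finally show ?thesis
          by (simp add: E.hnorm_sq)
      qed
      then have norm_\<xi>: "hnorm E (vec (\<lambda>s t. \<xi> s * cnj (\<xi> t))) = x"
        using \<open>0 \<le> x\<close> by (simp add: power2_eq_iff_nonneg)
      have "(\<Sum>s\<in>S. \<Sum>t\<in>S. cnj (\<xi> s) * e s t * \<xi> t) = ip E d (vec (\<lambda>s t. \<xi> s * cnj (\<xi> t)))"
        unfolding d_eq ip_vec by (intro sum.cong) (auto simp: vec_def e_def)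
      then have "Re (\<Sum>s\<in>S. \<Sum>t\<in>S. cnj (\<xi> s) * e s t * \<xi> t) \<le>
          cmod (ip E d (vec (\<lambda>s t. \<xi> s * cnj (\<xi> t))))"
        by (simp only: complex_Re_le_cmod)
      also have "cmod (ip E d (vec (\<lambda>s t. \<xi> s * cnj (\<xi> t)))) \<le> hnorm E d * x"
        using E.cauchy_schwarz[of d "vec (\<lambda>s t. \<xi> s * cnj (\<xi> t))"] norm_\<xi> by (simp add: d_eq)
      also have "hnorm E d * x \<le> r * x"
        using \<open>\<not> r \<le> hnorm E d\<close> \<open>0 \<le> x\<close> by (intro mult_right_mono) auto
      finally have e_le: "Re (\<Sum>s\<in>S. \<Sum>t\<in>S. cnj (\<xi> s) * e s t * \<xi> t) \<le> r * x" .
      have diag_r: "(\<Sum>s\<in>S. \<Sum>t\<in>S. cnj (\<xi> s) * (if s = t then complex_of_real r else 0) * \<xi> t) = complex_of_real (r * x)"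
      proof -
        have "(\<Sum>s\<in>S. \<Sum>t\<in>S. cnj (\<xi> s) * (if s = t then complex_of_real r else 0) * \<xi> t) =
            (\<Sum>s\<in>S. \<Sum>t\<in>S. if s = t then complex_of_real r * (\<xi> s * cnj (\<xi> s)) else 0)"
          by (intro sum.cong) auto
        also have "\<dots> = (\<Sum>s\<in>S. complex_of_real r * (\<xi> s * cnj (\<xi> s)))"
          using S by simp
        finally show ?thesis
          unfolding complex_norm_square[symmetric] x_def by (simp add: sum_distrib_left)
      qed
      have "(\<Sum>s\<in>S. \<Sum>t\<in>S. cnj (\<xi> s) * (a s t + (if s = t then complex_of_real r else 0) +
          (- 1 * b s t + cnj (- 1 * b t s))) * \<xi> t) =
          (\<Sum>s\<in>S. \<Sum>t\<in>S. cnj (\<xi> s) * p s t * \<xi> t) + complex_of_real (r * x) - (\<Sum>s\<in>S. \<Sum>t\<in>S. cnj (\<xi> s) * e s t * \<xi> t)"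
        unfolding diag_r[symmetric] sum.distrib[symmetric] sum_subtractf[symmetric]
        by (intro sum.cong HOL.refl) (simp add: e_def algebra_simps)
      moreover have "0 \<le> Re (\<Sum>s\<in>S. \<Sum>t\<in>S. cnj (\<xi> s) * p s t * \<xi> t)"
        using p by (simp add: psd_on_def)
      ultimately show "0 \<le> Re (\<Sum>s\<in>S. \<Sum>t\<in>S. cnj (\<xi> s) * (a s t + (if s = t then complex_of_real r else 0) +
          (- 1 * b s t + cnj (- 1 * b t s))) * \<xi> t)"
        using e_le by simp
    qed
    then show False
      using not_psd[OF J_scale[OF p(2), of "- 1"]] by blast
  qed
  have s_carrier: "s n \<in> carrier E" for n
    using s[of n] by (auto simp: D_def)
  have "r \<le> hnorm E \<rho>"
    by (rule LIMSEQ_le_const[OF E.hnorm_tendsto[OF s_carrier \<rho> lim]]) (use D_norm s in auto)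
  define m where "m = (hnorm E \<rho>)\<^sup>2"
  have "0 < m"
    using \<open>r \<le> hnorm E \<rho>\<close> \<open>0 < r\<close> by (simp add: m_def)
  define f where "f y = (\<Sum>s\<in>S. \<Sum>t\<in>S. y s t * cnj (\<rho> (s, t)))" for y
  have f_add: "f (\<lambda>s t. y s t + z s t) = f y + f z" for y z
    by (simp add: f_def distrib_right sum.distrib)
  have f_scale: "f (\<lambda>s t. k * y s t) = k * f y" for k y
    by (simp add: f_def sum_distrib_left mult.assoc)
  have ge: "m + Re (f a) \<le> Re (f p) + Re (f (\<lambda>s t. b s t + cnj (b t s)))"
    if "hermitian_on S p" "psd_on S p" "b \<in> J" for p b
  proof -
    have "m \<le> Re (ip E (vec (\<lambda>s t. p s t + (b s t + cnj (b t s)) - a s t)) \<rho>)"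
      unfolding m_def by (rule min[OF D_I[OF that]])
    also have "ip E (vec (\<lambda>s t. p s t + (b s t + cnj (b t s)) - a s t)) \<rho> =
        f p + f (\<lambda>s t. b s t + cnj (b t s)) - f a"
      unfolding ip_vec f_def sum.distrib[symmetric] sum_subtractf[symmetric]
      by (intro sum.cong HOL.refl) (simp add: algebra_simps)
    finally show ?thesis by simp
  qed
  have f_zero: "f (\<lambda>_ _. 0) = 0"
    by (simp add: f_def)
  have f_a: "Re (f a) \<le> - m"
    using ge[OF zero_psd J0] by (simp add: f_zero)
  \<comment> \<open>All multiples of \<open>p\<close> belong to the cone while the lower bound stays
    fixed, which leaves no room for a negative value.\<close>
  have f_psd: "0 \<le> Re (f p)" if p: "hermitian_on S p" "psd_on S p" for p
  proof (rule nonneg_if_unbounded_multiples)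
    fix k :: real assume "0 \<le> k"
    have "hermitian_on S (\<lambda>s t. complex_of_real k * p s t)"
      using p by (simp add: hermitian_on_def)
    from ge[OF this scale_psd[OF p(2) \<open>0 \<le> k\<close>] J0] show "m + Re (f a) \<le> k * Re (f p)"
      by (simp add: f_zero f_scale)
  qed
  have f_J: "Re (f (\<lambda>s t. b s t + cnj (b t s))) = 0" if b: "b \<in> J" for b
  proof -
    have scaled: "f (\<lambda>s t. complex_of_real k * b s t + cnj (complex_of_real k * b t s)) =
        complex_of_real k * f (\<lambda>s t. b s t + cnj (b t s))" for k
      unfolding f_scale[symmetric] by (simp add: distrib_left)
    have *: "m + Re (f a) \<le> k * Re (f (\<lambda>s t. b s t + cnj (b t s)))" for k
      using ge[OF zero_psd J_scale[OF b, of "complex_of_real k"]] unfolding scaled by (simp add: f_zero)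
    have "0 \<le> Re (f (\<lambda>s t. b s t + cnj (b t s)))"
      by (rule nonneg_if_unbounded_multiples[OF *])
    moreover have "0 \<le> - Re (f (\<lambda>s t. b s t + cnj (b t s)))"
      by (rule nonneg_if_unbounded_multiples[of "m + Re (f a)"]) (use *[of "- k" for k] in simp)
    ultimately show ?thesis by simp
  qed
  \<comment> \<open>On Hermitian matrices only the real part of the functional matters. Replacing
    the conjugate of \<rho> by its Hermitian part preserves that value and makes \<open>Q\<close>
    Hermitian.\<close>
  define Q where "Q s t = (cnj (\<rho> (s, t)) + \<rho> (t, s)) / 2" for s t
  have Q_eq: "(\<Sum>s\<in>S. \<Sum>t\<in>S. y s t * Q s t) = (f y + cnj (f (\<lambda>s t. cnj (y t s)))) / 2" for y
  proof -
    have "cnj (f (\<lambda>s t. cnj (y t s))) = (\<Sum>s\<in>S. \<Sum>t\<in>S. y s t * \<rho> (t, s))"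
      unfolding f_def by (subst sum.swap) simp
    moreover have "(\<Sum>s\<in>S. \<Sum>t\<in>S. y s t * Q s t) =
        (\<Sum>s\<in>S. \<Sum>t\<in>S. (y s t * cnj (\<rho> (s, t)) + y s t * \<rho> (t, s)) / 2)"
      by (simp add: Q_def distrib_left)
    moreover have "\<dots> = (f y + (\<Sum>s\<in>S. \<Sum>t\<in>S. y s t * \<rho> (t, s))) / 2"
      unfolding f_def by (simp only: sum_divide_distrib[symmetric] sum.distrib)
    ultimately show ?thesis
      by (simp only:)
  qed
  have Q_herm: "Re (\<Sum>s\<in>S. \<Sum>t\<in>S. y s t * Q s t) = Re (f y)" if "hermitian_on S y" for y
  proof -
    have "f (\<lambda>s t. cnj (y t s)) = f y"
      unfolding f_def using that by (intro sum.cong) (auto simp: hermitian_on_def)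
    then show ?thesis
      by (simp add: Q_eq)
  qed
  show thesis
  proof (rule that)
    show "hermitian_on S Q"
      by (simp add: hermitian_on_def Q_def add.commute)
    show "psd_on S Q"
      unfolding psd_on_def
    proof
      fix \<xi> :: "'s \<Rightarrow> complex"
      \<comment> \<open>Rank one matrices are positive semidefinite, and on them the functional
        gives the quadratic form of \<open>Q\<close>.\<close>
      define y where "y s t = cnj (\<xi> s) * \<xi> t" for s t
      have herm: "hermitian_on S y"
        by (simp add: hermitian_on_def y_def)
      have "psd_on S y"
        unfolding psd_on_def
      proof
        fix \<eta> :: "'s \<Rightarrow> complex"
        define z where "z = (\<Sum>s\<in>S. \<xi> s * \<eta> s)"
        have "(\<Sum>s\<in>S. \<Sum>t\<in>S. cnj (\<eta> s) * y s t * \<eta> t) = cnj z * z"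
          unfolding z_def cnj_sum sum_product by (simp add: y_def ac_simps)
        then show "0 \<le> Re (\<Sum>s\<in>S. \<Sum>t\<in>S. cnj (\<eta> s) * y s t * \<eta> t)"
          by simp
      qed
      from f_psd[OF herm this] have "0 \<le> Re (\<Sum>s\<in>S. \<Sum>t\<in>S. y s t * Q s t)"
        by (simp only: Q_herm[OF herm])
      also have "(\<Sum>s\<in>S. \<Sum>t\<in>S. y s t * Q s t) = (\<Sum>s\<in>S. \<Sum>t\<in>S. cnj (\<xi> s) * Q s t * \<xi> t)"
        by (simp add: y_def ac_simps)
      finally show "0 \<le> Re (\<Sum>s\<in>S. \<Sum>t\<in>S. cnj (\<xi> s) * Q s t * \<xi> t)" .
    qed
    show "Re (\<Sum>s\<in>S. \<Sum>t\<in>S. a s t * Q s t) < 0"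
      unfolding Q_herm[OF a] using f_a \<open>0 < m\<close> by simp
    show "(\<Sum>s\<in>S. \<Sum>t\<in>S. b s t * Q s t) = 0" if b: "b \<in> J" for b
    proof -
      have Re0: "Re (\<Sum>s\<in>S. \<Sum>t\<in>S. b s t * Q s t) = 0" if "b \<in> J" for b
        unfolding Q_eq using f_J[OF that] by (simp add: f_add)
      \<comment> \<open>\<open>J\<close> is closed under multiplication by \<i>, so the vanishing of
        all real parts forces the vanishing of the pairing.\<close>
      have "(\<Sum>s\<in>S. \<Sum>t\<in>S. (\<i> * b s t) * Q s t) = \<i> * (\<Sum>s\<in>S. \<Sum>t\<in>S. b s t * Q s t)"
        by (simp add: sum_distrib_left mult.assoc)
      with Re0[OF J_scale[OF b, of \<i>]] have "Im (\<Sum>s\<in>S. \<Sum>t\<in>S. b s t * Q s t) = 0"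
        by simp
      with Re0[OF b] show ?thesis
        by (simp add: complex_eq_iff)
    qed
  qed
qed

section \<open>Realizing strictly positive matrices with the right partial trace by
  representations\<close>

section \<open>Representations with a prescribed Gram matrix\<close>

text \<open>Operators are determined by their inner products, so the weak form of the relation gives
  back the operator identity and spares the computation of concrete adjoints.\<close>

lemma (in hilbert_pair) representationI:
  assumes V: "\<And>a x. V a x \<in> bounded_ops H K"
    and rel: "\<And>\<xi> \<eta> x x'. \<lbrakk>\<xi> \<in> carrier H; \<eta> \<in> carrier H\<rbrakk> \<Longrightarrow>
      (\<Sum>a\<in>UNIV. ip K (V a x' \<xi>) (V a x \<eta>)) = (if x = x' then ip H \<xi> \<eta> else 0)"
  shows "representation H K (V :: 'a::finite \<Rightarrow> 'x \<Rightarrow> 'h \<Rightarrow> 'k)"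
proof (intro representation.intro representation_axioms.intro)
  interpret HH: hilbert_pair H H ..
  show "hilbert_pair H K" ..
  show "V a x \<in> bounded_ops H K" for a x
    by (rule V)
  fix x x' :: 'x
  let ?c = "\<lambda>a. compose (carrier H) (adj H K (V a x)) (V a x')"
  have c: "?c a \<in> bounded_ops H H" for a
    by (rule compose_op(1)[OF dom.hilbert_space_axioms cod.hilbert_space_axioms dom.hilbert_space_axioms
        adj_bounded[OF V] V])
  have "finsum (op_space H H) ?c UNIV \<in> carrier (op_space H H)"
    using c by (intro HH.op.finsum_closed) auto
  then have sum: "finsum (op_space H H) ?c UNIV \<in> bounded_ops H H"
    by simp
  have ip_sum: "ip H (finsum (op_space H H) ?c UNIV \<xi>) \<eta> = (if x = x' then ip H \<xi> \<eta> else 0)"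
    if \<xi>: "\<xi> \<in> carrier H" and \<eta>: "\<eta> \<in> carrier H" for \<xi> \<eta>
  proof -
    have c': "?c \<in> UNIV \<rightarrow> bounded_ops H H"
      using c by auto
    have "ip H (finsum (op_space H H) ?c UNIV \<xi>) \<eta> = (\<Sum>a\<in>UNIV. ip H (?c a \<xi>) \<eta>)"
      unfolding HH.op_space_finsum_apply[OF \<xi> c'] using HH.op_closed[OF c \<xi>] \<eta> by (subst dom.ip_finsum) auto
    also have "\<dots> = (\<Sum>a\<in>UNIV. ip K (V a x' \<xi>) (V a x \<eta>))"
      using V \<xi> \<eta> by (simp add: compose_def ip_adj_left)
    finally show ?thesis
      by (simp add: rel[OF \<xi> \<eta>])
  qed
  show "finsum (op_space H H) ?c UNIV = (if x = x' then \<lambda>\<xi>\<in>carrier H. \<xi> else \<zero>\<^bsub>op_space H H\<^esub>)"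
    by (rule HH.op_eqI[OF sum]) (use dom.id_op ip_sum in auto)
qed

lemma ip_kernel_hilbert_image:
  assumes "inj_on \<kappa> S"
  shows "ip (kernel_hilbert (\<kappa> ` S) G) \<xi> \<eta> = (\<Sum>s\<in>S. \<Sum>t\<in>S. G (\<kappa> s) (\<kappa> t) * \<xi> (\<kappa> t) * cnj (\<eta> (\<kappa> s)))"
  using assms by (simp add: kernel_hilbert_simps sum.reindex)

lemma sum_rotate:
  "(\<Sum>a\<in>A. \<Sum>i\<in>I. \<Sum>j\<in>J. f a i j) = (\<Sum>i\<in>I. \<Sum>j\<in>J. \<Sum>a\<in>A. f a i j)"
  by (subst sum.swap) (intro sum.cong HOL.refl sum.swap)

text \<open>The Hilbert spaces are \<open>\<complex>\<^sup>n\<close> and \<open>\<complex>\<^sup>n \<otimes> \<complex>\<^sup>X \<otimes> \<complex>\<^sup>A\<close> with the inner products given by \<open>g\<close> and \<open>Q\<close>,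
  and \<open>V a x\<close> maps \<open>\<xi>\<close> to \<open>\<xi> \<otimes> e\<^sub>x \<otimes> e\<^sub>a\<close>; strict positivity makes the inner products definite.\<close>

lemma gram_representation:
  fixes Q :: "nat \<times> 'x::finite \<times> 'a::finite \<Rightarrow> nat \<times> 'x \<times> 'a \<Rightarrow> complex"
    and n :: nat
  defines "S \<equiv> {..<n} \<times> UNIV"
  assumes Q: "hermitian_on S Q" and "0 < \<epsilon>"
    and pos: "\<And>\<xi>. \<epsilon> * (\<Sum>s\<in>S. (cmod (\<xi> s))\<^sup>2) \<le> Re (\<Sum>s\<in>S. \<Sum>t\<in>S. cnj (\<xi> s) * Q s t * \<xi> t)"
    and rel: "\<And>i j x x'. \<lbrakk>i < n; j < n\<rbrakk> \<Longrightarrow> (\<Sum>a\<in>UNIV. Q (i, x, a) (j, x', a)) = (if x = x' then g i j else 0)"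
  shows "\<exists>H K V h. (H, K, V) \<in> (all_reps :: ('u, 'a, 'x) rep set) \<and> (\<forall>i<n. h i \<in> carrier H) \<and>
    (\<forall>i<n. \<forall>j<n. \<forall>x a x' a'. ip K (V a' x' (h j)) (V a x (h i)) = Q (i, x, a) (j, x', a'))"
proof -
  \<comment> \<open>Indices are coded in the first component, with a constant second component, so
    the spaces lie in \<open>'u univ\<close> whatever the type \<open>'u\<close> is.\<close>
  define \<kappa> :: "nat \<times> 'x \<times> 'a \<Rightarrow> nat \<times> 'u" where "\<kappa> s = (to_nat s, undefined)" for s
  define \<kappa>' :: "nat \<times> 'u \<Rightarrow> nat \<times> 'x \<times> 'a" where "\<kappa>' k = from_nat (fst k)" for k
  define c :: "nat \<Rightarrow> nat \<times> 'u" where "c i = (i, undefined)" for i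
  have fst_c: "fst (c i) = i" for i
    by (simp add: c_def)
  have \<kappa>'_\<kappa> [simp]: "\<kappa>' (\<kappa> s) = s" for s
    by (simp add: \<kappa>_def \<kappa>'_def)
  have inj: "inj_on \<kappa> S" "inj_on c {..<n}"
    by (metis \<kappa>'_\<kappa> inj_onI) (auto simp: c_def inj_on_def)
  have S: "finite S"
    by (simp add: S_def)
  define H where "H = kernel_hilbert (c ` {..<n}) (\<lambda>k l. g (fst k) (fst l))"
  define K where "K = kernel_hilbert (\<kappa> ` S) (\<lambda>k l. Q (\<kappa>' k) (\<kappa>' l))"
  define V :: "'a \<Rightarrow> 'x \<Rightarrow> 'u univ \<Rightarrow> 'u univ" where
    "V a x = (\<lambda>\<xi>\<in>carrier H. \<lambda>k. if k \<in> \<kappa> ` S \<and> snd (\<kappa>' k) = (x, a) then \<xi> (c (fst (\<kappa>' k))) else 0)" for a x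
  \<comment> \<open>By \<open>rel\<close> the sum is the same for every \<open>x\<close>, so one
    \<open>x\<close> suffices to express \<open>g\<close> through \<open>Q\<close>.\<close>
  obtain x0 :: 'x where True by simp
  have g: "g i j = (\<Sum>a\<in>UNIV. Q (i, x0, a) (j, x0, a))" if "i < n" "j < n" for i j
    using rel[OF that, of x0 x0] by simp
  have ip_H: "ip H \<xi> \<eta> = (\<Sum>i<n. \<Sum>j<n. g i j * \<xi> (c j) * cnj (\<eta> (c i)))" for \<xi> \<eta>
    unfolding H_def ip_kernel_hilbert_image[OF inj(2)] by (simp add: c_def)
  have sum_S: "(\<Sum>s\<in>S. f s) = (\<Sum>i<n. \<Sum>p\<in>UNIV. f (i, p))" for f :: "_ \<Rightarrow> 'c::comm_monoid_add"
    by (simp add: S_def sum_Times)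
  have pick: "(\<Sum>p\<in>UNIV. if p = (x, a) then f p else 0) = f (x, a)" for f :: "'x \<times> 'a \<Rightarrow> 'c::comm_monoid_add" and x a
    by simp
  have form: "(\<Sum>s\<in>S. \<Sum>t\<in>S. cnj (if snd s = (x, b) then \<eta> (fst s) else 0) * Q s t *
        (if snd t = (x', a) then \<xi> (fst t) else 0)) =
      (\<Sum>i<n. \<Sum>j<n. Q (i, x, b) (j, x', a) * \<xi> j * cnj (\<eta> i))" for x x' a b and \<xi> \<eta> :: "nat \<Rightarrow> complex"
  proof -
    have "(\<Sum>s\<in>S. \<Sum>t\<in>S. cnj (if snd s = (x, b) then \<eta> (fst s) else 0) * Q s t *
        (if snd t = (x', a) then \<xi> (fst t) else 0)) =
      (\<Sum>i<n. \<Sum>p\<in>UNIV. if p = (x, b) then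
        (\<Sum>j<n. \<Sum>q\<in>UNIV. if q = (x', a) then Q (i, p) (j, q) * \<xi> j * cnj (\<eta> i) else 0) else 0)"
      unfolding sum_S by (intro sum.cong HOL.refl)
        (auto intro!: sum.cong simp: if_distrib[of "\<lambda>z. _ * z"] cong: if_cong)
    then show ?thesis
      unfolding pick .
  qed
  interpret H: hilbert_space H
    unfolding H_def
  proof (rule kernel_hilbert[OF _ _ \<open>0 < \<epsilon>\<close>])
    show "g (fst l) (fst k) = cnj (g (fst k) (fst l))" if "k \<in> c ` {..<n}" "l \<in> c ` {..<n}" for k l
      using that Q by (auto simp: c_def g hermitian_on_def S_def)
    fix \<xi> :: "nat \<times> 'u \<Rightarrow> complex"
    \<comment> \<open>Vectors supported at x0 and one \<open>a\<close> show that each summand of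
      \<open>g\<close> is bounded below by \<epsilon>. There is at least one summand, so
      \<open>g\<close> inherits the bound.\<close>
    have "\<epsilon> * (\<Sum>i<n. (cmod (\<xi> (c i)))\<^sup>2) \<le> Re (\<Sum>i<n. \<Sum>j<n. Q (i, x0, a) (j, x0, a) * \<xi> (c j) * cnj (\<xi> (c i)))" for a
    proof -
      have "(\<Sum>s\<in>S. (cmod (if snd s = (x0, a) then \<xi> (c (fst s)) else 0))\<^sup>2) =
          (\<Sum>i<n. \<Sum>p\<in>UNIV. if p = (x0, a) then (cmod (\<xi> (c i)))\<^sup>2 else 0)"
        unfolding sum_S by (intro sum.cong) auto
      also have "\<dots> = (\<Sum>i<n. (cmod (\<xi> (c i)))\<^sup>2)"
        unfolding pick ..
      finally show ?thesis
        using pos[of "\<lambda>s. if snd s = (x0, a) then \<xi> (c (fst s)) else 0"]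
        unfolding form[of x0 a "\<lambda>i. \<xi> (c i)" x0 a "\<lambda>i. \<xi> (c i)"] by simp
    qed
    then have "(\<Sum>a\<in>(UNIV :: 'a set). \<epsilon> * (\<Sum>i<n. (cmod (\<xi> (c i)))\<^sup>2)) \<le>
        (\<Sum>a\<in>UNIV. Re (\<Sum>i<n. \<Sum>j<n. Q (i, x0, a) (j, x0, a) * \<xi> (c j) * cnj (\<xi> (c i))))"
      by (rule sum_mono)
    also have "\<dots> = Re (\<Sum>i<n. \<Sum>j<n. g i j * \<xi> (c j) * cnj (\<xi> (c i)))"
    proof -
      have "(\<Sum>a\<in>UNIV. \<Sum>i<n. \<Sum>j<n. Q (i, x0, a) (j, x0, a) * \<xi> (c j) * cnj (\<xi> (c i))) =
          (\<Sum>i<n. \<Sum>j<n. g i j * \<xi> (c j) * cnj (\<xi> (c i)))"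
        by (subst sum_rotate, intro sum.cong HOL.refl) (simp add: g sum_distrib_right)
      then show ?thesis
        by (simp only: Re_sum[symmetric])
    qed
    finally have "real CARD('a) * (\<epsilon> * (\<Sum>i<n. (cmod (\<xi> (c i)))\<^sup>2)) \<le> Re (\<Sum>i<n. \<Sum>j<n. g i j * \<xi> (c j) * cnj (\<xi> (c i)))"
      by simp
    moreover have "1 * (\<epsilon> * (\<Sum>i<n. (cmod (\<xi> (c i)))\<^sup>2)) \<le> real CARD('a) * (\<epsilon> * (\<Sum>i<n. (cmod (\<xi> (c i)))\<^sup>2))"
      using \<open>0 < \<epsilon>\<close> by (intro mult_right_mono) (auto intro!: mult_nonneg_nonneg sum_nonneg simp: Suc_le_eq)
    ultimately show "\<epsilon> * (\<Sum>k\<in>c ` {..<n}. (cmod (\<xi> k))\<^sup>2) \<le>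
        Re (\<Sum>k\<in>c ` {..<n}. \<Sum>l\<in>c ` {..<n}. g (fst k) (fst l) * \<xi> l * cnj (\<xi> k))"
      unfolding sum.reindex[OF inj(2)] comp_def fst_c by linarith
  qed simp
  interpret K: hilbert_space K
    unfolding K_def
  proof (rule kernel_hilbert[OF _ _ \<open>0 < \<epsilon>\<close>])
    show "Q (\<kappa>' l) (\<kappa>' k) = cnj (Q (\<kappa>' k) (\<kappa>' l))" if "k \<in> \<kappa> ` S" "l \<in> \<kappa> ` S" for k l
      using that Q by (auto simp: hermitian_on_def)
    show "\<epsilon> * (\<Sum>k\<in>\<kappa> ` S. (cmod (\<xi> k))\<^sup>2) \<le> Re (\<Sum>k\<in>\<kappa> ` S. \<Sum>l\<in>\<kappa> ` S. Q (\<kappa>' k) (\<kappa>' l) * \<xi> l * cnj (\<xi> k))" for \<xi>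
      unfolding sum.reindex[OF inj(1)] comp_def \<kappa>'_\<kappa>
      using pos[of "\<lambda>s. \<xi> (\<kappa> s)"] by (simp only: ac_simps)
  qed (simp add: S)
  interpret p: hilbert_pair H K ..
  have V_apply: "V a x \<xi> (\<kappa> s) = (if snd s = (x, a) then \<xi> (c (fst s)) else 0)"
    if "\<xi> \<in> carrier H" "s \<in> S" for a x \<xi> s
    using that by (simp add: V_def)
  have ip_V: "ip K (V a x' \<xi>) (V b x \<eta>) = (\<Sum>i<n. \<Sum>j<n. Q (i, x, b) (j, x', a) * \<xi> (c j) * cnj (\<eta> (c i)))"
    if "\<xi> \<in> carrier H" "\<eta> \<in> carrier H" for a x' \<xi> b x \<eta>
  proof -
    have "ip K (V a x' \<xi>) (V b x \<eta>) = (\<Sum>s\<in>S. \<Sum>t\<in>S. cnj (if snd s = (x, b) then \<eta> (c (fst s)) else 0) * Q s t *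
        (if snd t = (x', a) then \<xi> (c (fst t)) else 0))"
      unfolding K_def ip_kernel_hilbert_image[OF inj(1)]
      using that by (intro sum.cong HOL.refl) (simp add: V_apply)
    then show ?thesis
      unfolding form[of x b "\<lambda>i. \<eta> (c i)" x' a "\<lambda>i. \<xi> (c i)"] .
  qed
  have sum_V: "(\<Sum>a\<in>UNIV. ip K (V a x' \<xi>) (V a x \<eta>)) = (if x = x' then ip H \<xi> \<eta> else 0)"
    if "\<xi> \<in> carrier H" "\<eta> \<in> carrier H" for \<xi> \<eta> x x'
  proof -
    have "(\<Sum>a\<in>UNIV. ip K (V a x' \<xi>) (V a x \<eta>)) =
        (\<Sum>i<n. \<Sum>j<n. (\<Sum>a\<in>UNIV. Q (i, x, a) (j, x', a)) * \<xi> (c j) * cnj (\<eta> (c i)))"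
      unfolding ip_V[OF that] by (subst sum_rotate) (simp add: sum_distrib_right)
    also have "\<dots> = (\<Sum>i<n. \<Sum>j<n. (if x = x' then g i j else 0) * \<xi> (c j) * cnj (\<eta> (c i)))"
      by (intro sum.cong HOL.refl) (simp add: rel)
    finally show ?thesis
      by (simp add: ip_H)
  qed
  have V_closed: "V a x \<xi> \<in> carrier K" if "\<xi> \<in> carrier H" for a x \<xi>
    using that by (auto simp: V_def K_def kernel_hilbert_simps)
  have V: "V a x \<in> bounded_ops H K" for a x
  proof (rule p.bounded_opsI[where c = 1])
    show "V a x \<in> extensional (carrier H)"
      by (simp add: V_def)
    fix \<xi> assume \<xi>: "\<xi> \<in> carrier H"
    show "V a x \<xi> \<in> carrier K"
      by (rule V_closed[OF \<xi>])
    show "V a x (d \<odot>\<^bsub>H\<^esub> \<xi>) = d \<odot>\<^bsub>K\<^esub> V a x \<xi>" for d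
      using \<xi> H.smult_in_carrier[OF \<xi>, of d]
      by (auto simp: V_def fun_eq_iff) (auto simp: H_def K_def kernel_hilbert_simps)
    show "V a x (\<xi> \<oplus>\<^bsub>H\<^esub> \<eta>) = V a x \<xi> \<oplus>\<^bsub>K\<^esub> V a x \<eta>" if \<eta>: "\<eta> \<in> carrier H" for \<eta>
      using \<xi> \<eta> H.a_closed[OF \<xi> \<eta>]
      by (auto simp: V_def fun_eq_iff) (auto simp: H_def K_def kernel_hilbert_simps)
    \<comment> \<open>The column of all \<open>V a x\<close> is isometric, which bounds each entry
      by 1.\<close>
    have "(hnorm K (V a x \<xi>))\<^sup>2 \<le> (\<Sum>a\<in>UNIV. (hnorm K (V a x \<xi>))\<^sup>2)"
      by (rule member_le_sum) auto
    also have "\<dots> = (hnorm H \<xi>)\<^sup>2"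
      using arg_cong[OF sum_V[OF \<xi> \<xi>, of x x], of Re] \<xi> V_closed[OF \<xi>]
      by (simp add: K.hnorm_sq H.hnorm_sq)
    finally show "hnorm K (V a x \<xi>) \<le> 1 * hnorm H \<xi>"
      using \<xi> by (auto intro: power2_le_imp_le)
  qed
  \<comment> \<open>The standard basis: \<open>V a x\<close> sends its i-th vector to the basis
    vector at (i, x, a), and the inner products of those are the entries of
    \<open>Q\<close>.\<close>
  define h where "h i = (\<lambda>k. if k = c i then 1 else 0 :: complex)" for i
  have h: "h i \<in> carrier H" if "i < n" for i
    using that by (auto simp: h_def H_def kernel_hilbert_simps)
  have h_c: "h i (c j) = (if j = i then 1 else 0)" for i j
    by (simp add: h_def c_def)
  have "ip K (V a' x' (h j)) (V a x (h i)) = Q (i, x, a) (j, x', a')" if ij: "i < n" "j < n" for i j x a x' a'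
  proof -
    have "ip K (V a' x' (h j)) (V a x (h i)) =
        (\<Sum>i'<n. if i' = i then \<Sum>j'<n. if j' = j then Q (i', x, a) (j', x', a') else 0 else 0)"
      unfolding ip_V[OF h[OF ij(2)] h[OF ij(1)]] h_c by (intro sum.cong HOL.refl)
        (auto simp: if_distrib[of "\<lambda>z. _ * z"] ij cong: if_cong)
    then show ?thesis
      using ij by simp
  qed
  moreover have "(H, K, V) \<in> all_reps"
    using p.representationI[OF V sum_V] by (simp add: all_reps_def is_rep_iff)
  ultimately show ?thesis
    using h by blast
qed

section \<open>Carrying the operator system axioms across a bijection\<close>

section \<open>Transport of operator systems\<close>

text \<open>No axiom is assumed for the record \<open>Q\<close>; the bijection brings all of them
  from \<open>T\<close>. In this way the space of cosets becomes an operator system without a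
  separate study of its cones.\<close>

locale opsys_bijection = T: operator_system T
  for T :: "('s, 'm) opsys_scheme" and Q :: "('t, 'n) opsys_scheme" and \<psi> :: "'s \<Rightarrow> 't" +
  assumes bij: "bij_betw \<psi> (carrier T) (carrier Q)"
    and \<psi>_zero: "\<psi> \<zero>\<^bsub>T\<^esub> = \<zero>\<^bsub>Q\<^esub>"
    and \<psi>_one: "\<psi> \<one>\<^bsub>T\<^esub> = \<one>\<^bsub>Q\<^esub>"
    and \<psi>_add: "\<lbrakk>s \<in> carrier T; t \<in> carrier T\<rbrakk> \<Longrightarrow> \<psi> (s \<oplus>\<^bsub>T\<^esub> t) = \<psi> s \<oplus>\<^bsub>Q\<^esub> \<psi> t"
    and \<psi>_smult: "s \<in> carrier T \<Longrightarrow> \<psi> (c \<odot>\<^bsub>T\<^esub> s) = c \<odot>\<^bsub>Q\<^esub> \<psi> s"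
    and \<psi>_star: "s \<in> carrier T \<Longrightarrow> \<psi> (star T s) = star Q (\<psi> s)"
    and \<psi>_pos: "pos Q n = map_mat \<psi> ` pos T n"
begin

lemma \<psi>_closed: "s \<in> carrier T \<Longrightarrow> \<psi> s \<in> carrier Q"
  using bij by (auto simp: bij_betw_def)

lemma \<psi>_surj: "t \<in> carrier Q \<Longrightarrow> \<exists>s\<in>carrier T. t = \<psi> s"
  using bij by (auto simp: bij_betw_def)

lemma \<psi>_inj: "\<lbrakk>s \<in> carrier T; t \<in> carrier T\<rbrakk> \<Longrightarrow> \<psi> s = \<psi> t \<longleftrightarrow> s = t"
  using bij by (auto simp: bij_betw_def inj_on_def)

lemma smult_T_closed: "s \<in> carrier T \<Longrightarrow> c \<odot>\<^bsub>T\<^esub> s \<in> carrier T"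
  by (rule T.smult_closed) auto

lemma Q_module: "module class_ring Q"
proof (rule module_criteria)
  show "cring (class_ring :: complex ring)" ..
  show "\<zero>\<^bsub>Q\<^esub> \<in> carrier Q"
    unfolding \<psi>_zero[symmetric] by (intro \<psi>_closed T.zero_closed)
  show "\<forall>v w. v \<in> carrier Q \<and> w \<in> carrier Q \<longrightarrow> v \<oplus>\<^bsub>Q\<^esub> w \<in> carrier Q"
    by (auto dest!: \<psi>_surj simp: \<psi>_add[symmetric] intro!: \<psi>_closed)
  show "\<forall>v\<in>carrier Q. \<exists>w\<in>carrier Q. v \<oplus>\<^bsub>Q\<^esub> w = \<zero>\<^bsub>Q\<^esub>"
  proof
    fix v assume "v \<in> carrier Q"
    then obtain s where s: "s \<in> carrier T" "v = \<psi> s"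
      using \<psi>_surj by blast
    then have "v \<oplus>\<^bsub>Q\<^esub> \<psi> (\<ominus>\<^bsub>T\<^esub> s) = \<zero>\<^bsub>Q\<^esub>"
      by (simp add: \<psi>_add[symmetric] T.r_neg \<psi>_zero)
    then show "\<exists>w\<in>carrier Q. v \<oplus>\<^bsub>Q\<^esub> w = \<zero>\<^bsub>Q\<^esub>"
      using s \<psi>_closed by blast
  qed
  show "\<forall>c v. c \<in> carrier class_ring \<and> v \<in> carrier Q \<longrightarrow> c \<odot>\<^bsub>Q\<^esub> v \<in> carrier Q"
    by (auto dest!: \<psi>_surj simp: \<psi>_smult[symmetric] intro!: \<psi>_closed smult_T_closed)
  show "\<forall>v w. v \<in> carrier Q \<and> w \<in> carrier Q \<longrightarrow> v \<oplus>\<^bsub>Q\<^esub> w = w \<oplus>\<^bsub>Q\<^esub> v"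
    by (auto dest!: \<psi>_surj simp: \<psi>_add[symmetric] T.a_comm)
  show "\<forall>v w x. v \<in> carrier Q \<and> w \<in> carrier Q \<and> x \<in> carrier Q \<longrightarrow>
      v \<oplus>\<^bsub>Q\<^esub> w \<oplus>\<^bsub>Q\<^esub> x = v \<oplus>\<^bsub>Q\<^esub> (w \<oplus>\<^bsub>Q\<^esub> x)"
    by (auto dest!: \<psi>_surj simp: \<psi>_add[symmetric] T.a_assoc)
  show "\<forall>v\<in>carrier Q. v \<oplus>\<^bsub>Q\<^esub> \<zero>\<^bsub>Q\<^esub> = v"
    by (auto dest!: \<psi>_surj simp: \<psi>_add[symmetric] \<psi>_zero[symmetric])
  show "\<forall>a b v. a \<in> carrier class_ring \<and> b \<in> carrier class_ring \<and> v \<in> carrier Q \<longrightarrow>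
      (a \<otimes>\<^bsub>class_ring\<^esub> b) \<odot>\<^bsub>Q\<^esub> v = a \<odot>\<^bsub>Q\<^esub> (b \<odot>\<^bsub>Q\<^esub> v)"
    by (auto dest!: \<psi>_surj simp: \<psi>_smult[symmetric] smult_T_closed T.smult_assoc1[simplified])
  show "\<forall>v\<in>carrier Q. \<one>\<^bsub>class_ring\<^esub> \<odot>\<^bsub>Q\<^esub> v = v"
    by (auto dest!: \<psi>_surj simp: \<psi>_smult[symmetric] T.smult_one[simplified])
  show "\<forall>a b v. a \<in> carrier class_ring \<and> b \<in> carrier class_ring \<and> v \<in> carrier Q \<longrightarrow>
      (a \<oplus>\<^bsub>class_ring\<^esub> b) \<odot>\<^bsub>Q\<^esub> v = a \<odot>\<^bsub>Q\<^esub> v \<oplus>\<^bsub>Q\<^esub> b \<odot>\<^bsub>Q\<^esub> v"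
    by (auto dest!: \<psi>_surj simp: \<psi>_smult[symmetric] \<psi>_add[symmetric] smult_T_closed T.smult_l_distr[simplified])
  show "\<forall>a v w. a \<in> carrier class_ring \<and> v \<in> carrier Q \<and> w \<in> carrier Q \<longrightarrow>
      a \<odot>\<^bsub>Q\<^esub> (v \<oplus>\<^bsub>Q\<^esub> w) = a \<odot>\<^bsub>Q\<^esub> v \<oplus>\<^bsub>Q\<^esub> a \<odot>\<^bsub>Q\<^esub> w"
    by (auto dest!: \<psi>_surj simp: \<psi>_add[symmetric] \<psi>_smult[symmetric] smult_T_closed T.smult_r_distr)
qed

lemma \<psi>_finsum:
  assumes "f \<in> I \<rightarrow> carrier T"
  shows "\<psi> (finsum T f I) = finsum Q (\<lambda>i. \<psi> (f i)) I"
proof -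
  interpret Q: module class_ring Q by (rule Q_module)
  show ?thesis
    using assms
    by (induction I rule: infinite_finite_induct) (auto simp: \<psi>_zero \<psi>_add Pi_iff \<psi>_closed)
qed

lemma matrices_Q: "A \<in> matrices n Q \<longleftrightarrow> (\<exists>B\<in>matrices n T. A = map_mat \<psi> B)"
proof
  assume A: "A \<in> matrices n Q"
  then have dims: "A \<in> carrier_mat n n" and entries: "\<And>i j. \<lbrakk>i < n; j < n\<rbrakk> \<Longrightarrow> A $$ (i, j) \<in> carrier Q"
    by (auto simp: matrices_def)
  obtain \<theta> where "\<And>t. t \<in> carrier Q \<Longrightarrow> \<theta> t \<in> carrier T \<and> t = \<psi> (\<theta> t)"
    using \<psi>_surj by metis
  then have \<theta>: "\<theta> t \<in> carrier T" "\<psi> (\<theta> t) = t" if "t \<in> carrier Q" for t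
    using that by auto
  have "map_mat \<theta> A \<in> matrices n T"
    using dims entries \<theta> by (auto simp: matrices_def)
  moreover have "A = map_mat \<psi> (map_mat \<theta> A)"
    using dims entries \<theta> by (intro eq_matI) auto
  ultimately show "\<exists>B\<in>matrices n T. A = map_mat \<psi> B" by blast
qed (auto simp: matrices_def \<psi>_closed)

lemma
  assumes A: "A \<in> matrices n T"
  shows \<psi>_mat_plus: "B \<in> matrices n T \<Longrightarrow> mat_plus Q (map_mat \<psi> A) (map_mat \<psi> B) = map_mat \<psi> (mat_plus T A B)"
    and \<psi>_mat_scale: "mat_scale Q c (map_mat \<psi> A) = map_mat \<psi> (mat_scale T c A)"
    and \<psi>_mat_star: "mat_star Q (map_mat \<psi> A) = map_mat \<psi> (mat_star T A)"
    and \<psi>_mat_compress: "\<alpha> \<in> carrier_mat n m \<Longrightarrow> mat_compress Q \<alpha> (map_mat \<psi> A) = map_mat \<psi> (mat_compress T \<alpha> A)"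
proof -
  have dims: "A \<in> carrier_mat n n" and entries: "\<And>i j. \<lbrakk>i < n; j < n\<rbrakk> \<Longrightarrow> A $$ (i, j) \<in> carrier T"
    using A by (auto simp: matrices_def)
  show "mat_plus Q (map_mat \<psi> A) (map_mat \<psi> B) = map_mat \<psi> (mat_plus T A B)" if "B \<in> matrices n T"
    using that A by (intro eq_matI) (auto simp: matrices_def mat_plus_def \<psi>_add)
  show "mat_scale Q c (map_mat \<psi> A) = map_mat \<psi> (mat_scale T c A)"
    using A by (intro eq_matI) (auto simp: matrices_def mat_scale_def \<psi>_smult)
  show "mat_star Q (map_mat \<psi> A) = map_mat \<psi> (mat_star T A)"
    using A by (intro eq_matI) (auto simp: matrices_def mat_star_def \<psi>_star)
  show "mat_compress Q \<alpha> (map_mat \<psi> A) = map_mat \<psi> (mat_compress T \<alpha> A)" if "\<alpha> \<in> carrier_mat n m"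
  proof -
    interpret Q: module class_ring Q by (rule Q_module)
    have inner: "(\<lambda>j. c j \<odot>\<^bsub>T\<^esub> A $$ (i, j)) \<in> {..<n} \<rightarrow> carrier T" if "i < n" for c i
      using that entries by (auto simp: smult_T_closed)
    have "finsum Q (\<lambda>i. finsum Q (\<lambda>j. c i j \<odot>\<^bsub>Q\<^esub> (map_mat \<psi> A) $$ (i, j)) {..<n}) {..<n} =
        \<psi> (finsum T (\<lambda>i. finsum T (\<lambda>j. c i j \<odot>\<^bsub>T\<^esub> A $$ (i, j)) {..<n}) {..<n})" for c
    proof -
      have "finsum Q (\<lambda>j. c i j \<odot>\<^bsub>Q\<^esub> (map_mat \<psi> A) $$ (i, j)) {..<n} =
          \<psi> (finsum T (\<lambda>j. c i j \<odot>\<^bsub>T\<^esub> A $$ (i, j)) {..<n})" if "i < n" for i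
        unfolding \<psi>_finsum[OF inner[OF that]]
        using that entries dims by (intro Q.finsum_cong') (auto simp: \<psi>_smult[symmetric] smult_T_closed \<psi>_closed)
      moreover have "(\<lambda>i. finsum T (\<lambda>j. c i j \<odot>\<^bsub>T\<^esub> A $$ (i, j)) {..<n}) \<in> {..<n} \<rightarrow> carrier T"
        using inner by (auto intro!: T.finsum_closed)
      ultimately show ?thesis
        by (subst \<psi>_finsum) (auto intro!: Q.finsum_cong' \<psi>_closed simp: Pi_iff)
    qed
    then show ?thesis
      using that by (intro eq_matI) (auto simp: mat_compress_def)
  qed
qed

lemma \<psi>_mat_unit: "mat_unit Q n = map_mat \<psi> (mat_unit T n)"
  by (intro eq_matI) (auto simp: mat_unit_def \<psi>_one \<psi>_zero)

lemma \<psi>_mat_null: "mat_null Q n = map_mat \<psi> (mat_null T n)"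
  by (intro eq_matI) (auto simp: mat_null_def \<psi>_zero)

lemma map_mat_\<psi>_eq: "\<lbrakk>A \<in> matrices n T; B \<in> matrices n T\<rbrakk> \<Longrightarrow> map_mat \<psi> A = map_mat \<psi> B \<longleftrightarrow> A = B"
proof
  assume AB: "A \<in> matrices n T" "B \<in> matrices n T" and eq: "map_mat \<psi> A = map_mat \<psi> B"
  show "A = B"
  proof (rule eq_matI)
    fix i j assume ij: "i < dim_row B" "j < dim_col B"
    then have "\<psi> (A $$ (i, j)) = \<psi> (B $$ (i, j))"
      using arg_cong[OF eq, of "\<lambda>M. M $$ (i, j)"] AB by (auto simp: matrices_def)
    then show "A $$ (i, j) = B $$ (i, j)"
      using AB ij by (subst (asm) \<psi>_inj) (auto simp: matrices_def)
  qed (use AB in \<open>auto simp: matrices_def\<close>)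
qed simp

lemma matrices_ops_closed:
  shows "\<lbrakk>A \<in> matrices n T; B \<in> matrices n T\<rbrakk> \<Longrightarrow> mat_plus T A B \<in> matrices n T"
    and "A \<in> matrices n T \<Longrightarrow> mat_scale T c A \<in> matrices n T"
    and "A \<in> matrices n T \<Longrightarrow> mat_star T A \<in> matrices n T"
    and "mat_unit T n \<in> matrices n T" and "mat_null T n \<in> matrices n T"
  using T.zero_closed T.unit_closed
  by (auto simp: matrices_def mat_plus_def mat_scale_def mat_star_def mat_unit_def mat_null_def
      smult_T_closed T.star_closed)

lemma \<psi>_plus_unit:
  assumes "A \<in> matrices n T"
  shows "mat_plus Q (mat_scale Q c (mat_unit Q n)) (map_mat \<psi> A) =
    map_mat \<psi> (mat_plus T (mat_scale T c (mat_unit T n)) A)"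
  unfolding \<psi>_mat_unit \<psi>_mat_scale[OF matrices_ops_closed(4)]
  by (rule \<psi>_mat_plus[OF matrices_ops_closed(2)[OF matrices_ops_closed(4)] assms])

lemma pos_Q: "B \<in> matrices n T \<Longrightarrow> map_mat \<psi> B \<in> pos Q n \<longleftrightarrow> B \<in> pos T n"
  unfolding \<psi>_pos using T.pos_hermitian map_mat_\<psi>_eq by (auto simp: image_iff)

theorem operator_system_Q: "operator_system Q"
proof (intro operator_system.intro operator_system_axioms.intro)
  show "vectorspace class_ring Q"
    by (rule vectorspace_class_ringI[OF Q_module])
  show "star Q s \<in> carrier Q" if "s \<in> carrier Q" for s
    using that by (auto dest!: \<psi>_surj simp: \<psi>_star[symmetric] intro!: \<psi>_closed T.star_closed)
  show "star Q (star Q s) = s" if "s \<in> carrier Q" for s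
    using that by (auto dest!: \<psi>_surj simp: \<psi>_star[symmetric] T.star_star T.star_closed)
  show "star Q (s \<oplus>\<^bsub>Q\<^esub> t) = star Q s \<oplus>\<^bsub>Q\<^esub> star Q t" if "s \<in> carrier Q" "t \<in> carrier Q" for s t
    using that by (auto dest!: \<psi>_surj simp: \<psi>_star[symmetric] \<psi>_add[symmetric] T.star_add T.star_closed)
  show "star Q (c \<odot>\<^bsub>Q\<^esub> s) = cnj c \<odot>\<^bsub>Q\<^esub> star Q s" if "s \<in> carrier Q" for s c
    using that by (auto dest!: \<psi>_surj
        simp: \<psi>_star[symmetric] \<psi>_smult[symmetric] T.star_smult smult_T_closed T.star_closed)
  show "\<one>\<^bsub>Q\<^esub> \<in> carrier Q"
    unfolding \<psi>_one[symmetric] by (intro \<psi>_closed T.unit_closed)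
  show "star Q \<one>\<^bsub>Q\<^esub> = \<one>\<^bsub>Q\<^esub>"
    unfolding \<psi>_one[symmetric] \<psi>_star[OF T.unit_closed, symmetric] T.star_unit ..
next
  fix A n assume "A \<in> pos Q n"
  then obtain B where B: "B \<in> pos T n" "A = map_mat \<psi> B"
    by (auto simp: \<psi>_pos)
  then have "B \<in> matrices n T" "mat_star T B = B"
    using T.pos_hermitian by auto
  then show "A \<in> matrices n Q \<and> mat_star Q A = A"
    using B matrices_Q by (auto simp: \<psi>_mat_star)
next
  fix A B n assume "A \<in> pos Q n" "B \<in> pos Q n"
  then obtain A' B' where B: "A' \<in> pos T n" "A = map_mat \<psi> A'" "B' \<in> pos T n" "B = map_mat \<psi> B'"
    by (auto simp: \<psi>_pos)
  then have "A' \<in> matrices n T" "B' \<in> matrices n T"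
    using T.pos_hermitian by auto
  then show "mat_plus Q A B \<in> pos Q n"
    using B T.pos_plus by (auto simp: \<psi>_mat_plus \<psi>_pos)
next
  fix A n and r :: real assume "A \<in> pos Q n" "0 \<le> r"
  then obtain A' where A': "A' \<in> pos T n" "A = map_mat \<psi> A'"
    by (auto simp: \<psi>_pos)
  then have "A' \<in> matrices n T"
    using T.pos_hermitian by auto
  then show "mat_scale Q (complex_of_real r) A \<in> pos Q n"
    using A' \<open>0 \<le> r\<close> T.pos_scale by (auto simp: \<psi>_mat_scale \<psi>_pos)
next
  fix A n assume "A \<in> pos Q n" and neg: "mat_scale Q (- 1) A \<in> pos Q n"
  then obtain A' where A': "A' \<in> pos T n" "A = map_mat \<psi> A'"
    by (auto simp: \<psi>_pos)
  then have mat: "A' \<in> matrices n T"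
    using T.pos_hermitian by auto
  then have "mat_scale T (- 1) A' \<in> pos T n"
    using neg A' by (simp add: \<psi>_mat_scale pos_Q matrices_ops_closed)
  then show "A = mat_null Q n"
    using T.pos_proper[OF A'(1)] by (simp add: A' \<psi>_mat_null)
next
  fix A n m and \<alpha> :: "complex mat" assume "A \<in> pos Q n" and \<alpha>: "\<alpha> \<in> carrier_mat n m"
  then obtain A' where A': "A' \<in> pos T n" "A = map_mat \<psi> A'"
    by (auto simp: \<psi>_pos)
  then have "A' \<in> matrices n T"
    using T.pos_hermitian by auto
  then show "mat_compress Q \<alpha> A \<in> pos Q m"
    using A' T.pos_compress[OF A'(1) \<alpha>] by (auto simp: \<psi>_mat_compress[OF _ \<alpha>] \<psi>_pos)
next
  fix A n assume "A \<in> matrices n Q" and star: "mat_star Q A = A"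
  then obtain A' where A': "A' \<in> matrices n T" "A = map_mat \<psi> A'"
    by (auto simp: matrices_Q)
  then have "mat_star T A' = A'"
    using star map_mat_\<psi>_eq[OF matrices_ops_closed(3)[OF A'(1)] A'(1)] by (simp add: \<psi>_mat_star)
  then obtain r where "r > 0" "mat_plus T (mat_scale T (complex_of_real r) (mat_unit T n)) A' \<in> pos T n"
    using T.order_unit A' by blast
  then show "\<exists>r>0. mat_plus Q (mat_scale Q (complex_of_real r) (mat_unit Q n)) A \<in> pos Q n"
    unfolding A'(2) \<psi>_plus_unit[OF A'(1)] \<psi>_pos by blast
next
  fix A n assume "A \<in> matrices n Q"
    and pos: "\<And>r. r > 0 \<Longrightarrow> mat_plus Q (mat_scale Q (complex_of_real r) (mat_unit Q n)) A \<in> pos Q n"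
  then obtain A' where A': "A' \<in> matrices n T" "A = map_mat \<psi> A'"
    by (auto simp: matrices_Q)
  have "A' \<in> pos T n"
  proof (rule T.archimedean[OF A'(1)])
    fix r :: real assume "r > 0"
    then show "mat_plus T (mat_scale T (complex_of_real r) (mat_unit T n)) A' \<in> pos T n"
      using pos[of r] unfolding A'(2) \<psi>_plus_unit[OF A'(1)]
      by (simp add: pos_Q matrices_ops_closed A'(1))
  qed
  then show "A \<in> pos Q n"
    using A' by (simp add: \<psi>_pos)
qed

end

section \<open>The image system, its kernel, and the universal property of the cosets\<close>

section \<open>The quotient of the matrix algebra\<close>

lemma M_XA_simps [simp]:
  "carrier M_XA = UNIV" "\<one>\<^bsub>M_XA\<^esub> = Finite_Cartesian_Product.mat 1" "\<zero>\<^bsub>M_XA\<^esub> = 0" "add M_XA = (+)"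
  "smult M_XA = (\<lambda>c \<mu>. \<chi> p q. c * \<mu> $ p $ q)" "star M_XA = (\<lambda>\<mu>. \<chi> p q. cnj (\<mu> $ q $ p))"
  by (simp_all add: M_XA_def matrix_system_def)

text \<open>The identification of n by n matrices over the matrix algebra with scalar matrices
  indexed by pairs.\<close>

definition block :: "(complex ^ 'i ^ 'i) Matrix.mat \<Rightarrow> nat \<times> 'i \<Rightarrow> nat \<times> 'i \<Rightarrow> complex" where
  "block A s t = (A $$ (fst s, fst t)) $ snd s $ snd t"

text \<open>Nonnegativity of a complex number includes reality, and polarization between two basis
  vectors then gives the symmetry of the entries.\<close>

lemma hermitian_on_if_form_nonneg:
  assumes S: "finite S" and nonneg: "\<And>\<xi>. 0 \<le> (\<Sum>s\<in>S. \<Sum>t\<in>S. cnj (\<xi> s) * p s t * \<xi> t)"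
  shows "hermitian_on S p"
  unfolding hermitian_on_def
proof (intro ballI)
  fix s t assume st: "s \<in> S" "t \<in> S"
  define F where "F \<xi> \<eta> = (\<Sum>s\<in>S. \<Sum>t\<in>S. cnj (\<xi> s) * p s t * \<eta> t)" for \<xi> \<eta>
  define e :: "'a \<Rightarrow> 'a \<Rightarrow> complex" where "e s u = (if u = s then 1 else 0)" for s u
  have F_e: "F (e s) (e t) = p s t" if "s \<in> S" "t \<in> S" for s t
  proof -
    have "F (e s) (e t) = (\<Sum>s'\<in>S. if s' = s then \<Sum>t'\<in>S. if t' = t then p s' t' else 0 else 0)"
      unfolding F_def by (intro sum.cong HOL.refl) (auto simp: e_def intro!: sum.cong)
    then show ?thesis
      using that S by simp
  qed
  have F_lin: "F (\<lambda>u. e s u + c * e t u) (\<lambda>u. e s u + c * e t u) =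
      F (e s) (e s) + cnj c * F (e t) (e s) + c * F (e s) (e t) + c * cnj c * F (e t) (e t)" for c
    unfolding F_def sum_distrib_left sum.distrib[symmetric]
    by (intro sum.cong HOL.refl) (simp add: algebra_simps)
  have "p s t = cnj (p t s)"
  proof (rule sesquilinear_hermitian)
    fix c
    have "0 \<le> F (\<lambda>u. e s u + c * e t u) (\<lambda>u. e s u + c * e t u)"
      unfolding F_def by (rule nonneg)
    then show "Im (p s s + cnj c * p t s + c * p s t + c * cnj c * p t t) = 0"
      unfolding F_lin by (simp add: F_e st complex_nonneg_iff)
  qed
  then show "cnj (p s t) = p t s"
    by simp
qed

lemma hermitian_form_real:
  assumes "hermitian_on S p" and w: "\<And>s t. \<lbrakk>s \<in> S; t \<in> S\<rbrakk> \<Longrightarrow> cnj (w s t) = w t s"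
  shows "Im (\<Sum>s\<in>S. \<Sum>t\<in>S. p s t * w s t) = 0"
proof -
  have "cnj (\<Sum>s\<in>S. \<Sum>t\<in>S. p s t * w s t) = (\<Sum>s\<in>S. \<Sum>t\<in>S. p t s * w t s)"
    unfolding cnj_sum using assms by (intro sum.cong) (auto simp: hermitian_on_def)
  also have "\<dots> = (\<Sum>s\<in>S. \<Sum>t\<in>S. p s t * w s t)"
    by (rule sum.swap)
  finally show ?thesis
    by (simp only: complex_eq_iff cnj.sel) simp
qed

text \<open>Tuples of vectors are regrouped as functions on pairs. Splitting the complex inequality
  into Hermitian symmetry and a real inequality suits both the separation and the pairing with Gram
  matrices.\<close>

lemma pos_M_XA_iff:
  fixes A :: "(complex ^ ('x::finite \<times> 'a::finite) ^ ('x \<times> 'a)) Matrix.mat"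
  shows "A \<in> pos M_XA n \<longleftrightarrow> A \<in> carrier_mat n n \<and>
    hermitian_on ({..<n} \<times> UNIV) (block A) \<and> psd_on ({..<n} \<times> UNIV) (block A)"
proof -
  let ?S = "{..<n} \<times> (UNIV :: ('x \<times> 'a) set)"
  have form: "(\<Sum>i<n. \<Sum>j<n. \<Sum>p\<in>UNIV. \<Sum>q\<in>UNIV. cnj (\<xi> (i, p)) * A $$ (i, j) $ p $ q * \<xi> (j, q)) =
      (\<Sum>s\<in>?S. \<Sum>t\<in>?S. cnj (\<xi> s) * block A s t * \<xi> t)" for \<xi> :: "nat \<times> 'x \<times> 'a \<Rightarrow> complex"
  proof -
    have "(\<Sum>i<n. \<Sum>j<n. \<Sum>p\<in>UNIV. \<Sum>q\<in>UNIV. cnj (\<xi> (i, p)) * A $$ (i, j) $ p $ q * \<xi> (j, q)) =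
        (\<Sum>i<n. \<Sum>p\<in>UNIV. \<Sum>j<n. \<Sum>q\<in>UNIV. cnj (\<xi> (i, p)) * A $$ (i, j) $ p $ q * \<xi> (j, q))"
      by (intro sum.cong HOL.refl sum.swap)
    then show ?thesis
      unfolding sum_Times by (simp add: block_def)
  qed
  have pos: "A \<in> pos M_XA n \<longleftrightarrow> A \<in> carrier_mat n n \<and>
      (\<forall>\<xi>. 0 \<le> (\<Sum>s\<in>?S. \<Sum>t\<in>?S. cnj (\<xi> s) * block A s t * \<xi> t))"
  proof -
    have "(\<forall>\<xi> :: nat \<Rightarrow> complex ^ ('x \<times> 'a). 0 \<le> (\<Sum>i<n. \<Sum>j<n. \<Sum>p\<in>UNIV. \<Sum>q\<in>UNIV.
          cnj (\<xi> i $ p) * A $$ (i, j) $ p $ q * \<xi> j $ q)) \<longleftrightarrow>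
        (\<forall>\<xi>. 0 \<le> (\<Sum>s\<in>?S. \<Sum>t\<in>?S. cnj (\<xi> s) * block A s t * \<xi> t))" (is "?L \<longleftrightarrow> ?R")
    proof
      assume L: ?L
      show ?R
      proof
        fix \<xi> :: "nat \<times> 'x \<times> 'a \<Rightarrow> complex"
        from L have "0 \<le> (\<Sum>i<n. \<Sum>j<n. \<Sum>p\<in>UNIV. \<Sum>q\<in>UNIV.
            cnj ((\<chi> p. \<xi> (i, p)) $ p) * A $$ (i, j) $ p $ q * (\<chi> p. \<xi> (j, p)) $ q)"
          by (rule spec[of _ "\<lambda>i. \<chi> p. \<xi> (i, p)"])
        then show "0 \<le> (\<Sum>s\<in>?S. \<Sum>t\<in>?S. cnj (\<xi> s) * block A s t * \<xi> t)"
          by (simp only: vec_lambda_beta form)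
      qed
    next
      assume R: ?R
      show ?L
      proof
        fix \<xi> :: "nat \<Rightarrow> complex ^ ('x \<times> 'a)"
        show "0 \<le> (\<Sum>i<n. \<Sum>j<n. \<Sum>p\<in>UNIV. \<Sum>q\<in>UNIV. cnj (\<xi> i $ p) * A $$ (i, j) $ p $ q * \<xi> j $ q)"
          using R[rule_format, of "\<lambda>s. \<xi> (fst s) $ snd s"]
          unfolding form[of "\<lambda>s. \<xi> (fst s) $ snd s", symmetric] by simp
      qed
    qed
    then show ?thesis
      by (simp add: M_XA_def matrix_system_def)
  qed
  show ?thesis
  proof
    assume "A \<in> pos M_XA n"
    then have "A \<in> carrier_mat n n"
      and nonneg: "\<And>\<xi>. 0 \<le> (\<Sum>s\<in>?S. \<Sum>t\<in>?S. cnj (\<xi> s) * block A s t * \<xi> t)"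
      by (auto simp only: pos)
    moreover have "psd_on ?S (block A)"
      unfolding psd_on_def using nonneg by (auto simp only: complex_nonneg_iff)
    ultimately show "A \<in> carrier_mat n n \<and> hermitian_on ?S (block A) \<and> psd_on ?S (block A)"
      using hermitian_on_if_form_nonneg[OF _ nonneg] by simp
  next
    assume A: "A \<in> carrier_mat n n \<and> hermitian_on ?S (block A) \<and> psd_on ?S (block A)"
    have "0 \<le> (\<Sum>s\<in>?S. \<Sum>t\<in>?S. cnj (\<xi> s) * block A s t * \<xi> t)" for \<xi>
    proof -
      have "Im (\<Sum>s\<in>?S. \<Sum>t\<in>?S. block A s t * (cnj (\<xi> s) * \<xi> t)) = 0"
        using A by (intro hermitian_form_real) auto
      moreover have "(\<Sum>s\<in>?S. \<Sum>t\<in>?S. block A s t * (cnj (\<xi> s) * \<xi> t)) =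
          (\<Sum>s\<in>?S. \<Sum>t\<in>?S. cnj (\<xi> s) * block A s t * \<xi> t)"
        by (intro sum.cong HOL.refl) (simp add: ac_simps)
      ultimately show ?thesis
        using A unfolding psd_on_def by (simp only: complex_nonneg_iff)
    qed
    then show "A \<in> pos M_XA n"
      using A by (simp only: pos simp_thms)
  qed
qed

text \<open>A completely positive map sends the unit to the matrix that perturbs the image in
  \<open>quotient_universal\<close>; this makes that matrix positive, hence Hermitian.\<close>

lemma mat_unit_M_XA_pos: "mat_unit M_XA n \<in> pos M_XA n"
proof -
  let ?S = "{..<n} \<times> UNIV"
  have unit: "block (mat_unit M_XA n) s t = (if s = t then 1 else 0)" if "s \<in> ?S" "t \<in> ?S"
    for s t :: "nat \<times> 'a \<times> 'b"
    using that by (auto simp: block_def mat_unit_def Finite_Cartesian_Product.mat_def prod_eq_iff)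
  have "(\<Sum>s\<in>?S. \<Sum>t\<in>?S. cnj (\<xi> s) * block (mat_unit M_XA n) s t * \<xi> t) =
      complex_of_real (\<Sum>s\<in>?S. (cmod (\<xi> s))\<^sup>2)" for \<xi> :: "nat \<times> 'a \<times> 'b \<Rightarrow> complex"
  proof -
    have "(\<Sum>s\<in>?S. \<Sum>t\<in>?S. cnj (\<xi> s) * block (mat_unit M_XA n) s t * \<xi> t) =
        (\<Sum>s\<in>?S. \<Sum>t\<in>?S. if s = t then \<xi> s * cnj (\<xi> s) else 0)"
      by (intro sum.cong HOL.refl) (auto simp: unit)
    also have "\<dots> = (\<Sum>s\<in>?S. \<xi> s * cnj (\<xi> s))"
      by simp
    finally show ?thesis
      by (simp only: of_real_sum complex_norm_square)
  qed
  then have "psd_on ?S (block (mat_unit M_XA n :: (complex ^ ('a \<times> 'b) ^ ('a \<times> 'b)) Matrix.mat))"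
    by (simp add: psd_on_def sum_nonneg)
  then show ?thesis
    by (auto simp: pos_M_XA_iff hermitian_on_def unit) (simp add: mat_unit_def)
qed

lemma coset_M_XA: "J +>\<^bsub>M_XA\<^esub> \<mu> = {\<nu>. \<nu> - \<mu> \<in> J}"
  by (auto simp: a_r_coset_def' intro!: bexI[of _ "_ - \<mu>"])

lemma J_XA_0: "0 \<in> J_XA"
  and J_XA_add: "\<lbrakk>\<mu> \<in> J_XA; \<nu> \<in> J_XA\<rbrakk> \<Longrightarrow> \<mu> + \<nu> \<in> J_XA"
  and J_XA_smult: "\<mu> \<in> J_XA \<Longrightarrow> (\<chi> p q. c * \<mu> $ p $ q) \<in> J_XA"
  by (auto simp: J_XA_def sum.distrib simp flip: sum_distrib_left)

lemma J_XA_star: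
  assumes "\<mu> \<in> J_XA"
  shows "(\<chi> p q. cnj (\<mu> $ q $ p)) \<in> J_XA"
  using assms by (simp add: J_XA_def flip: cnj_sum)

text \<open>In tensor notation J consists of the matrices c \<otimes> 1 with c of trace zero. They
  are the test elements for functionals that annihilate J.\<close>

lemma unbalanced_in_J_XA:
  fixes c :: "'x::finite \<Rightarrow> 'x \<Rightarrow> complex"
  assumes "(\<Sum>x\<in>UNIV. c x x) = 0"
  shows "(\<chi> p q. if snd p = snd q then c (fst p) (fst q) else 0) \<in> (J_XA :: (complex ^ ('x \<times> 'a::finite) ^ ('x \<times> 'a)) set)"
  using assms by (simp add: J_XA_def)

text \<open>The abstract properties of the generators \<open>v\<^bsub>a,x\<^esub>\<close> of the universal TRO: the relations, and the
  occurrence of every strictly positive Gram matrix that is compatible with them.\<close>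

locale universal_family = operator_family H K v
  for H :: "('h, 'm) hilbert_scheme" and K :: "('k, 'n) hilbert_scheme" and v :: "'x::finite \<times> 'a::finite \<Rightarrow> 'h \<Rightarrow> 'k" +
  assumes v_relation: "\<lbrakk>\<xi> \<in> carrier H; \<eta> \<in> carrier H\<rbrakk> \<Longrightarrow>
      (\<Sum>a\<in>UNIV. ip K (v (x', a) \<xi>) (v (x, a) \<eta>)) = (if x = x' then ip H \<xi> \<eta> else 0)"
    and universal: "\<And>(n :: nat) (Q :: nat \<times> 'x \<times> 'a \<Rightarrow> nat \<times> 'x \<times> 'a \<Rightarrow> complex) \<epsilon> g. \<lbrakk>hermitian_on ({..<n} \<times> UNIV) Q; 0 < \<epsilon>;
      \<And>\<xi>. \<epsilon> * (\<Sum>s\<in>{..<n} \<times> UNIV. (cmod (\<xi> s))\<^sup>2) \<le>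
        Re (\<Sum>s\<in>{..<n} \<times> UNIV. \<Sum>t\<in>{..<n} \<times> UNIV. cnj (\<xi> s) * Q s t * \<xi> t);
      \<And>i j x x'. \<lbrakk>i < n; j < n\<rbrakk> \<Longrightarrow> (\<Sum>a\<in>UNIV. Q (i, x, a) (j, x', a)) = (if x = x' then g i j else 0)\<rbrakk> \<Longrightarrow>
      \<exists>h. (\<forall>i<n. h i \<in> carrier H) \<and>
        (\<forall>i<n. \<forall>j<n. \<forall>p q. ip K (v q (h j)) (v p (h i)) = Q (i, p) (j, q))"
begin

interpretation HH: hilbert_pair H H ..

text \<open>For each \<open>x\<close> the sum of v^* v over \<open>a\<close> is the identity, so the
  sum over all of X \<times> A is |X| times the identity; the division makes the map unital.\<close>

definition quot :: "complex ^ ('x \<times> 'a) ^ ('x \<times> 'a) \<Rightarrow> 'h \<Rightarrow> 'h" where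
  "quot \<mu> = gram_sum (\<chi> p q. \<mu> $ p $ q / of_nat CARD('x))"

lemma quot_bounded: "quot \<mu> \<in> bounded_ops H H"
  by (simp add: quot_def gram_sum_bounded)

lemma ip_quot:
  assumes "\<xi> \<in> carrier H" "\<eta> \<in> carrier H"
  shows "ip H (quot \<mu> \<xi>) \<eta> = (\<Sum>p\<in>UNIV. \<Sum>q\<in>UNIV. \<mu> $ p $ q * ip K (v q \<xi>) (v p \<eta>)) / of_nat CARD('x)"
  using assms by (simp add: quot_def ip_gram_sum sum_divide_distrib)

lemma quot_add: "quot (\<mu> + \<nu>) = quot \<mu> \<oplus>\<^bsub>op_space H H\<^esub> quot \<nu>"
  unfolding quot_def gram_sum_add[symmetric]
  by (rule arg_cong[of _ _ gram_sum]) (simp add: Finite_Cartesian_Product.vec_eq_iff add_divide_distrib)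

lemma quot_smult: "quot (\<chi> p q. c * \<mu> $ p $ q) = c \<odot>\<^bsub>op_space H H\<^esub> quot \<mu>"
  unfolding quot_def gram_sum_smult[symmetric]
  by (rule arg_cong[of _ _ gram_sum]) (simp add: Finite_Cartesian_Product.vec_eq_iff)

lemma quot_zero: "quot 0 = \<zero>\<^bsub>op_space H H\<^esub>"
  unfolding quot_def gram_sum_zero[symmetric]
  by (rule arg_cong[of _ _ gram_sum]) (simp add: Finite_Cartesian_Product.vec_eq_iff)

lemma quot_minus: "quot (\<mu> - \<nu>) = \<zero>\<^bsub>op_space H H\<^esub> \<longleftrightarrow> quot \<mu> = quot \<nu>"
proof -
  have "quot (\<mu> - \<nu>) = quot (\<mu> + (\<chi> p q. (- 1) * \<nu> $ p $ q))"
    by (rule arg_cong[of _ _ quot]) (simp add: Finite_Cartesian_Product.vec_eq_iff)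
  also have "\<dots> = quot \<mu> \<ominus>\<^bsub>op_space H H\<^esub> quot \<nu>"
    unfolding quot_add quot_smult by (rule HH.op_minus_eq_smult[symmetric]) (rule quot_bounded)+
  finally show ?thesis
    using HH.op_minus_eq_zeroD[OF quot_bounded quot_bounded] HH.op.r_neg[of "quot \<nu>"] quot_bounded
    by (auto simp: a_minus_def)
qed

lemma quot_star: "quot (\<chi> p q. cnj (\<mu> $ q $ p)) = adj H H (quot \<mu>)"
  by (simp add: quot_def gram_sum_adj)

lemma quot_unit: "quot (Finite_Cartesian_Product.mat 1) = (\<lambda>\<xi>\<in>carrier H. \<xi>)"
proof (rule HH.op_eqI[OF quot_bounded dom.id_op])
  fix \<xi> \<eta> assume *: "\<xi> \<in> carrier H" "\<eta> \<in> carrier H"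
  have "(\<Sum>p\<in>UNIV. \<Sum>q\<in>UNIV. (Finite_Cartesian_Product.mat 1 :: complex ^ ('x \<times> 'a) ^ ('x \<times> 'a)) $ p $ q * ip K (v q \<xi>) (v p \<eta>)) =
      (\<Sum>p\<in>UNIV. \<Sum>q\<in>UNIV. if p = q then ip K (v p \<xi>) (v p \<eta>) else 0)"
    by (intro sum.cong HOL.refl) (auto simp: Finite_Cartesian_Product.mat_def)
  also have "\<dots> = (\<Sum>p\<in>UNIV \<times> UNIV. ip K (v p \<xi>) (v p \<eta>))"
    by simp
  also have "\<dots> = of_nat CARD('x) * ip H \<xi> \<eta>"
    unfolding sum_Times v_relation[OF *] by simp
  finally show "ip H (quot (Finite_Cartesian_Product.mat 1) \<xi>) \<eta> = ip H ((\<lambda>\<xi>\<in>carrier H. \<xi>) \<xi>) \<eta>"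
    using * by (simp add: ip_quot)
qed

lemma range_quot: "range quot = range gram_sum"
proof
  show "range quot \<subseteq> range gram_sum"
    by (auto simp: quot_def)
  have "gram_sum \<mu> = quot (\<chi> p q. of_nat CARD('x) * \<mu> $ p $ q)" for \<mu>
    unfolding quot_def by (rule arg_cong[of _ _ gram_sum]) (simp add: Finite_Cartesian_Product.vec_eq_iff)
  then show "range gram_sum \<subseteq> range quot"
    by (metis image_subsetI rangeI)
qed

text \<open>\<open>T_XA\<close> is formed inside \<open>C_XA\<close>. Here the span is cut out of
  all bounded operators in one step; for the universal representation the two are identified
  later.\<close>

definition T :: "('h \<Rightarrow> 'h) opsys" where
  "T = operator_subsystem (bounded_op_system H) (range gram_sum)"

lemma T_simps [simp]:
  "carrier T = range quot" "\<one>\<^bsub>T\<^esub> = (\<lambda>\<xi>\<in>carrier H. \<xi>)" "\<zero>\<^bsub>T\<^esub> = \<zero>\<^bsub>op_space H H\<^esub>"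
  "add T = add (op_space H H)" "smult T = smult (op_space H H)" "star T = adj H H"
  by (simp_all add: T_def operator_subsystem_def range_quot)

lemma T_pos: "A \<in> pos T n \<longleftrightarrow> A \<in> pos (bounded_op_system H) n \<and> A \<in> matrices n T"
proof -
  have dims: "A \<in> carrier_mat n n" if "A \<in> pos (bounded_op_system H) n"
    using operator_system.pos_hermitian[OF dom.bounded_op_system that] unfolding matrices_def by blast
  have "A \<in> pos T n \<longleftrightarrow> A \<in> pos (bounded_op_system H) n \<and> elements_mat A \<subseteq> range quot"
    unfolding T_def operator_subsystem_def range_quot by simp
  then show ?thesis
    using dims elements_mat_subset_iff[of A n "range quot"] unfolding matrices_def T_simps by blast
qed

lemma operator_system_T: "operator_system T"
  unfolding T_def
proof (rule operator_system.operator_subsystem[OF dom.bounded_op_system])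
  show "submodule class_ring (range gram_sum) (bounded_op_system H)"
    using range_gram_sum_submodule dom.bounded_op_system_module by (simp add: submodule_def)
  show "star (bounded_op_system H) w \<in> range gram_sum" if "w \<in> range gram_sum" for w
    using that by (auto simp: gram_sum_adj)
  show "\<one>\<^bsub>bounded_op_system H\<^esub> \<in> range gram_sum"
    using quot_unit range_quot by (metis dom.bounded_op_system_simps(2) rangeI)
qed

lemma op_form_quot:
  assumes \<xi>: "\<forall>i<n. \<xi> i \<in> carrier H" and A: "A \<in> carrier_mat n n"
  shows "dom.op_form n (map_mat quot A) \<xi> \<xi> =
    (\<Sum>s\<in>{..<n} \<times> UNIV. \<Sum>t\<in>{..<n} \<times> UNIV.
      block A s t * ip K (v (snd t) (\<xi> (fst t))) (v (snd s) (\<xi> (fst s)))) / of_nat CARD('x)"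
proof -
  let ?A = "map_mat (\<lambda>\<mu>. \<chi> p q. \<mu> $ p $ q / of_nat CARD('x)) A"
  have "map_mat quot A = map_mat gram_sum ?A"
    by (intro eq_matI) (auto simp: quot_def)
  then have "dom.op_form n (map_mat quot A) \<xi> \<xi> =
    (\<Sum>s\<in>{..<n} \<times> UNIV. \<Sum>t\<in>{..<n} \<times> UNIV.
      (?A $$ (fst s, fst t)) $ snd s $ snd t * ip K (v (snd t) (\<xi> (fst t))) (v (snd s) (\<xi> (fst s))))"
    using op_form_gram_sum[OF \<xi>, of ?A] A by simp
  also have "\<dots> = (\<Sum>s\<in>{..<n} \<times> UNIV. \<Sum>t\<in>{..<n} \<times> UNIV.
      block A s t * ip K (v (snd t) (\<xi> (fst t))) (v (snd s) (\<xi> (fst s))) / of_nat CARD('x))"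
    using A by (intro sum.cong HOL.refl) (auto simp: block_def)
  finally show ?thesis
    by (simp only: sum_divide_distrib)
qed

lemma map_quot_matrices: "A \<in> carrier_mat n n \<Longrightarrow> map_mat quot A \<in> matrices n T"
  by (auto simp: matrices_def)

text \<open>The form of the image pairs the scalar matrix with the Gram matrix of the vectors
  \<open>v p (\<xi> i)\<close>, so \<open>gram_nonneg\<close> settles all matrix sizes at
  once.\<close>

lemma map_quot_pos:
  assumes A: "A \<in> pos M_XA n"
  shows "map_mat quot A \<in> pos T n"
proof -
  let ?S = "{..<n} \<times> (UNIV :: ('x \<times> 'a) set)"
  have dims: "A \<in> carrier_mat n n" and herm: "hermitian_on ?S (block A)" and psd: "psd_on ?S (block A)"
    using A by (auto simp: pos_M_XA_iff)
  have "0 \<le> dom.op_form n (map_mat quot A) \<xi> \<xi>" if \<xi>: "\<forall>i<n. \<xi> i \<in> carrier H" for \<xi>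
  proof -
    let ?w = "\<lambda>s. v (snd s) (\<xi> (fst s))"
    let ?z = "\<Sum>s\<in>?S. \<Sum>t\<in>?S. block A s t * ip K (?w t) (?w s)"
    have w: "?w s \<in> carrier K" if "s \<in> ?S" for s
      using that \<xi> v_bounded by auto
    have "0 \<le> Re ?z"
      using herm psd by (intro cod.gram_nonneg w) (auto simp: hermitian_on_def psd_on_def)
    moreover have "Im ?z = 0"
    proof (rule hermitian_form_real[OF herm])
      fix s t assume s: "s \<in> ?S" and t: "t \<in> ?S"
      show "cnj (ip K (?w t) (?w s)) = ip K (?w s) (?w t)"
        by (rule cod.ip_cnj[OF w[OF t] w[OF s], symmetric])
    qed
    ultimately show ?thesis
      unfolding op_form_quot[OF \<xi> dims] by (simp only: complex_nonneg_iff Re_divide_of_nat Im_divide_of_nat) auto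
  qed
  then show ?thesis
    unfolding T_pos dom.pos_iff using map_quot_matrices[OF dims] dims quot_bounded
    by (auto simp: dom.matrices_iff)
qed

text \<open>An element of J is of the form c \<otimes> 1, and the relations reduce its image to the
  trace of c times the identity, up to the factor 1/|X|.\<close>

lemma quot_J_XA: "\<mu> \<in> J_XA \<Longrightarrow> quot \<mu> = \<zero>\<^bsub>op_space H H\<^esub>"
proof (rule HH.op_eqI[OF quot_bounded HH.zero_op])
  fix \<xi> \<eta> assume \<mu>: "\<mu> \<in> J_XA" and *: "\<xi> \<in> carrier H" "\<eta> \<in> carrier H"
  \<comment> \<open>The diagonal blocks of \<mu> agree, so any one index in A recovers
    \<open>c\<close>.\<close>
  obtain a0 :: 'a where True by simp
  define c where "c x x' = \<mu> $ (x, a0) $ (x', a0)" for x x'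
  have \<mu>_eq: "\<mu> $ (x, a) $ (x', a') = (if a = a' then c x x' else 0)" for x x' a a'
  proof (cases "a = a0")
    case False
    then show ?thesis
      using \<mu> unfolding J_XA_def c_def by auto
  qed (use \<mu> in \<open>auto simp: J_XA_def c_def\<close>)
  have tr: "(\<Sum>x\<in>UNIV. c x x) = 0"
    using \<mu> by (simp add: J_XA_def c_def)
  have "(\<Sum>p\<in>UNIV \<times> UNIV. \<Sum>q\<in>UNIV \<times> UNIV. \<mu> $ p $ q * ip K (v q \<xi>) (v p \<eta>)) =
      (\<Sum>x\<in>UNIV. \<Sum>a\<in>UNIV. \<Sum>x'\<in>UNIV. c x x' * ip K (v (x', a) \<xi>) (v (x, a) \<eta>))"
  proof -
    have "(\<Sum>a'\<in>UNIV. \<mu> $ (x, a) $ (x', a') * ip K (v (x', a') \<xi>) (v (x, a) \<eta>)) =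
        c x x' * ip K (v (x', a) \<xi>) (v (x, a) \<eta>)" for x a x'
    proof -
      have "(\<Sum>a'\<in>UNIV. \<mu> $ (x, a) $ (x', a') * ip K (v (x', a') \<xi>) (v (x, a) \<eta>)) =
          (\<Sum>a'\<in>UNIV. if a = a' then c x x' * ip K (v (x', a) \<xi>) (v (x, a) \<eta>) else 0)"
        by (intro sum.cong) (auto simp: \<mu>_eq)
      then show ?thesis by simp
    qed
    then show ?thesis
      unfolding sum_Times by simp
  qed
  also have "\<dots> = (\<Sum>x\<in>UNIV. \<Sum>x'\<in>UNIV. c x x' * (\<Sum>a\<in>UNIV. ip K (v (x', a) \<xi>) (v (x, a) \<eta>)))"
    unfolding sum_distrib_left by (intro sum.cong HOL.refl sum.swap)
  also have "\<dots> = (\<Sum>x\<in>UNIV. c x x * ip H \<xi> \<eta>)"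
  proof (intro sum.cong HOL.refl)
    fix x
    have "(\<Sum>x'\<in>UNIV. c x x' * (\<Sum>a\<in>UNIV. ip K (v (x', a) \<xi>) (v (x, a) \<eta>))) =
        (\<Sum>x'\<in>UNIV. if x = x' then c x x * ip H \<xi> \<eta> else 0)"
      unfolding v_relation[OF *] by (intro sum.cong) auto
    then show "(\<Sum>x'\<in>UNIV. c x x' * (\<Sum>a\<in>UNIV. ip K (v (x', a) \<xi>) (v (x, a) \<eta>))) = c x x * ip H \<xi> \<eta>"
      by simp
  qed
  also have "\<dots> = 0"
    using tr by (simp flip: sum_distrib_right)
  finally show "ip H (quot \<mu> \<xi>) \<eta> = ip H (\<zero>\<^bsub>op_space H H\<^esub> \<xi>) \<eta>"
    using * by (simp add: ip_quot)
qed

text \<open>For large \<open>k\<close> the matrix \<open>k + R\<close> is the Gram matrix of a single vector; comparing two values of \<open>k\<close>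
  separates \<open>R\<close> from the identity.\<close>

lemma quot_zero_pairing_hermitian:
  assumes \<mu>: "quot \<mu> = \<zero>\<^bsub>op_space H H\<^esub>"
    and R: "\<And>p q. cnj (R p q) = R q p"
    and rel: "\<And>x x'. (\<Sum>a\<in>UNIV. R (x, a) (x', a)) = (if x = x' then g else 0)"
  shows "(\<Sum>p\<in>UNIV. \<Sum>q\<in>UNIV. \<mu> $ p $ q * R p q) = 0"
proof -
  \<comment> \<open>\<open>m\<close> bounds the operator norm of \<open>R\<close>, so k \<ge> m + 1
    makes k + R at least the identity, as strict positivity requires.\<close>
  define m where "m = (\<Sum>p\<in>UNIV. \<Sum>q\<in>UNIV. cmod (R p q))"
  define \<tau> where "\<tau> = (\<Sum>p\<in>UNIV. \<mu> $ p $ p)"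
  have shifted: "complex_of_real k * \<tau> + (\<Sum>p\<in>UNIV. \<Sum>q\<in>UNIV. \<mu> $ p $ q * R p q) = 0" if k: "m + 1 \<le> k" for k
  proof -
    \<comment> \<open>With n = 1 the first component of an index is constant. The multiple of the
      identity contributes |A| times \<open>k\<close> to the relation, whence the choice of
      \<open>g\<close> below.\<close>
    define Q where "Q s t = (if snd s = snd t then complex_of_real k else 0) + R (snd s) (snd t)"
      for s t :: "nat \<times> 'x \<times> 'a"
    let ?S = "{..<1} \<times> (UNIV :: ('x \<times> 'a) set)"
    have "\<exists>h. (\<forall>i<1. h i \<in> carrier H) \<and> (\<forall>i<1. \<forall>j<1. \<forall>p q. ip K (v q (h j)) (v p (h i)) = Q (i, p) (j, q))"
    proof (rule universal[where \<epsilon> = 1 and n = 1 and Q = Q and g = "\<lambda>_ _. of_nat CARD('a) * complex_of_real k + g"])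
      show "hermitian_on ?S Q"
        by (simp add: hermitian_on_def Q_def R)
      show "(\<Sum>a\<in>UNIV. Q (i, x, a) (j, x', a)) = (if x = x' then of_nat CARD('a) * complex_of_real k + g else 0)" for i j x x'
        by (simp add: Q_def sum.distrib rel)
      fix \<xi> :: "nat \<times> 'x \<times> 'a \<Rightarrow> complex"
      define y where "y = (\<Sum>p\<in>UNIV. (cmod (\<xi> (0, p)))\<^sup>2)"
      have "0 \<le> y"
        unfolding y_def by (rule sum_nonneg) simp
      have le_y: "(cmod (\<xi> (0, p)))\<^sup>2 \<le> y" for p
        unfolding y_def by (rule member_le_sum) auto
      have prod_le: "cmod (\<xi> (0, p)) * cmod (\<xi> (0, q)) \<le> y" for p q
      proof -
        have "0 \<le> (cmod (\<xi> (0, p)) - cmod (\<xi> (0, q)))\<^sup>2"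
          by simp
        then show ?thesis
          using le_y[of p] le_y[of q] unfolding power2_diff by simp
      qed
      have "cmod (\<Sum>p\<in>UNIV. \<Sum>q\<in>UNIV. cnj (\<xi> (0, p)) * R p q * \<xi> (0, q)) \<le> m * y"
      proof -
        have "cmod (\<Sum>p\<in>UNIV. \<Sum>q\<in>UNIV. cnj (\<xi> (0, p)) * R p q * \<xi> (0, q)) \<le>
            (\<Sum>p\<in>UNIV. \<Sum>q\<in>UNIV. cmod (cnj (\<xi> (0, p)) * R p q * \<xi> (0, q)))"
          by (intro order_trans[OF norm_sum] sum_mono norm_sum)
        also have "\<dots> \<le> (\<Sum>p\<in>UNIV. \<Sum>q\<in>UNIV. cmod (R p q) * y)"
        proof (intro sum_mono)
          fix p q
          have "cmod (R p q) * (cmod (\<xi> (0, p)) * cmod (\<xi> (0, q))) \<le> cmod (R p q) * y"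
            by (intro mult_left_mono prod_le) simp
          then show "cmod (cnj (\<xi> (0, p)) * R p q * \<xi> (0, q)) \<le> cmod (R p q) * y"
            by (simp add: norm_mult ac_simps)
        qed
        finally show ?thesis
          by (simp add: m_def sum_distrib_right)
      qed
      then have R_ge: "- (m * y) \<le> Re (\<Sum>p\<in>UNIV. \<Sum>q\<in>UNIV. cnj (\<xi> (0, p)) * R p q * \<xi> (0, q))"
        using abs_Re_le_cmod[of "\<Sum>p\<in>UNIV. \<Sum>q\<in>UNIV. cnj (\<xi> (0, p)) * R p q * \<xi> (0, q)"] by linarith
      have "(\<Sum>s\<in>?S. \<Sum>t\<in>?S. cnj (\<xi> s) * Q s t * \<xi> t) =
          (\<Sum>p\<in>UNIV. \<Sum>q\<in>UNIV. cnj (\<xi> (0, p)) * Q (0, p) (0, q) * \<xi> (0, q))"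
        unfolding sum_Times by (simp add: lessThan_Suc)
      also have "\<dots> =
          (\<Sum>p\<in>UNIV. \<Sum>q\<in>UNIV. (if p = q then complex_of_real k * (\<xi> (0, p) * cnj (\<xi> (0, p))) else 0) +
            cnj (\<xi> (0, p)) * R p q * \<xi> (0, q))"
        by (intro sum.cong HOL.refl) (auto simp: Q_def algebra_simps)
      also have "\<dots> = complex_of_real (k * y) + (\<Sum>p\<in>UNIV. \<Sum>q\<in>UNIV. cnj (\<xi> (0, p)) * R p q * \<xi> (0, q))"
        unfolding sum.distrib complex_norm_square[symmetric] by (simp add: y_def sum_distrib_left)
      finally have form: "Re (\<Sum>s\<in>?S. \<Sum>t\<in>?S. cnj (\<xi> s) * Q s t * \<xi> t) =
          k * y + Re (\<Sum>p\<in>UNIV. \<Sum>q\<in>UNIV. cnj (\<xi> (0, p)) * R p q * \<xi> (0, q))"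
        by (simp only: plus_complex.sel Re_complex_of_real)
      have "(\<Sum>s\<in>?S. (cmod (\<xi> s))\<^sup>2) = y"
        unfolding sum_Times by (simp add: y_def lessThan_Suc)
      moreover have "(m + 1) * y \<le> k * y"
        using k \<open>0 \<le> y\<close> by (rule mult_right_mono)
      ultimately show "1 * (\<Sum>s\<in>?S. (cmod (\<xi> s))\<^sup>2) \<le> Re (\<Sum>s\<in>?S. \<Sum>t\<in>?S. cnj (\<xi> s) * Q s t * \<xi> t)"
        using form R_ge by (simp add: distrib_right)
    qed simp
    then obtain h where h: "h \<in> carrier H" and gram: "\<And>p q. ip K (v q h) (v p h) = Q (0, p) (0, q)"
      by auto
    have "ip H (quot \<mu> h) h = 0"
      using h by (simp add: \<mu>)
    then have "(\<Sum>p\<in>UNIV. \<Sum>q\<in>UNIV. \<mu> $ p $ q * Q (0, p) (0, q)) = 0"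
      using h by (simp add: ip_quot gram)
    moreover have "(\<Sum>p\<in>UNIV. \<Sum>q\<in>UNIV. \<mu> $ p $ q * Q (0, p) (0, q)) =
        (\<Sum>p\<in>UNIV. \<Sum>q\<in>UNIV. (if p = q then complex_of_real k * \<mu> $ p $ p else 0) + \<mu> $ p $ q * R p q)"
      by (intro sum.cong HOL.refl) (auto simp: Q_def algebra_simps)
    ultimately show ?thesis
      by (simp add: sum.distrib \<tau>_def sum_distrib_left)
  qed
  let ?X = "\<Sum>p\<in>UNIV. \<Sum>q\<in>UNIV. \<mu> $ p $ q * R p q"
  have eqs: "complex_of_real (m + 1) * \<tau> + ?X = 0" "complex_of_real (m + 2) * \<tau> + ?X = 0"
    by (rule shifted; simp)+
  have "\<tau> = (complex_of_real (m + 2) * \<tau> + ?X) - (complex_of_real (m + 1) * \<tau> + ?X)"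
    by (simp only: add_diff_cancel_right) (simp add: algebra_simps)
  then have "\<tau> = 0"
    by (simp only: eqs diff_self)
  then show ?thesis
    using eqs(1) by (simp only: mult_zero_right add_0)
qed

text \<open>For every scalar c the sum of c b and its adjoint is Hermitian and still compatible with
  the relation. The cases c = 1 and c = \<i> together isolate the pairing with
  \<open>b\<close>.\<close>

lemma quot_zero_pairing:
  assumes \<mu>: "quot \<mu> = \<zero>\<^bsub>op_space H H\<^esub>"
    and rel: "\<And>x x'. (\<Sum>a\<in>UNIV. b (x, a) (x', a)) = (if x = x' then g else 0)"
  shows "(\<Sum>p\<in>UNIV. \<Sum>q\<in>UNIV. \<mu> $ p $ q * b p q) = 0"
proof -
  have eq: "c * (\<Sum>p\<in>UNIV. \<Sum>q\<in>UNIV. \<mu> $ p $ q * b p q) + cnj c * (\<Sum>p\<in>UNIV. \<Sum>q\<in>UNIV. \<mu> $ p $ q * cnj (b q p)) = 0" for c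
  proof -
    have "(\<Sum>p\<in>UNIV. \<Sum>q\<in>UNIV. \<mu> $ p $ q * (c * b p q + cnj c * cnj (b q p))) = 0"
    proof (rule quot_zero_pairing_hermitian[OF \<mu>])
      show "(\<Sum>a\<in>UNIV. c * b (x, a) (x', a) + cnj c * cnj (b (x', a) (x, a))) =
          (if x = x' then c * g + cnj c * cnj g else 0)" for x x'
        by (simp add: sum.distrib rel flip: sum_distrib_left cnj_sum)
    qed simp
    then show ?thesis
      by (simp add: distrib_left sum.distrib sum_distrib_left ac_simps)
  qed
  from eq[of 1] eq[of \<i>] show ?thesis
    by (simp add: complex_eq_iff)
qed

text \<open>\<mu> pairs to zero with every matrix whose partial trace over A is a multiple of the
  identity. Three kinds of these read off the conditions of J: a matrix unit with a \<noteq> a', the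
  difference of two units in diagonal blocks, and the sum over x of the diagonal units at a fixed
  \<open>a\<close>, where g = 1.\<close>

lemma quot_eq_zero_iff: "quot \<mu> = \<zero>\<^bsub>op_space H H\<^esub> \<longleftrightarrow> \<mu> \<in> J_XA"
proof
  assume \<mu>: "quot \<mu> = \<zero>\<^bsub>op_space H H\<^esub>"
  have pick: "(\<Sum>p\<in>UNIV. \<Sum>q\<in>UNIV. \<mu> $ p $ q * (if p = p0 \<and> q = q0 then 1 else 0)) = \<mu> $ p0 $ q0" for p0 q0
  proof -
    have "(\<Sum>p\<in>UNIV. \<Sum>q\<in>UNIV. \<mu> $ p $ q * (if p = p0 \<and> q = q0 then 1 else 0)) =
        (\<Sum>p\<in>UNIV. if p = p0 then \<Sum>q\<in>UNIV. if q = q0 then \<mu> $ p $ q else 0 else 0)"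
      by (intro sum.cong HOL.refl) (auto simp: if_distrib[of "\<lambda>z. _ * z"] cong: if_cong)
    then show ?thesis by simp
  qed
  have "\<mu> $ (x, a) $ (x', a') = 0" if "a \<noteq> a'" for x x' a a'
  proof -
    have "(\<Sum>p\<in>UNIV. \<Sum>q\<in>UNIV. \<mu> $ p $ q * (if p = (x, a) \<and> q = (x', a') then 1 else 0)) = 0"
      by (rule quot_zero_pairing[OF \<mu>, where g = 0]) (use that in auto)
    then show ?thesis
      unfolding pick .
  qed
  moreover have "\<mu> $ (x, a) $ (x', a) = \<mu> $ (x, a') $ (x', a')" for x x' a a'
  proof -
    have "(\<Sum>p\<in>UNIV. \<Sum>q\<in>UNIV. \<mu> $ p $ q * ((if p = (x, a) \<and> q = (x', a) then 1 else 0) -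
        (if p = (x, a') \<and> q = (x', a') then 1 else 0))) = 0"
    proof (rule quot_zero_pairing[OF \<mu>, where g = 0])
      fix y y' :: 'x
      have "(\<Sum>b\<in>UNIV. if (y, b) = (x, a) \<and> (y', b) = (x', a) then 1 else 0 :: complex) = (if y = x \<and> y' = x' then 1 else 0)" for a :: 'a
        by (cases "y = x \<and> y' = x'") auto
      then show "(\<Sum>b\<in>UNIV. (if (y, b) = (x, a) \<and> (y', b) = (x', a) then 1 else 0) -
          (if (y, b) = (x, a') \<and> (y', b) = (x', a') then 1 else 0)) = (if y = y' then 0 else (0 :: complex))"
        unfolding sum_subtractf by simp
    qed
    then show ?thesis
      unfolding right_diff_distrib sum_subtractf pick by simp
  qed
  moreover have "(\<Sum>x\<in>UNIV. \<mu> $ (x, a) $ (x, a)) = 0" for a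
  proof -
    have "(\<Sum>p\<in>UNIV. \<Sum>q\<in>UNIV. \<mu> $ p $ q * (\<Sum>x\<in>UNIV. if p = (x, a) \<and> q = (x, a) then 1 else 0)) = 0"
    proof (rule quot_zero_pairing[OF \<mu>, where g = 1])
      fix y y' :: 'x
      have "(\<Sum>b\<in>UNIV. \<Sum>x\<in>UNIV. if (y, b) = (x, a) \<and> (y', b) = (x, a) then 1 else 0 :: complex) =
          (\<Sum>b\<in>UNIV. if b = a then if y = y' then 1 else 0 else 0)"
        by (intro sum.cong HOL.refl) (auto simp: eq_commute[of y])
      then show "(\<Sum>b\<in>UNIV. \<Sum>x\<in>UNIV. if (y, b) = (x, a) \<and> (y', b) = (x, a) then 1 else 0 :: complex) =
          (if y = y' then 1 else 0)"
        by simp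
    qed
    then have "(\<Sum>x\<in>UNIV. \<Sum>p\<in>UNIV. \<Sum>q\<in>UNIV. \<mu> $ p $ q * (if p = (x, a) \<and> q = (x, a) then 1 else 0)) = 0"
      unfolding sum_distrib_left by (subst sum_rotate)
    then show ?thesis
      unfolding pick .
  qed
  ultimately show "\<mu> \<in> J_XA"
    by (simp add: J_XA_def)
qed (rule quot_J_XA)

end

context universal_family
begin

interpretation HH: hilbert_pair H H ..

text \<open>Failure of the conclusion leaves \<open>block B\<close> at distance at least
  \<open>r\<close> from the cone, so the separation is strict without any closedness of that
  cone.\<close>

lemma positive_lift:
  assumes B: "B \<in> carrier_mat n n" and herm: "hermitian_on ({..<n} \<times> UNIV) (block B)"
    and pos: "map_mat quot B \<in> pos T n" and "0 < r"
  shows "\<exists>C\<in>pos M_XA n. \<forall>i<n. \<forall>j<n. C $$ (i, j) -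
    (B $$ (i, j) + (if i = j then (\<chi> p q. complex_of_real r * Finite_Cartesian_Product.mat 1 $ p $ q) else 0)) \<in> J_XA"
proof (rule ccontr)
  assume no_lift: "\<not> ?thesis"
  let ?S = "{..<n} \<times> (UNIV :: ('x \<times> 'a) set)"
  \<comment> \<open>The n by n matrices over J, written as functions of two indices to fit
    \<open>separating_functional\<close>.\<close>
  define J where "J = {b. \<forall>i<n. \<forall>j<n. (\<chi> p q. b (i, p) (j, q)) \<in> (J_XA :: (complex ^ ('x \<times> 'a) ^ ('x \<times> 'a)) set)}"
  have zero_mat: "(\<chi> p q. 0) = (0 :: complex ^ ('x \<times> 'a) ^ ('x \<times> 'a))"
    by (simp add: Finite_Cartesian_Product.vec_eq_iff)
  have J0: "(\<lambda>_ _. 0) \<in> J"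
    by (simp add: J_def zero_mat J_XA_0)
  have J_add: "(\<lambda>s t. b s t + c s t) \<in> J" if "b \<in> J" "c \<in> J" for b c
  proof -
    have "(\<chi> p q. b (i, p) (j, q) + c (i, p) (j, q)) \<in> (J_XA :: (complex ^ ('x \<times> 'a) ^ ('x \<times> 'a)) set)" if "i < n" "j < n" for i j
    proof -
      have "(\<chi> p q. b (i, p) (j, q) + c (i, p) (j, q)) = (\<chi> p q. b (i, p) (j, q)) + (\<chi> p q. c (i, p) (j, q))"
        by (simp add: Finite_Cartesian_Product.vec_eq_iff)
      moreover have "(\<chi> p q. b (i, p) (j, q)) \<in> (J_XA :: (complex ^ ('x \<times> 'a) ^ ('x \<times> 'a)) set)"
        "(\<chi> p q. c (i, p) (j, q)) \<in> (J_XA :: (complex ^ ('x \<times> 'a) ^ ('x \<times> 'a)) set)"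
        using \<open>b \<in> J\<close> \<open>c \<in> J\<close> that by (simp_all add: J_def)
      ultimately show ?thesis
        by (simp only: J_XA_add)
    qed
    then show ?thesis
      by (simp add: J_def)
  qed
  have J_scale: "(\<lambda>s t. k * b s t) \<in> J" if "b \<in> J" for k b
    using that J_XA_smult[of "\<chi> p q. b (i, p) (j, q)" k for i j] by (simp add: J_def)
  have not_psd: "\<not> psd_on ?S (\<lambda>s t. block B s t + (if s = t then complex_of_real r else 0) + (b s t + cnj (b t s)))"
    if b: "b \<in> J" for b
  proof
    let ?F = "\<lambda>s t. block B s t + (if s = t then complex_of_real r else 0) + (b s t + cnj (b t s))"
    assume psd: "psd_on ?S ?F"
    \<comment> \<open>A positive semidefinite matrix of this shape would be a lift: it differs from
      B + r by b + b^*, and J is closed under the involution.\<close>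
    define C where "C = Matrix.mat n n (\<lambda>(i, j). \<chi> p q. ?F (i, p) (j, q))"
    have C: "block C s t = ?F s t" if "s \<in> ?S" "t \<in> ?S" for s t
      unfolding block_def[of C] unfolding C_def using that by (auto split: if_splits)
    have "psd_on ?S (block C)"
      using psd unfolding psd_on_def by (simp add: C cong: sum.cong_simp)
    moreover have "hermitian_on ?S (block C)"
      using herm by (auto simp: hermitian_on_def C add.commute)
    moreover have "C \<in> carrier_mat n n"
      by (simp add: C_def)
    ultimately have "C \<in> pos M_XA n"
      by (simp only: pos_M_XA_iff simp_thms)
    moreover have "C $$ (i, j) - (B $$ (i, j) +
        (if i = j then (\<chi> p q. complex_of_real r * Finite_Cartesian_Product.mat 1 $ p $ q) else 0)) \<in> J_XA"
      if ij: "i < n" "j < n" for i j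
    proof -
      have "C $$ (i, j) - (B $$ (i, j) +
          (if i = j then (\<chi> p q. complex_of_real r * Finite_Cartesian_Product.mat 1 $ p $ q) else 0)) =
        (\<chi> p q. b (i, p) (j, q)) + (\<chi> p q. cnj ((\<chi> p q. b (j, p) (i, q)) $ q $ p))"
        using ij by (auto simp: Finite_Cartesian_Product.vec_eq_iff C_def block_def Finite_Cartesian_Product.mat_def)
      also have "\<dots> \<in> J_XA"
        using b ij by (intro J_XA_add J_XA_star) (auto simp: J_def)
      finally show ?thesis .
    qed
    ultimately show False
      using no_lift by blast
  qed
  obtain Q where Q: "hermitian_on ?S Q" "psd_on ?S Q"
    and Q_J: "\<And>b. b \<in> J \<Longrightarrow> (\<Sum>s\<in>?S. \<Sum>t\<in>?S. b s t * Q s t) = 0"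
    and Q_B: "Re (\<Sum>s\<in>?S. \<Sum>t\<in>?S. block B s t * Q s t) < 0"
    by (rule separating_functional[of ?S "block B" r J, OF _ herm \<open>0 < r\<close> J0 J_add J_scale not_psd]) auto
  \<comment> \<open>The partial trace over A of the (i,j) block of \<open>Q\<close>. Pairing that
    block with c \<otimes> 1 pairs \<open>c\<close> with \<open>G i j\<close>, so vanishing for all
    \<open>c\<close> of trace zero makes \<open>G i j\<close> a multiple of the identity.\<close>
  define G where "G i j x x' = (\<Sum>a\<in>UNIV. Q (i, x, a) (j, x', a))" for i j x x'
  have G_pairing: "(\<Sum>x\<in>UNIV. \<Sum>x'\<in>UNIV. c x x' * G i j x x') = 0"
    if ij: "i < n" "j < n" and c: "(\<Sum>x\<in>UNIV. c x x) = 0" for i j c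
  proof -
    \<comment> \<open>The matrix c \<otimes> 1 placed in the block (i,j), with zeros
      elsewhere.\<close>
    define b where "b s t = (if fst s = i \<and> fst t = j \<and> snd (snd s) = snd (snd t)
      then c (fst (snd s)) (fst (snd t)) else 0)" for s t :: "nat \<times> 'x \<times> 'a"
    have "(\<chi> p q. b (i', p) (j', q)) \<in> (J_XA :: (complex ^ ('x \<times> 'a) ^ ('x \<times> 'a)) set)" for i' j'
      by (cases "i' = i \<and> j' = j") (auto simp: b_def zero_mat J_XA_0 unbalanced_in_J_XA[of c, OF c] cong: if_cong)
    then have "b \<in> J"
      by (simp add: J_def)
    define row where "row p = (\<Sum>q\<in>UNIV \<times> UNIV. if snd p = snd q then c (fst p) (fst q) * Q (i, p) (j, q) else 0)"
      for p :: "'x \<times> 'a"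
    have inner: "(\<Sum>q\<in>UNIV. b (i', p) (j', q) * Q (i', p) (j', q)) = (if i' = i \<and> j' = j then row p else 0)"
      for i' j' p
    proof (cases "i' = i \<and> j' = j")
      case True
      then show ?thesis
        by (auto simp: b_def row_def intro!: sum.cong)
    next
      case False
      then show ?thesis
        by (auto simp: b_def intro!: sum.neutral)
    qed
    have collapse: "(\<Sum>j'<n. if i' = i \<and> j' = j then row p else 0) = (if i' = i then row p else 0)" for i' p
      using ij by (cases "i' = i") simp_all
    have "(\<Sum>s\<in>?S. \<Sum>t\<in>?S. b s t * Q s t) = (\<Sum>i'<n. \<Sum>p\<in>UNIV. if i' = i then row p else 0)"
      unfolding sum_Times inner collapse ..
    also have "\<dots> = (\<Sum>p\<in>UNIV. \<Sum>i'<n. if i' = i then row p else 0)"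
      by (rule sum.swap)
    also have "\<dots> = (\<Sum>p\<in>UNIV \<times> UNIV. row p)"
      using ij by simp
    also have "\<dots> = (\<Sum>x\<in>UNIV. \<Sum>a\<in>UNIV. \<Sum>x'\<in>UNIV. c x x' * Q (i, x, a) (j, x', a))"
      unfolding row_def sum_Times by simp
    also have "\<dots> = (\<Sum>x\<in>UNIV. \<Sum>x'\<in>UNIV. c x x' * G i j x x')"
      unfolding G_def sum_distrib_left by (intro sum.cong HOL.refl sum.swap)
    finally show ?thesis
      using Q_J[OF \<open>b \<in> J\<close>] by simp
  qed
  have pick: "(\<Sum>x\<in>UNIV. \<Sum>x'\<in>UNIV. (if x = x1 \<and> x' = x2 then 1 else 0) * g x x') = g x1 x2"
    for x1 x2 :: 'x and g :: "'x \<Rightarrow> 'x \<Rightarrow> complex"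
  proof -
    have "(\<Sum>x\<in>UNIV. \<Sum>x'\<in>UNIV. (if x = x1 \<and> x' = x2 then 1 else 0) * g x x') =
        (\<Sum>x\<in>UNIV. if x = x1 then \<Sum>x'\<in>UNIV. if x' = x2 then g x x' else 0 else 0)"
      by (intro sum.cong HOL.refl) (auto simp: if_distrib[of "\<lambda>z. z * _"] cong: if_cong)
    then show ?thesis by simp
  qed
  have G_off: "G i j x1 x2 = 0" if "i < n" "j < n" "x1 \<noteq> x2" for i j x1 x2
    using G_pairing[of i j "\<lambda>x x'. if x = x1 \<and> x' = x2 then 1 else 0"] that unfolding pick by (auto intro!: sum.neutral)
  obtain x0 :: 'x where True by simp
  have G_diag: "G i j x1 x1 = G i j x0 x0" if "i < n" "j < n" for i j x1
  proof -
    have tr: "(\<Sum>x\<in>UNIV. (if x = x1 \<and> x = x1 then 1 else 0) - (if x = x0 \<and> x = x0 then 1 else 0)) = (0 :: complex)"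
      unfolding sum_subtractf by simp
    show ?thesis
      using G_pairing[of i j "\<lambda>x x'. (if x = x1 \<and> x' = x1 then 1 else 0) - (if x = x0 \<and> x' = x0 then 1 else 0)", OF that tr] unfolding left_diff_distrib sum_subtractf pick by simp
  qed
  define \<delta> where "\<delta> = - Re (\<Sum>s\<in>?S. \<Sum>t\<in>?S. block B s t * Q s t)"
  define \<tau> where "\<tau> = Re (\<Sum>s\<in>?S. block B s s)"
  \<comment> \<open>The perturbation changes the real part of the pairing with \<open>B\<close> by
    \<epsilon> \<tau>. This choice keeps the change at most \<delta> / 2, so the pairing stays
    negative; the 1 in the denominator covers \<tau> = 0.\<close>
  define \<epsilon> where "\<epsilon> = \<delta> / (2 * (\<bar>\<tau>\<bar> + 1))"
  have "0 < \<delta>"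
    using Q_B by (simp only: \<delta>_def neg_0_less_iff_less)
  then have "0 < \<epsilon>"
    by (simp add: \<epsilon>_def)
  have "\<epsilon> * \<tau> < \<delta>"
  proof -
    have "\<epsilon> * \<tau> \<le> \<epsilon> * (\<bar>\<tau>\<bar> + 1)"
      using \<open>0 < \<epsilon>\<close> by (intro mult_left_mono) auto
    also have "\<dots> = \<delta> / 2"
      by (simp add: \<epsilon>_def field_simps)
    finally show ?thesis
      using \<open>0 < \<delta>\<close> by simp
  qed
  define P where "P s t = Q s t + (if s = t then complex_of_real \<epsilon> else 0)" for s t
  have P_sum: "(\<Sum>s\<in>?S. \<Sum>t\<in>?S. y s t * P s t) =
      (\<Sum>s\<in>?S. \<Sum>t\<in>?S. y s t * Q s t) + complex_of_real \<epsilon> * (\<Sum>s\<in>?S. y s s)"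
    for y :: "nat \<times> 'x \<times> 'a \<Rightarrow> nat \<times> 'x \<times> 'a \<Rightarrow> complex"
  proof -
    have "(\<Sum>s\<in>?S. \<Sum>t\<in>?S. y s t * P s t) =
        (\<Sum>s\<in>?S. \<Sum>t\<in>?S. y s t * Q s t + (if s = t then complex_of_real \<epsilon> * y s s else 0))"
      by (intro sum.cong HOL.refl) (auto simp: P_def algebra_simps)
    also have "\<dots> = (\<Sum>s\<in>?S. \<Sum>t\<in>?S. y s t * Q s t) + (\<Sum>s\<in>?S. \<Sum>t\<in>?S. if s = t then complex_of_real \<epsilon> * y s s else 0)"
      by (simp only: sum.distrib)
    also have "(\<Sum>s\<in>?S. \<Sum>t\<in>?S. if s = t then complex_of_real \<epsilon> * y s s else 0) = (\<Sum>s\<in>?S. complex_of_real \<epsilon> * y s s)"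
      by (intro sum.cong HOL.refl) simp
    finally show ?thesis
      by (simp only: sum_distrib_left)
  qed
  have "\<exists>h. (\<forall>i<n. h i \<in> carrier H) \<and> (\<forall>i<n. \<forall>j<n. \<forall>p q. ip K (v q (h j)) (v p (h i)) = P (i, p) (j, q))"
  \<comment> \<open>In a diagonal block the identity has partial trace |A| times the identity, hence
    the second summand of \<open>g\<close>.\<close>
  proof (rule universal[where \<epsilon> = \<epsilon> and Q = P and g = "\<lambda>i j. G i j x0 x0 + (if i = j then of_nat CARD('a) * \<epsilon> else 0)"])
    show "hermitian_on ?S P"
      using Q by (auto simp: hermitian_on_def P_def)
    show "0 < \<epsilon>" by fact
    fix \<xi> :: "nat \<times> 'x \<times> 'a \<Rightarrow> complex"
    have "(\<Sum>s\<in>?S. \<Sum>t\<in>?S. cnj (\<xi> s) * P s t * \<xi> t) = (\<Sum>s\<in>?S. \<Sum>t\<in>?S. (cnj (\<xi> s) * \<xi> t) * P s t)"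
      by (simp add: ac_simps)
    also have "\<dots> = (\<Sum>s\<in>?S. \<Sum>t\<in>?S. cnj (\<xi> s) * Q s t * \<xi> t) + \<epsilon> * (\<Sum>s\<in>?S. \<xi> s * cnj (\<xi> s))"
      unfolding P_sum by (simp add: ac_simps)
    also have "\<epsilon> * (\<Sum>s\<in>?S. \<xi> s * cnj (\<xi> s)) = complex_of_real (\<epsilon> * (\<Sum>s\<in>?S. (cmod (\<xi> s))\<^sup>2))"
      by (simp only: of_real_mult of_real_sum complex_norm_square)
    finally have "Re (\<Sum>s\<in>?S. \<Sum>t\<in>?S. cnj (\<xi> s) * P s t * \<xi> t) =
        Re (\<Sum>s\<in>?S. \<Sum>t\<in>?S. cnj (\<xi> s) * Q s t * \<xi> t) + \<epsilon> * (\<Sum>s\<in>?S. (cmod (\<xi> s))\<^sup>2)"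
      by (simp only: plus_complex.sel Re_complex_of_real)
    moreover have "0 \<le> Re (\<Sum>s\<in>?S. \<Sum>t\<in>?S. cnj (\<xi> s) * Q s t * \<xi> t)"
      using Q(2) unfolding psd_on_def by blast
    ultimately show "\<epsilon> * (\<Sum>s\<in>?S. (cmod (\<xi> s))\<^sup>2) \<le> Re (\<Sum>s\<in>?S. \<Sum>t\<in>?S. cnj (\<xi> s) * P s t * \<xi> t)"
      by linarith
  next
    fix i j x x' assume "i < n" "j < n"
    then have "G i j x x' = (if x = x' then G i j x0 x0 else 0)"
      using G_off[of i j x x'] G_diag[of i j x] by auto
    then show "(\<Sum>a\<in>UNIV. P (i, x, a) (j, x', a)) =
        (if x = x' then G i j x0 x0 + (if i = j then of_nat CARD('a) * \<epsilon> else 0) else 0)"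
      unfolding P_def sum.distrib G_def[symmetric] by auto
  qed
  then obtain h where h: "\<forall>i<n. h i \<in> carrier H"
    and gram: "\<And>i j p q. \<lbrakk>i < n; j < n\<rbrakk> \<Longrightarrow> ip K (v q (h j)) (v p (h i)) = P (i, p) (j, q)"
    by auto
  have "dom.op_form n (map_mat quot B) h h = (\<Sum>s\<in>?S. \<Sum>t\<in>?S. block B s t * P s t) / of_nat CARD('x)"
    unfolding op_form_quot[OF h B]
    by (intro arg_cong[of _ _ "\<lambda>z. z / of_nat CARD('x)"] sum.cong HOL.refl) (auto simp: gram)
  moreover have "0 \<le> dom.op_form n (map_mat quot B) h h"
    using pos h by (auto simp: T_pos dom.pos_iff)
  ultimately have "0 \<le> Re (\<Sum>s\<in>?S. \<Sum>t\<in>?S. block B s t * P s t)"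
    by (simp only: complex_nonneg_iff Re_divide_of_nat zero_le_divide_iff) auto
  also have "\<dots> = - \<delta> + \<epsilon> * \<tau>"
    unfolding P_sum \<delta>_def \<tau>_def by (simp only: plus_complex.sel times_complex.sel Re_complex_of_real Im_complex_of_real)
  finally show False
    using \<open>\<epsilon> * \<tau> < \<delta>\<close> by simp
qed

text \<open>Cosets of J are the fibres of \<open>quot\<close>; indexing them by the value of
  \<open>quot\<close> makes \<open>lift\<close> a bijection from \<open>T\<close> to the
  quotient.\<close>

definition lift :: "('h \<Rightarrow> 'h) \<Rightarrow> (complex ^ ('x \<times> 'a) ^ ('x \<times> 'a)) set" where
  "lift t = {\<mu>. quot \<mu> = t}"

lemma coset_eq_lift: "J_XA +>\<^bsub>M_XA\<^esub> \<mu> = lift (quot \<mu>)"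
  by (auto simp: coset_M_XA lift_def quot_eq_zero_iff[symmetric] quot_minus)

text \<open>These cones are copied from \<open>T\<close> rather than built from those of
  \<open>M_XA\<close>; that they are the quotient cones is the content of the universal
  property.\<close>

definition cones :: "nat \<Rightarrow> (complex ^ ('x \<times> 'a) ^ ('x \<times> 'a)) set Matrix.mat set" where
  "cones n = map_mat lift ` pos T n"

abbreviation "M_quotient \<equiv> coset_opsys M_XA J_XA cones"

lemma quotient_simps:
  "carrier M_quotient = range (\<lambda>\<mu>. lift (quot \<mu>))" "\<one>\<^bsub>M_quotient\<^esub> = lift (quot (Finite_Cartesian_Product.mat 1))"
  "\<zero>\<^bsub>M_quotient\<^esub> = J_XA" "pos M_quotient n = map_mat lift ` pos T n"
  by (auto simp: coset_opsys_def A_RCOSETS_def' coset_eq_lift cones_def)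

lemma quotient_ops:
  shows quotient_add: "lift (quot \<mu>) \<oplus>\<^bsub>M_quotient\<^esub> lift (quot \<nu>) = lift (quot (\<mu> + \<nu>))"
    and quotient_smult: "c \<odot>\<^bsub>M_quotient\<^esub> lift (quot \<mu>) = lift (quot (\<chi> p q. c * \<mu> $ p $ q))"
    and quotient_star: "star M_quotient (lift (quot \<mu>)) = lift (quot (\<chi> p q. cnj (\<mu> $ q $ p)))"
proof -
  have "\<exists>k. quot k = quot \<mu> \<and> (\<exists>l. quot l = quot \<nu> \<and> \<rho> = k + l)" if "quot \<rho> = quot (\<mu> + \<nu>)" for \<rho>
  proof (intro exI conjI)
    have "quot ((\<rho> - \<mu>) - \<nu>) = \<zero>\<^bsub>op_space H H\<^esub>"
      using that unfolding quot_minus[symmetric] by (simp only: diff_diff_eq)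
    then show "quot (\<rho> - \<mu>) = quot \<nu>"
      by (simp only: quot_minus)
  qed auto
  then show "lift (quot \<mu>) \<oplus>\<^bsub>M_quotient\<^esub> lift (quot \<nu>) = lift (quot (\<mu> + \<nu>))"
    by (auto simp: coset_opsys_def set_add_def' lift_def quot_add)
  show "c \<odot>\<^bsub>M_quotient\<^esub> lift (quot \<mu>) = lift (quot (\<chi> p q. c * \<mu> $ p $ q))"
    by (auto simp: coset_opsys_def coset_eq_lift quot_smult) (auto simp: lift_def)
  show "star M_quotient (lift (quot \<mu>)) = lift (quot (\<chi> p q. cnj (\<mu> $ q $ p)))"
    by (auto simp: coset_opsys_def coset_eq_lift quot_star) (auto simp: lift_def)
qed

lemma lift_quot_eq: "lift (quot \<mu>) = lift (quot \<nu>) \<longleftrightarrow> quot \<mu> = quot \<nu>"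
  by (auto simp: lift_def)

lemma opsys_bijection_lift: "opsys_bijection T M_quotient lift"
proof (intro opsys_bijection.intro opsys_bijection_axioms.intro)
  show "operator_system T"
    by (rule operator_system_T)
  show "bij_betw lift (carrier T) (carrier M_quotient)"
    by (auto simp: bij_betw_def inj_on_def quotient_simps lift_quot_eq)
  show "lift \<zero>\<^bsub>T\<^esub> = \<zero>\<^bsub>M_quotient\<^esub>"
    by (auto simp: quotient_simps lift_def quot_eq_zero_iff)
  show "lift \<one>\<^bsub>T\<^esub> = \<one>\<^bsub>M_quotient\<^esub>"
    by (simp add: quotient_simps quot_unit)
  show "lift (s \<oplus>\<^bsub>T\<^esub> t) = lift s \<oplus>\<^bsub>M_quotient\<^esub> lift t" if "s \<in> carrier T" "t \<in> carrier T" for s t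
    using that by (auto simp: quotient_add quot_add)
  show "lift (c \<odot>\<^bsub>T\<^esub> s) = c \<odot>\<^bsub>M_quotient\<^esub> lift s" if "s \<in> carrier T" for s c
    using that by (auto simp: quotient_smult quot_smult)
  show "lift (star T s) = star M_quotient (lift s)" if "s \<in> carrier T" for s
    using that by (auto simp: quotient_star quot_star)
  show "pos M_quotient n = map_mat lift ` pos T n" for n
    by (rule quotient_simps(4))
qed

lemma coset_map_completely_positive:
  "unital_completely_positive M_XA M_quotient (\<lambda>\<mu>. J_XA +>\<^bsub>M_XA\<^esub> \<mu>)"
proof -
  have "map_mat (\<lambda>\<mu>. J_XA +>\<^bsub>M_XA\<^esub> \<mu>) A = map_mat lift (map_mat quot A)" for A
    by (intro eq_matI) (auto simp: coset_eq_lift)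
  then show ?thesis
    using map_quot_pos
    by (auto simp: unital_completely_positive_def completely_positive_def module_hom_def coset_eq_lift
        quotient_simps quotient_add quotient_smult)
qed

end

lemma mat_unit_dims [simp]: "dim_row (mat_unit S n) = n" "dim_col (mat_unit S n) = n"
  by (simp_all add: mat_unit_def)

context universal_family
begin

interpretation HH: hilbert_pair H H ..

text \<open>Lifting works after adding \<open>r\<close>, and \<phi> turns the added term into
  \<open>r\<close> times the image \<open>D\<close> of the unit, as \<phi> need not be unital. Since
  \<open>D\<close> is dominated by a multiple of the unit of the target, the Archimedean axiom there
  lets \<open>r\<close> tend to 0.\<close>

lemma quotient_universal:
  assumes S: "operator_system S" and cp: "completely_positive M_XA S \<phi>"
    and \<phi>': "\<And>\<mu>. \<phi>' (J_XA +>\<^bsub>M_XA\<^esub> \<mu>) = \<phi> \<mu>"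
  shows "completely_positive M_quotient S \<phi>'"
proof -
  interpret S: operator_system S by (rule S)
  have \<phi>'_lift: "\<phi>' (lift (quot \<mu>)) = \<phi> \<mu>" for \<mu>
    using \<phi>'[of \<mu>] by (simp only: coset_eq_lift)
  have \<phi>_closed [simp]: "\<phi> \<mu> \<in> carrier S" and \<phi>_add: "\<phi> (\<mu> + \<nu>) = \<phi> \<mu> \<oplus>\<^bsub>S\<^esub> \<phi> \<nu>"
    and \<phi>_smult: "\<phi> (\<chi> p q. c * \<mu> $ p $ q) = c \<odot>\<^bsub>S\<^esub> \<phi> \<mu>" for \<mu> \<nu> c
    using cp by (auto simp: completely_positive_def module_hom_def)
  have \<phi>_pos: "map_mat \<phi> C \<in> pos S n" if "C \<in> pos M_XA n" for C n
    using cp that by (auto simp: completely_positive_def)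
  have \<phi>_cong: "\<phi> \<mu> = \<phi> \<nu>" if "\<mu> - \<nu> \<in> J_XA" for \<mu> \<nu>
  proof -
    have "quot \<mu> = quot \<nu>"
      using that by (simp only: quot_eq_zero_iff[symmetric] quot_minus)
    then show ?thesis
      using \<phi>'_lift[of \<mu>] \<phi>'_lift[of \<nu>] by simp
  qed
  have smult_closed: "c \<odot>\<^bsub>S\<^esub> s \<in> carrier S" if "s \<in> carrier S" for c s
    using that by (intro S.smult_closed) auto
  \<comment> \<open>The identity f + k d + k (R u - d) = k R u + f, derived from the module laws for
    entries in an abstract space.\<close>
  have combine: "(f \<oplus>\<^bsub>S\<^esub> k \<odot>\<^bsub>S\<^esub> d) \<oplus>\<^bsub>S\<^esub> k \<odot>\<^bsub>S\<^esub> (R \<odot>\<^bsub>S\<^esub> u \<oplus>\<^bsub>S\<^esub> (- 1) \<odot>\<^bsub>S\<^esub> d) = (k * R) \<odot>\<^bsub>S\<^esub> u \<oplus>\<^bsub>S\<^esub> f"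
    if "f \<in> carrier S" "d \<in> carrier S" "u \<in> carrier S" for f d u k R
  proof -
    have assoc: "a \<odot>\<^bsub>S\<^esub> (b \<odot>\<^bsub>S\<^esub> s) = (a * b) \<odot>\<^bsub>S\<^esub> s" if "s \<in> carrier S" for a b s
      using S.smult_assoc1[of a b s] that by simp
    have "k \<odot>\<^bsub>S\<^esub> d \<oplus>\<^bsub>S\<^esub> (- k) \<odot>\<^bsub>S\<^esub> d = (k + - k) \<odot>\<^bsub>S\<^esub> d"
      using S.smult_l_distr[of k "- k" d] that by simp
    also have "\<dots> = \<zero>\<^bsub>S\<^esub>"
      using S.smult_l_null[of d] that by simp
    finally have cancel: "k \<odot>\<^bsub>S\<^esub> d \<oplus>\<^bsub>S\<^esub> (- k) \<odot>\<^bsub>S\<^esub> d = \<zero>\<^bsub>S\<^esub>" .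
    have "k \<odot>\<^bsub>S\<^esub> (R \<odot>\<^bsub>S\<^esub> u \<oplus>\<^bsub>S\<^esub> (- 1) \<odot>\<^bsub>S\<^esub> d) = (k * R) \<odot>\<^bsub>S\<^esub> u \<oplus>\<^bsub>S\<^esub> (- k) \<odot>\<^bsub>S\<^esub> d"
      using S.smult_r_distr[of k "R \<odot>\<^bsub>S\<^esub> u" "(- 1) \<odot>\<^bsub>S\<^esub> d"] that by (simp add: smult_closed assoc)
    then have "(f \<oplus>\<^bsub>S\<^esub> k \<odot>\<^bsub>S\<^esub> d) \<oplus>\<^bsub>S\<^esub> k \<odot>\<^bsub>S\<^esub> (R \<odot>\<^bsub>S\<^esub> u \<oplus>\<^bsub>S\<^esub> (- 1) \<odot>\<^bsub>S\<^esub> d) =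
        ((k * R) \<odot>\<^bsub>S\<^esub> u \<oplus>\<^bsub>S\<^esub> f) \<oplus>\<^bsub>S\<^esub> (k \<odot>\<^bsub>S\<^esub> d \<oplus>\<^bsub>S\<^esub> (- k) \<odot>\<^bsub>S\<^esub> d)"
      using that by (simp only: S.a_ac smult_closed S.add.m_closed)
    then show ?thesis
      using that by (simp add: cancel smult_closed)
  qed
  have "map_mat \<phi>' A \<in> pos S n" if A_pos: "A \<in> pos M_quotient n" for A n
  proof -
    obtain B where B: "B \<in> pos T n" and A: "A = map_mat lift B"
      using A_pos by (auto simp: quotient_simps)
    then have "B \<in> matrices n T" and B_star: "mat_star T B = B"
      using operator_system.pos_hermitian[OF operator_system_T] by auto
    then have dims: "B \<in> carrier_mat n n" and entries: "\<And>i j. \<lbrakk>i < n; j < n\<rbrakk> \<Longrightarrow> B $$ (i, j) \<in> range quot"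
      by (auto simp: matrices_def)
    define m where "m i j = inv_into UNIV quot (B $$ (i, j))" for i j
    have m: "quot (m i j) = B $$ (i, j)" if "i < n" "j < n" for i j
      unfolding m_def by (rule f_inv_into_f[OF entries[OF that]])
    have B_adj: "adj H H (B $$ (j, i)) = B $$ (i, j)" if "i < n" "j < n" for i j
      using arg_cong[OF B_star, of "\<lambda>M. M $$ (i, j)"] that dims by (simp add: mat_star_def)
    \<comment> \<open>Averaging a preimage with its adjoint gives the Hermitian matrix that
      \<open>positive_lift\<close> requires; the image is unchanged because \<open>B\<close> is
      self-adjoint.\<close>
    define b where "b i j = (\<chi> p q. (1/2) * (m i j $ p $ q + cnj (m j i $ q $ p)))" for i j
    have b: "quot (b i j) = B $$ (i, j)" if ij: "i < n" "j < n" for i j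
    proof -
      have "quot (\<chi> p q. cnj (m j i $ q $ p)) = quot (m i j)"
        using ij by (simp add: quot_star m B_adj)
      then have "(\<chi> p q. cnj (m j i $ q $ p)) - m i j \<in> J_XA"
        by (simp only: quot_minus[symmetric] quot_eq_zero_iff)
      then have "(\<chi> p q. (1/2) * ((\<chi> p q. cnj (m j i $ q $ p)) - m i j) $ p $ q) \<in> J_XA"
        by (rule J_XA_smult)
      also have "(\<chi> p q. (1/2) * ((\<chi> p q. cnj (m j i $ q $ p)) - m i j) $ p $ q) = b i j - m i j"
        by (simp add: Finite_Cartesian_Product.vec_eq_iff b_def field_simps)
      finally have "quot (b i j) = quot (m i j)"
        by (simp only: quot_eq_zero_iff[symmetric] quot_minus)
      then show ?thesis
        using ij by (simp only: m)
    qed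
    define B' where "B' = Matrix.mat n n (\<lambda>(i, j). b i j)"
    have B'_dims: "B' \<in> carrier_mat n n"
      by (simp add: B'_def)
    have "map_mat quot B' = B"
      using dims by (intro eq_matI) (auto simp: B'_def b)
    moreover have "hermitian_on ({..<n} \<times> UNIV) (block B')"
      by (auto simp: hermitian_on_def block_def B'_def b_def add.commute)
    ultimately have lift_r: "\<exists>C\<in>pos M_XA n. \<forall>i<n. \<forall>j<n. C $$ (i, j) - (B' $$ (i, j) +
        (if i = j then (\<chi> p q. complex_of_real r * Finite_Cartesian_Product.mat 1 $ p $ q) else 0)) \<in> J_XA" if "0 < r" for r
      using B(1) that by (intro positive_lift[OF B'_dims]) auto
    define D where "D = map_mat \<phi> (mat_unit M_XA n)"
    have D: "D \<in> pos S n"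
      unfolding D_def by (intro \<phi>_pos mat_unit_M_XA_pos)
    define F where "F = map_mat \<phi>' A"
    have F_entry: "F $$ (i, j) = \<phi> (b i j)" if "i < n" "j < n" for i j
      using that dims \<phi>'_lift[of "b i j"] by (simp add: F_def A b)
    have F: "F \<in> matrices n S"
      using dims by (auto simp: matrices_def F_entry) (auto simp: F_def A)
    have D_mat: "D \<in> matrices n S" and D_star: "mat_star S D = D"
      using S.pos_hermitian[OF D] by auto
    have FD: "mat_plus S F (mat_scale S (complex_of_real r) D) \<in> pos S n" if r: "0 < r" for r
    proof -
      obtain C where C: "C \<in> pos M_XA n" and C_eq: "\<And>i j. \<lbrakk>i < n; j < n\<rbrakk> \<Longrightarrow> C $$ (i, j) - (B' $$ (i, j) +
          (if i = j then (\<chi> p q. complex_of_real r * Finite_Cartesian_Product.mat 1 $ p $ q) else 0)) \<in> J_XA"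
        using lift_r[OF r] by blast
      have C_dims: "C \<in> carrier_mat n n"
        using C by (simp add: pos_M_XA_iff)
      have "map_mat \<phi> C = mat_plus S F (mat_scale S (complex_of_real r) D)"
      proof (rule eq_matI)
        fix i j assume "i < dim_row (mat_plus S F (mat_scale S (complex_of_real r) D))"
          "j < dim_col (mat_plus S F (mat_scale S (complex_of_real r) D))"
        then have ij: "i < n" "j < n"
          using F by (auto simp: mat_plus_def matrices_def)
        have "(if i = j then (\<chi> p q. complex_of_real r * Finite_Cartesian_Product.mat 1 $ p $ q) else 0) =
            (\<chi> p q. complex_of_real r * (mat_unit M_XA n $$ (i, j) :: complex ^ ('x \<times> 'a) ^ ('x \<times> 'a)) $ p $ q)"
          using ij by (auto simp: mat_unit_def Finite_Cartesian_Product.vec_eq_iff)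
        then have "\<phi> (C $$ (i, j)) = \<phi> (B' $$ (i, j) +
            (\<chi> p q. complex_of_real r * (mat_unit M_XA n $$ (i, j) :: complex ^ ('x \<times> 'a) ^ ('x \<times> 'a)) $ p $ q))"
          using \<phi>_cong[OF C_eq[OF ij]] by simp
        also have "\<dots> = \<phi> (b i j) \<oplus>\<^bsub>S\<^esub> complex_of_real r \<odot>\<^bsub>S\<^esub> \<phi> (mat_unit M_XA n $$ (i, j))"
          using ij by (simp only: \<phi>_add \<phi>_smult) (simp add: B'_def)
        finally show "map_mat \<phi> C $$ (i, j) = mat_plus S F (mat_scale S (complex_of_real r) D) $$ (i, j)"
          using ij C_dims F D_mat by (simp add: mat_plus_def mat_scale_def matrices_def F_entry D_def)
      qed (use C_dims F in \<open>auto simp: mat_plus_def matrices_def\<close>)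
      then show ?thesis
        using \<phi>_pos[OF C] by simp
    qed
    have "mat_scale S (- 1) D \<in> matrices n S"
      using D_mat by (auto simp: matrices_def mat_scale_def smult_closed)
    moreover have "mat_star S (mat_scale S (- 1) D) = mat_scale S (- 1) D"
    proof (rule eq_matI)
      fix i j assume "i < dim_row (mat_scale S (- 1) D)" "j < dim_col (mat_scale S (- 1) D)"
      then have ij: "i < n" "j < n"
        using D_mat by (auto simp: mat_scale_def matrices_def)
      have "star S (D $$ (j, i)) = D $$ (i, j)"
        using arg_cong[OF D_star, of "\<lambda>M. M $$ (i, j)"] ij D_mat by (auto simp: mat_star_def matrices_def)
      then show "mat_star S (mat_scale S (- 1) D) $$ (i, j) = mat_scale S (- 1) D $$ (i, j)"
        using ij D_mat S.star_smult[of "D $$ (j, i)" "- 1"] by (auto simp: mat_star_def mat_scale_def matrices_def)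
    qed (use D_mat in \<open>auto simp: mat_star_def mat_scale_def matrices_def\<close>)
    \<comment> \<open>The order unit axiom, applied to the negative of \<open>D\<close>, gives R
      such that R times the unit minus \<open>D\<close> is positive.\<close>
    ultimately obtain R where R: "0 < R"
      and R_pos: "mat_plus S (mat_scale S (complex_of_real R) (mat_unit S n)) (mat_scale S (- 1) D) \<in> pos S n"
      using S.order_unit[of "mat_scale S (- 1) D" n] by blast
    have dims': "dim_row F = n" "dim_col F = n" "dim_row D = n" "dim_col D = n"
      using F D_mat by (auto simp: matrices_def)
    have "F \<in> pos S n"
    proof (rule S.archimedean[OF F])
      fix r :: real assume r: "0 < r"
      \<comment> \<open>With k R = r, adding k times that positive matrix trades k D for r times the
        unit.\<close>
      define k where "k = r / R"
      have k: "0 < k" "complex_of_real k * complex_of_real R = complex_of_real r"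
        using r R by (auto simp: k_def)
      let ?U = "mat_plus S (mat_scale S (complex_of_real R) (mat_unit S n)) (mat_scale S (- 1) D)"
      have "mat_plus S (mat_plus S F (mat_scale S (complex_of_real k) D)) (mat_scale S (complex_of_real k) ?U) \<in> pos S n"
        by (rule S.pos_plus[OF FD S.pos_scale[OF R_pos]]) (use k in auto)
      also have "mat_plus S (mat_plus S F (mat_scale S (complex_of_real k) D)) (mat_scale S (complex_of_real k) ?U) =
          mat_plus S (mat_scale S (complex_of_real r) (mat_unit S n)) F"
      proof (rule eq_matI)
        fix i j assume "i < dim_row (mat_plus S (mat_scale S (complex_of_real r) (mat_unit S n)) F)"
          "j < dim_col (mat_plus S (mat_scale S (complex_of_real r) (mat_unit S n)) F)"
        then have ij: "i < n" "j < n"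
          by (auto simp: mat_plus_def mat_scale_def mat_unit_def)
        have "mat_unit S n $$ (i, j) \<in> carrier S" "F $$ (i, j) \<in> carrier S" "D $$ (i, j) \<in> carrier S"
          using ij F D_mat S.unit_closed by (auto simp: mat_unit_def matrices_def)
        from combine[OF this(2,3,1), of "complex_of_real k" "complex_of_real R"]
        show "mat_plus S (mat_plus S F (mat_scale S (complex_of_real k) D)) (mat_scale S (complex_of_real k) ?U) $$ (i, j) =
            mat_plus S (mat_scale S (complex_of_real r) (mat_unit S n)) F $$ (i, j)"
          unfolding k using ij by (cases "i = j") (simp_all add: mat_plus_def mat_scale_def mat_unit_def dims')
      qed (use F in \<open>auto simp: mat_plus_def mat_scale_def mat_unit_def matrices_def\<close>)
      finally show "mat_plus S (mat_scale S (complex_of_real r) (mat_unit S n)) F \<in> pos S n" .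
    qed
    then show ?thesis
      by (simp add: F_def)
  qed
  moreover have "\<phi>' \<in> module_hom class_ring M_quotient S"
    by (auto simp: module_hom_def quotient_simps quotient_add quotient_smult \<phi>'_lift \<phi>_add \<phi>_smult)
  ultimately show ?thesis
    by (simp add: completely_positive_def)
qed

lemma quotient_cones_cones: "quotient_cones M_XA J_XA cones"
  unfolding quotient_cones_def
  using opsys_bijection.operator_system_Q[OF opsys_bijection_lift] coset_map_completely_positive
  by (auto intro: quotient_universal)

text \<open>The quotient map for \<open>D\<close> is completely positive and annihilates J, so the
  universal property of \<open>C\<close> makes the identity on cosets completely positive from
  \<open>C\<close> to \<open>D\<close>. By symmetry the cones are unique.\<close>

lemma quotient_cones_subset:
  assumes C: "quotient_cones M_XA J_XA C" and D: "quotient_cones M_XA J_XA D"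
  shows "C n \<subseteq> (D n :: (complex ^ ('x \<times> 'a) ^ ('x \<times> 'a)) set Matrix.mat set)"
proof
  fix A assume A: "A \<in> C n"
  have "completely_positive (coset_opsys M_XA J_XA C) (coset_opsys M_XA J_XA D) (\<lambda>K. K)"
  proof (rule C[unfolded quotient_cones_def, THEN conjunct2, THEN conjunct2, rule_format])
    show "operator_system (coset_opsys M_XA J_XA D)"
      using D by (simp add: quotient_cones_def)
    show "completely_positive M_XA (coset_opsys M_XA J_XA D) (\<lambda>\<mu>. J_XA +>\<^bsub>M_XA\<^esub> \<mu>)"
      using D by (simp add: quotient_cones_def unital_completely_positive_def)
    show "J_XA +>\<^bsub>M_XA\<^esub> \<mu> = \<zero>\<^bsub>coset_opsys M_XA J_XA D\<^esub>"
      if "\<mu> \<in> J_XA" for \<mu> :: "complex ^ ('x \<times> 'a) ^ ('x \<times> 'a)"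
    proof -
      have "J_XA +>\<^bsub>M_XA\<^esub> \<mu> = J_XA"
        unfolding coset_eq_lift lift_def using that by (auto simp flip: quot_eq_zero_iff)
      then show ?thesis
        by (simp add: coset_opsys_def)
    qed
  qed (rule HOL.refl)
  then have "map_mat (\<lambda>K. K) A \<in> D n"
    using A by (auto simp: completely_positive_def coset_opsys_def)
  also have "map_mat (\<lambda>K. K) A = A"
    by (intro eq_matI) auto
  finally show "A \<in> D n" .
qed

lemma quotient_opsys_eq: "quotient_opsys M_XA J_XA = M_quotient"
proof -
  have "(THE C. quotient_cones M_XA J_XA C) = cones"
  proof (rule the_equality)
    show "quotient_cones M_XA J_XA cones"
      by (rule quotient_cones_cones)
    fix C :: "nat \<Rightarrow> (complex ^ ('x \<times> 'a) ^ ('x \<times> 'a)) set Matrix.mat set"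
    assume "quotient_cones M_XA J_XA C"
    then show "C = cones"
      using quotient_cones_cones by (intro ext subset_antisym quotient_cones_subset)
  qed
  then show ?thesis
    by (simp add: quotient_opsys_def)
qed

text \<open>The coset map into the quotient itself is a witness, and its target consists of sets of
  matrices, as the type in \<open>is_kernel\<close> demands.\<close>

lemma is_kernel_J_XA: "is_kernel (M_XA :: (complex ^ ('x \<times> 'a) ^ ('x \<times> 'a)) opsys) J_XA"
proof -
  have "J_XA = {\<mu> \<in> carrier M_XA. J_XA +>\<^bsub>M_XA\<^esub> \<mu> = \<zero>\<^bsub>M_quotient\<^esub>}"
  proof -
    have zero: "\<zero>\<^bsub>M_quotient\<^esub> = lift (quot 0)"
      by (auto simp: quotient_simps lift_def quot_zero quot_eq_zero_iff)
    show ?thesis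
      unfolding zero coset_eq_lift lift_quot_eq by (auto simp: quot_zero quot_eq_zero_iff)
  qed
  then show ?thesis
    unfolding is_kernel_def
    using opsys_bijection.operator_system_Q[OF opsys_bijection_lift] coset_map_completely_positive by blast
qed

text \<open>By construction the cones of the quotient are the images of those of \<open>T\<close>
  under \<open>lift\<close>, so \<open>lift\<close> and its inverse are both completely
  positive.\<close>

lemma completely_order_isomorphic_T:
  "completely_order_isomorphic T (quotient_opsys (M_XA :: (complex ^ ('x \<times> 'a) ^ ('x \<times> 'a)) opsys) J_XA)"
  unfolding quotient_opsys_eq completely_order_isomorphic_def
proof (intro conjI exI[of _ lift])
  interpret L: opsys_bijection T M_quotient lift
    by (rule opsys_bijection_lift)
  show "operator_system T"
    by (rule operator_system_T)
  show "operator_system M_quotient"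
    by (rule L.operator_system_Q)
  show "bij_betw lift (carrier T) (carrier M_quotient)" "lift \<one>\<^bsub>T\<^esub> = \<one>\<^bsub>M_quotient\<^esub>"
    by (rule L.bij L.\<psi>_one)+
  show "completely_positive T M_quotient lift"
    using L.\<psi>_closed L.\<psi>_add L.\<psi>_smult L.\<psi>_pos by (auto simp: completely_positive_def module_hom_def)
  let ?g = "inv_into (carrier T) lift"
  have g: "?g (lift t) = t" if "t \<in> carrier T" for t
    using L.bij that by (simp add: bij_betw_def)
  have g_quot: "inv_into (range quot) lift (lift (quot \<mu>)) = quot \<mu>" for \<mu>
    using g[of "quot \<mu>"] by simp
  have "map_mat ?g A \<in> pos T n" if A_pos: "A \<in> pos M_quotient n" for A n
  proof -
    obtain B where B: "B \<in> pos T n" and A: "A = map_mat lift B"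
      using A_pos by (auto simp: quotient_simps)
    then have "B \<in> matrices n T"
      using operator_system.pos_hermitian[OF operator_system_T] by auto
    then have "map_mat ?g A = B"
      unfolding A by (intro eq_matI) (auto simp: matrices_def g simp del: T_simps)
    then show ?thesis
      using B by simp
  qed
  moreover have "?g \<in> module_hom class_ring M_quotient T"
    by (auto simp: module_hom_def quotient_simps quotient_add quotient_smult g_quot quot_add[symmetric] quot_smult[symmetric])
  ultimately show "completely_positive M_quotient T ?g"
    by (simp add: completely_positive_def)
qed

text \<open>Passing to a subsystem twice restricts the cones twice, and the range of
  \<open>gram_sum\<close> lies in \<open>W\<close>, so only the second restriction remains. It is
  applied to the closed span underlying \<open>C_XA\<close>.\<close>

lemma nested_operator_subsystem:
  fixes W
  defines "C \<equiv> operator_subsystem (bounded_op_system H) W"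
  assumes W: "submodule class_ring W (op_space H H)" and gens: "\<And>p q. gram p q \<in> W"
  shows "operator_subsystem C (LinearCombinations.module.span class_ring C {gram p q | p q. True}) = T"
proof -
  have W_bounded: "W \<subseteq> bounded_ops H H"
    using W by (auto simp: submodule_def)
  have C_simps: "carrier C = W" "add C = add (op_space H H)" "\<zero>\<^bsub>C\<^esub> = \<zero>\<^bsub>op_space H H\<^esub>"
    "smult C = smult (op_space H H)"
    by (simp_all add: C_def operator_subsystem_def)
  have "module class_ring C"
    by (rule HH.op.submodule_module[OF W]) (simp_all add: C_simps)
  then have span: "LinearCombinations.module.span class_ring C {gram p q | p q. True} = range gram_sum"
    using W_bounded gens by (intro span_gram) (simp_all add: C_simps)
  have smult_W: "c \<odot>\<^bsub>op_space H H\<^esub> w \<in> W" if "w \<in> W" for c w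
    using W that by (auto simp: submodule_def)
  have "gram_sum \<mu> \<in> W" for \<mu>
    unfolding gram_sum_def using gens by (auto intro!: submodule_finsum[OF W] smult_W)
  then have "elements_mat A \<subseteq> W \<and> elements_mat A \<subseteq> range gram_sum \<longleftrightarrow> elements_mat A \<subseteq> range gram_sum" for A
    by auto
  then show ?thesis
    unfolding span by (simp add: C_def T_def operator_subsystem_def)
qed

end

section \<open>Verification of the abstract properties in the universal representation\<close>

section \<open>The generators of the universal TRO\<close>

lemma infsum_finite_sum:
  fixes f :: "'a \<Rightarrow> 'b \<Rightarrow> complex"
  assumes "finite A" "\<And>a. a \<in> A \<Longrightarrow> f a summable_on S"
  shows "(\<Sum>a\<in>A. infsum (f a) S) = (\<Sum>\<^sub>\<infinity>s\<in>S. \<Sum>a\<in>A. f a s)"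
proof -
  have "(\<Sum>a\<in>A. infsum (f a) S) = (\<Sum>\<^sub>\<infinity>s\<in>S. \<Sum>a\<in>A. f a s) \<and> (\<lambda>s. \<Sum>a\<in>A. f a s) summable_on S"
    using assms by (induction A rule: finite_induct) (auto simp: infsum_add summable_on_add)
  then show ?thesis by simp
qed

text \<open>The relation holds in each summand, and the finite sum over \<open>a\<close> may be
  exchanged with the sum over all representations.\<close>

lemma theta_univ_relation:
  fixes \<xi> \<eta> :: "('u, 'a::finite, 'x) rep \<Rightarrow> 'u univ"
  assumes \<xi>: "\<xi> \<in> carrier H_univ" and \<eta>: "\<eta> \<in> carrier H_univ"
  shows "(\<Sum>a\<in>UNIV. ip K_univ (theta_univ (gen a x') \<xi>) (theta_univ (gen a x) \<eta>)) = (if x = x' then ip H_univ \<xi> \<eta> else 0)"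
proof -
  have closed: "theta_univ u \<zeta> \<in> carrier K_univ" if "\<zeta> \<in> carrier H_univ"
    for u :: "('a, 'x) tern" and \<zeta> :: "('u, 'a, 'x) rep \<Rightarrow> 'u univ"
    by (rule hilbert_pair.op_closed[OF univ_pair theta_univ_bounded that])
  have "(\<Sum>a\<in>UNIV. ip K_univ (theta_univ (gen a x') \<xi>) (theta_univ (gen a x) \<eta>)) =
      (\<Sum>\<^sub>\<infinity>r\<in>all_reps. \<Sum>a\<in>UNIV. ip (fst (snd r)) (theta_univ (gen a x') \<xi> r) (theta_univ (gen a x) \<eta> r))"
    unfolding ip_K_univ by (rule infsum_finite_sum) (simp_all add: ip_K_univ_summable closed assms)
  also have "\<dots> = (\<Sum>\<^sub>\<infinity>r\<in>all_reps. if x = x' then ip (fst r) (\<xi> r) (\<eta> r) else 0)"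
  proof (rule infsum_cong)
    fix r :: "('u, 'a, 'x) rep" assume "r \<in> all_reps"
    moreover obtain H K V where r: "r = (H, K, V)"
      by (rule prod_cases3)
    ultimately have rep: "(H, K, V) \<in> all_reps" by simp
    show "(\<Sum>a\<in>UNIV. ip (fst (snd r)) (theta_univ (gen a x') \<xi> r) (theta_univ (gen a x) \<eta> r)) =
        (if x = x' then ip (fst r) (\<xi> r) (\<eta> r) else 0)"
      using representation.relation_ip[OF all_reps_representation[OF rep] H_univ_component[OF \<xi> rep] H_univ_component[OF \<eta> rep], of x' x]
      by (simp add: r theta_univ_apply rep assms representation.induced_rep_gen[OF all_reps_representation[OF rep]])
  qed
  also have "\<dots> = (if x = x' then ip H_univ \<xi> \<eta> else 0)"
    by (simp add: ip_H_univ)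
  finally show ?thesis .
qed

text \<open>A representation realizing \<open>Q\<close> is a summand of the universal one; its
  vectors enter the direct sum through extension by zero, which preserves the inner
  products.\<close>

lemma theta_univ_universal:
  fixes Q :: "nat \<times> 'x::finite \<times> 'a::finite \<Rightarrow> nat \<times> 'x \<times> 'a \<Rightarrow> complex" and n :: nat
  assumes Q: "hermitian_on ({..<n} \<times> UNIV) Q" "0 < \<epsilon>"
    "\<And>\<xi>. \<epsilon> * (\<Sum>s\<in>{..<n} \<times> UNIV. (cmod (\<xi> s))\<^sup>2) \<le>
      Re (\<Sum>s\<in>{..<n} \<times> UNIV. \<Sum>t\<in>{..<n} \<times> UNIV. cnj (\<xi> s) * Q s t * \<xi> t)"
    "\<And>i j x x'. \<lbrakk>i < n; j < n\<rbrakk> \<Longrightarrow> (\<Sum>a\<in>UNIV. Q (i, x, a) (j, x', a)) = (if x = x' then g i j else 0)"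
  shows "\<exists>h. (\<forall>i<n. h i \<in> carrier (H_univ :: (('u, 'a, 'x) rep \<Rightarrow> 'u univ) hilbert)) \<and>
    (\<forall>i<n. \<forall>j<n. \<forall>p q. ip K_univ (theta_univ (gen (snd q) (fst q)) (h j)) (theta_univ (gen (snd p) (fst p)) (h i)) = Q (i, p) (j, q))"
proof -
  have "\<exists>H K V h. (H, K, V) \<in> (all_reps :: ('u, 'a, 'x) rep set) \<and> (\<forall>i<n. h i \<in> carrier H) \<and>
      (\<forall>i<n. \<forall>j<n. \<forall>x a x' a'. ip K (V a' x' (h j)) (V a x (h i)) = Q (i, x, a) (j, x', a'))"
    by (rule gram_representation[OF Q])
  then obtain H K V h where rep: "(H, K, V) \<in> (all_reps :: ('u, 'a, 'x) rep set)" and h: "\<And>i. i < n \<Longrightarrow> h i \<in> carrier H"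
    and gram: "\<And>i j x a x' a'. \<lbrakk>i < n; j < n\<rbrakk> \<Longrightarrow> ip K (V a' x' (h j)) (V a x (h i)) = Q (i, x, a) (j, x', a')"
    by blast
  define k :: "nat \<Rightarrow> ('u, 'a, 'x) rep \<Rightarrow> 'u univ"
    where "k i = (\<lambda>r\<in>all_reps. if r = (H, K, V) then h i else \<zero>\<^bsub>fst r\<^esub>)" for i
  have k_other: "k i r = \<zero>\<^bsub>fst r\<^esub>" if "r \<in> all_reps" "r \<noteq> (H, K, V)" for i r
    using that by (simp add: k_def)
  have k_rep: "k i (H, K, V) = h i" for i
    using rep by (simp add: k_def)
  have k: "k i \<in> carrier H_univ" if "i < n" for i
    unfolding H_univ_def hilbert_family.hilbert_sum_carrier[OF H_fam]
  proof
    show "k i \<in> (\<Pi>\<^sub>E r\<in>all_reps. carrier (fst r))"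
    proof (rule PiE_I)
      fix r :: "('u, 'a, 'x) rep" assume r: "r \<in> all_reps"
      have "\<zero>\<^bsub>fst r\<^esub> \<in> carrier (fst r)"
        by (rule abelian_monoid.zero_closed[OF hilbert_family.component_monoid[OF H_fam r]])
      then show "k i r \<in> carrier (fst r)"
        using h[OF that] r by (cases "r = (H, K, V)") (simp_all add: k_def)
    qed (simp add: k_def)
    show "(\<lambda>r. (hnorm (fst r) (k i r))\<^sup>2) summable_on all_reps"
    proof (rule finite_nonzero_values_imp_summable_on)
      have "{r \<in> all_reps. (hnorm (fst r) (k i r))\<^sup>2 \<noteq> 0} \<subseteq> {(H, K, V)}"
        using hilbert_space.hnorm_zero[OF component_hilbert_spaces(1)] k_other by fastforce
      then show "finite {r \<in> all_reps. (hnorm (fst r) (k i r))\<^sup>2 \<noteq> 0}"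
        by (rule finite_subset) simp
    qed
  qed
  have "ip K_univ (theta_univ (gen a' x') (k j)) (theta_univ (gen a x) (k i)) = Q (i, x, a) (j, x', a')"
    if ij: "i < n" "j < n" for i j a x a' x'
  proof -
    let ?f = "\<lambda>r. ip (fst (snd r)) (theta_univ (gen a' x') (k j) r) (theta_univ (gen a x) (k i) r)"
    have "?f r = 0" if r: "r \<in> all_reps" "r \<noteq> (H, K, V)" for r
    proof -
      obtain H' K' V' where r': "r = (H', K', V')"
        by (rule prod_cases3)
      then have rep': "(H', K', V') \<in> all_reps"
        using r by simp
      interpret representation H' K' V'
        by (rule all_reps_representation[OF rep'])
      have "theta_univ (gen a'' x'') (k l) r = \<zero>\<^bsub>K'\<^esub>" if "l < n" for a'' x'' l
        using k[OF that] rep' r k_other[OF r] V_bounded op_zero[OF V_bounded]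
        by (simp add: r' theta_univ_apply induced_rep_gen)
      then show ?thesis
        using ij by (simp add: r')
    qed
    then have "infsum ?f all_reps = infsum ?f {(H, K, V)}"
      using rep by (intro infsum_cong_neutral) auto
    also have "\<dots> = Q (i, x, a) (j, x', a')"
      using k ij rep gram[OF ij, of a' x' a x]
      by (simp add: theta_univ_apply k_rep representation.induced_rep_gen[OF all_reps_representation[OF rep]])
    finally show ?thesis
      unfolding ip_K_univ .
  qed
  then show ?thesis
    using k by (intro exI[of _ k]) auto
qed

lemma universal_family_univ:
  "universal_family (H_univ :: (('u, 'a::finite, 'x::finite) rep \<Rightarrow> 'u univ) hilbert) K_univ
    (\<lambda>p. theta_univ (gen (snd p) (fst p)))"
proof (intro universal_family.intro operator_family.intro operator_family_axioms.intro universal_family_axioms.intro)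
  show "hilbert_pair (H_univ :: (('u, 'a, 'x) rep \<Rightarrow> 'u univ) hilbert) K_univ"
    by (rule univ_pair)
qed (simp_all only: theta_univ_bounded theta_univ_relation theta_univ_universal fst_conv snd_conv)

text \<open>After pairing the indices, the elements \<open>e_XA\<close> are the Gram products of the
  generators and lie in the closed span defining \<open>C_XA\<close>; the nested subsystems then
  collapse into one.\<close>

lemma T_XA_eq:
  "(T_XA :: ((('u, 'a::finite, 'x::finite) rep \<Rightarrow> 'u univ) \<Rightarrow> ('u, 'a, 'x) rep \<Rightarrow> 'u univ) opsys) =
    universal_family.T H_univ K_univ (\<lambda>p. theta_univ (gen (snd p) (fst p)))"
proof -
  let ?H = "H_univ :: (('u, 'a, 'x) rep \<Rightarrow> 'u univ) hilbert"
  let ?K = "K_univ :: (('u, 'a, 'x) rep \<Rightarrow> 'u univ) hilbert"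
  let ?v = "\<lambda>p :: 'x \<times> 'a. theta_univ (gen (snd p) (fst p)) :: (('u, 'a, 'x) rep \<Rightarrow> 'u univ) \<Rightarrow> ('u, 'a, 'x) rep \<Rightarrow> 'u univ"
  let ?G = "{compose (carrier ?H) (adj ?H ?K (faithful_rep s)) (faithful_rep t) | s t.
    s \<in> V_XA TYPE('u) \<and> t \<in> V_XA TYPE('u)}"
  have H: "hilbert_space ?H" and K: "hilbert_space ?K"
    using univ_pair unfolding hilbert_pair_def by blast+
  have family: "operator_family ?H ?K ?v"
    using universal_family_univ by (rule universal_family.axioms(1))
  have "?G \<subseteq> bounded_ops ?H ?H"
  proof
    fix T assume "T \<in> ?G"
    then obtain s t where T: "T = compose (carrier ?H) (adj ?H ?K (faithful_rep s)) (faithful_rep t)"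
      and s: "s \<in> V_XA TYPE('u)" and t: "t \<in> V_XA TYPE('u)"
      by blast
    show "T \<in> bounded_ops ?H ?H"
      unfolding T
      by (rule compose_op(1)[OF H K H hilbert_pair.adj_bounded[OF univ_pair faithful_rep_bounded[OF s]]
          faithful_rep_bounded[OF t]])
  qed
  note W = hilbert_space.closed_span_submodule[OF H this]
  have gram: "operator_family.gram ?H ?K ?v p q = e_XA (fst p) (fst q) (snd p) (snd q)" for p q
    using family by (simp add: operator_family.gram_def e_XA_def faithful_rep_v_XA)
  have e_XA_mem: "e_XA x x' a a' \<in> ?G" for x x' :: 'x and a a' :: 'a
    unfolding e_XA_def
    by (rule CollectI, rule exI[of _ "v_XA TYPE('u) a x"], rule exI[of _ "v_XA TYPE('u) a' x'"])
      (simp add: v_XA_in_V_XA)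
  have gens: "operator_family.gram ?H ?K ?v p q \<in> closed_span ?H ?G" for p q
    unfolding gram by (rule subsetD[OF W(2) e_XA_mem])
  have generators: "{e_XA x x' a a' | x x' a a'. True} = {operator_family.gram ?H ?K ?v p q | p q. True}"
    unfolding gram
  proof (intro subset_antisym subsetI)
    fix t :: "(('u, 'a, 'x) rep \<Rightarrow> 'u univ) \<Rightarrow> ('u, 'a, 'x) rep \<Rightarrow> 'u univ"
    assume "t \<in> {e_XA x x' a a' | x x' a a'. True}"
    then obtain x x' a a' where "t = e_XA x x' a a'"
      by blast
    then have "t = e_XA (fst (x, a)) (fst (x', a')) (snd (x, a)) (snd (x', a'))"
      by simp
    then show "t \<in> {e_XA (fst p) (fst q) (snd p) (snd q) | p q. True}"
      by blast
  qed blast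
  show ?thesis
    unfolding T_XA_def C_XA_def generators
    by (rule universal_family.nested_operator_subsystem[OF universal_family_univ W(1) gens])
qed

theorem corollary5p6:
  shows "is_kernel (M_XA :: (complex ^ ('x::finite \<times> 'a::finite) ^ ('x \<times> 'a)) opsys) J_XA \<and>
    completely_order_isomorphic
      (T_XA :: ((('u, 'a, 'x) rep \<Rightarrow> 'u univ) \<Rightarrow> ('u, 'a, 'x) rep \<Rightarrow> 'u univ) opsys)
      (quotient_opsys (M_XA :: (complex ^ ('x \<times> 'a) ^ ('x \<times> 'a)) opsys) J_XA)"
proof
  show "is_kernel (M_XA :: (complex ^ ('x \<times> 'a) ^ ('x \<times> 'a)) opsys) J_XA"
    by (rule universal_family.is_kernel_J_XA[OF universal_family_univ])
  show "completely_order_isomorphic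
      (T_XA :: ((('u, 'a, 'x) rep \<Rightarrow> 'u univ) \<Rightarrow> ('u, 'a, 'x) rep \<Rightarrow> 'u univ) opsys)
      (quotient_opsys (M_XA :: (complex ^ ('x \<times> 'a) ^ ('x \<times> 'a)) opsys) J_XA)"
    unfolding T_XA_eq by (rule universal_family.completely_order_isomorphic_T[OF universal_family_univ])
qed

end
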